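(* The morphism of species $$\gamma|_{\mathbf{Lie}}^*:\mathbf{Lie}\circ\boldsymbol\Gamma\to\boldsymbol\Gamma,\qquad \mathcal T\otimes\mathtt D\mapsto\partial^*_{\mathcal T}\,\mathtt D$$ (for $P=(S_1|\dots|S_k)$ a partition of a finite set $I$, $\mathcal T\in\mathbf{Lie}[P]$ and $\mathtt D\in\boldsymbol\Gamma[S_1]\otimes\dots\otimes\boldsymbol\Gamma[S_k]$) makes $\boldsymbol\Gamma$ a left $\mathbf{Lie}$-module, i.e. it is a unital and associative left action of the Lie operad on $\boldsymbol\Gamma$ with respect to the composition product of species.
   Context: **Arrangement and faces.** $\Bbbk$ is a field of characteristic zero, $I$ a finite set. A partition $P=(S_1|\dots|S_k)$ of $I$ is an unordered set of disjoint nonempty blocks with union $I$; $Q$ is finer than $P$ if every block of $Q$ is contained in a block of $P$ ($Q=P$ allowed). $(I)$ is the one-block partition; for $S\subseteq I$, ${}^IS$ is the partition of $I$ with block $S$ and all other blocks singletons. Put $T^\vee[P]=\{h\in\mathbb R I:\sum_{i\in S_j}h_i=0 \text{ for all } j\}$ and $T^\vee[I]=T^\vee[(I)]$. The adjoint braid arrangement consists of the hyperplanes $\{\sum_{i\in S}h_i=0\}$ of $T^\vee[I]$, $\emptyset\ne S\subsetneq I$. An adjoint face $X$ is (the characteristic function of) a relatively open face of this arrangement; it is determined by its sign function $s_X$, where $s_X(S)\in\{+,-,0\}$ is the sign of $\sum_{i\in S}h_i$ for $h$ in the face. Its support is its linear span. $\mathsf L^\vee[P]$ is the $\Bbbk$-vector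 space with basis the adjoint faces with support $T^\vee[P]$; $\mathsf L^{\vee *}[P]$ is its dual (functionals); $\mathsf L^\vee[I]:=\mathsf L^\vee[(I)]$. The natural isomorphism $T^\vee[{}^IS]\cong T^\vee[S]$ identifies $\mathsf L^\vee[{}^IS]$ with $\mathsf L^\vee[S]$. **External product.** For an adjoint face $X\in\mathsf L^\vee[P]$, $X|_{S_j}\in\mathsf L^\vee[{}^IS_j]=\mathsf L^\vee[S_j]$ is the adjoint face with sign $S\mapsto s_X(S\cap S_j)$ if $S\cap S_j\ne\emptyset$, and $0$ otherwise. $\mathrm{prod}_P:\bigotimes_j\mathsf L^{\vee*}[S_j]\to\mathsf L^{\vee*}[P]$ is $\mathrm{prod}_P(f_1\otimes\dots\otimes f_k)(X)=\prod_jf_j(X|_{S_j})$. A functional in $\mathsf L^{\vee*}[P]$ is semisimple if it lies in the image of $\mathrm{prod}_P$. **Forest derivative.** For $E\subseteq I$, $\mathrm{Redn}_P(E)$ is $E$ with all blocks of $P$ contained in $E$ removed; write $E=S \bmod P$ if $\mathrm{Redn}_P(E)=\mathrm{Redn}_P(S)$. A cut $\mathcal V=[C,D]:P\leftarrow Q$ is an ordered splitting of one block $S_m=C\sqcup D$ of $P$ ($C,D\neq\emptyset$), where $Q$ is $P$ with $S_m$ replaced by $C$ and $D$; $\overline{\mathcal V}=[D,C]$. For an adjoint face $X\in\mathsf L^\vee[Q]$, $X^{\mathcal V}\in\mathsf L^\vee[P]$ is the adjoint face with sign at $S$ equal to $+$ if $S=C\bmod P$, $-$ if $S=D\bmod P$,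 $s_X(S)$ if $S\ne\emptyset\bmod Q$, $0$ if $S=\emptyset\bmod P$. For $f\in\mathsf L^{\vee*}[P]$ set $\boldsymbol\partial_{\mathcal V}f(X)=f(X^{\mathcal V})-f(X^{\overline{\mathcal V}})$, in $\mathsf L^{\vee *}[Q]$. A layered forest $\mathcal F:P\leftarrow Q$ is a family of planar full binary trees, one over each block $S_j$ of $P$ with leaves labelled bijectively by the blocks of $Q$ contained in $S_j$, with a linear order on all the (internal) nodes in which each node precedes its descendants. Equivalently it is a sequence of successive cuts $\mathcal F=\mathcal V_1\circ\dots\circ\mathcal V_l$ in the order of the nodes (from $P$ to $Q$; left child $C$, right child $D$). Set $\boldsymbol\partial_{\mathcal F}f=\boldsymbol\partial_{\mathcal V_l}(\cdots(\boldsymbol\partial_{\mathcal V_1}f)\cdots)$; if $l=0$ (sticks) this is the identity. **The species $\boldsymbol\Gamma$.** $f\in\mathsf L^{\vee*}[P]$ is semisimply differentiable if $\boldsymbol\partial_{\mathcal F}f$ is semisimple for all layered forests $\mathcal F$ over $P$; $\boldsymbol\Gamma^*[P]$ is the space of such $f$, $\boldsymbol\Gamma[P]$ the dual quotient of $\mathsf L^\vee[P]$. $\boldsymbol\Gamma^*[I]:=\boldsymbol\Gamma^*[(I)]$, $\boldsymbol\Gamma[I]:=\boldsymbol\Gamma[(I)]$, and $\boldsymbol\Gamma[\emptyset]=0$. These are vector species (functors from finite sets and bijections to $\Bbbk$-vector spaces). $\mathrm{prod}_P$ restricts to an isomorphism $\mathrm{prod}_P|_{\boldsymbol\Gamma}:\bigotimes_j\boldsymbol\Gamma^*[S_j]\to\boldsymbol\Gamma^*[P]$.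 **The action.** $\mathbf{Lay}[I]$ is the vector space spanned by layered trees over $I$ with leaves labelled by singletons ($\mathbf{Lay}[\emptyset]=0$). For a partition $P$ of $I$, viewed as the finite set of its blocks, $\mathbf{Lay}[P]$ is spanned by the layered trees $\mathcal T:(I)\leftarrow P$. For such $\mathcal T$ with $P=(S_1|\dots|S_k)$ put $\partial_{\mathcal T}=(\mathrm{prod}_P|_{\boldsymbol\Gamma})^{-1}\circ\boldsymbol\partial_{\mathcal T}:\boldsymbol\Gamma^*[I]\to\bigotimes_j\boldsymbol\Gamma^*[S_j]$, with linear dual $\partial_{\mathcal T}^*:\bigotimes_j\boldsymbol\Gamma[S_j]\to\boldsymbol\Gamma[I]$. $\mathbf{Lie}$ is the positive Lie operad, represented as $\mathbf{Lay}$ modulo antisymmetry, the Jacobi identity, and identifying layered trees that differ only in their layering; operadic composition is grafting of trees at leaves, and the unit is the stick. The assignment $\mathcal T\mapsto\partial^*_{\mathcal T}$ factors through $\mathbf{Lie}[P]$. Composition of species (second factor positive): $(\mathbf p\circ\mathbf q)[I]=\bigoplus_P\big(\mathbf p[P]\otimes\bigotimes_j\mathbf q[S_j]\big)$, the sum over partitions $P=(S_1|\dots|S_k)$ of $I$. *)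

theory Defs
  imports Complex_Main "HOL-Library.FuncSet" "HOL-Library.Disjoint_Sets"
begin

section \<open>Vector spaces with explicit carriers\<close>

record ('k, 'v) vspace =
  vcarrier :: "'v set"
  vzero :: 'v
  vadd :: "'v \<Rightarrow> 'v \<Rightarrow> 'v"
  vscale :: "'k \<Rightarrow> 'v \<Rightarrow> 'v"

definition vlinear :: "('k, 'v) vspace \<Rightarrow> ('k, 'w) vspace \<Rightarrow> ('v \<Rightarrow> 'w) \<Rightarrow> bool" where
  "vlinear V W g \<longleftrightarrow>
     g \<in> vcarrier V \<rightarrow> vcarrier W \<and>
     (\<forall>u\<in>vcarrier V. \<forall>v\<in>vcarrier V. g (vadd V u v) = vadd W (g u) (g v)) \<and>
     (\<forall>c. \<forall>v\<in>vcarrier V. g (vscale V c v) = vscale W c (g v))"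

text \<open>The linear map \<open>V \<rightarrow> W\<close> that sends the vector \<open>e k\<close> to \<open>\<phi> k\<close> for all \<open>k \<in> K\<close>. It is only used
  when the vectors \<open>e k\<close> span \<open>V\<close>; outside \<open>V\<close> the map is \<open>undefined\<close>.\<close>

definition linext ::
  "('k, 'v) vspace \<Rightarrow> ('k, 'w) vspace \<Rightarrow> 'i set \<Rightarrow> ('i \<Rightarrow> 'v) \<Rightarrow> ('i \<Rightarrow> 'w) \<Rightarrow> 'v \<Rightarrow> 'w" where
  "linext V W K e \<phi> =
     (THE g. g \<in> extensional (vcarrier V) \<and> vlinear V W g \<and> (\<forall>k\<in>K. g (e k) = \<phi> k))"

inductive_set vspan :: "('k, 'v) vspace \<Rightarrow> 'v set \<Rightarrow> 'v set"
  for V :: "('k, 'v) vspace" and X :: "'v set" where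
  zero: "vzero V \<in> vspan V X"
| base: "x \<in> X \<Longrightarrow> x \<in> vspan V X"
| add: "u \<in> vspan V X \<Longrightarrow> v \<in> vspan V X \<Longrightarrow> vadd V u v \<in> vspan V X"
| scale: "v \<in> vspan V X \<Longrightarrow> vscale V c v \<in> vspan V X"

definition vfield :: "('k::field, 'k) vspace" where
  "vfield = \<lparr>vcarrier = UNIV, vzero = 0, vadd = (+), vscale = (*)\<rparr>"

definition vfree :: "'x set \<Rightarrow> ('k::field, 'x \<Rightarrow> 'k) vspace" where
  "vfree X = \<lparr>vcarrier = {v. finite {x. v x \<noteq> 0} \<and> (\<forall>x. x \<notin> X \<longrightarrow> v x = 0)},
     vzero = (\<lambda>_. 0), vadd = (\<lambda>u v x. u x + v x), vscale = (\<lambda>c v x. c * v x)\<rparr>"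

definition vbasis :: "'x \<Rightarrow> 'x \<Rightarrow> 'k::field" where
  "vbasis x = (\<lambda>y. if y = x then 1 else 0)"

text \<open>The linear map of free vector spaces induced by a map of bases.\<close>

definition free_map :: "('x \<Rightarrow> 'y) \<Rightarrow> ('x \<Rightarrow> 'k::field) \<Rightarrow> 'y \<Rightarrow> 'k" where
  "free_map \<phi> v = (\<lambda>y. \<Sum>x | v x \<noteq> 0 \<and> \<phi> x = y. v x)"

definition vcoset :: "('k, 'v) vspace \<Rightarrow> 'v set \<Rightarrow> 'v \<Rightarrow> 'v set" where
  "vcoset V W v = vadd V v ` W"

definition vquot :: "('k, 'v) vspace \<Rightarrow> 'v set \<Rightarrow> ('k, 'v set) vspace" where
  "vquot V W = \<lparr>vcarrier = vcoset V W ` vcarrier V, vzero = W,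
     vadd = (\<lambda>A B. {vadd V a b | a b. a \<in> A \<and> b \<in> B}),
     vscale = (\<lambda>c A. {vadd V (vscale V c a) w | a w. a \<in> A \<and> w \<in> W})\<rparr>"

text \<open>Tensor product of a family of vector spaces indexed by an (unordered) finite set: the free
  vector space on all families of vectors, modulo multilinearity.\<close>

definition tensor_rels :: "'i set \<Rightarrow> ('i \<Rightarrow> ('k::field, 'v) vspace) \<Rightarrow> (('i \<Rightarrow> 'v) \<Rightarrow> 'k) set" where
  "tensor_rels J V =
     {\<lambda>z. vbasis (x(j := vadd (V j) u w)) z - vbasis (x(j := u)) z - vbasis (x(j := w)) z | x j u w.
        x \<in> (\<Pi>\<^sub>E j\<in>J. vcarrier (V j)) \<and> j \<in> J \<and> u \<in> vcarrier (V j) \<and> w \<in> vcarrier (V j)} \<union>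
     {\<lambda>z. vbasis (x(j := vscale (V j) c u)) z - c * vbasis (x(j := u)) z | x j c u.
        x \<in> (\<Pi>\<^sub>E j\<in>J. vcarrier (V j)) \<and> j \<in> J \<and> u \<in> vcarrier (V j)}"

definition tensor_null :: "'i set \<Rightarrow> ('i \<Rightarrow> ('k::field, 'v) vspace) \<Rightarrow> (('i \<Rightarrow> 'v) \<Rightarrow> 'k) set" where
  "tensor_null J V = vspan (vfree (\<Pi>\<^sub>E j\<in>J. vcarrier (V j))) (tensor_rels J V)"

definition tensor :: "'i set \<Rightarrow> ('i \<Rightarrow> ('k::field, 'v) vspace) \<Rightarrow> ('k, (('i \<Rightarrow> 'v) \<Rightarrow> 'k) set) vspace" where
  "tensor J V = vquot (vfree (\<Pi>\<^sub>E j\<in>J. vcarrier (V j))) (tensor_null J V)"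

definition pure :: "'i set \<Rightarrow> ('i \<Rightarrow> ('k::field, 'v) vspace) \<Rightarrow> ('i \<Rightarrow> 'v) \<Rightarrow> (('i \<Rightarrow> 'v) \<Rightarrow> 'k) set" where
  "pure J V x = vcoset (vfree (\<Pi>\<^sub>E j\<in>J. vcarrier (V j))) (tensor_null J V) (vbasis x)"

definition tensor2_rels :: "('k::field, 'v) vspace \<Rightarrow> ('k, 'w) vspace \<Rightarrow> ('v \<times> 'w \<Rightarrow> 'k) set" where
  "tensor2_rels V W =
     {\<lambda>z. vbasis (vadd V a b, y) z - vbasis (a, y) z - vbasis (b, y) z | a b y.
        a \<in> vcarrier V \<and> b \<in> vcarrier V \<and> y \<in> vcarrier W} \<union>
     {\<lambda>z. vbasis (x, vadd W a b) z - vbasis (x, a) z - vbasis (x, b) z | x a b.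
        x \<in> vcarrier V \<and> a \<in> vcarrier W \<and> b \<in> vcarrier W} \<union>
     {\<lambda>z. vbasis (vscale V c x, y) z - c * vbasis (x, y) z | c x y.
        x \<in> vcarrier V \<and> y \<in> vcarrier W} \<union>
     {\<lambda>z. vbasis (x, vscale W c y) z - c * vbasis (x, y) z | c x y.
        x \<in> vcarrier V \<and> y \<in> vcarrier W}"

definition tensor2_null :: "('k::field, 'v) vspace \<Rightarrow> ('k, 'w) vspace \<Rightarrow> ('v \<times> 'w \<Rightarrow> 'k) set" where
  "tensor2_null V W = vspan (vfree (vcarrier V \<times> vcarrier W)) (tensor2_rels V W)"

definition tensor2 :: "('k::field, 'v) vspace \<Rightarrow> ('k, 'w) vspace \<Rightarrow> ('k, ('v \<times> 'w \<Rightarrow> 'k) set) vspace" where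
  "tensor2 V W = vquot (vfree (vcarrier V \<times> vcarrier W)) (tensor2_null V W)"

definition pure2 :: "('k::field, 'v) vspace \<Rightarrow> ('k, 'w) vspace \<Rightarrow> 'v \<Rightarrow> 'w \<Rightarrow> ('v \<times> 'w \<Rightarrow> 'k) set" where
  "pure2 V W x y = vcoset (vfree (vcarrier V \<times> vcarrier W)) (tensor2_null V W) (vbasis (x, y))"

text \<open>Direct sum over a finite index set.\<close>

definition dirsum :: "'i set \<Rightarrow> ('i \<Rightarrow> ('k, 'v) vspace) \<Rightarrow> ('k, 'i \<Rightarrow> 'v) vspace" where
  "dirsum K V = \<lparr>vcarrier = (\<Pi>\<^sub>E k\<in>K. vcarrier (V k)), vzero = (\<lambda>k\<in>K. vzero (V k)),
     vadd = (\<lambda>u v. \<lambda>k\<in>K. vadd (V k) (u k) (v k)), vscale = (\<lambda>c v. \<lambda>k\<in>K. vscale (V k) c (v k))\<rparr>"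

definition summand :: "'i set \<Rightarrow> ('i \<Rightarrow> ('k, 'v) vspace) \<Rightarrow> 'i \<Rightarrow> 'v \<Rightarrow> 'i \<Rightarrow> 'v" where
  "summand K V k v = (\<lambda>l\<in>K. if l = k then v else vzero (V l))"


section \<open>The composition product of species\<close>

text \<open>A partition of \<open>I :: 'a set\<close> is viewed as the finite set of its blocks, so that the first factor
  \<open>p\<close> is evaluated on sets of type \<open>'a set set\<close> and the second factor \<open>q\<close> on sets of type \<open>'a set\<close>.\<close>

type_synonym ('k, 'a, 'v, 'w) comp_elt = "'a set set \<Rightarrow> ('v \<times> (('a set \<Rightarrow> 'w) \<Rightarrow> 'k) set \<Rightarrow> 'k) set"

definition species_comp ::
  "('a set set \<Rightarrow> ('k::field, 'v) vspace) \<Rightarrow> ('a set \<Rightarrow> ('k, 'w) vspace) \<Rightarrow> 'a set \<Rightarrow>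
   ('k, ('k, 'a, 'v, 'w) comp_elt) vspace" where
  "species_comp p q I = dirsum {P. partition_on I P} (\<lambda>P. tensor2 (p P) (tensor P q))"

text \<open>The element \<open>t \<otimes> d\<close> of the summand of \<open>P\<close>, and the decomposable element
  \<open>t \<otimes> \<Otimes>\<^sub>S x\<^sub>S\<close>.\<close>

definition comp_elem ::
  "('a set set \<Rightarrow> ('k::field, 'v) vspace) \<Rightarrow> ('a set \<Rightarrow> ('k, 'w) vspace) \<Rightarrow> 'a set \<Rightarrow>
   'a set set \<Rightarrow> 'v \<Rightarrow> (('a set \<Rightarrow> 'w) \<Rightarrow> 'k) set \<Rightarrow> ('k, 'a, 'v, 'w) comp_elt" where
  "comp_elem p q I P t d =
     summand {P. partition_on I P} (\<lambda>P. tensor2 (p P) (tensor P q)) P (pure2 (p P) (tensor P q) t d)"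

definition comp_pure ::
  "('a set set \<Rightarrow> ('k::field, 'v) vspace) \<Rightarrow> ('a set \<Rightarrow> ('k, 'w) vspace) \<Rightarrow> 'a set \<Rightarrow>
   'a set set \<Rightarrow> 'v \<Rightarrow> ('a set \<Rightarrow> 'w) \<Rightarrow> ('k, 'a, 'v, 'w) comp_elt" where
  "comp_pure p q I P t x = comp_elem p q I P t (pure P q x)"

text \<open>The linear map \<open>(p \<circ> q)[I] \<rightarrow> W\<close> with prescribed values \<open>\<phi> P t x\<close> on decomposable elements.\<close>

definition comp_ext ::
  "('a set set \<Rightarrow> ('k::field, 'v) vspace) \<Rightarrow> ('a set \<Rightarrow> ('k, 'w) vspace) \<Rightarrow> 'a set \<Rightarrow> ('k, 'z) vspace \<Rightarrow>
   ('a set set \<Rightarrow> 'v \<Rightarrow> ('a set \<Rightarrow> 'w) \<Rightarrow> 'z) \<Rightarrow> ('k, 'a, 'v, 'w) comp_elt \<Rightarrow> 'z" where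
  "comp_ext p q I W \<phi> =
     linext (species_comp p q I) W
       {(P, t, x). partition_on I P \<and> t \<in> vcarrier (p P) \<and> x \<in> (\<Pi>\<^sub>E S\<in>P. vcarrier (q S))}
       (\<lambda>(P, t, x). comp_pure p q I P t x) (\<lambda>(P, t, x). \<phi> P t x)"


section \<open>Adjoint faces\<close>

text \<open>\<open>\<real>I\<close> is \<open>vfree I\<close>, i.e. the functions \<open>'a \<Rightarrow> real\<close> that vanish outside the finite set \<open>I\<close>. The
  ground set of a partition \<open>P\<close> is \<open>\<Union>P\<close>; the space \<open>T\<^sup>\<or>[I]\<close> is \<open>Tspace {I}\<close>. (The family \<open>{{}}\<close> is
  harmless: it only occurs for \<open>I = {}\<close>, where \<open>\<Gamma>\<close> is defined separately.)\<close>

definition Tspace :: "'a set set \<Rightarrow> ('a \<Rightarrow> real) set" where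
  "Tspace P = {h \<in> vcarrier (vfree (\<Union>P)). \<forall>S\<in>P. (\<Sum>i\<in>S. h i) = 0}"

type_synonym 'a face = "('a \<Rightarrow> real) set"

definition adjoint_faces :: "'a set \<Rightarrow> 'a face set" where
  "adjoint_faces I =
     (\<lambda>h. {h' \<in> Tspace {I}. \<forall>S. S \<noteq> {} \<and> S \<subset> I \<longrightarrow> sgn (\<Sum>i\<in>S. h' i) = sgn (\<Sum>i\<in>S. h i)}) ` Tspace {I}"

definition face_sign :: "'a face \<Rightarrow> 'a set \<Rightarrow> real" where
  "face_sign X S = the_elem ((\<lambda>h. sgn (\<Sum>i\<in>S. h i)) ` X)"

definition face_of_sign :: "'a set \<Rightarrow> ('a set \<Rightarrow> real) \<Rightarrow> 'a face" where
  "face_of_sign I s = {h \<in> Tspace {I}. \<forall>S\<subseteq>I. sgn (\<Sum>i\<in>S. h i) = s S}"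

text \<open>The adjoint faces with support \<open>T\<^sup>\<or>[P]\<close>.\<close>

definition faces :: "'a set set \<Rightarrow> 'a face set" where
  "faces P = {X \<in> adjoint_faces (\<Union>P). vspan (vfree (\<Union>P)) X = Tspace P}"

definition Lvee :: "'a set set \<Rightarrow> ('k::field, 'a face \<Rightarrow> 'k) vspace" where
  "Lvee P = vfree (faces P)"

text \<open>A functional on \<open>L\<^sup>\<or>[P]\<close> is given by its values on the basis of faces, and is \<open>0\<close> elsewhere.\<close>

definition Lvee_dual :: "'a set set \<Rightarrow> ('k::field, 'a face \<Rightarrow> 'k) vspace" where
  "Lvee_dual P = \<lparr>vcarrier = {f. \<forall>X. X \<notin> faces P \<longrightarrow> f X = 0},
     vzero = (\<lambda>_. 0), vadd = (\<lambda>f g X. f X + g X), vscale = (\<lambda>c f X. c * f X)\<rparr>"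

text \<open>\<open>X|\<^sub>S\<close> for a block \<open>S\<close>, directly as an element of \<open>L\<^sup>\<or>[S]\<close>: its sign at \<open>E \<subseteq> S\<close> is \<open>s\<^sub>X(E)\<close>.\<close>

definition face_restrict :: "'a face \<Rightarrow> 'a set \<Rightarrow> 'a face" where
  "face_restrict X S = face_of_sign S (face_sign X)"

text \<open>The external product \<open>\<Otimes>\<^sub>S V\<^sub>S \<rightarrow> L\<^sup>\<or>\<^sup>*[P]\<close>, for subspaces \<open>V\<^sub>S\<close> of \<open>L\<^sup>\<or>\<^sup>*[S]\<close>.\<close>

definition ext_prod ::
  "'a set set \<Rightarrow> ('a set \<Rightarrow> ('k::field, 'a face \<Rightarrow> 'k) vspace) \<Rightarrow>
   (('a set \<Rightarrow> 'a face \<Rightarrow> 'k) \<Rightarrow> 'k) set \<Rightarrow> 'a face \<Rightarrow> 'k" where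
  "ext_prod P V =
     linext (tensor P V) (Lvee_dual P) (\<Pi>\<^sub>E S\<in>P. vcarrier (V S)) (pure P V)
       (\<lambda>f X. if X \<in> faces P then \<Prod>S\<in>P. f S (face_restrict X S) else 0)"

definition semisimple :: "'a set set \<Rightarrow> ('a face \<Rightarrow> 'k::field) \<Rightarrow> bool" where
  "semisimple P f \<longleftrightarrow>
     f \<in> ext_prod P (\<lambda>S. Lvee_dual {S}) ` vcarrier (tensor P (\<lambda>S. Lvee_dual {S}))"


section \<open>Layered forests and the forest derivative\<close>

definition Redn :: "'a set set \<Rightarrow> 'a set \<Rightarrow> 'a set" where
  "Redn P E = E - \<Union>{B \<in> P. B \<subseteq> E}"

text \<open>The partition \<open>Q\<close> obtained from \<open>P\<close> by cutting the block \<open>C \<union> D\<close> into \<open>C\<close> and \<open>D\<close>.\<close>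

definition cut_target :: "'a set set \<Rightarrow> 'a set \<times> 'a set \<Rightarrow> 'a set set" where
  "cut_target P V = (case V of (C, D) \<Rightarrow> insert C (insert D (P - {C \<union> D})))"

definition face_cut :: "'a set set \<Rightarrow> 'a set \<times> 'a set \<Rightarrow> 'a face \<Rightarrow> 'a face" where
  "face_cut P V X = face_of_sign (\<Union>P) (\<lambda>S.
     if Redn P S = Redn P (fst V) then 1
     else if Redn P S = Redn P (snd V) then -1
     else if Redn (cut_target P V) S \<noteq> {} then face_sign X S
     else 0)"

definition cut_deriv ::
  "'a set set \<Rightarrow> 'a set \<times> 'a set \<Rightarrow> ('a face \<Rightarrow> 'k::field) \<Rightarrow> 'a face \<Rightarrow> 'k" where
  "cut_deriv P V f =
     (\<lambda>X. if X \<in> faces (cut_target P V)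
          then f (face_cut P V X) - f (face_cut P (prod.swap V) X) else 0)"

fun cuts_deriv ::
  "'a set set \<Rightarrow> ('a set \<times> 'a set) list \<Rightarrow> ('a face \<Rightarrow> 'k::field) \<Rightarrow> 'a face \<Rightarrow> 'k" where
  "cuts_deriv P [] f = f"
| "cuts_deriv P (V # Vs) f = cuts_deriv (cut_target P V) Vs (cut_deriv P V f)"

text \<open>Planar full binary trees with leaves labelled in \<open>'b\<close>. The number at a node is its position in the
  linear order on nodes.\<close>

datatype 'b ltree = Leaf 'b | Node nat "'b ltree" "'b ltree"

fun leaves :: "'b ltree \<Rightarrow> 'b list" where
  "leaves (Leaf b) = [b]"
| "leaves (Node n l r) = leaves l @ leaves r"

fun ranks :: "'b ltree \<Rightarrow> nat list" where
  "ranks (Leaf b) = []"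
| "ranks (Node n l r) = n # ranks l @ ranks r"

fun heap_ordered :: "'b ltree \<Rightarrow> bool" where
  "heap_ordered (Leaf b) = True"
| "heap_ordered (Node n l r) \<longleftrightarrow>
     (\<forall>m \<in> set (ranks l) \<union> set (ranks r). n < m) \<and> heap_ordered l \<and> heap_ordered r"

fun shape :: "'b ltree \<Rightarrow> 'b ltree" where
  "shape (Leaf b) = Leaf b"
| "shape (Node n l r) = Node 0 (shape l) (shape r)"

text \<open>The cuts at the nodes of a tree whose leaves are labelled by blocks.\<close>

fun node_cuts :: "'a set ltree \<Rightarrow> (nat \<times> 'a set \<times> 'a set) set" where
  "node_cuts (Leaf S) = {}"
| "node_cuts (Node n l r) =
     insert (n, \<Union>(set (leaves l)), \<Union>(set (leaves r))) (node_cuts l \<union> node_cuts r)"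

text \<open>A layered forest over \<open>P\<close> has one tree \<open>F S\<close> over each \<open>S \<in> P\<close>. The last condition says that the
  nodes of all trees together are numbered bijectively by \<open>0, \<dots>, l - 1\<close>, where \<open>l\<close> is their number.\<close>

definition forest_size :: "'a set set \<Rightarrow> ('a set \<Rightarrow> 'a set ltree) \<Rightarrow> nat" where
  "forest_size P F = (\<Sum>S\<in>P. length (ranks (F S)))"

definition layered_forest :: "'a set set \<Rightarrow> ('a set \<Rightarrow> 'a set ltree) \<Rightarrow> bool" where
  "layered_forest P F \<longleftrightarrow>
     (\<forall>S\<in>P. distinct (leaves (F S)) \<and> partition_on S (set (leaves (F S))) \<and> heap_ordered (F S)) \<and>
     (\<Union>S\<in>P. set (ranks (F S))) = {..<forest_size P F}"

definition forest_target :: "'a set set \<Rightarrow> ('a set \<Rightarrow> 'a set ltree) \<Rightarrow> 'a set set" where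
  "forest_target P F = (\<Union>S\<in>P. set (leaves (F S)))"

definition forest_cuts :: "'a set set \<Rightarrow> ('a set \<Rightarrow> 'a set ltree) \<Rightarrow> ('a set \<times> 'a set) list" where
  "forest_cuts P F = map (\<lambda>n. THE V. \<exists>S\<in>P. (n, V) \<in> node_cuts (F S)) [0..<forest_size P F]"

definition forest_deriv ::
  "'a set set \<Rightarrow> ('a set \<Rightarrow> 'a set ltree) \<Rightarrow> ('a face \<Rightarrow> 'k::field) \<Rightarrow> 'a face \<Rightarrow> 'k" where
  "forest_deriv P F = cuts_deriv P (forest_cuts P F)"


section \<open>The species \<open>\<Gamma>\<close>\<close>

definition semisimply_differentiable :: "'a set set \<Rightarrow> ('a face \<Rightarrow> 'k::field) \<Rightarrow> bool" where
  "semisimply_differentiable P f \<longleftrightarrow>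
     (\<forall>F. layered_forest P F \<longrightarrow> semisimple (forest_target P F) (forest_deriv P F f))"

definition gamma_dual :: "'a set \<Rightarrow> ('k::field, 'a face \<Rightarrow> 'k) vspace" where
  "gamma_dual I = (Lvee_dual {I})\<lparr>vcarrier :=
     (if I = {} then {\<lambda>_. 0} else {f \<in> vcarrier (Lvee_dual {I}). semisimply_differentiable {I} f})\<rparr>"

definition face_pairing :: "'a set set \<Rightarrow> ('a face \<Rightarrow> 'k::field) \<Rightarrow> ('a face \<Rightarrow> 'k) \<Rightarrow> 'k" where
  "face_pairing P f d = (\<Sum>X\<in>faces P. f X * d X)"

type_synonym ('k, 'a) gamma_elt = "('a face \<Rightarrow> 'k) set"

definition gamma_null :: "'a set \<Rightarrow> ('a face \<Rightarrow> 'k::field) set" where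
  "gamma_null I = {d \<in> vcarrier (Lvee {I}). \<forall>f\<in>vcarrier (gamma_dual I). face_pairing {I} f d = 0}"

definition gamma :: "'a set \<Rightarrow> ('k::field, ('k, 'a) gamma_elt) vspace" where
  "gamma I = vquot (Lvee {I}) (gamma_null I)"

definition gamma_pairing :: "'a set \<Rightarrow> ('a face \<Rightarrow> 'k::field) \<Rightarrow> ('k, 'a) gamma_elt \<Rightarrow> 'k" where
  "gamma_pairing I f D = the_elem (face_pairing {I} f ` D)"

text \<open>Relabelling along a bijection \<open>\<sigma> : I \<rightarrow> \<sigma> ` I\<close>. The image of a coset is a coset.\<close>

definition face_map :: "'a set \<Rightarrow> ('a \<Rightarrow> 'b) \<Rightarrow> 'a face \<Rightarrow> 'b face" where
  "face_map I \<sigma> X = (\<lambda>h j. if j \<in> \<sigma> ` I then h (inv_into I \<sigma> j) else 0) ` X"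

definition gamma_map :: "'a set \<Rightarrow> ('a \<Rightarrow> 'b) \<Rightarrow> ('k::field, 'a) gamma_elt \<Rightarrow> ('k, 'b) gamma_elt" where
  "gamma_map I \<sigma> D = free_map (face_map I \<sigma>) ` D"


section \<open>The operad \<open>Lie\<close>\<close>

definition layered_trees :: "'b set \<Rightarrow> 'b ltree set" where
  "layered_trees J = {t. distinct (leaves t) \<and> set (leaves t) = J \<and> heap_ordered t \<and>
     set (ranks t) = {..<length (ranks t)}}"

definition Lay :: "'b set \<Rightarrow> ('k::field, 'b ltree \<Rightarrow> 'k) vspace" where
  "Lay J = vfree (layered_trees J)"

text \<open>Exchange of the two subtrees at one node.\<close>

inductive swap_at_node :: "'b ltree \<Rightarrow> 'b ltree \<Rightarrow> bool" where
  "swap_at_node (Node n a b) (Node n b a)"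
| "swap_at_node a a' \<Longrightarrow> swap_at_node (Node n a b) (Node n a' b)"
| "swap_at_node b b' \<Longrightarrow> swap_at_node (Node n a b) (Node n a b')"

text \<open>Three trees that agree except for subtrees \<open>[[a,b],c]\<close>, \<open>[[b,c],a]\<close>, \<open>[[c,a],b]\<close>.\<close>

inductive jacobi_triple :: "'b ltree \<Rightarrow> 'b ltree \<Rightarrow> 'b ltree \<Rightarrow> bool" where
  "jacobi_triple (Node m (Node n a b) c) (Node m (Node n b c) a) (Node m (Node n c a) b)"
| "jacobi_triple a1 a2 a3 \<Longrightarrow> jacobi_triple (Node n a1 b) (Node n a2 b) (Node n a3 b)"
| "jacobi_triple b1 b2 b3 \<Longrightarrow> jacobi_triple (Node n a b1) (Node n a b2) (Node n a b3)"

definition lie_rels :: "'b set \<Rightarrow> ('b ltree \<Rightarrow> 'k::field) set" where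
  "lie_rels J =
     {\<lambda>z. vbasis t z + vbasis t' z | t t'.
        t \<in> layered_trees J \<and> t' \<in> layered_trees J \<and> swap_at_node t t'} \<union>
     {\<lambda>z. vbasis t1 z + vbasis t2 z + vbasis t3 z | t1 t2 t3.
        t1 \<in> layered_trees J \<and> t2 \<in> layered_trees J \<and> t3 \<in> layered_trees J \<and> jacobi_triple t1 t2 t3} \<union>
     {\<lambda>z. vbasis t z - vbasis t' z | t t'.
        t \<in> layered_trees J \<and> t' \<in> layered_trees J \<and> shape t = shape t'}"

type_synonym ('k, 'b) lie_elt = "('b ltree \<Rightarrow> 'k) set"

definition lie :: "'b set \<Rightarrow> ('k::field, ('k, 'b) lie_elt) vspace" where
  "lie J = vquot (Lay J) (vspan (Lay J) (lie_rels J))"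

definition lie_class :: "'b set \<Rightarrow> 'b ltree \<Rightarrow> ('k::field, 'b) lie_elt" where
  "lie_class J t = vcoset (Lay J) (vspan (Lay J) (lie_rels J)) (vbasis t)"

text \<open>Relabelling of leaves along a bijection.\<close>

definition lie_map :: "('b \<Rightarrow> 'c) \<Rightarrow> ('k::field, 'b) lie_elt \<Rightarrow> ('k, 'c) lie_elt" where
  "lie_map \<phi> A = free_map (map_ltree \<phi>) ` A"

fun graft :: "'b ltree \<Rightarrow> ('b \<Rightarrow> 'c ltree) \<Rightarrow> 'c ltree" where
  "graft (Leaf b) U = U b"
| "graft (Node n l r) U = Node n (graft l U) (graft r U)"

text \<open>Operadic composition \<open>Lie \<circ> Lie \<rightarrow> Lie\<close> by grafting. The numbering of the grafted tree is
  meaningless, so an arbitrary layering of it is chosen; its class does not depend on the choice.\<close>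

definition lie_mult ::
  "'b set \<Rightarrow> ('k::field, 'b, ('k, 'b set) lie_elt, ('k, 'b) lie_elt) comp_elt \<Rightarrow> ('k, 'b) lie_elt" where
  "lie_mult J =
     linext (species_comp lie lie J) (lie J)
       {(R, T, U). partition_on J R \<and> T \<in> layered_trees R \<and> U \<in> (\<Pi>\<^sub>E r\<in>R. layered_trees r)}
       (\<lambda>(R, T, U). comp_pure lie lie J R (lie_class R T) (\<lambda>r\<in>R. lie_class r (U r)))
       (\<lambda>(R, T, U). lie_class J (SOME t. t \<in> layered_trees J \<and> shape t = shape (graft T U)))"

text \<open>The value of the unit \<open>1 \<rightarrow> Lie\<close> on a one-element set.\<close>

definition lie_unit :: "'b \<Rightarrow> ('k::field, 'b) lie_elt" where
  "lie_unit b = lie_class {b} (Leaf b)"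


section \<open>The action of \<open>Lie\<close> on \<open>\<Gamma>\<close>\<close>

text \<open>\<open>tree_deriv I P T\<close> is \<open>\<partial>\<^sub>T : \<Gamma>\<^sup>*[I] \<rightarrow> \<Otimes>\<^sub>S \<Gamma>\<^sup>*[S]\<close>, for a layered tree \<open>T\<close> over \<open>I\<close> with leaves
  labelled by the blocks of \<open>P\<close>, and \<open>dual_tree_deriv I P T\<close> is its linear dual.\<close>

definition tree_deriv ::
  "'a set \<Rightarrow> 'a set set \<Rightarrow> 'a set ltree \<Rightarrow> ('a face \<Rightarrow> 'k::field) \<Rightarrow>
   (('a set \<Rightarrow> 'a face \<Rightarrow> 'k) \<Rightarrow> 'k) set" where
  "tree_deriv I P T f =
     inv_into (vcarrier (tensor P gamma_dual)) (ext_prod P gamma_dual) (forest_deriv {I} (\<lambda>_. T) f)"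

definition tensor_pairing ::
  "'a set set \<Rightarrow> (('a set \<Rightarrow> 'a face \<Rightarrow> 'k::field) \<Rightarrow> 'k) set \<Rightarrow>
   (('a set \<Rightarrow> ('k, 'a) gamma_elt) \<Rightarrow> 'k) set \<Rightarrow> 'k" where
  "tensor_pairing P u D =
     linext (tensor P gamma) vfield (\<Pi>\<^sub>E S\<in>P. vcarrier (gamma S)) (pure P gamma)
       (\<lambda>x. linext (tensor P gamma_dual) vfield (\<Pi>\<^sub>E S\<in>P. vcarrier (gamma_dual S)) (pure P gamma_dual)
              (\<lambda>f. \<Prod>S\<in>P. gamma_pairing S (f S) (x S)) u) D"

definition dual_tree_deriv ::
  "'a set \<Rightarrow> 'a set set \<Rightarrow> 'a set ltree \<Rightarrow> (('a set \<Rightarrow> ('k::field, 'a) gamma_elt) \<Rightarrow> 'k) set \<Rightarrow>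
   ('k, 'a) gamma_elt" where
  "dual_tree_deriv I P T D =
     (THE E. E \<in> vcarrier (gamma I) \<and>
       (\<forall>f\<in>vcarrier (gamma_dual I). gamma_pairing I f E = tensor_pairing P (tree_deriv I P T f) D))"

definition lie_action ::
  "'a set \<Rightarrow> ('k::field, 'a, ('k, 'a set) lie_elt, ('k, 'a) gamma_elt) comp_elt \<Rightarrow> ('k, 'a) gamma_elt" where
  "lie_action I =
     linext (species_comp lie gamma I) (gamma I)
       {(P, T, D). partition_on I P \<and> T \<in> layered_trees P \<and> D \<in> vcarrier (tensor P gamma)}
       (\<lambda>(P, T, D). comp_elem lie gamma I P (lie_class P T) D)
       (\<lambda>(P, T, D). dual_tree_deriv I P T D)"

text \<open>\<open>(Lie \<circ> \<Gamma>)[\<sigma>]\<close> for a bijection \<open>\<sigma> : I \<rightarrow> \<sigma> ` I\<close>.\<close>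

definition lie_gamma_map ::
  "'a set \<Rightarrow> ('a \<Rightarrow> 'b) \<Rightarrow> ('k::field, 'a, ('k, 'a set) lie_elt, ('k, 'a) gamma_elt) comp_elt \<Rightarrow>
   ('k, 'b, ('k, 'b set) lie_elt, ('k, 'b) gamma_elt) comp_elt" where
  "lie_gamma_map I \<sigma> =
     comp_ext lie gamma I (species_comp lie gamma (\<sigma> ` I))
       (\<lambda>P t x. comp_pure lie gamma (\<sigma> ` I) ((`) \<sigma> ` P) (lie_map ((`) \<sigma>) t)
          (\<lambda>S'\<in>(`) \<sigma> ` P. let S = inv_into P ((`) \<sigma>) S' in gamma_map S \<sigma> (x S)))"

text \<open>The map \<open>Lie \<circ> \<gamma> : Lie \<circ> (Lie \<circ> \<Gamma>) \<rightarrow> Lie \<circ> \<Gamma>\<close> induced by the action \<open>\<gamma>\<close>, the map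
  \<open>\<mu> \<circ> \<Gamma> : (Lie \<circ> Lie) \<circ> \<Gamma> \<rightarrow> Lie \<circ> \<Gamma>\<close> induced by the operadic composition \<open>\<mu>\<close>, and the canonical
  isomorphism \<open>Lie \<circ> (Lie \<circ> \<Gamma>) \<rightarrow> (Lie \<circ> Lie) \<circ> \<Gamma>\<close>.\<close>

type_synonym ('k, 'a) lie_gamma_elt =
  "('k, 'a, ('k, 'a set) lie_elt, ('k, 'a) gamma_elt) comp_elt"

type_synonym ('k, 'a) lie_lie_elt =
  "('k, 'a, ('k, 'a set) lie_elt, ('k, 'a) lie_elt) comp_elt"

definition lie_comp_action ::
  "'a set \<Rightarrow> ('k::field, 'a, ('k, 'a set) lie_elt, ('k, 'a) lie_gamma_elt) comp_elt \<Rightarrow>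
   ('k, 'a) lie_gamma_elt" where
  "lie_comp_action I =
     comp_ext lie (species_comp lie gamma) I (species_comp lie gamma I)
       (\<lambda>P t u. comp_pure lie gamma I P t (\<lambda>S\<in>P. lie_action S (u S)))"

definition mult_comp_gamma ::
  "'a set \<Rightarrow> ('k::field, 'a, ('k, 'a set) lie_lie_elt, ('k, 'a) gamma_elt) comp_elt \<Rightarrow>
   ('k, 'a) lie_gamma_elt" where
  "mult_comp_gamma I =
     comp_ext (species_comp lie lie) gamma I (species_comp lie gamma I)
       (\<lambda>Q m x. comp_pure lie gamma I Q (lie_mult Q m) x)"

text \<open>In the associator, \<open>Ps S\<close> is a partition of the block \<open>S\<close> of \<open>P\<close>; then \<open>Q = \<Union>\<^sub>S Ps S\<close> is a partition of
  \<open>I\<close>, \<open>{Ps S | S \<in> P}\<close> is the corresponding partition of the finite set \<open>Q\<close>, and \<open>\<Union>(Ps S) = S\<close>.\<close>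

definition lie_assoc ::
  "'a set \<Rightarrow> ('k::field, 'a, ('k, 'a set) lie_elt, ('k, 'a) lie_gamma_elt) comp_elt \<Rightarrow>
   ('k, 'a, ('k, 'a set) lie_lie_elt, ('k, 'a) gamma_elt) comp_elt" where
  "lie_assoc I =
     linext (species_comp lie (species_comp lie gamma) I) (species_comp (species_comp lie lie) gamma I)
       {(P, t, Ps, ts, x). partition_on I P \<and> t \<in> vcarrier (lie P) \<and>
          (\<forall>S\<in>P. partition_on S (Ps S) \<and> ts S \<in> vcarrier (lie (Ps S))) \<and>
          x \<in> (\<Pi>\<^sub>E B\<in>\<Union>(Ps ` P). vcarrier (gamma B))}
       (\<lambda>(P, t, Ps, ts, x).
          comp_pure lie (species_comp lie gamma) I P t
            (\<lambda>S\<in>P. comp_pure lie gamma S (Ps S) (ts S) (restrict x (Ps S))))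
       (\<lambda>(P, t, Ps, ts, x).
          comp_pure (species_comp lie lie) gamma I (\<Union>(Ps ` P))
            (comp_pure lie lie (\<Union>(Ps ` P)) (Ps ` P) (lie_map Ps t) (\<lambda>r\<in>Ps ` P. ts (\<Union>r)))
            x)"

end

theory Submission
 imports Defs "HOL-Algebra.FiniteProduct"
begin

text \<open>A functional on the faces with support \<open>T\<^sup>\<or>[P]\<close> is semisimple if and only if its value at \<open>X\<close> depends
only on the restrictions of \<open>X\<close> to the blocks of \<open>P\<close>. Since a layered forest is a sequence of cuts,
\<open>\<Gamma>\<^sup>*[I]\<close> therefore consists of the functionals all of whose iterated cut derivatives are local in this sense.
The derivative along one cut \<open>[C, D]\<close> dualizes to a bracket \<open>\<Gamma>[C] \<otimes> \<Gamma>[D] \<rightarrow> \<Gamma>[C \<union> D]\<close>, and the dual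
\<open>\<partial>\<^sup>*\<^sub>T\<close> of the derivative along a tree \<open>T\<close> is the iterated bracket of shape \<open>T\<close>. The bracket is antisymmetric,
and it satisfies the Jacobi identity because only six chambers surround a face with support \<open>T\<^sup>\<or>[(A|B|C)]\<close>.
So the iterated brackets factor through \<open>Lie\<close>, and associativity of the action reduces to the
observation that a bracket of grafted shape is a bracket of brackets.\<close>

section \<open>Linear algebra with explicit carriers\<close>

text \<open>Everything on the module side is dual: an identity in \<Gamma> is proved by pairing it
  with \<open>\<Gamma>\<^sup>*\<close>, and the bracket is defined on arbitrarily chosen
  representatives. What makes it well defined is a factorization. Freezing the face on one of the
  blocks \<open>C\<close>, \<open>D\<close> in the derivative of \<open>f\<close> along
  \<open>[C, D]\<close> leaves a functional in \<open>\<Gamma>\<^sup>*\<close> of the other block,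
  and a reproducing kernel of \<open>\<Gamma>\<^sup>*[C]\<close> then writes the derivative as a
  finite sum of products of functionals in \<open>\<Gamma>\<^sup>*[C]\<close> and
  \<open>\<Gamma>\<^sup>*[D]\<close>. The obstacle on the operadic side is that the composition of
  \<open>Lie\<close>, the associator and the action are definite descriptions of linear maps with
  values prescribed on generators. Each denotes the intended map only once such a map is known to
  exist, and for the composition and the associator the prescribed formula speaks only of inner
  arguments that are themselves generators. Existence is obtained by extending one coordinate at a
  time. Identities between these maps are then compared on generators, where they become statements
  about trees.\<close>

definition vs :: "('k::field, 'v) vspace => bool" where
 "vs V \<longleftrightarrow> vzero V \<in> vcarrier V \<and> (\<forall>u\<in>vcarrier V. \<forall>v\<in>vcarrier V. vadd V u v \<in> vcarrier V \<and> vadd V u v = vadd V v u)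
  \<and> (\<forall>c. \<forall>v\<in>vcarrier V. vscale V c v \<in> vcarrier V) \<and> (\<forall>u\<in>vcarrier V. \<forall>v\<in>vcarrier V. \<forall>w\<in>vcarrier V.
     vadd V (vadd V u v) w = vadd V u (vadd V v w))
  \<and> (\<forall>v\<in>vcarrier V. vadd V (vzero V) v = v \<and> vscale V 0 v = vzero V \<and> vscale V 1 v = v)
  \<and> (\<forall>a b. \<forall>v\<in>vcarrier V. vscale V (a + b) v = vadd V (vscale V a v) (vscale V b v) \<and> vscale V a (vscale V b v) = vscale V (a * b) v)
  \<and> (\<forall>a. \<forall>u\<in>vcarrier V. \<forall>v\<in>vcarrier V.
     vscale V a (vadd V u v) = vadd V (vscale V a u) (vscale V a v))"

context
 fixes V :: "('k::field, 'v) vspace"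
 assumes V: "vs V"
begin

lemma vs_zero [simp]: "vzero V \<in> vcarrier V"
 and vs_add [simp]: "u \<in> vcarrier V ==> v \<in> vcarrier V ==> vadd V u v \<in> vcarrier V"
 and vs_scale [simp]: "v \<in> vcarrier V ==> vscale V c v \<in> vcarrier V"
 and vs_comm: "u \<in> vcarrier V ==> v \<in> vcarrier V ==> vadd V u v = vadd V v u"
 and vs_assoc: "u \<in> vcarrier V ==> v \<in> vcarrier V ==> w \<in> vcarrier V ==>
   vadd V (vadd V u v) w = vadd V u (vadd V v w)"
 and vs_zero_left [simp]: "v \<in> vcarrier V ==> vadd V (vzero V) v = v"
 and vs_scale_0 [simp]: "v \<in> vcarrier V ==> vscale V 0 v = vzero V"
 and vs_scale_1 [simp]: "v \<in> vcarrier V ==> vscale V 1 v = v"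
 and vs_scale_add: "v \<in> vcarrier V ==> vscale V (a + b) v = vadd V (vscale V a v) (vscale V b v)"
 and vs_scale_scale [simp]: "v \<in> vcarrier V ==> vscale V a (vscale V b v) = vscale V (a * b) v"
 and vs_scale_vadd: "u \<in> vcarrier V ==> v \<in> vcarrier V ==>
   vscale V a (vadd V u v) = vadd V (vscale V a u) (vscale V a v)" using V unfolding vs_def by blast+

lemma vs_lcomm: "u \<in> vcarrier V ==> v \<in> vcarrier V ==> w \<in> vcarrier V ==>
  vadd V u (vadd V v w) = vadd V v (vadd V u w)" using vs_assoc vs_comm by metis

lemma vs_zero_right [simp]: "v \<in> vcarrier V ==> vadd V v (vzero V) = v" using vs_comm[of v "vzero V"] by simp

lemma vs_scale_zero [simp]: "vscale V c (vzero V) = vzero V" using vs_scale_scale[of "vzero V" c 0] by simp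

lemma vs_neg: "v \<in> vcarrier V ==> vadd V v (vscale V (-1) v) = vzero V" using vs_scale_add[of v 1 "-1"] by simp

lemma vs_neg': "v \<in> vcarrier V ==> vadd V (vscale V (-1) v) v = vzero V" using vs_scale_add[of v "-1" 1] by simp

lemma vs_cancel: "u \<in> vcarrier V ==> v \<in> vcarrier V ==> vadd V u (vscale V (-1) v) = vzero V ==> u = v"
 by (metis vs_assoc vs_neg' vs_scale vs_zero_left vs_zero_right)

end

text \<open>The additive monoid of a space. It turns finite products in commutative monoids into
  finite vector sums.\<close>

definition vmon :: "('k, 'v) vspace => 'v monoid" where
 "vmon V = \<lparr>carrier = vcarrier V, mult = vadd V, one = vzero V\<rparr>"

lemma vmon_simps [simp]: "carrier (vmon V) = vcarrier V" "mult (vmon V) = vadd V" "one (vmon V) = vzero V" by (simp_all add: vmon_def)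

lemma vmon_comm_monoid: "vs V ==> comm_monoid (vmon V)" by (rule comm_monoidI) (auto simp: vs_assoc intro: vs_comm)

definition vsum :: "('k, 'v) vspace => ('i => 'v) => 'i set => 'v" where
 "vsum V f A = finprod (vmon V) f A"

lemma vsum_closed: "vs V ==> f \<in> A \<rightarrow> vcarrier V ==> vsum V f A \<in> vcarrier V"
 unfolding vsum_def using comm_monoid.finprod_closed[OF vmon_comm_monoid, of V f A] by simp

lemma vsum_empty [simp]: "vs V ==> vsum V f {} = vzero V"
 unfolding vsum_def using comm_monoid.finprod_empty[OF vmon_comm_monoid, of V f] by simp

lemma vsum_insert: "vs V ==> finite A ==> a \<notin> A ==> f \<in> insert a A \<rightarrow> vcarrier V ==>
  vsum V f (insert a A) = vadd V (f a) (vsum V f A)"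
 unfolding vsum_def using comm_monoid.finprod_insert[OF vmon_comm_monoid, of V A a f] by simp

lemma vsum_add: "vs V ==> f \<in> A \<rightarrow> vcarrier V ==> g \<in> A \<rightarrow> vcarrier V ==>
  vsum V (\<lambda>x. vadd V (f x) (g x)) A = vadd V (vsum V f A) (vsum V g A)"
 unfolding vsum_def using comm_monoid.finprod_multf[OF vmon_comm_monoid, of V f A g] by simp

lemma vsum_cong: "vs V ==> A = B ==> g \<in> B \<rightarrow> vcarrier V ==> (!!x. x \<in> B ==> f x = g x) ==>
  vsum V f A = vsum V g B" unfolding vsum_def using comm_monoid.finprod_cong'[OF vmon_comm_monoid, of V A B g f] by simp

lemma vsum_scale: "finite A ==> vs V ==> f \<in> A \<rightarrow> vcarrier V ==>
  vsum V (\<lambda>x. vscale V c (f x)) A = vscale V c (vsum V f A)"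
proof (induction A rule: finite_induct)
 case (insert a A)
 then have "vsum V (\<lambda>x. vscale V c (f x)) (insert a A)
   = vadd V (vscale V c (f a)) (vsum V (\<lambda>x. vscale V c (f x)) A)" by (subst vsum_insert) (auto simp: Pi_iff)
 also have "\<dots> = vadd V (vscale V c (f a)) (vscale V c (vsum V f A))" using insert by auto
 also have "\<dots> = vscale V c (vsum V f (insert a A))" using insert by (subst vsum_insert) (auto simp: vs_scale_vadd vsum_closed)
 finally show ?case .
qed simp

lemma vsum_superset:
 assumes "vs V" "finite B" "A \<subseteq> B" "f \<in> A \<rightarrow> vcarrier V" "!!x. x \<in> B - A ==> f x = vzero V"
 shows "vsum V f B = vsum V f A"
proof -
 have fin: "finite A" "finite (B - A)" using assms finite_subset by auto
 have "\<forall>x\<in>C. f x = vzero V ==> C \<inter> A = {} ==> vsum V f (C \<union> A) = vsum V f A" if "finite C" for C using that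
 proof (induction C rule: finite_induct)
  case (insert c C)
  have "f \<in> insert c (C \<union> A) \<rightarrow> vcarrier V" using insert.prems assms(1,4) by auto
  then have "vsum V f (insert c (C \<union> A)) = vadd V (f c) (vsum V f (C \<union> A))" using insert fin assms(1) by (intro vsum_insert) auto
  then show ?case using insert vsum_closed[OF assms(1,4)] assms(1) by auto
 qed simp
 from this[of "B - A"] fin assms(3,5) show ?thesis by (metis Diff_disjoint Diff_partition Int_commute Un_commute)
qed

lemma vsum_single:
 assumes "vs V" "finite A" "a \<in> A" "f a \<in> vcarrier V" "!!x. x \<in> A ==> x \<noteq> a ==> f x = vzero V"
 shows "vsum V f A = f a"
proof -
 have "vsum V f A = vsum V f {a}" using assms by (intro vsum_superset) auto
 also have "\<dots> = f a" using assms vsum_insert[of V "{}" a f] by simp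
 finally show ?thesis .
qed

section \<open>Subspaces, spans and linear maps\<close>

definition vsub :: "('k::field, 'v) vspace => 'v set => bool" where
 "vsub V W \<longleftrightarrow> W \<subseteq> vcarrier V \<and> vzero V \<in> W \<and> (\<forall>u\<in>W. \<forall>v\<in>W. vadd V u v \<in> W) \<and> (\<forall>c. \<forall>v\<in>W. vscale V c v \<in> W)"

lemma vspan_sub:
 assumes "vs V" "X \<subseteq> vcarrier V" shows "vsub V (vspan V X)"
proof -
 have "x \<in> vcarrier V" if "x \<in> vspan V X" for x using that by induction (use assms in auto)
 then show ?thesis by (auto simp: vsub_def intro: vspan.intros)
qed

lemma vspan_closed: "vs V ==> X \<subseteq> vcarrier V ==> v \<in> vspan V X ==> v \<in> vcarrier V" using vspan_sub unfolding vsub_def by blast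

lemma vspan_least: "vsub V W ==> X \<subseteq> W ==> vspan V X \<subseteq> W"
proof
 fix x assume "vsub V W" "X \<subseteq> W" "x \<in> vspan V X"
 from this(3) show "x \<in> W" by induction (use \<open>vsub V W\<close> \<open>X \<subseteq> W\<close> in \<open>auto simp: vsub_def\<close>)
qed

lemma vspan_vsum: "finite A ==> vs V ==> vsub V W ==> f \<in> A \<rightarrow> W ==> vsum V f A \<in> W"
proof (induction A rule: finite_induct)
 case (insert a A)
 then have "vsum V f (insert a A) = vadd V (f a) (vsum V f A)" by (intro vsum_insert) (auto simp: vsub_def)
 then show ?case using insert by (auto simp: vsub_def)
qed (simp add: vsub_def)

lemma vlinearD:
 assumes "vlinear V W g"
 shows "v \<in> vcarrier V ==> g v \<in> vcarrier W" "u \<in> vcarrier V ==> v \<in> vcarrier V ==> g (vadd V u v) = vadd W (g u) (g v)"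
  "v \<in> vcarrier V ==> g (vscale V c v) = vscale W c (g v)" using assms unfolding vlinear_def by auto

lemma vlinear_zero: "vs V ==> vs W ==> vlinear V W g ==> g (vzero V) = vzero W"
 using vlinearD(3)[of V W g "vzero V" 0] vlinearD(1)[of V W g "vzero V"] by simp

lemma vlinear_comp: "vlinear U V f ==> vlinear V W g ==> vlinear U W (\<lambda>x. g (f x))" unfolding vlinear_def by (auto simp: Pi_iff)

lemma vlinear_cong: "vs V ==> vlinear V W g ==> (!!v. v \<in> vcarrier V ==> g' v = g v) ==> vlinear V W g'" unfolding vlinear_def by auto

lemma vlinear_restrict: "vs V ==> vlinear V W (restrict g (vcarrier V)) = vlinear V W g" unfolding vlinear_def by (auto simp: Pi_iff)

lemma vlinear_vsum:
 assumes "vs V" "vs W" "vlinear V W g"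
 shows "finite A ==> f \<in> A \<rightarrow> vcarrier V ==> g (vsum V f A) = vsum W (\<lambda>x. g (f x)) A"
proof (induction A rule: finite_induct)
 case empty then show ?case using assms vlinear_zero by auto
next
 case (insert a A)
 have "vsum V f (insert a A) = vadd V (f a) (vsum V f A)" using insert assms by (intro vsum_insert) auto
 moreover have "vsum W (\<lambda>x. g (f x)) (insert a A) = vadd W (g (f a)) (vsum W (\<lambda>x. g (f x)) A)"
  using insert assms vlinearD(1)[OF assms(3)] by (intro vsum_insert) auto
 ultimately show ?case using insert assms vlinearD(2)[OF assms(3)] by (auto simp: vsum_closed)
qed

lemma vlinear_eq_span:
 assumes "vs V" "vs W" "vlinear V W g" "vlinear V W h" "X \<subseteq> vcarrier V" "!!x. x \<in> X ==> g x = h x" "v \<in> vspan V X"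
 shows "g v = h v" using assms(7)
proof induction
 case zero show ?case using vlinear_zero[OF assms(1,2)] assms(3,4) by metis
qed (use assms vlinearD(2,3)[OF assms(3)] vlinearD(2,3)[OF assms(4)] vspan_closed[OF assms(1,5)] in auto)

lemma vlinear_zero_span:
 assumes "vs V" "vs W" "vlinear V W g" "X \<subseteq> vcarrier V" "!!x. x \<in> X ==> g x = vzero W" "v \<in> vspan V X"
 shows "g v = vzero W" using assms(6)
proof induction
 case zero show ?case using vlinear_zero[OF assms(1,2)] assms(3) by metis
qed (use assms vlinearD(2,3)[OF assms(3)] vspan_closed[OF assms(1,4)] in auto)

lemma vlinear_span_image:
 assumes "vs V" "vs W" "vlinear V W g" "X \<subseteq> vcarrier V" "g ` X \<subseteq> vspan W Y" "v \<in> vspan V X"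
 shows "g v \<in> vspan W Y" using assms(6)
proof induction
 case zero show ?case using vlinear_zero[OF assms(1-3)] by (simp add: vspan.zero)
next
 case (base x) then show ?case using assms by auto
next
 case (add u v) then show ?case using vlinearD(2)[OF assms(3)] vspan_closed[OF assms(1,4)] by (metis vspan.add)
next
 case (scale v c) then show ?case using vlinearD(3)[OF assms(3)] vspan_closed[OF assms(1,4)] by (metis vspan.scale)
qed

text \<open>A \<open>linext\<close> is a definite description, so it has to be matched with an
  actual linear map \<open>g\<close> before it can be used. Spanning by the vectors
  \<open>e k\<close> forces every competitor to agree with \<open>g\<close> on the carrier, and
  restricting \<open>g\<close> settles the values outside.\<close>

lemma linext_eq:
 assumes "vs V" "vs W" "vlinear V W g" "!!k. k \<in> K ==> e k \<in> vcarrier V" "!!k. k \<in> K ==> g (e k) = \<phi> k" "vcarrier V \<subseteq> vspan V (e ` K)"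
 shows "linext V W K e \<phi> = restrict g (vcarrier V)" unfolding linext_def
proof (rule the_equality)
 show "restrict g (vcarrier V) \<in> extensional (vcarrier V) \<and> vlinear V W (restrict g (vcarrier V)) \<and>
   (\<forall>k\<in>K. restrict g (vcarrier V) (e k) = \<phi> k)" using assms by (auto simp: vlinear_restrict)
next
 fix h assume h: "h \<in> extensional (vcarrier V) \<and> vlinear V W h \<and> (\<forall>k\<in>K. h (e k) = \<phi> k)"
 have "h v = g v" if "v \<in> vcarrier V" for v by (rule vlinear_eq_span[OF assms(1,2), where X = "e ` K"]) (use h assms that in auto)
 then show "h = restrict g (vcarrier V)" using h by (auto simp: extensional_def fun_eq_iff)
qed

lemma vs_vfield [simp]: "vs vfield" by (auto simp: vs_def vfield_def algebra_simps)

lemma vfield_simps [simp]: "vcarrier vfield = UNIV" "vadd vfield = (+)" "vscale vfield = (*)" "vzero vfield = 0" by (auto simp: vfield_def)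

section \<open>Free vector spaces\<close>

lemma vfree_simps [simp]: "vadd (vfree X) = (\<lambda>u v x. u x + v x)" "vscale (vfree X) = (\<lambda>c v x. c * v x)" "vzero (vfree X) = (\<lambda>_. 0)"
 by (auto simp: vfree_def)

lemma vfree_carrier: "v \<in> vcarrier (vfree X) \<longleftrightarrow> finite {x. v x \<noteq> 0} \<and> (\<forall>x. x \<notin> X \<longrightarrow> v x = 0)" by (auto simp: vfree_def)

lemma vs_vfree [simp]: "vs (vfree X :: ('k::field, 'x => 'k) vspace)"
proof -
 have "finite {x. u x + v x \<noteq> 0}" if "finite {x. u x \<noteq> 0}" "finite {x. v x \<noteq> 0}" for u v :: "'x => 'k"
  by (rule finite_subset[OF _ finite_UnI[OF that]]) auto
 moreover have "finite {x. c * v x \<noteq> 0}" if "finite {x. v x \<noteq> 0}" for c and v :: "'x => 'k" by (rule finite_subset[OF _ that]) auto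
 ultimately show ?thesis unfolding vs_def vfree_simps by (auto simp: vfree_carrier algebra_simps)
qed

lemma vbasis_in [simp]: "x \<in> X ==> vbasis x \<in> vcarrier (vfree X)" by (auto simp: vfree_carrier vbasis_def)

lemma vfree_span: "vcarrier (vfree X) \<subseteq> vspan (vfree X) (vbasis ` X :: ('x => 'k::field) set)"
proof
 fix v :: "'x => 'k" assume v: "v \<in> vcarrier (vfree X)"
 have "\<forall>v :: 'x => 'k. {x. v x \<noteq> 0} \<subseteq> A \<longrightarrow> v \<in> vspan (vfree X) (vbasis ` X)" if "finite A" "A \<subseteq> X" for A using that
 proof (induction A rule: finite_induct)
  case empty
  show ?case
  proof (intro allI impI)
   fix v :: "'x => 'k" assume "{x. v x \<noteq> 0} \<subseteq> {}"
   then have v0: "v = vzero (vfree X)" by auto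
   show "v \<in> vspan (vfree X) (vbasis ` X)" unfolding v0 by (rule vspan.zero)
  qed
 next
  case (insert a A)
  show ?case
  proof (intro allI impI)
   fix v :: "'x => 'k" assume v: "{x. v x \<noteq> 0} \<subseteq> insert a A"
   have "{x. (v(a := 0)) x \<noteq> 0} \<subseteq> A" using v by auto
   then have "v(a := 0) \<in> vspan (vfree X) (vbasis ` X)" using insert by blast
   moreover have "vscale (vfree X) (v a) (vbasis a) \<in> vspan (vfree X) (vbasis ` X)" using insert by (intro vspan.scale vspan.base) auto
   ultimately have "vadd (vfree X) (v(a := 0)) (vscale (vfree X) (v a) (vbasis a)) \<in> vspan (vfree X) (vbasis ` X)" by (rule vspan.add)
   moreover have "vadd (vfree X) (v(a := 0)) (vscale (vfree X) (v a) (vbasis a)) = v" by (auto simp: vbasis_def fun_eq_iff)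
   ultimately show "v \<in> vspan (vfree X) (vbasis ` X)" by simp
  qed
 qed
 from this[of "{x. v x \<noteq> 0}"] v show "v \<in> vspan (vfree X) (vbasis ` X)" by (auto simp: vfree_carrier)
qed

definition free_lift :: "('k::field, 'w) vspace => ('x => 'w) => ('x => 'k) => 'w" where
 "free_lift W \<phi> v = vsum W (\<lambda>x. vscale W (v x) (\<phi> x)) {x. v x \<noteq> 0}"

text \<open>The supports of \<open>u\<close>, \<open>v\<close> and \<open>u + v\<close> differ, so
  linearity is checked after enlarging all three sums to a common finite set of indices. The added
  terms have coefficient zero.\<close>

lemma free_lift_superset:
 assumes "vs W" "\<phi> \<in> X \<rightarrow> vcarrier W" "finite A" "{x. v x \<noteq> 0} \<subseteq> A" "A \<subseteq> X"
 shows "free_lift W \<phi> v = vsum W (\<lambda>x. vscale W (v x) (\<phi> x)) A" unfolding free_lift_def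
 by (rule vsum_superset[symmetric]) (use assms in \<open>auto simp: Pi_iff subset_iff\<close>)

lemma free_lift_linear:
 fixes W :: "('k::field, 'w) vspace" and \<phi> :: "'x => 'w"
 assumes "vs W" "\<phi> \<in> X \<rightarrow> vcarrier W"
 shows "vlinear (vfree X) W (free_lift W \<phi>)" unfolding vlinear_def
proof (intro conjI ballI allI)
 show "free_lift W \<phi> \<in> vcarrier (vfree X) \<rightarrow> vcarrier W"
  unfolding free_lift_def by (intro Pi_I vsum_closed) (use assms in \<open>auto simp: vfree_carrier intro!: vs_scale\<close>)
next
 fix u v :: "'x => 'k" assume u: "u \<in> vcarrier (vfree X)" and v: "v \<in> vcarrier (vfree X)"
 define A where "A = {x. u x \<noteq> 0} \<union> {x. v x \<noteq> 0}"
 have A: "finite A" "A \<subseteq> X" using u v by (auto simp: A_def vfree_carrier)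
 have \<phi>: "\<phi> x \<in> vcarrier W" if "x \<in> A" for x using that A assms by auto
 have e: "free_lift W \<phi> w = vsum W (\<lambda>x. vscale W (w x) (\<phi> x)) A" if "{x. w x \<noteq> 0} \<subseteq> A" for w
  using free_lift_superset[OF assms A(1) that A(2)] .
 have "free_lift W \<phi> (vadd (vfree X) u v) = vsum W (\<lambda>x. vadd W (vscale W (u x) (\<phi> x)) (vscale W (v x) (\<phi> x))) A"
  by (subst e) (use assms \<phi> in \<open>auto simp: A_def vs_scale_add intro!: vsum_cong\<close>)
 also have "\<dots> = vadd W (free_lift W \<phi> u) (free_lift W \<phi> v)" by (subst vsum_add) (use assms \<phi> in \<open>auto simp: A_def e\<close>)
 finally show "free_lift W \<phi> (vadd (vfree X) u v) = vadd W (free_lift W \<phi> u) (free_lift W \<phi> v)" .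
next
 fix c and v :: "'x => 'k" assume v: "v \<in> vcarrier (vfree X)"
 define A where "A = {x. v x \<noteq> 0}"
 have A: "finite A" "A \<subseteq> X" using v by (auto simp: A_def vfree_carrier)
 have \<phi>: "\<phi> x \<in> vcarrier W" if "x \<in> A" for x using that A assms by auto
 have e: "free_lift W \<phi> w = vsum W (\<lambda>x. vscale W (w x) (\<phi> x)) A" if "{x. w x \<noteq> 0} \<subseteq> A" for w
  using free_lift_superset[OF assms A(1) that A(2)] .
 have "free_lift W \<phi> (vscale (vfree X) c v) = vsum W (\<lambda>x. vscale W c (vscale W (v x) (\<phi> x))) A"
  by (subst e) (use assms \<phi> in \<open>auto simp: A_def intro!: vsum_cong\<close>)
 also have "\<dots> = vscale W c (free_lift W \<phi> v)" by (subst vsum_scale) (use assms \<phi> A in \<open>auto simp: A_def e\<close>)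
 finally show "free_lift W \<phi> (vscale (vfree X) c v) = vscale W c (free_lift W \<phi> v)" .
qed

lemma free_lift_basis: "vs W ==> \<phi> x \<in> vcarrier W ==> free_lift W \<phi> (vbasis x) = \<phi> x"
 using free_lift_superset[of W \<phi> "{x}" "{x}" "vbasis x"] vsum_single[of W "{x}" x] by (auto simp: vbasis_def)

section \<open>Quotients by subspaces\<close>

context
 fixes V :: "('k::field, 'v) vspace" and W
 assumes V: "vs V" and W: "vsub V W"
begin

lemma subD: "w \<in> W ==> w \<in> vcarrier V" "vzero V \<in> W" "u \<in> W ==> v \<in> W ==> vadd V u v \<in> W" "v \<in> W ==> vscale V c v \<in> W"
 using W unfolding vsub_def by auto

lemma vcoset_self: "v \<in> vcarrier V ==> v \<in> vcoset V W v" unfolding vcoset_def using V subD(2) by (auto intro!: image_eqI[of _ _ "vzero V"])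

lemma vcoset_eq:
 assumes u: "u \<in> vcarrier V" and v: "v \<in> vcarrier V"
 shows "vcoset V W u = vcoset V W v \<longleftrightarrow> vadd V u (vscale V (-1) v) \<in> W"
proof
 assume "vcoset V W u = vcoset V W v"
 then obtain w where w: "w \<in> W" "u = vadd V v w" using vcoset_self[OF u] by (auto simp: vcoset_def)
 then have "vadd V u (vscale V (-1) v) = vadd V (vadd V v (vscale V (-1) v)) w"
  using V v subD(1)[OF w(1)] by (simp add: vs_assoc vs_comm vs_lcomm)
 then show "vadd V u (vscale V (-1) v) \<in> W" using V v w vs_neg[OF V v] subD(1) by auto
next
 assume a: "vadd V u (vscale V (-1) v) \<in> W" (is "?d \<in> W")
 have *: "vcoset V W a \<subseteq> vcoset V W b" if "a \<in> vcarrier V" "b \<in> vcarrier V" "d \<in> W" "a = vadd V b d" for a b d unfolding vcoset_def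
 proof safe
  fix w assume "w \<in> W"
  then show "vadd V a w \<in> vadd V b ` W" using that V subD by (auto intro!: image_eqI[of _ _ "vadd V d w"] simp: vs_assoc)
 qed
 have 1: "u = vadd V v ?d"
 proof -
  have "vadd V v ?d = vadd V u (vadd V v (vscale V (-1) v))" using V u v by (simp add: vs_lcomm)
  then show ?thesis using vs_neg[OF V v] V u by simp
 qed
 have 2: "v = vadd V u (vscale V (-1) ?d)"
 proof -
  have "vadd V u (vscale V (-1) ?d) = vadd V (vadd V u (vscale V (-1) u)) v" using V u v by (simp add: vs_scale_vadd vs_assoc)
  then show ?thesis using vs_neg[OF V u] V v by simp
 qed
 show "vcoset V W u = vcoset V W v" using *[OF u v a 1] *[OF v u subD(4)[OF a] 2] by blast
qed

lemma vquot_carrier: "A \<in> vcarrier (vquot V W) \<longleftrightarrow> (\<exists>v\<in>vcarrier V. A = vcoset V W v)" by (auto simp: vquot_def)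

lemma vquot_add:
 assumes "u \<in> vcarrier V" "v \<in> vcarrier V"
 shows "vadd (vquot V W) (vcoset V W u) (vcoset V W v) = vcoset V W (vadd V u v)"
proof -
 have "{vadd V a b |a b. a \<in> vcoset V W u \<and> b \<in> vcoset V W v} = vcoset V W (vadd V u v)" (is "?l = ?r")
 proof (rule Set.set_eqI, rule iffI)
  fix x assume "x \<in> ?l"
  then obtain w w' where w: "w \<in> W" "w' \<in> W" "x = vadd V (vadd V u w) (vadd V v w')" by (auto simp: vcoset_def)
  then have "x = vadd V (vadd V u v) (vadd V w w')" using V assms subD(1)[OF w(1)] subD(1)[OF w(2)] by (simp add: vs_assoc vs_lcomm)
  then show "x \<in> ?r" using w subD(3) by (auto simp: vcoset_def)
 next
  fix x assume "x \<in> ?r"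
  then obtain w where w: "w \<in> W" "x = vadd V (vadd V u v) w" by (auto simp: vcoset_def)
  then have "x = vadd V u (vadd V v w)" using V assms subD(1)[OF w(1)] by (simp add: vs_assoc)
  moreover have "u \<in> vcoset V W u" using vcoset_self assms by auto
  moreover have "vadd V v w \<in> vcoset V W v" using w by (auto simp: vcoset_def)
  ultimately show "x \<in> ?l" by blast
 qed
 then show ?thesis by (simp add: vquot_def)
qed

lemma vquot_scale:
 assumes "v \<in> vcarrier V"
 shows "vscale (vquot V W) c (vcoset V W v) = vcoset V W (vscale V c v)"
proof -
 have "{vadd V (vscale V c a) w |a w. a \<in> vcoset V W v \<and> w \<in> W} = vcoset V W (vscale V c v)" (is "?l = ?r")
 proof (rule Set.set_eqI, rule iffI)
  fix x assume "x \<in> ?l"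
  then obtain w w' where w: "w \<in> W" "w' \<in> W" "x = vadd V (vscale V c (vadd V v w)) w'" by (auto simp: vcoset_def)
  then have "x = vadd V (vscale V c v) (vadd V (vscale V c w) w')"
   using V assms subD(1)[OF w(1)] subD(1)[OF w(2)] by (simp add: vs_assoc vs_scale_vadd)
  then show "x \<in> ?r" using w subD(3,4) by (auto simp: vcoset_def)
 next
  fix x assume "x \<in> ?r"
  then obtain w where "w \<in> W" "x = vadd V (vscale V c v) w" by (auto simp: vcoset_def)
  then show "x \<in> ?l" using vcoset_self assms by blast
 qed
 then show ?thesis by (simp add: vquot_def)
qed

lemma vquot_zero: "vzero (vquot V W) = vcoset V W (vzero V)" using V subD(1) by (auto simp: vquot_def vcoset_def image_iff)

lemma vs_vquot: "vs (vquot V W)"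
proof -
 have c: "vcarrier (vquot V W) = vcoset V W ` vcarrier V" by (simp add: vquot_def)
 have comm: "vcoset V W (vadd V u v) = vcoset V W (vadd V v u)"
  if "u \<in> vcarrier V" "v \<in> vcarrier V" for u v using vs_comm[OF V that] by simp
 show ?thesis unfolding vs_def c vquot_zero ball_simps by (intro conjI ballI allI)
   (simp_all add: V vquot_add vquot_scale vs_assoc vs_scale_add vs_scale_vadd comm)
qed

lemma vcoset_linear: "vlinear V (vquot V W) (vcoset V W)" unfolding vlinear_def by (auto simp: vquot_add vquot_scale vquot_carrier)

lemma vcoset_zero: "v \<in> W ==> vcoset V W v = vzero (vquot V W)" unfolding vquot_zero using vcoset_eq[of v "vzero V"] subD V by auto

text \<open>The induced map evaluates \<open>g\<close> at a chosen representative. Two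
  representatives differ by an element of \<open>W\<close>, where \<open>g\<close> vanishes, so the
  choice does not affect the value.\<close>

lemma quot_lift:
 assumes "vs Z" "vlinear V Z g" "!!w. w \<in> W ==> g w = vzero Z"
 shows "\<exists>g'. vlinear (vquot V W) Z g' \<and> (\<forall>v\<in>vcarrier V. g' (vcoset V W v) = g v)"
proof -
 define g' where "g' A = g (SOME v. v \<in> vcarrier V \<and> A = vcoset V W v)" for A
 have *: "g' (vcoset V W v) = g v" if v: "v \<in> vcarrier V" for v
 proof -
  define u where "u = (SOME u. u \<in> vcarrier V \<and> vcoset V W v = vcoset V W u)"
  have u: "u \<in> vcarrier V" "vcoset V W v = vcoset V W u"
   using someI[of "\<lambda>u. u \<in> vcarrier V \<and> vcoset V W v = vcoset V W u" v] v by (auto simp: u_def)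
  have "vadd V v (vscale V (-1) u) \<in> W" using vcoset_eq u v by simp
  then have "vadd Z (g v) (vscale Z (-1) (g u)) = vzero Z" using assms(3) vlinearD[OF assms(2)] u(1) v V by (metis vs_scale)
  then have "g v = g u" using vs_cancel[OF assms(1)] vlinearD(1)[OF assms(2)] u v by auto
  then show ?thesis by (simp add: g'_def u_def)
 qed
 have "vlinear (vquot V W) Z g'" unfolding vlinear_def using * V vlinearD[OF assms(2)] by (auto simp: vquot_carrier vquot_add vquot_scale)
 with * show ?thesis by blast
qed

lemma quot_span:
 assumes "vcarrier V \<subseteq> vspan V X" "X \<subseteq> vcarrier V"
 shows "vcarrier (vquot V W) \<subseteq> vspan (vquot V W) (vcoset V W ` X)"
proof
 fix A assume "A \<in> vcarrier (vquot V W)"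
 then obtain v where v: "v \<in> vspan V X" "A = vcoset V W v" using assms(1) by (auto simp: vquot_carrier)
 have "vcoset V W ` X \<subseteq> vspan (vquot V W) (vcoset V W ` X)" by (rule subsetI) (rule vspan.base)
 from vlinear_span_image[OF V vs_vquot vcoset_linear assms(2) this v(1)] v(2)
 show "A \<in> vspan (vquot V W) (vcoset V W ` X)" by simp
qed

lemma vcoset_image:
 assumes "vlinear V V' F" "F ` W = W'" "v \<in> vcarrier V"
 shows "F ` vcoset V W v = vcoset V' W' (F v)" unfolding vcoset_def assms(2)[symmetric] image_image
 by (rule image_cong) (use vlinearD(2)[OF assms(1)] assms(3) subD(1) in auto)

end

text \<open>Universal property of a space with generators \<open>X\<close> and relations
  \<open>R\<close>. The tensor products and \<open>Lie\<close> are all presented in this way, so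
  their lifting and spanning properties are instances of this lemma and of
  \<open>presented_span\<close>.\<close>

lemma presented_lift:
 assumes "vs Z" "\<phi> \<in> X \<rightarrow> vcarrier Z" "R \<subseteq> vcarrier (vfree X)" "!!r. r \<in> R ==> free_lift Z \<phi> r = vzero Z"
 shows "\<exists>g. vlinear (vquot (vfree X) (vspan (vfree X) R)) Z g \<and> (\<forall>x\<in>X. g (vcoset (vfree X) (vspan (vfree X) R) (vbasis x)) = \<phi> x)"
proof -
 have sub: "vsub (vfree X) (vspan (vfree X) R)" using vspan_sub[OF vs_vfree assms(3)] .
 have "\<exists>g'. vlinear (vquot (vfree X) (vspan (vfree X) R)) Z g' \<and>
   (\<forall>v\<in>vcarrier (vfree X). g' (vcoset (vfree X) (vspan (vfree X) R) v) = free_lift Z \<phi> v)"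
  using quot_lift[OF vs_vfree sub assms(1) free_lift_linear[OF assms(1,2)]]
   vlinear_zero_span[OF vs_vfree assms(1) free_lift_linear[OF assms(1,2)] assms(3,4)] by auto
 moreover have "free_lift Z \<phi> (vbasis x) = \<phi> x" if "x \<in> X" for x using that assms(2) by (intro free_lift_basis assms(1)) auto
 ultimately show ?thesis by (metis vbasis_in)
qed

lemma presented_span:
 assumes "R \<subseteq> vcarrier (vfree X)"
 shows "vcarrier (vquot (vfree X) (vspan (vfree X) R))
  \<subseteq> vspan (vquot (vfree X) (vspan (vfree X) R)) ((\<lambda>x. vcoset (vfree X) (vspan (vfree X) R) (vbasis x)) ` X)"
 using quot_span[OF vs_vfree vspan_sub[OF vs_vfree assms] vfree_span] by (force simp: image_image)

text \<open>Every defining relation of the tensor products and of \<open>Lie\<close> involves at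
  most three basis vectors. Padding the shorter ones with a zero coefficient lets one computation
  serve them all.\<close>

lemma free_comb3:
 assumes "a \<in> X" "b \<in> X" "c \<in> X"
 shows "(\<lambda>z. \<alpha> * vbasis a z + \<beta> * vbasis b z + \<gamma> * vbasis c z) \<in> vcarrier (vfree X)"
  and "vs Z ==> vlinear (vfree X) Z F ==> F (\<lambda>z. \<alpha> * vbasis a z + \<beta> * vbasis b z + \<gamma> * vbasis c z)
   = vadd Z (vadd Z (vscale Z \<alpha> (F (vbasis a))) (vscale Z \<beta> (F (vbasis b)))) (vscale Z \<gamma> (F (vbasis c)))"
proof -
 have e: "(\<lambda>z. \<alpha> * vbasis a z + \<beta> * vbasis b z + \<gamma> * vbasis c z) =
   vadd (vfree X) (vadd (vfree X) (vscale (vfree X) \<alpha> (vbasis a)) (vscale (vfree X) \<beta> (vbasis b)))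
    (vscale (vfree X) \<gamma> (vbasis c))" by simp
 show "(\<lambda>z. \<alpha> * vbasis a z + \<beta> * vbasis b z + \<gamma> * vbasis c z) \<in> vcarrier (vfree X)"
  unfolding e by (intro vs_add vs_scale vs_vfree vbasis_in assms)
 assume "vs Z" and F: "vlinear (vfree X) Z F"
 show "F (\<lambda>z. \<alpha> * vbasis a z + \<beta> * vbasis b z + \<gamma> * vbasis c z)
   = vadd Z (vadd Z (vscale Z \<alpha> (F (vbasis a))) (vscale Z \<beta> (F (vbasis b)))) (vscale Z \<gamma> (F (vbasis c)))" unfolding e
  by (simp only: vlinearD(2,3)[OF F] vs_add[OF vs_vfree] vs_scale[OF vs_vfree] vbasis_in assms)
qed

section \<open>Tensor products and the composition product\<close>

abbreviation fams :: "'i set => ('i => ('k, 'v) vspace) => ('i => 'v) set" where "fams J V \<equiv> \<Pi>\<^sub>E j\<in>J. vcarrier (V j)"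

text \<open>One coordinate is varied by a function update while the rest of the family is kept, in
  the same form as the relations in \<open>tensor_rels\<close>.\<close>

definition mlin :: "'i set => ('i => ('k::field, 'v) vspace) => ('k, 'z) vspace => (('i => 'v) => 'z) => bool"
 where "mlin J V Z g \<longleftrightarrow> (\<forall>x\<in>(fams J V). g x \<in> vcarrier Z \<and> (\<forall>j\<in>J. \<forall>u\<in>vcarrier (V j). \<forall>w\<in>vcarrier (V j).
    g (x(j := vadd (V j) u w)) = vadd Z (g (x(j := u))) (g (x(j := w)))) \<and>
   (\<forall>j\<in>J. \<forall>c. \<forall>u\<in>vcarrier (V j). g (x(j := vscale (V j) c u)) = vscale Z c (g (x(j := u)))))"

lemma mlinD:
 assumes "mlin J V Z g" "x \<in> fams J V"
 shows "g x \<in> vcarrier Z"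
  and "j \<in> J ==> u \<in> vcarrier (V j) ==> w \<in> vcarrier (V j) ==>
   g (x(j := vadd (V j) u w)) = vadd Z (g (x(j := u))) (g (x(j := w)))"
  and "j \<in> J ==> u \<in> vcarrier (V j) ==> g (x(j := vscale (V j) c u)) = vscale Z c (g (x(j := u)))" using assms unfolding mlin_def by blast+

lemma PiE_upd: "x \<in> (\<Pi>\<^sub>E j\<in>J. A j) ==> j \<in> J ==> u \<in> A j ==> x(j := u) \<in> (\<Pi>\<^sub>E j\<in>J. A j)" by (auto simp: PiE_iff extensional_def)

lemma restrict_in_PiE: "(!!j. j \<in> J ==> f j \<in> A j) ==> restrict f J \<in> (\<Pi>\<^sub>E j\<in>J. A j)" by simp

lemma mlin_zero:
 assumes "!!j. j \<in> J ==> vs (V j)" "vs Z" "mlin J V Z g" "x \<in> fams J V" "j \<in> J"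
 shows "g (x(j := vzero (V j))) = vzero Z"
proof -
 have "x j \<in> vcarrier (V j)" using assms by auto
 then have "g (x(j := vscale (V j) 0 (x j))) = vscale Z 0 (g (x(j := x j)))" using mlinD(3)[OF assms(3,4,5)] by blast
 then show ?thesis using assms mlinD(1)[OF assms(3,4)] \<open>x j \<in> _\<close> by simp
qed

lemma mlin_cong:
 assumes "mlin J V Z g" "!!j. j \<in> J ==> vs (V j)" "!!x. x \<in> fams J V ==> g' x = g x"
 shows "mlin J V Z g'" unfolding mlin_def using mlinD[OF assms(1)] assms(2,3) by (auto simp: PiE_upd)

lemma mlin_comp_linear: "mlin J V Y g ==> vlinear Y Z h ==> (!!j. j \<in> J ==> vs (V j)) ==> mlin J V Z (\<lambda>x. h (g x))"
 unfolding mlin_def using vlinearD[of Y Z h] by (auto simp: PiE_upd)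

text \<open>Coordinates are freed one at a time. The induction runs over the set of coordinates that
  may take arbitrary values while the others stay among the generators \<open>E j\<close>; freeing
  one more coordinate is an induction over the span of its generators.\<close>

lemma mlin_induct:
 assumes "finite J" "!!j. j \<in> J ==> vs (V j)"
  and sp: "!!j. j \<in> J ==> vcarrier (V j) \<subseteq> vspan (V j) (E j)" "!!j. j \<in> J ==> E j \<subseteq> vcarrier (V j)"
  and base: "!!x. x \<in> (\<Pi>\<^sub>E j\<in>J. E j) ==> Pr x"
  and zero: "!!x j. x \<in> fams J V ==> j \<in> J ==> Pr (x(j := vzero (V j)))"
  and add: "!!x j u w. x \<in> fams J V ==> j \<in> J ==> u \<in> vcarrier (V j) ==>
   w \<in> vcarrier (V j) ==> Pr (x(j := u)) ==> Pr (x(j := w)) ==> Pr (x(j := vadd (V j) u w))"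
  and scale: "!!x j u c. x \<in> fams J V ==> j \<in> J ==> u \<in> vcarrier (V j) ==>
   Pr (x(j := u)) ==> Pr (x(j := vscale (V j) c u))"
  and x: "x \<in> fams J V"
 shows "Pr x"
proof -
 have "A \<subseteq> J ==> \<forall>x\<in>(fams J V). (\<forall>j\<in>J - A. x j \<in> E j) \<longrightarrow> Pr x" if "finite A" for A using that
 proof (induction A rule: finite_induct)
  case empty
  then show ?case using base by (auto simp: PiE_iff)
 next
  case (insert a A)
  show ?case
  proof (intro ballI impI)
   fix x assume x: "x \<in> fams J V" and xE: "\<forall>j\<in>J - insert a A. x j \<in> E j"
   have a: "a \<in> J" using insert by auto
   have "Pr (x(a := v))" if "v \<in> vspan (V a) (E a)" for v using that
   proof induction
    case zero then show ?case by (rule assms(6)[OF x a])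
   next
    case (base y)
    have "x(a := y) \<in> fams J V" using base x a sp(2) by (intro PiE_upd) auto
    moreover have "\<forall>j\<in>J - A. (x(a := y)) j \<in> E j" using xE base by auto
    ultimately show ?case using insert.IH insert.prems by blast
   next
    case (add u w) then show ?case by (intro assms(7)[OF x a] vspan_closed[OF assms(2)[OF a] sp(2)[OF a]])
   next
    case (scale u c) then show ?case by (intro assms(8)[OF x a] vspan_closed[OF assms(2)[OF a] sp(2)[OF a]])
   qed
   moreover have "x a \<in> vspan (V a) (E a)" using sp(1)[OF a] x a by auto
   ultimately have "Pr (x(a := x a))" by blast
   then show "Pr x" by simp
  qed
 qed
 from this[OF assms(1)] x show ?thesis by auto
qed

lemma mlin_eq:
 assumes "finite J" "!!j. j \<in> J ==> vs (V j)" "vs Z" "mlin J V Z g" "mlin J V Z h"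
  "!!j. j \<in> J ==> vcarrier (V j) \<subseteq> vspan (V j) (E j)" "!!j. j \<in> J ==> E j \<subseteq> vcarrier (V j)" "!!x. x \<in> (\<Pi>\<^sub>E j\<in>J. E j) ==> g x = h x" "x \<in> fams J V"
 shows "g x = h x"
proof (rule mlin_induct[where V = V and J = J and E = E and Pr = "\<lambda>x. g x = h x", OF assms(1,2,6,7)])
 show "x \<in> fams J V" by (rule assms(9))
next
 fix x assume "x \<in> (\<Pi>\<^sub>E j\<in>J. E j)" then show "g x = h x" by (rule assms(8))
next
 fix x j assume "x \<in> fams J V" "j \<in> J"
 then show "g (x(j := vzero (V j))) = h (x(j := vzero (V j)))"
  by (simp only: mlin_zero[of J V, OF assms(2) assms(3) assms(4)] mlin_zero[of J V, OF assms(2) assms(3) assms(5)])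
next
 fix x j u w assume "x \<in> fams J V" "j \<in> J" "u \<in> vcarrier (V j)" "w \<in> vcarrier (V j)"
  "g (x(j := u)) = h (x(j := u))" "g (x(j := w)) = h (x(j := w))"
 then show "g (x(j := vadd (V j) u w)) = h (x(j := vadd (V j) u w))" by (simp only: mlinD(2)[OF assms(4)] mlinD(2)[OF assms(5)])
next
 fix x j u c assume "x \<in> fams J V" "j \<in> J" "u \<in> vcarrier (V j)" "g (x(j := u)) = h (x(j := u))"
 then show "g (x(j := vscale (V j) c u)) = h (x(j := vscale (V j) c u))" by (simp only: mlinD(3)[OF assms(4)] mlinD(3)[OF assms(5)])
qed

lemma comb3_simps: "(\<lambda>z. 1 * f z + (-1) * g z + (-1) * h z) = (\<lambda>z. f z - g z - h z :: 'k::field)"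
 "(\<lambda>z. 1 * f z + (-c) * g z + 0 * h z) = (\<lambda>z. f z - c * g z :: 'k::field)" by auto

lemma tensor_rels_in:
 assumes "!!j. j \<in> J ==> vs (V j)"
 shows "tensor_rels J V \<subseteq> vcarrier (vfree (fams J V))"
proof
 fix r assume "r \<in> tensor_rels J V"
 then consider (a) x j u w where "r = (\<lambda>z. vbasis (x(j := vadd (V j) u w)) z - vbasis (x(j := u)) z - vbasis (x(j := w)) z)"
   "x \<in> fams J V" "j \<in> J" "u \<in> vcarrier (V j)" "w \<in> vcarrier (V j)"
  | (b) x j c u where "r = (\<lambda>z. vbasis (x(j := vscale (V j) c u)) z - c * vbasis (x(j := u)) z)"
   "x \<in> fams J V" "j \<in> J" "u \<in> vcarrier (V j)" unfolding tensor_rels_def by blast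
 then show "r \<in> vcarrier (vfree (fams J V))"
 proof cases
  case a
  then show ?thesis using free_comb3(1)[of "x(j := vadd (V j) u w)" "fams J V" "x(j := u)" "x(j := w)" 1 "-1" "-1"]
    assms by (simp add: PiE_upd)
 next
  case b
  then show ?thesis using free_comb3(1)[of "x(j := vscale (V j) c u)" "fams J V" "x(j := u)" "x(j := u)" 1 "-c" 0]
    assms by (simp add: PiE_upd)
 qed
qed

lemma presented_rel3:
 assumes "R \<subseteq> vcarrier (vfree X)" "a \<in> X" "b \<in> X" "c \<in> X" "(\<lambda>z. \<alpha> * vbasis a z + \<beta> * vbasis b z + \<gamma> * vbasis c z) \<in> R"
 shows "vadd (vquot (vfree X) (vspan (vfree X) R)) (vadd (vquot (vfree X) (vspan (vfree X) R))
   (vscale (vquot (vfree X) (vspan (vfree X) R)) \<alpha> (vcoset (vfree X) (vspan (vfree X) R) (vbasis a)))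
   (vscale (vquot (vfree X) (vspan (vfree X) R)) \<beta> (vcoset (vfree X) (vspan (vfree X) R) (vbasis b))))
   (vscale (vquot (vfree X) (vspan (vfree X) R)) \<gamma> (vcoset (vfree X) (vspan (vfree X) R) (vbasis c)))
  = vzero (vquot (vfree X) (vspan (vfree X) R))"
proof -
 note sub = vspan_sub[OF vs_vfree assms(1)]
 show ?thesis using vcoset_zero[OF vs_vfree sub vspan.base[OF assms(5)]]
   free_comb3(2)[OF assms(2-4) vs_vquot[OF vs_vfree sub] vcoset_linear[OF vs_vfree sub], of \<alpha> \<beta> \<gamma>] by simp
qed

lemma vs_cancel_iff: "vs Z ==> u \<in> vcarrier Z ==> v \<in> vcarrier Z ==>
  vadd Z u (vscale Z (-1) v) = vzero Z \<longleftrightarrow> u = v" using vs_cancel[of Z u v] vs_neg[of Z v] by blast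

text \<open>The padded three-term relations, read back as additivity and as homogeneity.\<close>

lemma vs_sub3:
 assumes "vs Z" "a \<in> vcarrier Z" "b \<in> vcarrier Z" "c \<in> vcarrier Z"
 shows "vadd Z (vadd Z (vscale Z 1 a) (vscale Z (-1) b)) (vscale Z (-1) c) = vzero Z \<longleftrightarrow> a = vadd Z b c"
  "vadd Z (vadd Z (vscale Z 1 a) (vscale Z (-d) b)) (vscale Z 0 c) = vzero Z \<longleftrightarrow> a = vscale Z d b"
proof -
 have 1: "vadd Z (vadd Z (vscale Z 1 a) (vscale Z (-1) b)) (vscale Z (-1) c) = vadd Z a (vscale Z (-1) (vadd Z b c))"
  using assms by (simp add: vs_assoc vs_scale_vadd)
 show "vadd Z (vadd Z (vscale Z 1 a) (vscale Z (-1) b)) (vscale Z (-1) c) = vzero Z \<longleftrightarrow> a = vadd Z b c"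
  unfolding 1 using assms by (intro vs_cancel_iff vs_add)
 have 2: "vadd Z (vadd Z (vscale Z 1 a) (vscale Z (-d) b)) (vscale Z 0 c) = vadd Z a (vscale Z (-1) (vscale Z d b))" using assms by simp
 show "vadd Z (vadd Z (vscale Z 1 a) (vscale Z (-d) b)) (vscale Z 0 c) = vzero Z \<longleftrightarrow> a = vscale Z d b"
  unfolding 2 using assms by (intro vs_cancel_iff vs_scale)
qed

section \<open>Tensor products over an unordered finite index set\<close>

context
 fixes J :: "'i set" and V :: "'i => ('k::field, 'v) vspace"
 assumes Vs: "!!j. j \<in> J ==> vs (V j)"
begin

lemma vs_tensor: "vs (tensor J V)" unfolding tensor_def tensor_null_def
 by (rule vs_vquot[OF vs_vfree vspan_sub[OF vs_vfree tensor_rels_in[OF Vs]]])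

lemma pure_in: "x \<in> fams J V ==> pure J V x \<in> vcarrier (tensor J V)" unfolding tensor_def pure_def by (auto simp: vquot_def)

lemma tensor_span: "vcarrier (tensor J V) \<subseteq> vspan (tensor J V) (pure J V ` (fams J V))"
 using presented_span[OF tensor_rels_in[of J V]] Vs unfolding tensor_def tensor_null_def pure_def by auto

lemma pure_mlin: "mlin J V (tensor J V) (pure J V)" unfolding mlin_def
proof (intro ballI conjI allI)
 fix x assume x: "x \<in> fams J V"
 then show "pure J V x \<in> vcarrier (tensor J V)" by (rule pure_in)
 fix j u assume j: "j \<in> J" and u: "u \<in> vcarrier (V j)"
 let ?X = "fams J V"
 note i = pure_in[OF PiE_upd[OF x j]]
 { fix w assume w: "w \<in> vcarrier (V j)"
  have "(\<lambda>z. 1 * vbasis (x(j := vadd (V j) u w)) z + (-1) * vbasis (x(j := u)) z + (-1) * vbasis (x(j := w)) z) \<in> tensor_rels J V"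
   unfolding tensor_rels_def comb3_simps using x j u w by blast
  note r = presented_rel3[OF tensor_rels_in[OF Vs] _ _ _ this, folded tensor_null_def, folded tensor_def, folded pure_def]
  show "pure J V (x(j := vadd (V j) u w)) = vadd (tensor J V) (pure J V (x(j := u))) (pure J V (x(j := w)))"
   using r x j u w Vs[OF j] i vs_sub3(1)[OF vs_tensor] by (metis (no_types, lifting) PiE_upd vs_add)
 }
 fix c
 have "(\<lambda>z. 1 * vbasis (x(j := vscale (V j) c u)) z + (-c) * vbasis (x(j := u)) z + 0 * vbasis (x(j := u)) z) \<in> tensor_rels J V"
  unfolding tensor_rels_def comb3_simps using x j u by blast
 note r = presented_rel3[OF tensor_rels_in[OF Vs] _ _ _ this, folded tensor_null_def, folded tensor_def, folded pure_def]
 show "pure J V (x(j := vscale (V j) c u)) = vscale (tensor J V) c (pure J V (x(j := u)))"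
  using r x j u Vs[OF j] i vs_sub3(2)[OF vs_tensor] by (metis (no_types, lifting) PiE_upd vs_scale)
qed

lemma tensor_lift:
 assumes Z: "vs Z" and g: "mlin J V Z g"
 shows "\<exists>G. vlinear (tensor J V) Z G \<and> (\<forall>x\<in>(fams J V). G (pure J V x) = g x)" unfolding tensor_def tensor_null_def pure_def
proof (rule presented_lift[OF Z _ tensor_rels_in[OF Vs]])
 let ?X = "fams J V"
 show g_in: "g \<in> ?X \<rightarrow> vcarrier Z" using mlinD(1)[OF g] by auto
 note lin = free_lift_linear[OF Z g_in]
 have b: "free_lift Z g (vbasis x) = g x" if "x \<in> ?X" for x by (rule free_lift_basis[of Z g x, OF Z mlinD(1)[OF g that]])
 fix r assume "r \<in> tensor_rels J V"
 then consider (a) x j u w where "r = (\<lambda>z. vbasis (x(j := vadd (V j) u w)) z - vbasis (x(j := u)) z - vbasis (x(j := w)) z)"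
   "x \<in> ?X" "j \<in> J" "u \<in> vcarrier (V j)" "w \<in> vcarrier (V j)"
  | (b) x j c u where "r = (\<lambda>z. vbasis (x(j := vscale (V j) c u)) z - c * vbasis (x(j := u)) z)" "x \<in> ?X" "j \<in> J" "u \<in> vcarrier (V j)"
  unfolding tensor_rels_def by blast
 then show "free_lift Z g r = vzero Z"
 proof cases
  case a
  have in3: "x(j := vadd (V j) u w) \<in> ?X" "x(j := u) \<in> ?X" "x(j := w) \<in> ?X" using a Vs[of j] by (auto intro!: PiE_upd)
  have "r = (\<lambda>z. 1 * vbasis (x(j := vadd (V j) u w)) z + (-1) * vbasis (x(j := u)) z + (-1) * vbasis (x(j := w)) z)" using a by auto
  then have "free_lift Z g r = vadd Z (vadd Z (vscale Z 1 (g (x(j := vadd (V j) u w)))) (vscale Z (-1) (g (x(j := u))))) (vscale Z (-1) (g (x(j := w))))"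
   using free_comb3(2)[OF in3 Z lin, of 1 "-1" "-1"] by (simp add: b in3)
  also have "\<dots> = vzero Z" using vs_sub3(1)[OF Z] mlinD[OF g] in3 a by (metis (no_types, lifting))
  finally show ?thesis .
 next
  case b': b
  have in3: "x(j := vscale (V j) c u) \<in> ?X" "x(j := u) \<in> ?X" using b' Vs[of j] by (auto intro!: PiE_upd)
  have "r = (\<lambda>z. 1 * vbasis (x(j := vscale (V j) c u)) z + (-c) * vbasis (x(j := u)) z + 0 * vbasis (x(j := u)) z)" using b' by auto
  then have "free_lift Z g r = vadd Z (vadd Z (vscale Z 1 (g (x(j := vscale (V j) c u)))) (vscale Z (-c) (g (x(j := u))))) (vscale Z 0 (g (x(j := u))))"
   using free_comb3(2)[OF in3 in3(2) Z lin, of 1 "-c" 0] by (simp add: b in3)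
  also have "\<dots> = vzero Z" using vs_sub3(2)[OF Z] mlinD[OF g] in3 b' by (metis (no_types, lifting))
  finally show ?thesis .
 qed
qed

lemma tensor_span_gen:
 assumes "finite J" "!!j. j \<in> J ==> vcarrier (V j) \<subseteq> vspan (V j) (E j)" "!!j. j \<in> J ==> E j \<subseteq> vcarrier (V j)"
 shows "vcarrier (tensor J V) \<subseteq> vspan (tensor J V) (pure J V ` (\<Pi>\<^sub>E j\<in>J. E j))"
proof -
 let ?S = "vspan (tensor J V) (pure J V ` (\<Pi>\<^sub>E j\<in>J. E j))"
 have "pure J V x \<in> ?S" if "x \<in> fams J V" for x
 proof (rule mlin_induct[where V = V and J = J and E = E and Pr = "\<lambda>x. pure J V x \<in> ?S", OF assms(1) Vs assms(2,3)])
  fix x j assume "x \<in> fams J V" "j \<in> J"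
  then show "pure J V (x(j := vzero (V j))) \<in> ?S" using mlin_zero[of J V, OF Vs vs_tensor pure_mlin, of x j] by (simp add: vspan.zero)
 next
  fix x assume "x \<in> (\<Pi>\<^sub>E j\<in>J. E j)"
  then show "pure J V x \<in> ?S" by (intro vspan.base imageI)
 next
  fix x j u w assume "x \<in> fams J V" "j \<in> J" "u \<in> vcarrier (V j)" "w \<in> vcarrier (V j)"
   "pure J V (x(j := u)) \<in> ?S" "pure J V (x(j := w)) \<in> ?S"
  then show "pure J V (x(j := vadd (V j) u w)) \<in> ?S" by (simp only: mlinD(2)[OF pure_mlin] vspan.add)
 next
  fix x j u c assume "x \<in> fams J V" "j \<in> J" "u \<in> vcarrier (V j)" "pure J V (x(j := u)) \<in> ?S"
  then show "pure J V (x(j := vscale (V j) c u)) \<in> ?S" by (simp only: mlinD(3)[OF pure_mlin] vspan.scale)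
 qed (use that in auto)
 then have 1: "pure J V ` (fams J V) \<subseteq> ?S" by auto
 have sub: "(\<Pi>\<^sub>E j\<in>J. E j) \<subseteq> (fams J V)" using assms(3) by (intro PiE_mono) auto
 have "pure J V ` (\<Pi>\<^sub>E j\<in>J. E j) \<subseteq> vcarrier (tensor J V)" by (rule image_subsetI, rule pure_in, erule subsetD[OF sub])
 then have "vsub (tensor J V) ?S" by (rule vspan_sub[OF vs_tensor])
 from vspan_least[OF this 1] show ?thesis by (rule subset_trans[OF tensor_span])
qed

end

section \<open>Binary tensor products\<close>

definition bilin :: "('k::field, 'v) vspace => ('k, 'w) vspace => ('k, 'z) vspace => ('v => 'w => 'z) => bool" where
 "bilin V W Z g \<longleftrightarrow> (\<forall>x\<in>vcarrier V. vlinear W Z (g x)) \<and> (\<forall>y\<in>vcarrier W. vlinear V Z (\<lambda>x. g x y))"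

context
 fixes V :: "('k::field, 'v) vspace" and W :: "('k, 'w) vspace"
 assumes V: "vs V" and W: "vs W"
begin

lemma tensor2_rels_in: "tensor2_rels V W \<subseteq> vcarrier (vfree (vcarrier V \<times> vcarrier W))"
proof
 let ?X = "vcarrier V \<times> vcarrier W"
 fix r assume "r \<in> tensor2_rels V W"
 then consider (a) a b y where "r = (\<lambda>z. vbasis (vadd V a b, y) z - vbasis (a, y) z - vbasis (b, y) z)"
   "a \<in> vcarrier V" "b \<in> vcarrier V" "y \<in> vcarrier W"
  | (b) x a b where "r = (\<lambda>z. vbasis (x, vadd W a b) z - vbasis (x, a) z - vbasis (x, b) z)"
   "x \<in> vcarrier V" "a \<in> vcarrier W" "b \<in> vcarrier W"
  | (c) c x y where "r = (\<lambda>z. vbasis (vscale V c x, y) z - c * vbasis (x, y) z)" "x \<in> vcarrier V" "y \<in> vcarrier W"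
  | (d) c x y where "r = (\<lambda>z. vbasis (x, vscale W c y) z - c * vbasis (x, y) z)" "x \<in> vcarrier V" "y \<in> vcarrier W"
  unfolding tensor2_rels_def by blast
 then show "r \<in> vcarrier (vfree ?X)"
 proof cases
  case a then show ?thesis using free_comb3(1)[of "(vadd V a b, y)" ?X "(a, y)" "(b, y)" 1 "-1" "-1"] V W by simp
 next
  case b then show ?thesis using free_comb3(1)[of "(x, vadd W a b)" ?X "(x, a)" "(x, b)" 1 "-1" "-1"] V W by simp
 next
  case c then show ?thesis using free_comb3(1)[of "(vscale V c x, y)" ?X "(x, y)" "(x, y)" 1 "-c" 0] V W by simp
 next
  case d then show ?thesis using free_comb3(1)[of "(x, vscale W c y)" ?X "(x, y)" "(x, y)" 1 "-c" 0] V W by simp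
 qed
qed

lemma vs_tensor2: "vs (tensor2 V W)" unfolding tensor2_def tensor2_null_def
 by (rule vs_vquot[OF vs_vfree vspan_sub[OF vs_vfree tensor2_rels_in]])

lemma pure2_in: "x \<in> vcarrier V ==> y \<in> vcarrier W ==> pure2 V W x y \<in> vcarrier (tensor2 V W)"
 unfolding tensor2_def pure2_def by (auto simp: vquot_def)

lemma tensor2_span: "vcarrier (tensor2 V W) \<subseteq> vspan (tensor2 V W) {pure2 V W x y |x y. x \<in> vcarrier V \<and> y \<in> vcarrier W}"
proof -
 have "(\<lambda>x. vcoset (vfree (vcarrier V \<times> vcarrier W)) (tensor2_null V W) (vbasis x)) ` (vcarrier V \<times> vcarrier W)
   = {pure2 V W x y |x y. x \<in> vcarrier V \<and> y \<in> vcarrier W}" unfolding pure2_def by auto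
 then show ?thesis using presented_span[OF tensor2_rels_in] unfolding tensor2_def tensor2_null_def by simp
qed

lemma pure2_bilin: "bilin V W (tensor2 V W) (pure2 V W)"
proof -
 let ?X = "vcarrier V \<times> vcarrier W"
 have 1: "pure2 V W (vadd V a b) y = vadd (tensor2 V W) (pure2 V W a y) (pure2 V W b y)"
  if "a \<in> vcarrier V" "b \<in> vcarrier V" "y \<in> vcarrier W" for a b y
 proof -
  have "(\<lambda>z. 1 * vbasis (vadd V a b, y) z + (-1) * vbasis (a, y) z + (-1) * vbasis (b, y) z) \<in> tensor2_rels V W"
   unfolding tensor2_rels_def comb3_simps using that by blast
  note r = presented_rel3[OF tensor2_rels_in _ _ _ this, folded tensor2_null_def, folded tensor2_def, folded pure2_def]
  then show ?thesis using that vs_sub3(1)[OF vs_tensor2] pure2_in V by (metis (no_types, lifting) SigmaI vs_add)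
 qed
 have 2: "pure2 V W x (vadd W a b) = vadd (tensor2 V W) (pure2 V W x a) (pure2 V W x b)"
  if "a \<in> vcarrier W" "b \<in> vcarrier W" "x \<in> vcarrier V" for a b x
 proof -
  have "(\<lambda>z. 1 * vbasis (x, vadd W a b) z + (-1) * vbasis (x, a) z + (-1) * vbasis (x, b) z) \<in> tensor2_rels V W"
   unfolding tensor2_rels_def comb3_simps using that by blast
  note r = presented_rel3[OF tensor2_rels_in _ _ _ this, folded tensor2_null_def, folded tensor2_def, folded pure2_def]
  then show ?thesis using that vs_sub3(1)[OF vs_tensor2] pure2_in W by (metis (no_types, lifting) SigmaI vs_add)
 qed
 have 3: "pure2 V W (vscale V c x) y = vscale (tensor2 V W) c (pure2 V W x y)"
  if "x \<in> vcarrier V" "y \<in> vcarrier W" for c x y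
 proof -
  have "(\<lambda>z. 1 * vbasis (vscale V c x, y) z + (-c) * vbasis (x, y) z + 0 * vbasis (x, y) z) \<in> tensor2_rels V W"
   unfolding tensor2_rels_def comb3_simps using that by blast
  note r = presented_rel3[OF tensor2_rels_in _ _ _ this, folded tensor2_null_def, folded tensor2_def, folded pure2_def]
  then show ?thesis using that vs_sub3(2)[OF vs_tensor2] pure2_in V by (metis (no_types, lifting) SigmaI vs_scale)
 qed
 have 4: "pure2 V W x (vscale W c y) = vscale (tensor2 V W) c (pure2 V W x y)"
  if "x \<in> vcarrier V" "y \<in> vcarrier W" for c x y
 proof -
  have "(\<lambda>z. 1 * vbasis (x, vscale W c y) z + (-c) * vbasis (x, y) z + 0 * vbasis (x, y) z) \<in> tensor2_rels V W"
   unfolding tensor2_rels_def comb3_simps using that by blast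
  note r = presented_rel3[OF tensor2_rels_in _ _ _ this, folded tensor2_null_def, folded tensor2_def, folded pure2_def]
  then show ?thesis using that vs_sub3(2)[OF vs_tensor2] pure2_in W by (metis (no_types, lifting) SigmaI vs_scale)
 qed
 show ?thesis unfolding bilin_def vlinear_def using 1 2 3 4 pure2_in by auto
qed

lemma tensor2_lift:
 assumes Z: "vs Z" and g: "bilin V W Z g"
 shows "\<exists>G. vlinear (tensor2 V W) Z G \<and> (\<forall>x\<in>vcarrier V. \<forall>y\<in>vcarrier W. G (pure2 V W x y) = g x y)"
proof -
 let ?X = "vcarrier V \<times> vcarrier W"
 let ?g = "\<lambda>(x, y). g x y"
 have gV: "vlinear V Z (\<lambda>x. g x y)" if "y \<in> vcarrier W" for y using g that by (auto simp: bilin_def)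
 have gW: "vlinear W Z (\<lambda>y. g x y)" if "x \<in> vcarrier V" for x using g that by (auto simp: bilin_def)
 have g_in: "?g \<in> ?X \<rightarrow> vcarrier Z" using vlinearD(1)[OF gV] by auto
 note lin = free_lift_linear[OF Z g_in]
 have b: "free_lift Z ?g (vbasis (x, y)) = g x y" if "x \<in> vcarrier V" "y \<in> vcarrier W" for x y
  using free_lift_basis[OF Z, of ?g "(x, y)"] vlinearD(1)[OF gV] that by simp
 have gin: "g x y \<in> vcarrier Z" if "x \<in> vcarrier V" "y \<in> vcarrier W" for x y using vlinearD(1)[OF gV] that by simp
 have c3: "free_lift Z ?g r = vadd Z (vadd Z (vscale Z \<alpha> (g x y)) (vscale Z \<beta> (g x' y'))) (vscale Z \<gamma> (g x'' y''))"
  if "r = (\<lambda>z. \<alpha> * vbasis (x, y) z + \<beta> * vbasis (x', y') z + \<gamma> * vbasis (x'', y'') z)"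
   "x \<in> vcarrier V" "y \<in> vcarrier W" "x' \<in> vcarrier V" "y' \<in> vcarrier W" "x'' \<in> vcarrier V" "y'' \<in> vcarrier W"
  for r \<alpha> \<beta> \<gamma> x y x' y' x'' y'' using free_comb3(2)[OF _ _ _ Z lin, of "(x, y)" "(x', y')" "(x'', y'')" \<alpha> \<beta> \<gamma>] that by (simp add: b)
 have "free_lift Z ?g r = vzero Z" if "r \<in> tensor2_rels V W" for r
 proof -
  from that consider (a) a b y where "r = (\<lambda>z. vbasis (vadd V a b, y) z - vbasis (a, y) z - vbasis (b, y) z)"
    "a \<in> vcarrier V" "b \<in> vcarrier V" "y \<in> vcarrier W"
   | (b) x a b where "r = (\<lambda>z. vbasis (x, vadd W a b) z - vbasis (x, a) z - vbasis (x, b) z)"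
    "x \<in> vcarrier V" "a \<in> vcarrier W" "b \<in> vcarrier W"
   | (c) c x y where "r = (\<lambda>z. vbasis (vscale V c x, y) z - c * vbasis (x, y) z)" "x \<in> vcarrier V" "y \<in> vcarrier W"
   | (d) c x y where "r = (\<lambda>z. vbasis (x, vscale W c y) z - c * vbasis (x, y) z)" "x \<in> vcarrier V" "y \<in> vcarrier W"
   unfolding tensor2_rels_def by blast
  then show ?thesis
  proof cases
   case a
   have "free_lift Z ?g r = vadd Z (vadd Z (vscale Z 1 (g (vadd V a b) y)) (vscale Z (-1) (g a y))) (vscale Z (-1) (g b y))"
    by (rule c3, unfold comb3_simps, rule a(1)) (use a V W in auto)
   also have "\<dots> = vzero Z" by (rule iffD2[OF vs_sub3(1)[OF Z]]) (use a V W Z gin vlinearD(2)[OF gV] in auto)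
   finally show ?thesis .
  next
   case b
   have "free_lift Z ?g r = vadd Z (vadd Z (vscale Z 1 (g x (vadd W a b))) (vscale Z (-1) (g x a))) (vscale Z (-1) (g x b))"
    by (rule c3, unfold comb3_simps, rule b(1)) (use b V W in auto)
   also have "\<dots> = vzero Z" by (rule iffD2[OF vs_sub3(1)[OF Z]]) (use b V W Z gin vlinearD(2)[OF gW] in auto)
   finally show ?thesis .
  next
   case c
   have "free_lift Z ?g r = vadd Z (vadd Z (vscale Z 1 (g (vscale V c x) y)) (vscale Z (-c) (g x y))) (vscale Z 0 (g x y))"
    by (rule c3, unfold comb3_simps, rule c(1)) (use c V W in auto)
   also have "\<dots> = vzero Z" by (rule iffD2[OF vs_sub3(2)[OF Z]]) (use c V W Z gin vlinearD(3)[OF gV] in auto)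
   finally show ?thesis .
  next
   case d
   have "free_lift Z ?g r = vadd Z (vadd Z (vscale Z 1 (g x (vscale W c y))) (vscale Z (-c) (g x y))) (vscale Z 0 (g x y))"
    by (rule c3, unfold comb3_simps, rule d(1)) (use d V W in auto)
   also have "\<dots> = vzero Z" by (rule iffD2[OF vs_sub3(2)[OF Z]]) (use d V W Z gin vlinearD(3)[OF gW] in auto)
   finally show ?thesis .
  qed
 qed
 from presented_lift[OF Z g_in tensor2_rels_in this] show ?thesis unfolding tensor2_def tensor2_null_def pure2_def by auto
qed

text \<open>One factor at a time: with \<open>y\<close> among the generators \<open>B\<close>,
  linearity in the first factor gives all \<open>x\<close>; then with \<open>x\<close> arbitrary,
  linearity in the second factor gives all \<open>y\<close>.\<close>

lemma tensor2_span_gen: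
 assumes "vcarrier V \<subseteq> vspan V A" "A \<subseteq> vcarrier V" "vcarrier W \<subseteq> vspan W B" "B \<subseteq> vcarrier W"
 shows "vcarrier (tensor2 V W) \<subseteq> vspan (tensor2 V W) {pure2 V W x y |x y. x \<in> A \<and> y \<in> B}" (is "_ \<subseteq> ?S")
proof -
 have l1: "vlinear V (tensor2 V W) (\<lambda>x. pure2 V W x y)" if "y \<in> vcarrier W" for y using pure2_bilin that by (auto simp: bilin_def)
 have l2: "vlinear W (tensor2 V W) (\<lambda>y. pure2 V W x y)" if "x \<in> vcarrier V" for x using pure2_bilin that by (auto simp: bilin_def)
 have 1: "pure2 V W x y \<in> ?S" if "x \<in> vcarrier V" "y \<in> B" for x y
  by (rule vlinear_span_image[OF V vs_tensor2 l1 assms(2)]) (use that assms in \<open>auto intro: vspan.base\<close>)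
 have 2: "pure2 V W x y \<in> ?S" if "x \<in> vcarrier V" "y \<in> vcarrier W" for x y
  by (rule vlinear_span_image[OF W vs_tensor2 l2 assms(4)]) (use that assms 1 in auto)
 have "vsub (tensor2 V W) ?S" by (rule vspan_sub[OF vs_tensor2]) (use assms pure2_in in blast)
 then have "vspan (tensor2 V W) {pure2 V W x y |x y. x \<in> vcarrier V \<and> y \<in> vcarrier W} \<subseteq> ?S" using 2 by (intro vspan_least) blast+
 then show ?thesis using tensor2_span by blast
qed

end

section \<open>Finite direct sums\<close>

context
 fixes K :: "'i set" and V :: "'i => ('k::field, 'v) vspace"
 assumes Vs: "!!k. k \<in> K ==> vs (V k)"
begin

lemma vs_dirsum: "vs (dirsum K V)"
proof -
 have e: "(\<lambda>k\<in>K. x k) = (\<lambda>k\<in>K. y k) \<longleftrightarrow> (\<forall>k\<in>K. x k = y k)" for x y :: "'i => 'v" by (metis restrict_apply' restrict_ext)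
 have e2: "(\<lambda>k\<in>K. x k) = y \<longleftrightarrow> (\<forall>k\<in>K. x k = y k)" if "y \<in> extensional K" for x y :: "'i => 'v"
  using that by (metis extensional_restrict restrict_apply' restrict_ext)
 show ?thesis unfolding vs_def dirsum_def using Vs by (auto simp: PiE_iff e e2 vs_comm vs_lcomm vs_assoc vs_scale_add vs_scale_vadd)
qed

lemma summand_linear: "k \<in> K ==> vlinear (V k) (dirsum K V) (summand K V k)" unfolding vlinear_def dirsum_def summand_def using Vs
 by (auto simp: fun_eq_iff restrict_def)

lemma dirsum_lift:
 assumes "finite K" "vs Z" "!!k. k \<in> K ==> vlinear (V k) Z (G k)"
 shows "\<exists>G'. vlinear (dirsum K V) Z G' \<and> (\<forall>k\<in>K. \<forall>v\<in>vcarrier (V k). G' (summand K V k v) = G k v)"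
proof -
 define G' where "G' u = vsum Z (\<lambda>k. G k (u k)) K" for u
 have G: "G k v \<in> vcarrier Z" if "k \<in> K" "v \<in> vcarrier (V k)" for k v using vlinearD(1)[OF assms(3)] that .
 have "vlinear (dirsum K V) Z G'" unfolding vlinear_def
 proof (intro conjI ballI allI)
  show "G' \<in> vcarrier (dirsum K V) \<rightarrow> vcarrier Z" unfolding G'_def dirsum_def by (auto intro!: vsum_closed assms G)
 next
  fix u v assume "u \<in> vcarrier (dirsum K V)" "v \<in> vcarrier (dirsum K V)"
  then have uv: "!!k. k \<in> K ==> u k \<in> vcarrier (V k)" "!!k. k \<in> K ==> v k \<in> vcarrier (V k)" by (auto simp: dirsum_def)
  have "G' (vadd (dirsum K V) u v) = vsum Z (\<lambda>k. vadd Z (G k (u k)) (G k (v k))) K" unfolding G'_def by (rule vsum_cong)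
    (use assms uv G vlinearD(2)[OF assms(3)] in \<open>auto simp: dirsum_def\<close>)
  then show "G' (vadd (dirsum K V) u v) = vadd Z (G' u) (G' v)" unfolding G'_def using uv G by (simp add: vsum_add assms)
 next
  fix c v assume "v \<in> vcarrier (dirsum K V)"
  then have v: "!!k. k \<in> K ==> v k \<in> vcarrier (V k)" by (auto simp: dirsum_def)
  have "G' (vscale (dirsum K V) c v) = vsum Z (\<lambda>k. vscale Z c (G k (v k))) K" unfolding G'_def by (rule vsum_cong)
    (use assms v G vlinearD(3)[OF assms(3)] in \<open>auto simp: dirsum_def\<close>)
  then show "G' (vscale (dirsum K V) c v) = vscale Z c (G' v)" unfolding G'_def using v G by (simp add: vsum_scale assms)
 qed
 moreover have "G' (summand K V k v) = G k v" if "k \<in> K" "v \<in> vcarrier (V k)" for k v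
 proof -
  have "G' (summand K V k v) = G k (summand K V k v k)" unfolding G'_def by (rule vsum_single)
    (use that assms G vlinear_zero[OF Vs assms(2,3)] in \<open>auto simp: summand_def\<close>)
  then show ?thesis using that by (simp add: summand_def)
 qed
 ultimately show ?thesis by blast
qed

lemma dirsum_span:
 assumes "finite K" "!!k. k \<in> K ==> vcarrier (V k) \<subseteq> vspan (V k) (E k)" "!!k. k \<in> K ==> E k \<subseteq> vcarrier (V k)"
  "!!k v. k \<in> K ==> v \<in> E k ==> summand K V k v \<in> B"
 shows "vcarrier (dirsum K V) \<subseteq> vspan (dirsum K V) B"
proof
 fix u assume u: "u \<in> vcarrier (dirsum K V)"
 have s: "summand K V k v \<in> vspan (dirsum K V) B" if "k \<in> K" "v \<in> vcarrier (V k)" for k v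
  by (rule vlinear_span_image[OF Vs vs_dirsum summand_linear assms(3)]) (use that assms in \<open>auto intro: vspan.base\<close>)
 \<comment> \<open>The family \<open>u\<close> is built up from zero by switching on its components
   one after another; at \<open>A = K\<close> it is \<open>u\<close> itself.\<close>
 have "A \<subseteq> K ==> (\<lambda>k\<in>K. if k \<in> A then u k else vzero (V k)) \<in> vspan (dirsum K V) B" if "finite A" for A using that
 proof (induction A rule: finite_induct)
  case empty
  have "(\<lambda>k\<in>K. if k \<in> {} then u k else vzero (V k)) = vzero (dirsum K V)" by (simp add: dirsum_def)
  then show ?case by (simp only: vspan.zero)
 next
  case (insert a A)
  have "(\<lambda>k\<in>K. if k \<in> insert a A then u k else vzero (V k)) =
    vadd (dirsum K V) (summand K V a (u a)) (\<lambda>k\<in>K. if k \<in> A then u k else vzero (V k))"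
   using insert u Vs by (auto simp: dirsum_def summand_def fun_eq_iff PiE_iff)
  moreover have "summand K V a (u a) \<in> vspan (dirsum K V) B" using insert u by (intro s) (auto simp: dirsum_def)
  moreover have "(\<lambda>k\<in>K. if k \<in> A then u k else vzero (V k)) \<in> vspan (dirsum K V) B" using insert.IH insert.prems by blast
  ultimately show ?case by (simp only: vspan.add)
 qed
 from this[OF assms(1)] have "(\<lambda>k\<in>K. if k \<in> K then u k else vzero (V k)) \<in> vspan (dirsum K V) B" by auto
 moreover have "(\<lambda>k\<in>K. if k \<in> K then u k else vzero (V k)) = u"
  using u by (auto simp: dirsum_def fun_eq_iff PiE_iff extensional_def restrict_def)
 ultimately show "u \<in> vspan (dirsum K V) B" by simp
qed

end

lemma finite_partitions: "finite I ==> finite {P. partition_on I P}" by (rule finite_subset[of _ "Pow (Pow I)"]) (auto simp: partition_on_def)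

lemma partition_on_finite: "finite I ==> partition_on I P ==> finite P" by (auto simp: partition_on_def intro: finite_UnionD)

lemma partition_block_finite: "finite I ==> partition_on I P ==> S \<in> P ==> finite S" by (auto simp: partition_on_def intro: finite_subset)

section \<open>The composition product\<close>

context
 fixes I :: "'a set" and p :: "'a set set => ('k::field, 'v) vspace" and q :: "'a set => ('k, 'w) vspace"
 assumes I: "finite I" and p: "!!P. partition_on I P ==> vs (p P)"
  and q: "!!S. S \<subseteq> I ==> vs (q S)"
begin

lemma comp_vs_tensor: "partition_on I P ==> vs (tensor P q)" using q by (intro vs_tensor) (auto simp: partition_on_def)

lemma vs_species_comp: "vs (species_comp p q I)" unfolding species_comp_def using comp_vs_tensor p by (intro vs_dirsum vs_tensor2) auto

lemma comp_elem_in: "partition_on I P ==> t \<in> vcarrier (p P) ==> D \<in> vcarrier (tensor P q) ==>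
  comp_elem p q I P t D \<in> vcarrier (species_comp p q I)" unfolding species_comp_def comp_elem_def
 by (rule vlinearD(1)[OF summand_linear]) (use comp_vs_tensor p in \<open>auto intro!: vs_tensor2 pure2_in\<close>)

lemma comp_elem_bilin:
 assumes "partition_on I P"
 shows "bilin (p P) (tensor P q) (species_comp p q I) (comp_elem p q I P)"
proof -
 have s: "vlinear (tensor2 (p P) (tensor P q)) (species_comp p q I) (summand {P. partition_on I P} (\<lambda>P. tensor2 (p P) (tensor P q)) P)"
  unfolding species_comp_def using assms comp_vs_tensor p by (intro summand_linear vs_tensor2) auto
 show ?thesis using pure2_bilin[OF p[OF assms] comp_vs_tensor[OF assms]] vlinear_comp[OF _ s] unfolding bilin_def comp_elem_def
  by (intro conjI ballI) (rule vlinear_comp[OF _ s], simp)+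
qed

lemma comp_pure_in: "partition_on I P ==> t \<in> vcarrier (p P) ==> x \<in> fams P q ==>
  comp_pure p q I P t x \<in> vcarrier (species_comp p q I)"
 unfolding comp_pure_def using q by (intro comp_elem_in pure_in) (auto simp: partition_on_def)

lemma comp_pure_linear:
 assumes "partition_on I P" "x \<in> fams P q"
 shows "vlinear (p P) (species_comp p q I) (\<lambda>t. comp_pure p q I P t x)"
proof -
 have "pure P q x \<in> vcarrier (tensor P q)" using assms q by (intro pure_in) (auto simp: partition_on_def)
 then show ?thesis using comp_elem_bilin[OF assms(1)] unfolding bilin_def comp_pure_def by blast
qed

lemma comp_pure_mlin:
 assumes "partition_on I P" "t \<in> vcarrier (p P)"
 shows "mlin P q (species_comp p q I) (comp_pure p q I P t)"
proof -
 have qs: "!!S. S \<in> P ==> vs (q S)" using assms q by (auto simp: partition_on_def)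
 have "vlinear (tensor P q) (species_comp p q I) (comp_elem p q I P t)"
  using comp_elem_bilin[OF assms(1)] assms(2) unfolding bilin_def by blast
 from mlin_comp_linear[OF pure_mlin[of P q, OF qs] this qs] show ?thesis by (simp add: comp_pure_def[abs_def])
qed

text \<open>Generators are propagated through the three layers of the construction: the tensor
  product over the blocks, the tensor product with \<open>p P\<close>, and the direct sum over
  partitions. The target set \<open>C\<close> is left free because the generating families used
  later are described in different ways.\<close>

lemma species_comp_span:
 assumes "!!P. partition_on I P ==> vcarrier (p P) \<subseteq> vspan (p P) (A P)" "!!P. partition_on I P ==> A P \<subseteq> vcarrier (p P)"
  "!!S. S \<subseteq> I ==> vcarrier (q S) \<subseteq> vspan (q S) (B S)" "!!S. S \<subseteq> I ==> B S \<subseteq> vcarrier (q S)"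
  "!!P t x. partition_on I P ==> t \<in> A P ==> x \<in> (\<Pi>\<^sub>E S\<in>P. B S) ==> comp_pure p q I P t x \<in> C"
 shows "vcarrier (species_comp p q I) \<subseteq> vspan (species_comp p q I) C" unfolding species_comp_def
proof (rule dirsum_span[where E = "\<lambda>P. {pure2 (p P) (tensor P q) t D |t D. t \<in> A P \<and> D \<in> pure P q ` (\<Pi>\<^sub>E S\<in>P. B S)}"])
 show "finite {P. partition_on I P}" using I by (rule finite_partitions)
next
 fix P assume "P \<in> {P. partition_on I P}"
 then have P: "partition_on I P" by simp
 have PS: "S \<subseteq> I" if "S \<in> P" for S using P that by (auto simp: partition_on_def)
 show "vs (tensor2 (p P) (tensor P q))" using vs_tensor2 p comp_vs_tensor P by blast
 have BP: "(\<Pi>\<^sub>E S\<in>P. B S) \<subseteq> (fams P q)" using PS assms(4) by (intro PiE_mono) auto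
 have sp: "vcarrier (tensor P q) \<subseteq> vspan (tensor P q) (pure P q ` (\<Pi>\<^sub>E S\<in>P. B S))"
  using partition_on_finite[OF I P] PS q assms by (intro tensor_span_gen) auto
 have qs: "!!S. S \<in> P ==> vs (q S)" using PS q by auto
 have sub: "pure P q ` (\<Pi>\<^sub>E S\<in>P. B S) \<subseteq> vcarrier (tensor P q)" using BP pure_in[of P q, OF qs] by blast
 show "vcarrier (tensor2 (p P) (tensor P q)) \<subseteq> vspan (tensor2 (p P) (tensor P q))
   {pure2 (p P) (tensor P q) t D |t D. t \<in> A P \<and> D \<in> pure P q ` (\<Pi>\<^sub>E S\<in>P. B S)}"
  by (rule tensor2_span_gen[OF p[OF P] comp_vs_tensor[OF P] assms(1)[OF P] assms(2)[OF P] sp sub])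
 show "{pure2 (p P) (tensor P q) t D |t D. t \<in> A P \<and> D \<in> pure P q ` (\<Pi>\<^sub>E S\<in>P. B S)} \<subseteq> vcarrier (tensor2 (p P) (tensor P q))"
  using assms(2)[OF P] sub pure2_in[OF p[OF P] comp_vs_tensor[OF P]] by blast
 fix v assume "v \<in> {pure2 (p P) (tensor P q) t D |t D. t \<in> A P \<and> D \<in> pure P q ` (\<Pi>\<^sub>E S\<in>P. B S)}"
 then show "summand {P. partition_on I P} (\<lambda>P. tensor2 (p P) (tensor P q)) P v \<in> C"
  using assms(5)[OF P] unfolding comp_pure_def comp_elem_def by blast
qed

lemma species_comp_span_all: "vcarrier (species_comp p q I) \<subseteq> vspan (species_comp p q I)
  ((\<lambda>(P, t, x). comp_pure p q I P t x) ` {(P, t, x). partition_on I P \<and> t \<in> vcarrier (p P) \<and> x \<in> fams P q})"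
proof (rule species_comp_span[of "\<lambda>P. vcarrier (p P)" "\<lambda>S. vcarrier (q S)"])
 fix P t x assume "partition_on I P" "t \<in> vcarrier (p P)" "x \<in> fams P q"
 then show "comp_pure p q I P t x \<in> (\<lambda>(P, t, x). comp_pure p q I P t x) `
   {(P, t, x). partition_on I P \<and> t \<in> vcarrier (p P) \<and> x \<in> fams P q}" by (intro image_eqI[of _ _ "(P, t, x)"]) auto
qed (auto intro: vspan.base)

text \<open>Universal property of the composition product. For fixed \<open>t\<close> the tensor
  product over the blocks turns the multilinear dependence on \<open>x\<close> into a linear map;
  then \<open>t\<close> is absorbed by the binary tensor product; last, the maps for the single
  partitions are added up on the direct sum.\<close>

lemma comp_lift:
 assumes Z: "vs Z"
  and lin: "!!P x. partition_on I P ==> x \<in> fams P q ==> vlinear (p P) Z (\<lambda>t. \<phi> P t x)"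
  and ml: "!!P t. partition_on I P ==> t \<in> vcarrier (p P) ==> mlin P q Z (\<phi> P t)"
 shows "\<exists>G. vlinear (species_comp p q I) Z G \<and> (\<forall>P t x. partition_on I P \<longrightarrow> t \<in> vcarrier (p P) \<longrightarrow>
  x \<in> fams P q \<longrightarrow> G (comp_pure p q I P t x) = \<phi> P t x)"
proof -
 have "\<exists>GP. vlinear (tensor2 (p P) (tensor P q)) Z GP \<and> (\<forall>t\<in>vcarrier (p P). \<forall>x\<in>(fams P q).
   GP (pure2 (p P) (tensor P q) t (pure P q x)) = \<phi> P t x)" if P: "partition_on I P" for P
 proof -
  have qs: "!!S. S \<in> P ==> vs (q S)" using P q by (auto simp: partition_on_def)
  have vsT: "vs (tensor P q)" using comp_vs_tensor[OF P] .
  have pin: "!!x. x \<in> fams P q ==> pure P q x \<in> vcarrier (tensor P q)" by (rule pure_in[of P q, OF qs])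
  have "\<exists>L. \<forall>t\<in>vcarrier (p P). vlinear (tensor P q) Z (L t) \<and> (\<forall>x\<in>(fams P q). L t (pure P q x) = \<phi> P t x)"
   by (rule bchoice) (use tensor_lift[of P q, OF qs Z ml[OF P]] in blast)
  then obtain L where L: "!!t. t \<in> vcarrier (p P) ==> vlinear (tensor P q) Z (L t)"
   "!!t x. t \<in> vcarrier (p P) ==> x \<in> fams P q ==> L t (pure P q x) = \<phi> P t x" by blast
  have sub: "pure P q ` (fams P q) \<subseteq> vcarrier (tensor P q)" using pin by blast
  \<comment> \<open>The maps \<open>L t\<close> were chosen separately for each \<open>t\<close>.
    Linearity in \<open>t\<close> at an arbitrary tensor \<open>D\<close> follows because a linear
    map on the tensor product is determined by its values on pure tensors, where linearity in
    \<open>t\<close> is assumed.\<close>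
  have lL: "vlinear (p P) Z (\<lambda>t. L t D)" if D: "D \<in> vcarrier (tensor P q)" for D unfolding vlinear_def
  proof (intro conjI ballI allI)
   show "(\<lambda>t. L t D) \<in> vcarrier (p P) \<rightarrow> vcarrier Z" using vlinearD(1)[OF L(1)] D by auto
  next
   fix s t assume s: "s \<in> vcarrier (p P)" and t: "t \<in> vcarrier (p P)"
   have st: "vadd (p P) s t \<in> vcarrier (p P)" using s t p[OF P] by simp
   have lin2: "vlinear (tensor P q) Z (\<lambda>D. vadd Z (L s D) (L t D))"
    unfolding vlinear_def using vlinearD[OF L(1)[OF s]] vlinearD[OF L(1)[OF t]] Z by (auto simp: vs_scale_vadd vs_assoc vs_lcomm)
   show "L (vadd (p P) s t) D = vadd Z (L s D) (L t D)" by (rule vlinear_eq_span[OF vsT Z L(1)[OF st] lin2 sub])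
     (use L(2) s t st vlinearD(2)[OF lin[OF P]] tensor_span[of P q, OF qs] D in auto)
  next
   fix c s assume s: "s \<in> vcarrier (p P)"
   have st: "vscale (p P) c s \<in> vcarrier (p P)" using s p[OF P] by simp
   have lin2: "vlinear (tensor P q) Z (\<lambda>D. vscale Z c (L s D))" unfolding vlinear_def using vlinearD[OF L(1)[OF s]] Z
    by (auto simp: vs_scale_vadd mult.commute)
   show "L (vscale (p P) c s) D = vscale Z c (L s D)" by (rule vlinear_eq_span[OF vsT Z L(1)[OF st] lin2 sub])
     (use L(2) s st vlinearD(3)[OF lin[OF P]] tensor_span[of P q, OF qs] D in auto)
  qed
  have "bilin (p P) (tensor P q) Z L" using L(1) lL by (auto simp: bilin_def)
  from tensor2_lift[OF p[OF P] vsT Z this] show ?thesis using L(2) pin by metis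
 qed
 then have "\<forall>P\<in>{P. partition_on I P}. \<exists>GP. vlinear (tensor2 (p P) (tensor P q)) Z GP \<and> (\<forall>t\<in>vcarrier (p P). \<forall>x\<in>(fams P q).
   GP (pure2 (p P) (tensor P q) t (pure P q x)) = \<phi> P t x)" by blast
 from bchoice[OF this] obtain GP where GP: "!!P. partition_on I P ==> vlinear (tensor2 (p P) (tensor P q)) Z (GP P)"
  "!!P t x. partition_on I P ==> t \<in> vcarrier (p P) ==> x \<in> fams P q ==>
   GP P (pure2 (p P) (tensor P q) t (pure P q x)) = \<phi> P t x" by blast
 have vsP: "vs (tensor2 (p P) (tensor P q))" if "P \<in> {P. partition_on I P}" for P using vs_tensor2 p comp_vs_tensor that by blast
 have "\<exists>G'. vlinear (dirsum {P. partition_on I P} (\<lambda>P. tensor2 (p P) (tensor P q))) Z G' \<and>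
   (\<forall>P\<in>{P. partition_on I P}. \<forall>v\<in>vcarrier (tensor2 (p P) (tensor P q)).
    G' (summand {P. partition_on I P} (\<lambda>P. tensor2 (p P) (tensor P q)) P v) = GP P v)"
  by (rule dirsum_lift[OF vsP finite_partitions[OF I] Z]) (use GP(1) in auto)
 then obtain G where G: "vlinear (species_comp p q I) Z G" "!!P v. partition_on I P ==> v \<in> vcarrier (tensor2 (p P) (tensor P q)) ==>
   G (summand {P. partition_on I P} (\<lambda>P. tensor2 (p P) (tensor P q)) P v) = GP P v" unfolding species_comp_def by auto
 have "G (comp_pure p q I P t x) = \<phi> P t x"
  if P: "partition_on I P" "t \<in> vcarrier (p P)" "x \<in> fams P q" for P t x
 proof -
  have qs: "!!S. S \<in> P ==> vs (q S)" using P q by (auto simp: partition_on_def)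
  have "pure P q x \<in> vcarrier (tensor P q)" by (rule pure_in[of P q, OF qs P(3)])
  then show ?thesis unfolding comp_pure_def comp_elem_def
   using G(2)[OF P(1)] GP(2)[OF P] pure2_in[OF p[OF P(1)] comp_vs_tensor[OF P(1)] P(2)] by simp
 qed
 then show ?thesis using G(1) by blast
qed

lemma comp_ext_works:
 assumes Z: "vs Z"
  and lin: "!!P x. partition_on I P ==> x \<in> fams P q ==> vlinear (p P) Z (\<lambda>t. \<phi> P t x)"
  and ml: "!!P t. partition_on I P ==> t \<in> vcarrier (p P) ==> mlin P q Z (\<phi> P t)"
 shows "vlinear (species_comp p q I) Z (comp_ext p q I Z \<phi>)"
  and "partition_on I P ==> t \<in> vcarrier (p P) ==> x \<in> fams P q ==>
   comp_ext p q I Z \<phi> (comp_pure p q I P t x) = \<phi> P t x"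
proof -
 obtain G where G: "vlinear (species_comp p q I) Z G" "!!P t x. partition_on I P ==> t \<in> vcarrier (p P) ==> x \<in> fams P q ==>
   G (comp_pure p q I P t x) = \<phi> P t x" using comp_lift[of Z \<phi>, OF assms] by blast
 have e: "comp_ext p q I Z \<phi> = restrict G (vcarrier (species_comp p q I))" unfolding comp_ext_def
  by (rule linext_eq[OF vs_species_comp Z G(1)]) (use G comp_pure_in species_comp_span_all in auto)
 show "vlinear (species_comp p q I) Z (comp_ext p q I Z \<phi>)" unfolding e using G(1) vlinear_restrict[OF vs_species_comp] by blast
 show "partition_on I P ==> t \<in> vcarrier (p P) ==> x \<in> fams P q ==>
   comp_ext p q I Z \<phi> (comp_pure p q I P t x) = \<phi> P t x" unfolding e using G(2) comp_pure_in by simp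
qed

end

section \<open>Adjoint faces and their signs\<close>

text \<open>The face through a point \<open>h\<close> of \<open>T\<^sup>\<or>[I]\<close>.
  Quantifying over all subsets of \<open>I\<close> rather than the proper nonempty ones changes
  nothing, since both extreme sums vanish there.\<close>

definition cell :: "'a set => ('a => real) => 'a face" where
 "cell I h = {h' \<in> Tspace {I}. \<forall>E\<subseteq>I. sgn (sum h' E) = sgn (sum h E)}"

text \<open>\<open>Redn P E = {}\<close> says that \<open>E\<close> is a union of blocks of
  \<open>P\<close>. So a generic point lies in \<open>T\<^sup>\<or>[P]\<close> and on no hyperplane
  except those that contain this whole space.\<close>

definition generic :: "'a set set => ('a => real) => bool" where
 "generic P h \<longleftrightarrow> h \<in> Tspace P \<and> (\<forall>E\<subseteq>\<Union>P. sum h E = 0 \<longrightarrow> Redn P E = {})"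

definition valid_cut :: "'a set set => 'a set \<times> 'a set => bool" where
 "valid_cut P V \<longleftrightarrow> fst V \<union> snd V \<in> P \<and> fst V \<inter> snd V = {} \<and> fst V \<noteq> {} \<and> snd V \<noteq> {}"

text \<open>The face of \<open>h + \<epsilon> g\<close> for a point \<open>h\<close> of
  \<open>z\<close>, a point \<open>g\<close> of \<open>X\<close> and small positive
  \<open>\<epsilon>\<close>: the sign on \<open>D\<close> decides, and the sign on \<open>C\<close>
  breaks ties. Other faces may have the same restrictions; this one has an explicit sign
  function.\<close>

definition face_glue :: "'a set => 'a face => 'a set => 'a face => 'a face" where
 "face_glue D z C X = face_of_sign (C \<union> D) (\<lambda>E. if face_sign z (E \<inter> D) \<noteq> 0 then face_sign z (E \<inter> D) else face_sign X (E \<inter> C))"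

text \<open>If the sum of \<open>h\<close> over \<open>E\<close> is nonzero, a small perturbation
  preserves its sign; otherwise the sign is that of \<open>t\<close>. One \<open>\<epsilon>\<close>
  serves all \<open>E\<close>, because \<open>I\<close> has only finitely many subsets. Faces
  obtained by cutting and gluing are realized by points of this kind.\<close>

lemma sgn_perturb:
 fixes h t :: "'a => real"
 assumes "finite I"
 obtains \<epsilon> where "\<epsilon> > 0" "!!E. E \<subseteq> I ==> sum (\<lambda>i. h i + \<epsilon> * t i) E = sum h E + \<epsilon> * sum t E"
  "!!E. E \<subseteq> I ==> sgn (sum h E + \<epsilon> * sum t E) = (if sum h E \<noteq> 0 then sgn (sum h E) else sgn (sum t E))"
proof -
 have 1: "\<forall>\<^sub>F \<epsilon> in at_right 0. sgn (a + \<epsilon> * b) = (if a \<noteq> 0 then sgn a else sgn b)" for a b :: real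
 proof -
  have l: "((\<lambda>\<epsilon>. a + \<epsilon> * b) \<longlongrightarrow> a + 0 * b) (at_right 0)" by (intro tendsto_intros)
  consider "a > 0" | "a < 0" | "a = 0" by linarith
  then show ?thesis
  proof cases
   case 1
   then have "\<forall>\<^sub>F \<epsilon> in at_right 0. a + \<epsilon> * b > 0" using order_tendstoD(1)[OF l, of 0] by simp
   then show ?thesis by eventually_elim (use 1 in auto)
  next
   case 2
   then have "\<forall>\<^sub>F \<epsilon> in at_right 0. a + \<epsilon> * b < 0" using order_tendstoD(2)[OF l, of 0] by simp
   then show ?thesis by eventually_elim (use 2 in auto)
  next
   case 3
   have "\<forall>\<^sub>F \<epsilon> in at_right 0. (0::real) < \<epsilon>" by (rule eventually_at_right_less)
   then show ?thesis by eventually_elim (use 3 in \<open>auto simp: sgn_mult\<close>)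
  qed
 qed
 have "\<forall>\<^sub>F \<epsilon> in at_right 0. \<forall>E\<in>Pow I. sgn (sum h E + \<epsilon> * sum t E) = (if sum h E \<noteq> 0 then sgn (sum h E) else sgn (sum t E))"
  using assms 1 by (intro eventually_ball_finite) auto
 moreover have "\<forall>\<^sub>F \<epsilon> in at_right 0. (0::real) < \<epsilon>" by (rule eventually_at_right_less)
 ultimately have "\<forall>\<^sub>F \<epsilon> in at_right 0. 0 < \<epsilon> \<and> (\<forall>E\<in>Pow I. sgn (sum h E + \<epsilon> * sum t E) = (if sum h E \<noteq> 0 then sgn (sum h E) else sgn (sum t E)))"
  by eventually_elim auto
 then obtain \<epsilon> where "0 < \<epsilon> \<and> (\<forall>E\<in>Pow I. sgn (sum h E + \<epsilon> * sum t E) = (if sum h E \<noteq> 0 then sgn (sum h E) else sgn (sum t E)))"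
  using eventually_happens'[OF trivial_limit_at_right_real] by blast
 then show ?thesis using that[of \<epsilon>] by (simp add: sum.distrib sum_distrib_left)
qed

lemma TspaceD: "h \<in> Tspace P ==> i \<notin> \<Union>P ==> h i = 0" "h \<in> Tspace P ==> S \<in> P ==> sum h S = 0" by (auto simp: Tspace_def vfree_carrier)

lemma TspaceI: "finite (\<Union>P) ==> (!!i. i \<notin> \<Union>P ==> h i = 0) ==> (!!S. S \<in> P ==> sum h S = 0) ==> h \<in> Tspace P"
proof -
 assume a: "finite (\<Union>P)" "!!i. i \<notin> \<Union>P ==> h i = 0" "!!S. S \<in> P ==> sum h S = 0"
 then have "{x. h x \<noteq> 0} \<subseteq> \<Union>P" by blast
 then show ?thesis using a finite_subset by (auto simp: Tspace_def vfree_carrier)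
qed

lemma Redn_emptyD: "Redn P E = {} ==> E = \<Union>{B \<in> P. B \<subseteq> E}" by (auto simp: Redn_def)

lemma Redn_empty_iff: "Redn P E = {} \<longleftrightarrow> (\<forall>i\<in>E. \<exists>B\<in>P. i \<in> B \<and> B \<subseteq> E)" by (auto simp: Redn_def)

lemma partition_onD_block: "partition_on I P ==> S \<in> P ==> T \<in> P ==> i \<in> S ==> i \<in> T ==> S = T" by (auto simp: partition_on_def disjoint_def)

lemma Redn_block: "partition_on I P ==> Redn P E = {} ==> S \<in> P ==> i \<in> S ==> i \<in> E \<longleftrightarrow> S \<subseteq> E"
 unfolding Redn_empty_iff using partition_onD_block by fast

section \<open>Faces as cells of generic points\<close>

context
 fixes I :: "'a set" and P
 assumes I: "finite I" and P: "partition_on I P"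
begin

lemma UnP: "\<Union>P = I" using P by (auto simp: partition_on_def)

lemma sum_blocks: "R \<subseteq> P ==> sum h (\<Union>R) = (\<Sum>S\<in>R. sum h S)" for h :: "'a => real"
proof -
 assume R: "R \<subseteq> P"
 have "A \<inter> B = {}" if "A \<in> R" "B \<in> R" "A \<noteq> B" for A B
 proof -
  have "A \<in> P" "B \<in> P" using that R by auto
  then show ?thesis using P that(3) unfolding partition_on_def disjoint_def by blast
 qed
 then have "\<forall>A\<in>R. \<forall>B\<in>R. A \<noteq> B \<longrightarrow> A \<inter> B = {}" by blast
 then show ?thesis using R partition_block_finite[OF I P] by (subst sum.Union_disjoint) auto
qed

lemma Tspace_Redn: "h \<in> Tspace P ==> Redn P E = {} ==> sum h E = 0"
proof -
 assume h: "h \<in> Tspace P" and E: "Redn P E = {}"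
 have "sum h (\<Union>{B \<in> P. B \<subseteq> E}) = (\<Sum>S\<in>{B \<in> P. B \<subseteq> E}. sum h S)" by (rule sum_blocks) auto
 also have "\<dots> = 0" using TspaceD(2)[OF h] by simp
 finally show ?thesis using Redn_emptyD[OF E] by simp
qed

lemma Tspace_sub: "Tspace P \<subseteq> Tspace {I}"
proof
 fix h assume h: "h \<in> Tspace P"
 have "Redn P I = {}" using UnP by (auto simp: Redn_def)
 then have "sum h I = 0" by (rule Tspace_Redn[OF h])
 then show "h \<in> Tspace {I}" using h UnP by (auto simp: Tspace_def)
qed

lemma adjoint_faces_cell: "adjoint_faces I = cell I ` Tspace {I}"
proof -
 have "{h' \<in> Tspace {I}. \<forall>S. S \<noteq> {} \<and> S \<subset> I \<longrightarrow> sgn (\<Sum>i\<in>S. h' i) = sgn (\<Sum>i\<in>S. h i)} = cell I h"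
  if h: "h \<in> Tspace {I}" for h
 proof -
  have "sgn (sum h' E) = sgn (sum h E)" if "h' \<in> Tspace {I}" "E \<subseteq> I" "\<forall>S. S \<noteq> {} \<and> S \<subset> I \<longrightarrow> sgn (\<Sum>i\<in>S. h' i) = sgn (\<Sum>i\<in>S. h i)" for h' E
  proof -
   from that(2) consider "E = {}" | "E = I" | "E \<noteq> {} \<and> E \<subset> I" by blast
   then show ?thesis
   proof cases
    case 2
    then show ?thesis using TspaceD(2)[OF h, of I] TspaceD(2)[OF that(1), of I] by simp
   qed (use that(3) in auto)
  qed
  then show ?thesis unfolding cell_def by blast
 qed
 then show ?thesis unfolding adjoint_faces_def by (auto simp: image_iff)
qed

lemma vsub_sum_zero: "vsub (vfree I) {t \<in> vcarrier (vfree I). \<forall>S\<in>F. sum t S = (0::real)}" unfolding vsub_def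
proof (intro conjI ballI allI)
 fix u v :: "'a => real"
 assume "u \<in> {t \<in> vcarrier (vfree I). \<forall>S\<in>F. sum t S = 0}" "v \<in> {t \<in> vcarrier (vfree I). \<forall>S\<in>F. sum t S = 0}"
 then show "vadd (vfree I) u v \<in> {t \<in> vcarrier (vfree I). \<forall>S\<in>F. sum t S = 0}"
  using vs_add[OF vs_vfree, of u I v] by (simp add: sum.distrib)
next
 fix c and v :: "'a => real"
 assume "v \<in> {t \<in> vcarrier (vfree I). \<forall>S\<in>F. sum t S = 0}"
 then show "vscale (vfree I) c v \<in> {t \<in> vcarrier (vfree I). \<forall>S\<in>F. sum t S = 0}"
  using vs_scale[OF vs_vfree, of v I c] by (simp add: sum_distrib_left[symmetric])
qed (auto simp: vfree_carrier)

lemma vsub_Tspace: "vsub (vfree I) (Tspace P)" using vsub_sum_zero[of P] unfolding Tspace_def UnP .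

lemma cell_self: "h \<in> Tspace {I} ==> h \<in> cell I h" by (auto simp: cell_def)

text \<open>If the sum over \<open>E\<close> vanishes at \<open>h\<close>, it vanishes on the whole
  face and hence on its span \<open>T\<^sup>\<or>[P]\<close>. This is only possible for a union of
  blocks, since otherwise some block meets \<open>E\<close> without being contained in it.\<close>

lemma cell_face_generic:
 assumes h: "h \<in> Tspace {I}" and sp: "vspan (vfree I) (cell I h) = Tspace P"
 shows "generic P h" unfolding generic_def
proof (intro conjI allI impI)
 show "h \<in> Tspace P" using vspan.base[OF cell_self[OF h]] sp by auto
 fix E assume "E \<subseteq> \<Union>P" and E0: "sum h E = 0"
 then have EI: "E \<subseteq> I" using UnP by simp
 have fE: "finite E" using EI I finite_subset by auto
 let ?W = "{t \<in> vcarrier (vfree I). sum t E = (0::real)}"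
 have W: "vsub (vfree I) ?W" using vsub_sum_zero[of "{E}"] by simp
 have "cell I h \<subseteq> ?W"
 proof
  fix g assume "g \<in> cell I h"
  then have "g \<in> Tspace {I}" "sgn (sum g E) = sgn (sum h E)" using EI by (auto simp: cell_def)
  then show "g \<in> ?W" using E0 by (auto simp: Tspace_def sgn_zero_iff)
 qed
 from vspan_least[OF W this] have TW: "Tspace P \<subseteq> ?W" using sp by simp
 show "Redn P E = {}"
 proof (rule ccontr)
  assume "Redn P E \<noteq> {}"
  then obtain i where i: "i \<in> E" "!!B. B \<in> P ==> i \<in> B ==> \<not> B \<subseteq> E" unfolding Redn_empty_iff by blast
  then obtain B where B: "B \<in> P" "i \<in> B" using EI UnP by blast
  then obtain j where j: "j \<in> B" "j \<notin> E" using i(2) by blast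
  \<comment> \<open>The difference of the coordinate vectors at \<open>i\<close> and
    \<open>j\<close>. It lies in \<open>T\<^sup>\<or>[P]\<close> because \<open>i\<close> and
    \<open>j\<close> share the block \<open>B\<close>, but its sum over \<open>E\<close> is
    1.\<close>
  define t :: "'a => real" where "t = (\<lambda>k. (if k = i then 1 else 0) - (if k = j then 1 else 0))"
  have st: "sum t S = of_bool (i \<in> S) - of_bool (j \<in> S)" if "finite S" for S unfolding t_def sum_subtractf using that by simp
  have "t \<in> Tspace P"
  proof (rule TspaceI)
   show "finite (\<Union>P)" using UnP I by simp
   show "!!k. k \<notin> \<Union>P ==> t k = 0" using B j by (auto simp: t_def)
   fix S assume S: "S \<in> P"
   have "i \<in> S \<longleftrightarrow> j \<in> S" using partition_onD_block[OF P S B(1)] B j by blast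
   then show "sum t S = 0" using st partition_block_finite[OF I P S] by auto
  qed
  then have "sum t E = 0" using TW by auto
  then show False using st[OF fE] i j by simp
 qed
qed

lemma generic_Tspace: "generic P h ==> h \<in> Tspace {I}" using Tspace_sub by (auto simp: generic_def)

lemma generic_zero: "generic P h ==> E \<subseteq> I ==> sum h E = 0 \<longleftrightarrow> Redn P E = {}" using Tspace_Redn UnP by (auto simp: generic_def)

text \<open>Relative openness: a small step from \<open>h\<close> in any direction \<open>t\<close>
  of \<open>T\<^sup>\<or>[P]\<close> keeps all signs, so \<open>t\<close> is a multiple of a
  difference of two points of the face.\<close>

lemma generic_cell_span:
 assumes g: "generic P h"
 shows "vspan (vfree I) (cell I h) = Tspace P"
proof
 have "cell I h \<subseteq> Tspace P"
 proof
  fix k assume "k \<in> cell I h"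
  then have k: "k \<in> Tspace {I}" "!!E. E \<subseteq> I ==> sgn (sum k E) = sgn (sum h E)" by (auto simp: cell_def)
  show "k \<in> Tspace P"
  proof (rule TspaceI)
   show "finite (\<Union>P)" using UnP I by simp
   show "!!i. i \<notin> \<Union>P ==> k i = 0" using TspaceD(1)[OF k(1)] UnP by simp
   fix S assume S: "S \<in> P"
   then have "S \<subseteq> I" using UnP by auto
   moreover have "sum h S = 0" using g S TspaceD(2) by (auto simp: generic_def)
   ultimately have "sgn (sum k S) = 0" using k(2) by simp
   then show "sum k S = 0" by (simp add: sgn_zero_iff)
  qed
 qed
 then show "vspan (vfree I) (cell I h) \<subseteq> Tspace P" by (rule vspan_least[OF vsub_Tspace])
 show "Tspace P \<subseteq> vspan (vfree I) (cell I h)"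
 proof
  fix t assume t: "t \<in> Tspace P"
  obtain \<epsilon> where e: "\<epsilon> > 0" "!!E. E \<subseteq> I ==> sum (\<lambda>i. h i + \<epsilon> * t i) E = sum h E + \<epsilon> * sum t E"
   "!!E. E \<subseteq> I ==> sgn (sum h E + \<epsilon> * sum t E) = (if sum h E \<noteq> 0 then sgn (sum h E) else sgn (sum t E))"
   by (rule sgn_perturb[OF I, of h t]) (rule that)
  let ?g = "\<lambda>i. h i + \<epsilon> * t i"
  have hT: "h \<in> Tspace P" using g by (simp add: generic_def)
  have "?g \<in> Tspace {I}"
  proof (rule TspaceI)
   show "finite (\<Union>{I})" using I by simp
   have tT: "t \<in> Tspace {I}" using t Tspace_sub by blast
   note hI = generic_Tspace[OF g]
   show "!!i. i \<notin> \<Union>{I} ==> h i + \<epsilon> * t i = 0" using TspaceD(1)[OF hI] TspaceD(1)[OF tT] by simp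
   show "!!S. S \<in> {I} ==> sum ?g S = 0" using TspaceD(2)[OF hI, of I] TspaceD(2)[OF tT, of I] e(2)[of I] by simp
  qed
  moreover have "sgn (sum ?g E) = sgn (sum h E)" if "E \<subseteq> I" for E
   using e(2,3)[OF that] generic_zero[OF g that] Tspace_Redn[OF t, of E] by auto
  ultimately have "?g \<in> cell I h" by (simp add: cell_def)
  then have "vadd (vfree I) ?g (vscale (vfree I) (-1) h) \<in> vspan (vfree I) (cell I h)"
   using cell_self[OF generic_Tspace[OF g]] by (intro vspan.add vspan.scale vspan.base)
  then have "vscale (vfree I) (1 / \<epsilon>) (vadd (vfree I) ?g (vscale (vfree I) (-1) h)) \<in> vspan (vfree I) (cell I h)" by (rule vspan.scale)
  moreover have "vscale (vfree I) (1 / \<epsilon>) (vadd (vfree I) ?g (vscale (vfree I) (-1) h)) = t" using e(1) by (auto simp: fun_eq_iff)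
  ultimately show "t \<in> vspan (vfree I) (cell I h)" by simp
 qed
qed

text \<open>The working description of faces. Membership in \<open>faces P\<close> is established by
  exhibiting a generic point, and the signs of the face are then the signs of sums at that
  point.\<close>

lemma faces_iff: "X \<in> faces P \<longleftrightarrow> (\<exists>h. generic P h \<and> X = cell I h)"
proof
 assume "X \<in> faces P"
 then obtain h where h: "h \<in> Tspace {I}" "X = cell I h" "vspan (vfree I) X = Tspace P" unfolding faces_def UnP adjoint_faces_cell by auto
 then show "\<exists>h. generic P h \<and> X = cell I h" using cell_face_generic[OF h(1)] by auto
next
 assume "\<exists>h. generic P h \<and> X = cell I h"
 then obtain h where h: "generic P h" "X = cell I h" by blast
 then show "X \<in> faces P" unfolding faces_def UnP adjoint_faces_cell using generic_Tspace[OF h(1)] generic_cell_span[OF h(1)] by auto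
qed

lemma face_sign_cell: "h \<in> Tspace {I} ==> E \<subseteq> I ==> face_sign (cell I h) E = sgn (sum h E)"
proof -
 assume h: "h \<in> Tspace {I}" and E: "E \<subseteq> I"
 have "(\<lambda>h. sgn (\<Sum>i\<in>E. h i)) ` cell I h = {sgn (sum h E)}" using cell_self[OF h] E by (auto simp: cell_def image_iff)
 then show ?thesis by (simp add: face_sign_def)
qed

lemma face_of_sign_cell: "(!!E. E \<subseteq> I ==> s E = sgn (sum h E)) ==> face_of_sign I s = cell I h" unfolding face_of_sign_def cell_def by auto

lemma facesE:
 assumes "X \<in> faces P"
 obtains h where "generic P h" "X = cell I h" "!!E. E \<subseteq> I ==> face_sign X E = sgn (sum h E)"
 using assms faces_iff face_sign_cell generic_Tspace by metis

lemma facesI: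
 assumes "generic P h" "!!E. E \<subseteq> I ==> s E = sgn (sum h E)"
 shows "face_of_sign I s \<in> faces P" "E \<subseteq> I ==> face_sign (face_of_sign I s) E = s E"
proof -
 have "face_of_sign I s = cell I h" using face_of_sign_cell[of s h] assms(2) by blast
 then show "face_of_sign I s \<in> faces P" "E \<subseteq> I ==> face_sign (face_of_sign I s) E = s E"
  using assms faces_iff face_sign_cell[OF generic_Tspace[OF assms(1)]] by auto
qed

lemma face_sign_zero: "X \<in> faces P ==> E \<subseteq> I ==> face_sign X E = 0 \<longleftrightarrow> Redn P E = {}" using facesE generic_zero by (metis sgn_zero_iff)

lemma face_sign_empty: "X \<in> faces P ==> face_sign X {} = 0" using face_sign_zero[of X "{}"] by (simp add: Redn_def)

lemma face_ext:
 assumes "X \<in> faces P" "Y \<in> faces P" "!!E. E \<subseteq> I ==> face_sign X E = face_sign Y E"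
 shows "X = Y"
proof -
 obtain h where h: "X = cell I h" "!!E. E \<subseteq> I ==> face_sign X E = sgn (sum h E)" by (rule facesE[OF assms(1)]) (rule that)
 obtain g where g: "Y = cell I g" "!!E. E \<subseteq> I ==> face_sign Y E = sgn (sum g E)" by (rule facesE[OF assms(2)]) (rule that)
 have "sgn (sum h E) = sgn (sum g E)" if "E \<subseteq> I" for E using h(2) g(2) assms(3) that by metis
 then show ?thesis unfolding h(1) g(1) cell_def by auto
qed

text \<open>A face is determined by its signs, and there are finitely many functions from the
  subsets of \<open>I\<close> to the three signs.\<close>

lemma finite_faces: "finite (faces P)"
proof -
 have "faces P \<subseteq> face_of_sign I ` (\<Pi>\<^sub>E E\<in>Pow I. {-1, 0, 1})"
 proof
  fix X assume "X \<in> faces P"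
  then obtain h where h: "generic P h" "X = cell I h" using faces_iff by blast
  have "X = face_of_sign I (\<lambda>E\<in>Pow I. sgn (sum h E))" using face_of_sign_cell[of "\<lambda>E\<in>Pow I. sgn (sum h E)" h] h(2) by auto
  moreover have "(\<lambda>E\<in>Pow I. sgn (sum h E)) \<in> (\<Pi>\<^sub>E E\<in>Pow I. {-1, 0, 1})" by (auto simp: sgn_if)
  ultimately show "X \<in> face_of_sign I ` (\<Pi>\<^sub>E E\<in>Pow I. {-1, 0, 1})" by blast
 qed
 moreover have "finite (\<Pi>\<^sub>E E\<in>Pow I. {-1, 0, 1 :: real})" using I by (intro finite_PiE) auto
 ultimately show ?thesis by (meson finite_imageI finite_subset)
qed

lemma partition_on_sub: "R \<subseteq> P ==> partition_on (\<Union>R) R" using P by (auto simp: partition_on_def disjoint_def)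

end

text \<open>A generic point of \<open>X\<close>, set to zero outside the union of \<open>R\<close>,
  is generic for \<open>R\<close> and has the required signs. Unions of several blocks are allowed
  because the two halves of a cut have to be restricted together.\<close>

lemma face_restrict:
 assumes I: "finite I" and P: "partition_on I P" and R: "R \<subseteq> P" and X: "X \<in> faces P"
 shows "face_restrict X (\<Union>R) \<in> faces R" "E \<subseteq> \<Union>R ==> face_sign (face_restrict X (\<Union>R)) E = face_sign X E"
proof -
 let ?S = "\<Union>R"
 note UnP = UnP[OF I P]
 have SI: "?S \<subseteq> I" using R UnP by auto
 have S: "finite ?S" "partition_on ?S R" using finite_subset[OF SI I] partition_on_sub[OF I P R] by auto
 obtain h where h: "generic P h" "!!E. E \<subseteq> I ==> face_sign X E = sgn (sum h E)" by (rule facesE[OF I P X]) (rule that)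
 define k where "k = (\<lambda>i. if i \<in> ?S then h i else 0)"
 have sk: "sum k E = sum h E" if "E \<subseteq> ?S" for E unfolding k_def using that by (intro sum.cong) auto
 have g: "generic R k" unfolding generic_def
 proof (intro conjI allI impI)
  show "k \<in> Tspace R"
  proof (rule TspaceI[OF S(1)])
   show "!!i. i \<notin> ?S ==> k i = 0" by (simp add: k_def)
   fix B assume "B \<in> R"
   then have "B \<subseteq> ?S" "B \<in> P" using R by auto
   then show "sum k B = 0" using sk[of B] R TspaceD(2)[of h P B] h(1) by (auto simp: generic_def)
  qed
  fix E assume E: "E \<subseteq> ?S" "sum k E = 0"
  then have "Redn P E = {}" using generic_zero[OF I P h(1), of E] sk SI by auto
  note RE = this
  show "Redn R E = {}" unfolding Redn_empty_iff
  proof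
   fix i assume i: "i \<in> E"
   then obtain S B where SB: "S \<in> R" "i \<in> S" "B \<in> P" "i \<in> B" "B \<subseteq> E" using E(1) RE unfolding Redn_empty_iff by blast
   have "B = S" using partition_onD_block[OF P SB(3) _ SB(4,2)] SB(1) R by blast
   then show "\<exists>B\<in>R. i \<in> B \<and> B \<subseteq> E" using SB by blast
  qed
 qed
 have s: "face_sign X E = sgn (sum k E)" if "E \<subseteq> ?S" for E using h(2)[of E] sk[OF that] that SI by auto
 show "face_restrict X ?S \<in> faces R" "E \<subseteq> ?S ==> face_sign (face_restrict X ?S) E = face_sign X E"
  unfolding face_restrict_def using facesI[OF S g s] by auto
qed

lemma face_restrict_block:
 assumes "finite I" "partition_on I P" "S \<in> P" "X \<in> faces P"
 shows "face_restrict X S \<in> faces {S}" "E \<subseteq> S ==> face_sign (face_restrict X S) E = face_sign X E"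
 using face_restrict[OF assms(1,2) _ assms(4), of "{S}"] assms(3) by auto

lemma partition_on_block: "partition_on I P ==> S \<in> P ==> partition_on S {S}" by (auto simp: partition_on_def)

lemma face_restrict_eqI:
 assumes "finite I" "partition_on I P" "S \<in> P" "X \<in> faces P" "Y \<in> faces {S}" "!!E. E \<subseteq> S ==> face_sign X E = face_sign Y E"
 shows "face_restrict X S = Y" by (rule face_ext[of S "{S}"])
  (use assms face_restrict_block[OF assms(1-4)] partition_block_finite[OF assms(1-3)]
   partition_on_block[OF assms(2,3)] in auto)

section \<open>Cutting and gluing faces\<close>

lemma partition_on_cut:
 assumes "partition_on I P" "valid_cut P (C, D)"
 shows "partition_on I (cut_target P (C, D))"
proof -
 have v: "C \<union> D \<in> P" "C \<inter> D = {}" "C \<noteq> {}" "D \<noteq> {}" using assms by (auto simp: valid_cut_def)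
 have dj: "S \<inter> (C \<union> D) = {}" if "S \<in> P" "S \<noteq> C \<union> D" for S using assms(1) v that by (auto simp: partition_on_def disjoint_def)
 show ?thesis unfolding cut_target_def prod.case
 proof (rule partition_onI)
  show "\<Union> (insert C (insert D (P - {C \<union> D}))) = I"
  proof -
   have "\<Union> (insert C (insert D (P - {C \<union> D}))) = \<Union> (insert (C \<union> D) (P - {C \<union> D}))" by auto
   also have "\<dots> = \<Union>P" using v(1) by (simp add: insert_absorb)
   finally show ?thesis using assms(1) by (simp add: partition_on_def)
  qed
 next
  fix p q assume pq: "p \<in> insert C (insert D (P - {C \<union> D}))" "q \<in> insert C (insert D (P - {C \<union> D}))" "p \<noteq> q"
  have "p \<inter> q = {}" if "p \<in> P" "q \<in> P" using that pq(3) assms(1) by (auto simp: partition_on_def disjoint_def)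
  moreover have *: "p \<inter> q = {}" if "p \<in> {C, D}" "q \<in> P - {C \<union> D}" for p q using dj[of q] that by blast
  moreover have "C \<inter> D = {}" "D \<inter> C = {}" using v(2) by auto
  ultimately have "p \<inter> q = {}"
   using *[of p q] *[of q p] pq unfolding insert_iff Int_commute[of q p] by (elim disjE) (simp_all add: Int_commute)
  then show "disjnt p q" by (simp add: disjnt_def)
 next
  show "{} \<notin> insert C (insert D (P - {C \<union> D}))" using v assms(1) by (auto simp: partition_on_def)
 qed
qed

lemma cut_target_swap: "cut_target P (D, C) = cut_target P (C, D)" by (simp add: cut_target_def insert_commute Un_commute)

lemma valid_cut_swap: "valid_cut P (D, C) = valid_cut P (C, D)" by (auto simp: valid_cut_def Un_commute Int_commute)

text \<open>No block of \<open>P\<close> fits inside \<open>C\<close>, so \<open>C\<close> is its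
  own reduction. The condition \<open>E = C mod P\<close> therefore singles out those unions of
  blocks of the refined partition that contain \<open>C\<close> but not \<open>D\<close>. These lie
  among the sets at which a face of the refined partition has sign zero, so the cut only breaks
  ties.\<close>

lemma Redn_cut_iff:
 assumes P: "partition_on I P" and V: "valid_cut P (C, D)" and E: "E \<subseteq> I"
 shows "Redn P E = Redn P C \<longleftrightarrow> Redn (cut_target P (C, D)) E = {} \<and> C \<subseteq> E \<and> \<not> D \<subseteq> E"
proof -
 have v: "C \<union> D \<in> P" "C \<inter> D = {}" "C \<noteq> {}" "D \<noteq> {}" using V by (auto simp: valid_cut_def)
 have RC: "Redn P C = C"
 proof -
  have "\<not> B \<subseteq> C" if B: "B \<in> P" for B
  proof
   assume BC: "B \<subseteq> C"
   moreover have "B \<noteq> {}" using P B by (auto simp: partition_on_def)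
   ultimately have "B = C \<union> D" using partition_onD_block[OF P B v(1)] by blast
   then show False using BC v by blast
  qed
  then show ?thesis by (auto simp: Redn_def)
 qed
 let ?Q = "cut_target P (C, D)"
 note Q = partition_on_cut[OF P V]
 show ?thesis
 proof
  assume "Redn P E = Redn P C"
  then have E': "Redn P E = C" using RC by simp
  then have CE: "C \<subseteq> E" by (auto simp: Redn_def)
  have nCD: "\<not> C \<union> D \<subseteq> E"
  proof
   assume "C \<union> D \<subseteq> E"
   then have "c \<notin> Redn P E" if "c \<in> C" for c using that v(1) unfolding Redn_def by blast
   then show False using E' v(3) by blast
  qed
  have "\<exists>B\<in>?Q. i \<in> B \<and> B \<subseteq> E" if i: "i \<in> E" for i
  proof (cases "i \<in> C")
   case True then show ?thesis using CE by (auto simp: cut_target_def)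
  next
   case False
   then have "i \<notin> Redn P E" using E' by simp
   then obtain B where "B \<in> P" "B \<subseteq> E" "i \<in> B" using i by (auto simp: Redn_def)
   then show ?thesis using nCD by (auto simp: cut_target_def)
  qed
  then show "Redn ?Q E = {} \<and> C \<subseteq> E \<and> \<not> D \<subseteq> E" using CE nCD unfolding Redn_empty_iff by blast
 next
  assume a: "Redn ?Q E = {} \<and> C \<subseteq> E \<and> \<not> D \<subseteq> E"
  have DQ: "D \<in> ?Q" by (auto simp: cut_target_def)
  have DE: "D \<inter> E = {}" using Redn_block[OF Q conjunct1[OF a] DQ] a by blast
  have "Redn P E = C"
  proof
   show "Redn P E \<subseteq> C"
   proof
    fix i assume i: "i \<in> Redn P E"
    then have iE: "i \<in> E" and n: "!!B. B \<in> P ==> i \<in> B ==> \<not> B \<subseteq> E" by (auto simp: Redn_def)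
    obtain B where B: "B \<in> ?Q" "i \<in> B" "B \<subseteq> E" using a iE unfolding Redn_empty_iff by blast
    then show "i \<in> C" using n DE by (auto simp: cut_target_def)
   qed
   show "C \<subseteq> Redn P E"
   proof
    fix i assume i: "i \<in> C"
    have "\<not> B \<subseteq> E" if "B \<in> P" "i \<in> B" for B
    proof -
     have "B = C \<union> D" using partition_onD_block[OF P that(1) v(1) that(2)] i by blast
     then show ?thesis using a by blast
    qed
    then show "i \<in> Redn P E" using i a by (auto simp: Redn_def)
   qed
  qed
  then show "Redn P E = Redn P C" using RC by simp
 qed
qed

text \<open>The cut face is realized by moving a generic point of \<open>X\<close> slightly, up on
  one element of \<open>C\<close> and down by the same amount on one element of \<open>D\<close>.
  Nonzero signs survive, and a zero sign is replaced according to which of \<open>C\<close> and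
  \<open>D\<close> the set contains.\<close>

lemma face_cut:
 assumes I: "finite I" and P: "partition_on I P" and V: "valid_cut P (C, D)" and X: "X \<in> faces (cut_target P (C, D))"
 shows "face_cut P (C, D) X \<in> faces P" "E \<subseteq> I ==> face_sign (face_cut P (C, D) X) E =
   (if face_sign X E \<noteq> 0 then face_sign X E else of_bool (C \<subseteq> E) - of_bool (D \<subseteq> E))"
proof -
 let ?Q = "cut_target P (C, D)"
 have v: "C \<union> D \<in> P" "C \<inter> D = {}" "C \<noteq> {}" "D \<noteq> {}" using V by (auto simp: valid_cut_def)
 note Q = partition_on_cut[OF P V] and UnP = UnP[OF I P]
 obtain h where h: "generic ?Q h" "!!E. E \<subseteq> I ==> face_sign X E = sgn (sum h E)" by (rule facesE[OF I Q X]) (rule that)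
 obtain c d where cd: "c \<in> C" "d \<in> D" using v by auto
 have CDQ: "C \<in> ?Q" "D \<in> ?Q" by (auto simp: cut_target_def)
 have CDI: "C \<subseteq> I" "D \<subseteq> I" using v(1) UnP by auto
 \<comment> \<open>The direction of the perturbation. On a union of blocks of the refined partition,
   containing \<open>c\<close> is the same as containing all of \<open>C\<close>, and likewise for
   \<open>d\<close> and \<open>D\<close>; the choice of \<open>c\<close> and \<open>d\<close> is
   therefore invisible in the signs.\<close>
 define t :: "'a => real" where "t = (\<lambda>k. (if k = c then 1 else 0) - (if k = d then 1 else 0))"
 have st: "sum t S = of_bool (c \<in> S) - of_bool (d \<in> S)" if "S \<subseteq> I" for S
  unfolding t_def sum_subtractf using finite_subset[OF that I] by simp
 obtain \<epsilon> where e: "\<epsilon> > 0" "!!E. E \<subseteq> I ==> sum (\<lambda>i. h i + \<epsilon> * t i) E = sum h E + \<epsilon> * sum t E"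
  "!!E. E \<subseteq> I ==> sgn (sum h E + \<epsilon> * sum t E) = (if sum h E \<noteq> 0 then sgn (sum h E) else sgn (sum t E))"
  by (rule sgn_perturb[OF I, of h t]) (rule that)
 define k where "k = (\<lambda>i. h i + \<epsilon> * t i)"
 have z: "sum h E = 0 \<longleftrightarrow> Redn ?Q E = {}" if "E \<subseteq> I" for E using generic_zero[OF I Q h(1) that] .
 have cE: "c \<in> E \<longleftrightarrow> C \<subseteq> E" "d \<in> E \<longleftrightarrow> D \<subseteq> E" if "Redn ?Q E = {}" for E
  using Redn_block[OF Q that CDQ(1) cd(1)] Redn_block[OF Q that CDQ(2) cd(2)] .
 have sk: "sgn (sum k E) = (if sum h E \<noteq> 0 then sgn (sum h E) else of_bool (C \<subseteq> E) - of_bool (D \<subseteq> E))"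
  if "E \<subseteq> I" for E using e(2,3)[OF that] st[OF that] cE z[OF that] by (auto simp: k_def)
 have g: "generic P k" unfolding generic_def
 proof (intro conjI allI impI)
  show "k \<in> Tspace P"
  proof (rule TspaceI)
   show "finite (\<Union>P)" using UnP I by simp
   fix i assume "i \<notin> \<Union>P"
   then have "i \<notin> I" using UnP by simp
   then show "k i = 0" using TspaceD(1)[OF generic_Tspace[OF I Q h(1)], of i] cd CDI by (auto simp: k_def t_def)
  next
   fix S assume S: "S \<in> P"
   then have SI: "S \<subseteq> I" using UnP by auto
   have RS: "Redn ?Q S = {}" unfolding Redn_empty_iff using S by (auto simp: cut_target_def)
   have "C \<subseteq> S \<longleftrightarrow> D \<subseteq> S" using partition_onD_block[OF P S v(1)] cd by blast
   then have "sgn (sum k S) = 0" using sk[OF SI] z[OF SI] RS by simp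
   then show "sum k S = 0" by (simp add: sgn_zero_iff)
  qed
  fix E assume E: "E \<subseteq> \<Union>P" "sum k E = 0"
  then have EI: "E \<subseteq> I" using UnP by simp
  have "sgn (sum k E) = 0" using E by simp
  then have "Redn ?Q E = {}" "C \<subseteq> E \<longleftrightarrow> D \<subseteq> E" using sk[OF EI] z[OF EI] by (auto simp: sgn_zero_iff split: if_splits)
  note QE = this
  show "Redn P E = {}" unfolding Redn_empty_iff
  proof
   fix i assume "i \<in> E"
   then obtain B where B: "B \<in> ?Q" "i \<in> B" "B \<subseteq> E" using QE(1) unfolding Redn_empty_iff by blast
   show "\<exists>B\<in>P. i \<in> B \<and> B \<subseteq> E"
   proof (cases "B = C \<or> B = D")
    case True
    then have "i \<in> C \<union> D \<and> C \<union> D \<subseteq> E" using B QE(2) by auto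
    then show ?thesis using v(1) by blast
   next
    case False
    then have "B \<in> P" using B(1) by (auto simp: cut_target_def)
    then show ?thesis using B by blast
   qed
  qed
 qed
 have s: "(if Redn P S = Redn P (fst (C, D)) then 1
   else if Redn P S = Redn P (snd (C, D)) then -1
   else if Redn (cut_target P (C, D)) S \<noteq> {} then face_sign X S
   else 0) = sgn (sum k S)" if S: "S \<subseteq> I" for S
 proof -
  have V': "valid_cut P (D, C)" using V valid_cut_swap by auto
  note r1 = Redn_cut_iff[OF P V S] and r2 = Redn_cut_iff[OF P V' S, unfolded cut_target_swap]
  show ?thesis using r1 r2 sk[OF S] z[OF S] h(2)[OF S] by auto
 qed
 show "face_cut P (C, D) X \<in> faces P" "E \<subseteq> I ==> face_sign (face_cut P (C, D) X) E =
   (if face_sign X E \<noteq> 0 then face_sign X E else of_bool (C \<subseteq> E) - of_bool (D \<subseteq> E))"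
  unfolding face_cut_def UnP using facesI[OF I P g s] sk h(2) s by (auto simp: sgn_zero_iff)
qed

lemma face_cut_swap:
 assumes "finite I" "partition_on I P" "valid_cut P (C, D)" "X \<in> faces (cut_target P (C, D))"
 shows "face_cut P (D, C) X \<in> faces P" "E \<subseteq> I ==> face_sign (face_cut P (D, C) X) E =
   (if face_sign X E \<noteq> 0 then face_sign X E else of_bool (D \<subseteq> E) - of_bool (C \<subseteq> E))"
 using face_cut[OF assms(1,2), of D C X] assms(3,4) unfolding cut_target_swap[of P D C] valid_cut_swap[of P D C] by auto

lemma partition_on_insert_block:
 assumes "partition_on C R" "D \<noteq> {}" "C \<inter> D = {}"
 shows "partition_on (C \<union> D) (insert D R)"
proof -
 have "\<Union>R = C" using assms by (auto simp: partition_on_def)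
 then have "B \<inter> D = {}" if "B \<in> R" for B using that assms(3) by blast
 then have "disjnt B D" "disjnt D B" if "B \<in> R" for B using that by (auto simp: disjnt_def)
 moreover have "disjnt A B" if "A \<in> R" "B \<in> R" "A \<noteq> B" for A B
  using assms(1) that unfolding partition_on_def disjoint_def disjnt_def by simp
 moreover have "\<Union> (insert D R) = C \<union> D" using assms(1) by (auto simp: partition_on_def)
 moreover have "{} \<notin> insert D R" using assms(1,2) by (auto simp: partition_on_def)
 ultimately show ?thesis by (intro partition_onI) auto
qed

text \<open>The witness is \<open>h + \<epsilon> g\<close> with \<open>h\<close> generic for
  \<open>{D}\<close> and \<open>g\<close> generic for \<open>R\<close>. Its sum over
  \<open>E\<close> has sign zero only if both parts do, that is, if both pieces of \<open>E\<close>
  are unions of blocks.\<close>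

lemma face_glue:
 assumes fin: "finite C" "finite D" and R: "partition_on C R" and D: "D \<noteq> {}" "C \<inter> D = {}"
  and z: "z \<in> faces {D}" and X: "X \<in> faces R"
 shows "face_glue D z C X \<in> faces (insert D R)" "E \<subseteq> C \<union> D ==> face_sign (face_glue D z C X) E =
   (if face_sign z (E \<inter> D) \<noteq> 0 then face_sign z (E \<inter> D) else face_sign X (E \<inter> C))"
proof -
 have pD: "partition_on D {D}" using D by (auto simp: partition_on_def)
 have CD: "finite (C \<union> D)" using fin by simp
 note pCD = partition_on_insert_block[OF R D]
 obtain h where h: "generic {D} h" "!!E. E \<subseteq> D ==> face_sign z E = sgn (sum h E)" by (rule facesE[OF fin(2) pD z]) (rule that)
 obtain g where g: "generic R g" "!!E. E \<subseteq> C ==> face_sign X E = sgn (sum g E)" by (rule facesE[OF fin(1) R X]) (rule that)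
 have h0: "h i = 0" if "i \<notin> D" for i using TspaceD(1)[of h "{D}"] h(1) that by (auto simp: generic_def)
 have g0: "g i = 0" if "i \<notin> C" for i using TspaceD(1)[of g R] g(1) that UnP[OF fin(1) R] by (auto simp: generic_def)
 have sh: "sum h E = sum h (E \<inter> D)" "sum g E = sum g (E \<inter> C)" if "E \<subseteq> C \<union> D" for E
  using finite_subset[OF that CD] h0 g0 by (auto intro!: sum.mono_neutral_right)
 obtain \<epsilon> where e: "\<epsilon> > 0" "!!E. E \<subseteq> C \<union> D ==> sum (\<lambda>i. h i + \<epsilon> * g i) E = sum h E + \<epsilon> * sum g E"
  "!!E. E \<subseteq> C \<union> D ==> sgn (sum h E + \<epsilon> * sum g E) = (if sum h E \<noteq> 0 then sgn (sum h E) else sgn (sum g E))"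
  by (rule sgn_perturb[OF CD, of h g]) (rule that)
 define k where "k = (\<lambda>i. h i + \<epsilon> * g i)"
 have sk: "sgn (sum k E) = (if sum h (E \<inter> D) \<noteq> 0 then sgn (sum h (E \<inter> D)) else sgn (sum g (E \<inter> C)))"
  if "E \<subseteq> C \<union> D" for E using e(2,3)[OF that] sh[OF that] by (auto simp: k_def)
 have gen: "generic (insert D R) k" unfolding generic_def
 proof (intro conjI allI impI)
  show "k \<in> Tspace (insert D R)"
  proof (rule TspaceI)
   show "finite (\<Union>(insert D R))" using fin UnP[OF fin(1) R] by simp
   show "!!i. i \<notin> \<Union>(insert D R) ==> k i = 0" using h0 g0 UnP[OF fin(1) R] by (auto simp: k_def)
   fix S assume S: "S \<in> insert D R"
   then have SC: "S \<subseteq> C \<union> D" using UnP[OF fin(1) R] by auto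
   have "sum h (S \<inter> D) = 0 \<and> sum g (S \<inter> C) = 0"
   proof (cases "S = D")
    case True
    have "S \<inter> C = {}" using True D by auto
    then show ?thesis using True TspaceD(2)[of h "{D}" D] h(1) by (auto simp: generic_def)
   next
    case False
    then have "S \<in> R" using S by simp
    moreover have "S \<inter> D = {}" "S \<inter> C = S" using \<open>S \<in> R\<close> UnP[OF fin(1) R] D(2) by auto
    ultimately show ?thesis using TspaceD(2)[of g R S] g(1) by (auto simp: generic_def)
   qed
   then have "sgn (sum k S) = 0" using sk[OF SC] by simp
   then show "sum k S = 0" by (simp add: sgn_zero_iff)
  qed
  fix E assume E: "E \<subseteq> \<Union>(insert D R)" "sum k E = 0"
  then have EI: "E \<subseteq> C \<union> D" using UnP[OF fin(1) R] by auto
  have "sgn (sum k E) = 0" using E by simp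
  then have "sum h (E \<inter> D) = 0" "sum g (E \<inter> C) = 0" using sk[OF EI] by (auto simp: sgn_zero_iff split: if_splits)
  then have "Redn {D} (E \<inter> D) = {}" "Redn R (E \<inter> C) = {}"
   using generic_zero[OF fin(2) pD h(1), of "E \<inter> D"] generic_zero[OF fin(1) R g(1), of "E \<inter> C"] by auto
  then show "Redn (insert D R) E = {}" using EI unfolding Redn_empty_iff by fastforce
 qed
 have s: "(if face_sign z (E \<inter> D) \<noteq> 0 then face_sign z (E \<inter> D) else face_sign X (E \<inter> C)) = sgn (sum k E)"
  if "E \<subseteq> C \<union> D" for E using sk[OF that] h(2)[of "E \<inter> D"] g(2)[of "E \<inter> C"] by (auto simp: sgn_zero_iff)
 show "face_glue D z C X \<in> faces (insert D R)" "E \<subseteq> C \<union> D ==> face_sign (face_glue D z C X) E =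
   (if face_sign z (E \<inter> D) \<noteq> 0 then face_sign z (E \<inter> D) else face_sign X (E \<inter> C))"
  unfolding face_glue_def using facesI[OF CD pCD gen s] by auto
qed

text \<open>A subset of \<open>D\<close> misses \<open>C\<close>, and a subset of a block of
  \<open>R\<close> misses \<open>D\<close>, so in either case the tie-breaking rule collapses to the
  sign of a single one of the two faces.\<close>

lemma face_glue_restrict:
 assumes "finite C" "finite D" "partition_on C R" "D \<noteq> {}" "C \<inter> D = {}" "z \<in> faces {D}" "X \<in> faces R"
 shows "face_restrict (face_glue D z C X) D = z"
  and "B \<in> R ==> face_restrict (face_glue D z C X) B = face_restrict X B"
proof -
 have pD: "partition_on D {D}" using assms by (auto simp: partition_on_def)
 note g = face_glue[OF assms] and p = partition_on_insert_block[OF assms(3-5)]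
 have CD: "finite (C \<union> D)" using assms by simp
 show "face_restrict (face_glue D z C X) D = z"
 proof (rule face_restrict_eqI[OF CD p _ g(1) assms(6)])
  fix E assume E: "E \<subseteq> D"
  then have "E \<inter> D = E" "E \<inter> C = {}" "E \<subseteq> C \<union> D" using assms(5) by auto
  then show "face_sign (face_glue D z C X) E = face_sign z E" using g(2)[of E] face_sign_empty[OF assms(1,3,7)] by auto
 qed simp
 assume B: "B \<in> R"
 show "face_restrict (face_glue D z C X) B = face_restrict X B"
 proof (rule face_restrict_eqI[OF CD p _ g(1) face_restrict_block(1)[OF assms(1,3) B assms(7)]])
  fix E assume E: "E \<subseteq> B"
  then have "E \<inter> C = E" "E \<inter> D = {}" "E \<subseteq> C \<union> D" using assms(5) UnP[OF assms(1,3)] B by auto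
  then show "face_sign (face_glue D z C X) E = face_sign (face_restrict X B) E"
   using g(2)[of E] face_sign_empty[OF assms(2) pD assms(6)] face_restrict_block(2)[OF assms(1,3) B assms(7) E] by auto
 qed (use B in simp)
qed

text \<open>The blocks are glued on one at a time. The resulting face may depend on the order, but
  its restrictions to the blocks do not.\<close>

lemma exists_face_glue:
 assumes "finite I" "partition_on I P" "!!S. S \<in> P ==> y S \<in> faces {S}"
 shows "\<exists>X\<in>faces P. \<forall>S\<in>P. face_restrict X S = y S"
proof -
 have "finite P" using partition_on_finite assms(1,2) by blast
 then show ?thesis using assms
 proof (induction P arbitrary: I rule: finite_induct)
  case empty
  then have "I = {}" by (auto simp: partition_on_def)
  have "generic {} (\<lambda>_. 0)" by (auto simp: generic_def Tspace_def vfree_carrier Redn_def)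
  then show ?case using faces_iff[OF empty.prems(1,2)] by auto
 next
  case (insert D P)
  have D: "D \<noteq> {}" "D \<inter> \<Union>P = {}" and I: "I = \<Union>P \<union> D" using insert.prems(2) insert.hyps(2) by (auto simp: partition_on_def disjoint_def)
  have P: "partition_on (\<Union>P) P" using insert.prems(2) by (auto simp: partition_on_def disjoint_def)
  have fin: "finite (\<Union>P)" "finite D" using insert.prems(1) I by auto
  obtain X where X: "X \<in> faces P" "\<forall>S\<in>P. face_restrict X S = y S" using insert.IH[OF fin(1) P] insert.prems(3) by blast
  have D': "\<Union>P \<inter> D = {}" using D(2) by blast
  have z: "y D \<in> faces {D}" using insert.prems(3) by simp
  note g = face_glue(1)[OF fin P D(1) D' z X(1)] face_glue_restrict[OF fin P D(1) D' z X(1)]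
  show ?case using g X(2) by (intro bexI[of _ "face_glue D (y D) (\<Union>P) X"]) auto
 qed
qed

section \<open>Transport of faces along an injection\<close>

definition push :: "'a set => ('a => 'b) => ('a => real) => 'b => real" where
 "push I \<sigma> h = (\<lambda>j. if j \<in> \<sigma> ` I then h (inv_into I \<sigma> j) else 0)"

lemma Redn_image:
 assumes "inj_on \<sigma> I" "partition_on I P" "E \<subseteq> I"
 shows "Redn ((`) \<sigma> ` P) (\<sigma> ` E) = {} \<longleftrightarrow> Redn P E = {}"
proof -
 have PI: "B \<subseteq> I" if "B \<in> P" for B using assms(2) that by (auto simp: partition_on_def)
 have "\<sigma> i \<in> \<sigma> ` B \<longleftrightarrow> i \<in> B" if "i \<in> E" "B \<in> P" for i B using inj_on_image_mem_iff[OF assms(1)] that PI assms(3) by blast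
 moreover have "\<sigma> ` B \<subseteq> \<sigma> ` E \<longleftrightarrow> B \<subseteq> E" if B: "B \<in> P" for B
 proof
  assume a: "\<sigma> ` B \<subseteq> \<sigma> ` E"
  show "B \<subseteq> E"
  proof
   fix i assume "i \<in> B"
   then have "\<sigma> i \<in> \<sigma> ` E" "i \<in> I" using a PI[OF B] by auto
   then show "i \<in> E" using inj_on_image_mem_iff[OF assms(1)] assms(3) by simp
  qed
 qed auto
 ultimately show ?thesis unfolding Redn_empty_iff by auto
qed

lemma partition_on_image: "inj_on \<sigma> I ==> partition_on I P ==> partition_on (\<sigma> ` I) ((`) \<sigma> ` P)"
proof (rule partition_onI)
 assume \<sigma>: "inj_on \<sigma> I" and P: "partition_on I P"
 show "\<Union> ((`) \<sigma> ` P) = \<sigma> ` I" using P by (auto simp: partition_on_def)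
 fix p q assume "p \<in> (`) \<sigma> ` P" "q \<in> (`) \<sigma> ` P" "p \<noteq> q"
 then obtain A B where AB: "A \<in> P" "B \<in> P" "p = \<sigma> ` A" "q = \<sigma> ` B" "A \<noteq> B" by blast
 then have "A \<inter> B = {}" "A \<subseteq> I" "B \<subseteq> I" using P by (auto simp: partition_on_def disjoint_def)
 then show "disjnt p q" using AB inj_on_image_Int[OF \<sigma>, of A B] by (simp add: disjnt_def)
next
 assume "partition_on I P" then show "{} \<notin> (`) \<sigma> ` P" by (auto simp: partition_on_def)
qed

text \<open>The relabelled face is the cell of the relabelled generic point, because sums over
  \<open>E\<close> become sums over its image and every subset of the image of \<open>I\<close>
  arises in this way.\<close>

lemma face_map:
 assumes I: "finite I" and P: "partition_on I P" and \<sigma>: "inj_on \<sigma> I" and X: "X \<in> faces P"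
 shows "face_map I \<sigma> X \<in> faces ((`) \<sigma> ` P)" "E \<subseteq> I ==> face_sign (face_map I \<sigma> X) (\<sigma> ` E) = face_sign X E"
proof -
 have fin: "finite (\<sigma> ` I)" using I by simp
 note Q = partition_on_image[OF \<sigma> P] and UnP = UnP[OF I P]
 obtain h where h: "generic P h" "X = cell I h" "!!E. E \<subseteq> I ==> face_sign X E = sgn (sum h E)" by (rule facesE[OF I P X]) (rule that)
 have sp: "sum (push I \<sigma> k) (\<sigma> ` E) = sum k E" if "E \<subseteq> I" for k E unfolding push_def using that inj_on_subset[OF \<sigma> that]
  by (subst sum.reindex) (auto intro!: sum.cong simp: inv_into_f_f[OF \<sigma>] subset_iff)
 have psub: "\<exists>E\<subseteq>I. F = \<sigma> ` E" if "F \<subseteq> \<sigma> ` I" for F using that by (auto simp: subset_image_iff)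
 have tp: "push I \<sigma> k \<in> Tspace {\<sigma> ` I}" if "k \<in> Tspace {I}" for k
  by (rule TspaceI) (use fin sp[of I k] TspaceD(2)[OF that] in \<open>auto simp: push_def\<close>)
 have im: "face_map I \<sigma> X = cell (\<sigma> ` I) (push I \<sigma> h)"
 proof -
  have "push I \<sigma> ` cell I h = cell (\<sigma> ` I) (push I \<sigma> h)"
  proof (rule Set.set_eqI, rule iffI)
   fix g assume "g \<in> push I \<sigma> ` cell I h"
   then obtain k where k: "k \<in> Tspace {I}" "!!E. E \<subseteq> I ==> sgn (sum k E) = sgn (sum h E)" "g = push I \<sigma> k" by (auto simp: cell_def)
   show "g \<in> cell (\<sigma> ` I) (push I \<sigma> h)" unfolding cell_def
   proof (rule CollectI, intro conjI allI impI)
    show "g \<in> Tspace {\<sigma> ` I}" using tp[OF k(1)] k(3) by simp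
    fix F assume "F \<subseteq> \<sigma> ` I"
    then obtain E where E: "E \<subseteq> I" "F = \<sigma> ` E" using psub by blast
    show "sgn (sum g F) = sgn (sum (push I \<sigma> h) F)" unfolding E(2) k(3) sp[OF E(1)] by (rule k(2)[OF E(1)])
   qed
  next
   fix g assume g: "g \<in> cell (\<sigma> ` I) (push I \<sigma> h)"
   define k where "k = (\<lambda>i. if i \<in> I then g (\<sigma> i) else 0)"
   have gT: "g \<in> Tspace {\<sigma> ` I}" using g by (simp add: cell_def)
   have gk: "g = push I \<sigma> k"
   proof
    fix j
    show "g j = push I \<sigma> k j" using TspaceD(1)[OF gT, of j] by (auto simp: push_def k_def inv_into_f_f[OF \<sigma>])
   qed
   have "k \<in> Tspace {I}" by (rule TspaceI) (use I sp[of I k] TspaceD(2)[OF gT] gk in \<open>auto simp: k_def\<close>)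
   moreover have "sgn (sum k E) = sgn (sum h E)" if "E \<subseteq> I" for E
   proof -
    have "sgn (sum g (\<sigma> ` E)) = sgn (sum (push I \<sigma> h) (\<sigma> ` E))" using g image_mono[OF that, of \<sigma>] unfolding cell_def by blast
    then show ?thesis unfolding gk sp[OF that] .
   qed
   ultimately have "k \<in> cell I h" by (simp add: cell_def)
   then show "g \<in> push I \<sigma> ` cell I h" using gk by blast
  qed
  then show ?thesis using h(2) by (simp add: face_map_def push_def[abs_def])
 qed
 have g: "generic ((`) \<sigma> ` P) (push I \<sigma> h)" unfolding generic_def
 proof (intro conjI allI impI)
  show "push I \<sigma> h \<in> Tspace ((`) \<sigma> ` P)"
  proof (rule TspaceI)
   have U: "\<Union> ((`) \<sigma> ` P) = \<sigma> ` I" using UnP by auto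
   show "finite (\<Union> ((`) \<sigma> ` P))" using U fin by simp
   show "!!i. i \<notin> \<Union> ((`) \<sigma> ` P) ==> push I \<sigma> h i = 0" using U by (simp add: push_def)
   fix S assume "S \<in> (`) \<sigma> ` P"
   then obtain B where B: "B \<in> P" "S = \<sigma> ` B" by blast
   have "B \<subseteq> I" using B UnP by auto
   then show "sum (push I \<sigma> h) S = 0" using sp[of B h] B h(1) TspaceD(2)[of h P B] by (auto simp: generic_def)
  qed
  fix F assume F: "F \<subseteq> \<Union> ((`) \<sigma> ` P)" "sum (push I \<sigma> h) F = 0"
  have "\<Union> ((`) \<sigma> ` P) = \<sigma> ` I" using UnP by auto
  then obtain E where E: "E \<subseteq> I" "F = \<sigma> ` E" using psub[of F] F(1) by metis
  show "Redn ((`) \<sigma> ` P) F = {}" using F(2) E(2) sp[OF E(1)] generic_zero[OF I P h(1) E(1)] Redn_image[OF \<sigma> P E(1)] by simp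
 qed
 show "face_map I \<sigma> X \<in> faces ((`) \<sigma> ` P)" using im g faces_iff[OF fin Q] by blast
 assume E: "E \<subseteq> I"
 show "face_sign (face_map I \<sigma> X) (\<sigma> ` E) = face_sign X E"
  unfolding im using face_sign_cell[OF fin Q generic_Tspace[OF fin Q g], of "\<sigma> ` E"] sp[OF E] h(3)[OF E] E by auto
qed

section \<open>Semisimple functionals\<close>

definition local_on :: "'a set set => ('a face => 'k::field) => bool" where
 "local_on P F \<longleftrightarrow> F \<in> vcarrier (Lvee_dual P) \<and> (\<forall>X\<in>faces P. \<forall>Y\<in>faces P. (\<forall>S\<in>P. face_restrict X S = face_restrict Y S) \<longrightarrow> F X = F Y)"

definition prod_fun :: "'a set set => ('a set => 'a face => 'k::field) => 'a face => 'k" where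
 "prod_fun P g = (\<lambda>X. if X \<in> faces P then \<Prod>S\<in>P. g S (face_restrict X S) else 0)"

text \<open>Common ground of \<open>Lvee_dual\<close> and \<open>gamma_dual\<close>, which share
  their operations and differ in the carrier. The external product is needed for both.\<close>

definition pointwise :: "('k::field, 'x => 'k) vspace => bool" where
 "pointwise V \<longleftrightarrow> vs V \<and> vadd V = (\<lambda>u v x. u x + v x) \<and> vscale V = (\<lambda>c v x. c * v x)"

lemma Lvee_dual_simps [simp]: "vadd (Lvee_dual P) = (\<lambda>u v x. u x + v x)"
 "vscale (Lvee_dual P) = (\<lambda>c v x. c * v x)" "vzero (Lvee_dual P) = (\<lambda>_. 0)" by (auto simp: Lvee_dual_def)

lemma Lvee_dual_carrier: "f \<in> vcarrier (Lvee_dual P) \<longleftrightarrow> (\<forall>X. X \<notin> faces P \<longrightarrow> f X = 0)" by (auto simp: Lvee_dual_def)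

lemma vs_Lvee_dual [simp]: "vs (Lvee_dual P)" unfolding vs_def by (auto simp: Lvee_dual_carrier algebra_simps)

lemma pointwise_Lvee_dual: "pointwise (Lvee_dual P)" by (simp add: pointwise_def)

lemma vsum_Lvee_dual: "finite A ==> (!!a. a \<in> A ==> f a \<in> vcarrier (Lvee_dual P)) ==> vsum (Lvee_dual P) f A = (\<lambda>X. \<Sum>a\<in>A. f a X)"
proof (induction A rule: finite_induct)
 case (insert a A)
 then have "vsum (Lvee_dual P) f (insert a A) = vadd (Lvee_dual P) (f a) (vsum (Lvee_dual P) f A)" by (intro vsum_insert) auto
 then show ?case using insert by simp
qed simp

lemma prod_fun_upd:
 assumes "finite P" "S \<in> P" "X \<in> faces P"
 shows "prod_fun P (g(S := a)) X = a (face_restrict X S) * (\<Prod>T\<in>P - {S}. g T (face_restrict X T))"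
proof -
 have "prod_fun P (g(S := a)) X = (\<Prod>T\<in>P. (g(S := a)) T (face_restrict X T))" using assms by (simp add: prod_fun_def)
 also have "\<dots> = a (face_restrict X S) * (\<Prod>T\<in>P - {S}. (g(S := a)) T (face_restrict X T))" by (subst prod.remove[OF assms(1,2)]) simp
 also have "(\<Prod>T\<in>P - {S}. (g(S := a)) T (face_restrict X T)) = (\<Prod>T\<in>P - {S}. g T (face_restrict X T))" by (rule prod.cong) auto
 finally show ?thesis .
qed

lemma prod_fun_mlin:
 assumes "finite P" "!!S. S \<in> P ==> pointwise (V S)"
 shows "mlin P V (Lvee_dual P) (prod_fun P)" unfolding mlin_def
proof (intro ballI conjI allI)
 fix x
 show "prod_fun P x \<in> vcarrier (Lvee_dual P)" by (simp add: Lvee_dual_carrier prod_fun_def)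
next
 fix x S u w assume S: "S \<in> P"
 show "prod_fun P (x(S := vadd (V S) u w)) = vadd (Lvee_dual P) (prod_fun P (x(S := u))) (prod_fun P (x(S := w)))"
 proof
  fix X
  show "prod_fun P (x(S := vadd (V S) u w)) X = vadd (Lvee_dual P) (prod_fun P (x(S := u))) (prod_fun P (x(S := w))) X"
  proof (cases "X \<in> faces P")
   case True
   then show ?thesis using assms(2)[OF S] by (simp add: prod_fun_upd[OF assms(1) S] pointwise_def algebra_simps)
  qed (simp add: prod_fun_def)
 qed
next
 fix x S c u assume S: "S \<in> P"
 show "prod_fun P (x(S := vscale (V S) c u)) = vscale (Lvee_dual P) c (prod_fun P (x(S := u)))"
 proof
  fix X
  show "prod_fun P (x(S := vscale (V S) c u)) X = vscale (Lvee_dual P) c (prod_fun P (x(S := u))) X"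
  proof (cases "X \<in> faces P")
   case True
   then show ?thesis using assms(2)[OF S] by (simp add: prod_fun_upd[OF assms(1) S] pointwise_def algebra_simps)
  qed (simp add: prod_fun_def)
 qed
qed

lemma ext_prod_works:
 assumes "finite P" "!!S. S \<in> P ==> pointwise (V S)"
 shows "vlinear (tensor P V) (Lvee_dual P) (ext_prod P V)" "x \<in> fams P V ==> ext_prod P V (pure P V x) = prod_fun P x"
proof -
 have vsV: "!!S. S \<in> P ==> vs (V S)" using assms(2) by (auto simp: pointwise_def)
 note vsT = vs_tensor[of P V, OF vsV] and pin = pure_in[of P V, OF vsV]
 obtain G where G: "vlinear (tensor P V) (Lvee_dual P) G" "!!x. x \<in> fams P V ==> G (pure P V x) = prod_fun P x"
  using tensor_lift[of P V, OF vsV vs_Lvee_dual prod_fun_mlin[OF assms]] by blast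
 have e: "ext_prod P V = restrict G (vcarrier (tensor P V))" unfolding ext_prod_def
  by (rule linext_eq[OF vsT vs_Lvee_dual G(1)]) (use pin G(2) tensor_span[of P V, OF vsV] in \<open>auto simp: prod_fun_def\<close>)
 show "vlinear (tensor P V) (Lvee_dual P) (ext_prod P V)" using G(1) vlinear_restrict[OF vsT, of "Lvee_dual P" G] by (simp add: e)
 show "x \<in> fams P V ==> ext_prod P V (pure P V x) = prod_fun P x" unfolding e using G(2) pin by simp
qed

lemma local_on_prod_fun: "local_on P (prod_fun P g)" unfolding local_on_def Lvee_dual_carrier by (simp add: prod_fun_def)

lemma local_onI: "(!!X. X \<notin> faces P ==> F X = 0) ==> (!!X Y. X \<in> faces P ==> Y \<in> faces P ==>
  (!!S. S \<in> P ==> face_restrict X S = face_restrict Y S) ==> F X = F Y) ==> local_on P F" unfolding local_on_def Lvee_dual_carrier by blast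

lemma local_onD:
 assumes "local_on P F"
 shows "X \<notin> faces P ==> F X = 0" "X \<in> faces P ==> Y \<in> faces P ==> (!!S. S \<in> P ==> face_restrict X S = face_restrict Y S) ==> F X = F Y"
 using assms unfolding local_on_def Lvee_dual_carrier by blast+

lemma local_on_add: "local_on P F ==> local_on P G ==> local_on P (\<lambda>X. F X + G X)"
proof (rule local_onI)
 fix X Y assume a: "local_on P F" "local_on P G" "X \<in> faces P" "Y \<in> faces P" "!!S. S \<in> P ==> face_restrict X S = face_restrict Y S"
 then show "F X + G X = F Y + G Y" using local_onD(2)[OF a(1) a(3-5)] local_onD(2)[OF a(2) a(3-5)] by simp
qed (simp add: local_onD(1))

lemma local_on_scale: "local_on P F ==> local_on P (\<lambda>X. c * F X)"
proof (rule local_onI)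
 fix X Y assume a: "local_on P F" "X \<in> faces P" "Y \<in> faces P" "!!S. S \<in> P ==> face_restrict X S = face_restrict Y S"
 then show "c * F X = c * F Y" using local_onD(2)[OF a(1) a(2-4)] by simp
qed (simp add: local_onD(1))

lemma local_on_zero: "local_on P (\<lambda>_. 0)" by (rule local_onI) auto

text \<open>A chosen face with prescribed restrictions. A local functional takes the same value at
  every such face, so for it the choice is immaterial.\<close>

definition glue_all :: "'a set set => ('a set => 'a face) => 'a face" where
 "glue_all P y = (SOME X. X \<in> faces P \<and> (\<forall>S\<in>P. face_restrict X S = y S))"

lemma glue_all:
 assumes "finite I" "partition_on I P" "!!S. S \<in> P ==> y S \<in> faces {S}"
 shows "glue_all P y \<in> faces P" "S \<in> P ==> face_restrict (glue_all P y) S = y S"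
 using someI_ex[of "\<lambda>X. X \<in> faces P \<and> (\<forall>S\<in>P. face_restrict X S = y S)"] exists_face_glue[of I P y, OF assms]
 unfolding glue_all_def by blast+

lemma finite_face_families:
 assumes "finite I" "partition_on I P"
 shows "finite (\<Pi>\<^sub>E S\<in>P. faces {S})" by (rule finite_PiE[OF partition_on_finite[OF assms]])
  (use finite_faces partition_block_finite[OF assms] partition_on_block[OF assms(2)] in blast)

text \<open>External products of pure tensors are local, and locality is a linear condition.
  Conversely a local functional is the finite sum, over all families \<open>y\<close> of faces of
  the blocks, of its value at a face glued from \<open>y\<close> times the product of the delta
  functions at the \<open>y S\<close>.\<close>

lemma semisimple_iff:
 fixes F :: "'a face => 'k::field"
 assumes I: "finite I" and P: "partition_on I P"
 shows "semisimple P F \<longleftrightarrow> local_on P F"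
proof -
 let ?V = "\<lambda>S. Lvee_dual {S} :: ('k, 'a face => 'k) vspace"
 have fP: "finite P" using partition_on_finite[OF I P] .
 note ext = ext_prod_works[of P ?V, OF fP pointwise_Lvee_dual]
 note vsT = vs_tensor[of P ?V, OF vs_Lvee_dual] and pin = pure_in[of P ?V, OF vs_Lvee_dual]
 have sub: "pure P ?V ` (fams P ?V) \<subseteq> vcarrier (tensor P ?V)" by (rule image_subsetI) (rule pin)
 show ?thesis
 proof
  assume "semisimple P F"
  then obtain u where u: "u \<in> vcarrier (tensor P ?V)" "F = ext_prod P ?V u" unfolding semisimple_def by blast
  have "u \<in> vspan (tensor P ?V) (pure P ?V ` (fams P ?V))" using u(1) tensor_span[of P ?V, OF vs_Lvee_dual] by blast
  then have "local_on P (ext_prod P ?V u)"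
  proof induction
   case zero
   then show ?case using vlinear_zero[OF vsT vs_Lvee_dual ext(1)] local_on_zero by simp
  next
   case (base x) then show ?case using ext(2) local_on_prod_fun by (metis (no_types, lifting) imageE)
  next
   case (add u v)
   then show ?case using vlinearD(2)[OF ext(1)] vspan_closed[OF vsT sub] local_on_add by simp
  next
   case (scale v c)
   then show ?case using vlinearD(3)[OF ext(1)] vspan_closed[OF vsT sub] local_on_scale by simp
  qed
  then show "local_on P F" using u(2) by simp
 next
  assume loc: "local_on P F"
  define Y where "Y = (\<Pi>\<^sub>E S\<in>P. faces {S})"
  have fY: "finite Y" unfolding Y_def by (rule finite_face_families[OF I P])
  \<comment> \<open>One delta function for each block, so that the external product of
    \<open>b y\<close> is the indicator of the faces whose restrictions are
    \<open>y\<close>.\<close>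
  define b where "b y = (\<lambda>S\<in>P. vbasis (y S) :: 'a face => 'k)" for y
  have bin: "b y \<in> fams P ?V" if "y \<in> Y" for y using that by (auto simp: b_def Y_def Lvee_dual_carrier vbasis_def PiE_iff)
  define u where "u = vsum (tensor P ?V) (\<lambda>y. vscale (tensor P ?V) (F (glue_all P y)) (pure P ?V (b y))) Y"
  have tin: "(\<lambda>y. vscale (tensor P ?V) (F (glue_all P y)) (pure P ?V (b y))) \<in> Y \<rightarrow> vcarrier (tensor P ?V)" using bin pin vsT by auto
  have "u \<in> vcarrier (tensor P ?V)" unfolding u_def by (rule vsum_closed[OF vsT tin])
  moreover have "ext_prod P ?V u = F"
  proof
   fix X
   have "ext_prod P ?V u = vsum (Lvee_dual P) (\<lambda>y. ext_prod P ?V (vscale (tensor P ?V) (F (glue_all P y)) (pure P ?V (b y)))) Y"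
    unfolding u_def by (rule vlinear_vsum[OF vsT vs_Lvee_dual ext(1) fY tin])
   also have "\<dots> = (\<lambda>X. \<Sum>y\<in>Y. ext_prod P ?V (vscale (tensor P ?V) (F (glue_all P y)) (pure P ?V (b y))) X)"
    using tin vlinearD(1)[OF ext(1)] by (intro vsum_Lvee_dual fY) auto
   finally have "ext_prod P ?V u X = (\<Sum>y\<in>Y. ext_prod P ?V (vscale (tensor P ?V) (F (glue_all P y)) (pure P ?V (b y))) X)"
    by (rule fun_cong)
   also have "\<dots> = (\<Sum>y\<in>Y. F (glue_all P y) * prod_fun P (b y) X)" by (rule sum.cong) (use vlinearD(3)[OF ext(1)] pin bin ext(2) in auto)
   also have "\<dots> = F X"
   proof (cases "X \<in> faces P")
    case False
    then show ?thesis using loc by (simp add: prod_fun_def local_on_def Lvee_dual_carrier)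
   next
    case True
    define x where "x = (\<lambda>S\<in>P. face_restrict X S)"
    have xr: "face_restrict X S \<in> faces {S}" if "S \<in> P" for S using face_restrict_block(1)[OF I P that True] .
    have xY: "x \<in> Y" unfolding x_def Y_def using xr by auto
    have pf: "prod_fun P (b y) X = (if y = x then 1 else 0)" if y: "y \<in> Y" for y
    proof (cases "y = x")
     case True
     then show ?thesis using \<open>X \<in> faces P\<close> by (simp add: prod_fun_def b_def x_def vbasis_def)
    next
     case False
     then obtain S where "S \<in> P" "y S \<noteq> x S" using y xY unfolding Y_def by (meson PiE_ext)
     then have "b y S (face_restrict X S) = 0" by (simp add: b_def x_def vbasis_def)
     then have "(\<Prod>S\<in>P. b y S (face_restrict X S)) = 0" using \<open>S \<in> P\<close> by (intro prod_zero[OF fP]) blast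
     then show ?thesis using False by (simp add: prod_fun_def)
    qed
    have "(\<Sum>y\<in>Y. F (glue_all P y) * prod_fun P (b y) X) = (\<Sum>y\<in>Y. if y = x then F (glue_all P y) else 0)"
     by (rule sum.cong) (use pf in auto)
    also have "\<dots> = F (glue_all P x)" using fY xY by simp
    also have "\<dots> = F X"
    proof -
     have xS: "!!S. S \<in> P ==> x S \<in> faces {S}" using xr by (simp add: x_def)
     note g = glue_all[of I P x, OF I P xS]
     show ?thesis
     proof (rule local_onD(2)[OF loc _ True])
      show "glue_all P x \<in> faces P" by (rule g(1))
      fix S assume "S \<in> P"
      then show "face_restrict (glue_all P x) S = face_restrict X S" using g(2)[of S] by (simp add: x_def)
     qed
    qed
    finally show ?thesis .
   qed
   finally show "ext_prod P ?V u X = F X" .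
  qed
  ultimately show "semisimple P F" unfolding semisimple_def by blast
 qed
qed

section \<open>Layered forests as sequences of cuts\<close>

fun valid_cuts :: "'a set set => ('a set \<times> 'a set) list => bool" where
 "valid_cuts P [] = True"
| "valid_cuts P (V # Vs) \<longleftrightarrow> valid_cut P V \<and> valid_cuts (cut_target P V) Vs"

fun cuts_target :: "'a set set => ('a set \<times> 'a set) list => 'a set set" where
 "cuts_target P [] = P"
| "cuts_target P (V # Vs) = cuts_target (cut_target P V) Vs"

text \<open>Renumbering of the nodes. Removing the node of rank 0 lowers all other ranks by one, and
  \<open>rank_map Suc\<close> undoes this.\<close>

fun rank_map :: "(nat => nat) => 'b ltree => 'b ltree" where
 "rank_map f (Leaf b) = Leaf b"
| "rank_map f (Node n l r) = Node (f n) (rank_map f l) (rank_map f r)"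

lemma rank_map_simps [simp]: "leaves (rank_map f t) = leaves t" "ranks (rank_map f t) = map f (ranks t)" by (induction t) auto

lemma node_cuts_rank_map [simp]: "node_cuts (rank_map f t) = map_prod f id ` node_cuts t" by (induction t) (auto simp: image_Un)

lemma heap_ordered_rank_map [simp]: "heap_ordered (rank_map Suc t) = heap_ordered t" by (induction t) auto

lemma rank_map_pred: "0 \<notin> set (ranks t) ==> rank_map Suc (rank_map (\<lambda>n. n - 1) t) = t" by (induction t) auto

text \<open>\<open>F\<close> is the forest that starts with the cut \<open>[C, D]\<close> and
  continues with \<open>F'\<close>: the trees of \<open>F'\<close> over \<open>C\<close> and
  \<open>D\<close> are joined at a new root of rank 0, and all old ranks go up by one.\<close>

definition forest_step ::
 "'a set set => 'a set => 'a set => ('a set => 'a set ltree) => ('a set => 'a set ltree) => bool" where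
 "forest_step P C D F F' \<longleftrightarrow> F (C \<union> D) = Node 0 (rank_map Suc (F' C)) (rank_map Suc (F' D)) \<and> (\<forall>S\<in>P - {C \<union> D}. F S = rank_map Suc (F' S))"

lemma cut_parts:
 assumes "partition_on I P" "valid_cut P (C, D)"
 shows "cut_target P (C, D) = insert C (insert D (P - {C \<union> D}))" "P = insert (C \<union> D) (P - {C \<union> D})"
  "C \<notin> P" "D \<notin> P" "C \<noteq> D" "C \<union> D \<in> P" "C \<inter> D = {}" "C \<noteq> {}" "D \<noteq> {}"
proof -
 have v: "C \<union> D \<in> P" "C \<inter> D = {}" "C \<noteq> {}" "D \<noteq> {}" using assms(2) by (auto simp: valid_cut_def)
 show "cut_target P (C, D) = insert C (insert D (P - {C \<union> D}))" by (simp add: cut_target_def)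
 show "P = insert (C \<union> D) (P - {C \<union> D})" using v(1) by auto
 show "C \<notin> P" using partition_onD_block[OF assms(1) _ v(1)] v by blast
 show "D \<notin> P" using partition_onD_block[OF assms(1) _ v(1)] v by blast
 show "C \<noteq> D" using v by auto
 show "C \<union> D \<in> P" "C \<inter> D = {}" "C \<noteq> {}" "D \<noteq> {}" using v by auto
qed

context
 fixes I :: "'a set" and P C D and F F' :: "'a set => 'a set ltree"
 assumes I: "finite I" and P: "partition_on I P" and V: "valid_cut P (C, D)"
  and st: "forest_step P C D F F'"
begin

lemma step_size: "forest_size P F = Suc (forest_size (cut_target P (C, D)) F')"
proof -
 let ?P = "P - {C \<union> D}"
 have fin: "finite ?P" using partition_on_finite[OF I P] by simp
 note c = cut_parts[OF P V]
 have e: "(\<Sum>S\<in>?P. length (ranks (F S))) = (\<Sum>S\<in>?P. length (ranks (F' S)))" using st by (intro sum.cong) (auto simp: forest_step_def)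
 have "forest_size P F = length (ranks (F (C \<union> D))) + (\<Sum>S\<in>?P. length (ranks (F S)))"
  unfolding forest_size_def by (rule sum.remove) (use c partition_on_finite[OF I P] in auto)
 moreover have "forest_size (cut_target P (C, D)) F' = length (ranks (F' C)) + (length (ranks (F' D)) + (\<Sum>S\<in>?P. length (ranks (F' S))))"
  unfolding forest_size_def c(1) using fin c(3-5) by simp
 moreover have "length (ranks (F (C \<union> D))) = Suc (length (ranks (F' C)) + length (ranks (F' D)))" using st by (simp add: forest_step_def)
 ultimately show ?thesis using e by simp
qed

lemma step_ranks: "(\<Union>S\<in>P. set (ranks (F S))) = insert 0 (Suc ` (\<Union>S\<in>cut_target P (C, D). set (ranks (F' S))))"
proof -
 let ?P = "P - {C \<union> D}"
 note c = cut_parts[OF P V]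
 have e: "(\<Union>S\<in>?P. set (ranks (F S))) = Suc ` (\<Union>S\<in>?P. set (ranks (F' S)))" using st by (auto simp: forest_step_def)
 have "(\<Union>S\<in>P. set (ranks (F S))) = set (ranks (F (C \<union> D))) \<union> (\<Union>S\<in>?P. set (ranks (F S)))" using c(6) by blast
 then show ?thesis unfolding e c(1) using st by (auto simp: forest_step_def)
qed

lemma step_target: "forest_target P F = forest_target (cut_target P (C, D)) F'"
proof -
 let ?P = "P - {C \<union> D}"
 note c = cut_parts[OF P V]
 have e: "(\<Union>S\<in>?P. set (leaves (F S))) = (\<Union>S\<in>?P. set (leaves (F' S)))" using st by (auto simp: forest_step_def)
 have "forest_target P F = set (leaves (F (C \<union> D))) \<union> (\<Union>S\<in>?P. set (leaves (F S)))" unfolding forest_target_def using c(6) by blast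
 then show ?thesis unfolding e forest_target_def c(1) using st by (auto simp: forest_step_def)
qed

text \<open>\<open>node_cuts\<close> labels a node by the unions of the leaves below its two
  children. The two hypotheses make these unions \<open>C\<close> and \<open>D\<close> at the new
  root.\<close>

lemma step_cuts:
 assumes "partition_on C (set (leaves (F' C)))" "partition_on D (set (leaves (F' D)))"
 shows "forest_cuts P F = (C, D) # forest_cuts (cut_target P (C, D)) F'"
proof -
 let ?P = "P - {C \<union> D}"
 note c = cut_parts[OF P V]
 have U: "\<Union> (set (leaves (F' C))) = C" "\<Union> (set (leaves (F' D))) = D" using assms by (auto simp: partition_on_def)
 have nc: "(\<exists>S\<in>P. (n, W) \<in> node_cuts (F S)) \<longleftrightarrow> (n = 0 \<and> W = (C, D)) \<or>
   (\<exists>m. n = Suc m \<and> (\<exists>S\<in>cut_target P (C, D). (m, W) \<in> node_cuts (F' S)))" for n W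
 proof -
  have "(\<exists>S\<in>P. (n, W) \<in> node_cuts (F S)) \<longleftrightarrow> (n, W) \<in> node_cuts (F (C \<union> D)) \<or> (\<exists>S\<in>?P. (n, W) \<in> node_cuts (F S))" using c(6) by blast
  also have "(\<exists>S\<in>?P. (n, W) \<in> node_cuts (F S)) \<longleftrightarrow> (\<exists>S\<in>?P. \<exists>m. n = Suc m \<and> (m, W) \<in> node_cuts (F' S))"
   by (rule bex_cong[OF refl]) (use st in \<open>auto simp: forest_step_def image_iff map_prod_def split_beta split: prod.splits; force\<close>)
  also have "(n, W) \<in> node_cuts (F (C \<union> D)) \<longleftrightarrow> (n = 0 \<and> W = (C, D)) \<or>
    (\<exists>m. n = Suc m \<and> ((m, W) \<in> node_cuts (F' C) \<or> (m, W) \<in> node_cuts (F' D)))"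
   using st U by (force simp: forest_step_def map_prod_def image_iff)
  finally show ?thesis unfolding c(1) by auto
 qed
 have "forest_cuts P F = map (\<lambda>n. THE W. \<exists>S\<in>P. (n, W) \<in> node_cuts (F S)) (0 # map Suc [0..<forest_size (cut_target P (C, D)) F'])"
  unfolding forest_cuts_def step_size by (simp add: upt_conv_Cons map_Suc_upt del: upt_Suc)
 then show ?thesis unfolding nc by (simp add: forest_cuts_def)
qed

lemma step_layered:
 assumes "layered_forest (cut_target P (C, D)) F'"
 shows "layered_forest P F" unfolding layered_forest_def
proof (intro conjI ballI)
 note c = cut_parts[OF P V]
 have L: "distinct (leaves (F' S)) \<and> partition_on S (set (leaves (F' S))) \<and> heap_ordered (F' S)"
  if "S \<in> cut_target P (C, D)" for S using assms that by (auto simp: layered_forest_def)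
 have LC: "distinct (leaves (F' C)) \<and> partition_on C (set (leaves (F' C))) \<and> heap_ordered (F' C)" using L c(1) by simp
 have LD: "distinct (leaves (F' D)) \<and> partition_on D (set (leaves (F' D))) \<and> heap_ordered (F' D)" using L c(1) by simp
 have UC: "\<Union> (set (leaves (F' C))) = C" "\<Union> (set (leaves (F' D))) = D" "{} \<notin> set (leaves (F' C))" "{} \<notin> set (leaves (F' D))"
  using LC LD by (auto simp: partition_on_def)
 have dj: "A \<inter> B = {}" if "A \<in> set (leaves (F' C))" "B \<in> set (leaves (F' D))" for A B using UC c(7) that by blast
 have dj2: "set (leaves (F' C)) \<inter> set (leaves (F' D)) = {}" using dj UC(3) by (metis Int_absorb disjoint_iff)
 have pCD: "partition_on (C \<union> D) (set (leaves (F' C)) \<union> set (leaves (F' D)))"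
 proof (rule partition_onI)
  show "\<Union> (set (leaves (F' C)) \<union> set (leaves (F' D))) = C \<union> D" using UC by blast
  show "{} \<notin> set (leaves (F' C)) \<union> set (leaves (F' D))" using UC by blast
  fix p q assume pq: "p \<in> set (leaves (F' C)) \<union> set (leaves (F' D))" "q \<in> set (leaves (F' C)) \<union> set (leaves (F' D))" "p \<noteq> q"
  have "disjnt p q" if "p \<in> set (leaves (F' C))" "q \<in> set (leaves (F' C))"
   using LC that pq(3) by (auto simp: partition_on_def disjoint_def disjnt_def)
  moreover have "disjnt p q" if "p \<in> set (leaves (F' D))" "q \<in> set (leaves (F' D))"
   using LD that pq(3) by (auto simp: partition_on_def disjoint_def disjnt_def)
  ultimately show "disjnt p q" using pq(1,2) dj unfolding disjnt_def by blast
 qed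
 fix S assume S: "S \<in> P"
 show "distinct (leaves (F S))" using st S L[of S] LC LD dj2 c(1) by (cases "S = C \<union> D") (auto simp: forest_step_def)
 show "partition_on S (set (leaves (F S)))" using st S L[of S] pCD c(1) by (cases "S = C \<union> D") (auto simp: forest_step_def)
 show "heap_ordered (F S)" using st S L[of S] LC LD c(1) by (cases "S = C \<union> D") (auto simp: forest_step_def)
next
 have "(\<Union>S\<in>cut_target P (C, D). set (ranks (F' S))) = {..<forest_size (cut_target P (C, D)) F'}"
  using assms by (simp add: layered_forest_def)
 then show "(\<Union>S\<in>P. set (ranks (F S))) = {..<forest_size P F}" unfolding step_ranks step_size by (simp add: lessThan_Suc_eq_insert_0)
qed

end

text \<open>By heap order the node of rank 0 is the root of its tree, and the unions of the leaves
  of its two subtrees give the first cut. That the rest is again layered requires that 0 occur in no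
  other tree.\<close>

lemma forest_decompose:
 assumes I: "finite I" and P: "partition_on I P" and lay: "layered_forest P F" and pos: "forest_size P F > 0"
 obtains C D F' where "valid_cut P (C, D)" "forest_step P C D F F'" "layered_forest (cut_target P (C, D)) F'"
proof -
 have fP: "finite P" using partition_on_finite[OF I P] .
 have Un: "(\<Union>S\<in>P. set (ranks (F S))) = {..<forest_size P F}" using lay by (simp add: layered_forest_def)
 have tree: "distinct (leaves (F S))" "partition_on S (set (leaves (F S)))" "heap_ordered (F S)" if "S \<in> P" for S
  using lay that by (auto simp: layered_forest_def)
 obtain S where S: "S \<in> P" "0 \<in> set (ranks (F S))" using Un pos by blast
 obtain l r where FS: "F S = Node 0 l r" using S(2) tree(3)[OF S(1)] by (cases "F S") auto
 define C where "C = \<Union> (set (leaves l))"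
 define D where "D = \<Union> (set (leaves r))"
 have pS: "partition_on S (set (leaves l) \<union> set (leaves r))" using tree(2)[OF S(1)] FS by simp
 have dist: "distinct (leaves l)" "distinct (leaves r)" "set (leaves l) \<inter> set (leaves r) = {}" using tree(1)[OF S(1)] FS by auto
 have ne: "set (leaves t) \<noteq> {}" for t :: "'a set ltree" by (induction t) auto
 have CD: "C \<union> D = S" using pS by (auto simp: partition_on_def C_def D_def)
 have bne: "B \<noteq> {}" if "B \<in> set (leaves l) \<union> set (leaves r)" for B using pS that by (auto simp: partition_on_def)
 have CD0: "C \<noteq> {}" "D \<noteq> {}" using ne[of l] ne[of r] bne unfolding C_def D_def by (meson UnI1 UnI2 Union_empty_conv all_not_in_conv)+
 have bdj: "A \<inter> B = {}" if "A \<in> set (leaves l) \<union> set (leaves r)" "B \<in> set (leaves l) \<union> set (leaves r)" "A \<noteq> B" for A B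
  using pS that unfolding partition_on_def disjoint_def by blast
 have CDi: "C \<inter> D = {}"
 proof -
  have "A \<inter> B = {}" if "A \<in> set (leaves l)" "B \<in> set (leaves r)" for A B using bdj[of A B] that dist(3) by blast
  then show ?thesis unfolding C_def D_def by blast
 qed
 have V: "valid_cut P (C, D)" using CD CD0 CDi S(1) by (auto simp: valid_cut_def)
 note c = cut_parts[OF P V]
 have pl: "partition_on C (set (leaves l))" unfolding C_def by (rule partition_onI) (use bdj bne in \<open>auto simp: disjnt_def\<close>)
 have pr: "partition_on D (set (leaves r))" unfolding D_def by (rule partition_onI) (use bdj bne in \<open>auto simp: disjnt_def\<close>)
 have h: "0 \<notin> set (ranks l)" "0 \<notin> set (ranks r)" "heap_ordered l" "heap_ordered r" using tree(3)[OF S(1)] FS by auto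
 \<comment> \<open>By counting: the ranks of all trees together fill the numbers below the total
   number of nodes, and a second occurrence of 0 would leave too few distinct values.\<close>
 have z: "0 \<notin> set (ranks (F T))" if T: "T \<in> P" "T \<noteq> S" for T
 proof
  assume 0: "0 \<in> set (ranks (F T))"
  have "(\<Union>S\<in>P. set (ranks (F S))) \<subseteq> (\<Union>S\<in>P - {T}. set (ranks (F S))) \<union> (set (ranks (F T)) - {0})" using S T by auto
  then have "card (\<Union>S\<in>P. set (ranks (F S))) \<le> card ((\<Union>S\<in>P - {T}. set (ranks (F S))) \<union> (set (ranks (F T)) - {0}))"
   using fP by (intro card_mono) auto
  also have "\<dots> \<le> card (\<Union>S\<in>P - {T}. set (ranks (F S))) + card (set (ranks (F T)) - {0})" by (rule card_Un_le)
  also have "\<dots> < card (\<Union>S\<in>P - {T}. set (ranks (F S))) + card (set (ranks (F T)))"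
   using 0 by (intro add_strict_left_mono psubset_card_mono) auto
  also have "\<dots> \<le> (\<Sum>S\<in>P - {T}. card (set (ranks (F S)))) + card (set (ranks (F T)))"
   using card_UN_le[of "P - {T}" "\<lambda>S. set (ranks (F S))"] fP by simp
  also have "\<dots> \<le> (\<Sum>S\<in>P - {T}. length (ranks (F S))) + length (ranks (F T))" by (intro add_mono sum_mono card_length)
  also have "\<dots> = forest_size P F" unfolding forest_size_def using sum.remove[OF fP T(1), of "\<lambda>S. length (ranks (F S))"] by simp
  finally show False using Un by simp
 qed
 \<comment> \<open>Neither \<open>C\<close> nor \<open>D\<close> is a block of \<open>P\<close>, so
   the two subtrees do not overwrite any of the other trees.\<close>
 define F0 where "F0 T = (if T = C then l else if T = D then r else F T)" for T
 define F' where "F' T = rank_map (\<lambda>n. n - 1) (F0 T)" for T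
 have z0: "0 \<notin> set (ranks (F0 T))" if "T \<in> cut_target P (C, D)" for T using that z h unfolding c(1) F0_def CD by auto
 have suc: "rank_map Suc (F' T) = F0 T" if "T \<in> cut_target P (C, D)" for T unfolding F'_def using rank_map_pred z0[OF that] by blast
 have st: "forest_step P C D F F'" unfolding forest_step_def CD
 proof (intro conjI ballI)
  show "F S = Node 0 (rank_map Suc (F' C)) (rank_map Suc (F' D))" using suc[of C] suc[of D] c(1,5) FS by (simp add: F0_def)
  fix T assume "T \<in> P - {S}"
  then show "F T = rank_map Suc (F' T)" using suc[of T] c(1,3,4) CD by (auto simp: F0_def)
 qed
 have "layered_forest (cut_target P (C, D)) F'" unfolding layered_forest_def
 proof (intro conjI ballI)
  fix T assume T: "T \<in> cut_target P (C, D)"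
  have hF: "heap_ordered (F' T) = heap_ordered (F0 T)" using suc[OF T] heap_ordered_rank_map[of "F' T"] by simp
  have lF: "leaves (F' T) = leaves (F0 T)" by (simp add: F'_def)
  have TP: "T \<noteq> C ==> T \<noteq> D ==> T \<in> P" using T unfolding c(1) by simp
  show "distinct (leaves (F' T))" "heap_ordered (F' T)" "partition_on T (set (leaves (F' T)))"
   unfolding hF lF F0_def using TP dist h pl pr tree[of T] by auto
 next
  have "insert 0 (Suc ` (\<Union>S\<in>cut_target P (C, D). set (ranks (F' S)))) = insert 0 (Suc ` {..<forest_size (cut_target P (C, D)) F'})"
   using step_ranks[OF I P V st] step_size[OF I P V st] Un by (simp add: lessThan_Suc_eq_insert_0)
  moreover have n0: "0 \<notin> Suc ` A" for A by auto
  ultimately have "Suc ` (\<Union>S\<in>cut_target P (C, D). set (ranks (F' S))) = Suc ` {..<forest_size (cut_target P (C, D)) F'}"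
   by (subst (asm) insert_ident[OF n0 n0])
  then show "(\<Union>S\<in>cut_target P (C, D). set (ranks (F' S))) = {..<forest_size (cut_target P (C, D)) F'}"
   by (simp only: inj_image_eq_iff[OF inj_Suc])
 qed
 with that V st show ?thesis by blast
qed

lemma forest_of_cuts:
 assumes "finite I" "partition_on I P" "valid_cuts P Vs"
 shows "\<exists>F. layered_forest P F \<and> forest_cuts P F = Vs \<and> forest_target P F = cuts_target P Vs" using assms(2,3)
proof (induction Vs arbitrary: P)
 case Nil
 have "partition_on S {S}" if "S \<in> P" for S using partition_on_block[OF Nil(1) that] .
 then have "layered_forest P Leaf \<and> forest_cuts P Leaf = [] \<and> forest_target P Leaf = P"
  by (auto simp: layered_forest_def forest_cuts_def forest_target_def forest_size_def)
 then show ?case by auto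
next
 case (Cons W Vs)
 obtain C D where W: "W = (C, D)" by (cases W)
 have V: "valid_cut P (C, D)" using Cons.prems(2) W by simp
 note Q = partition_on_cut[OF Cons.prems(1) V] and c = cut_parts[OF Cons.prems(1) V]
 obtain F' where F': "layered_forest (cut_target P (C, D)) F'" "forest_cuts (cut_target P (C, D)) F' = Vs"
  "forest_target (cut_target P (C, D)) F' = cuts_target (cut_target P (C, D)) Vs" using Cons.IH[OF Q] Cons.prems(2) W by auto
 define F where "F S = (if S = C \<union> D then Node 0 (rank_map Suc (F' C)) (rank_map Suc (F' D)) else rank_map Suc (F' S))" for S
 have st: "forest_step P C D F F'" by (auto simp: forest_step_def F_def)
 have "partition_on C (set (leaves (F' C)))" "partition_on D (set (leaves (F' D)))" using F'(1) c(1) by (auto simp: layered_forest_def)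
 then show ?case using step_layered[OF assms(1) Cons.prems(1) V st F'(1)] step_cuts[OF assms(1) Cons.prems(1) V st]
   step_target[OF assms(1) Cons.prems(1) V st] F' W by auto
qed

text \<open>Stripping the node of rank 0 leaves a layered forest over the refined partition with one
  node fewer. When no nodes are left every tree is a single leaf, whose label is the block itself
  because the labels partition the block.\<close>

lemma forest_induct [consumes 3, case_names sticks step]:
 assumes I: "finite I" and "partition_on I P" "layered_forest P F"
  and sticks: "!!P F. partition_on I P ==> (!!S. S \<in> P ==> F S = Leaf S) ==> layered_forest P F ==>
   forest_cuts P F = [] ==> forest_target P F = P ==> Pr P F"
  and step: "!!P F C D F'. partition_on I P ==> valid_cut P (C, D) ==> partition_on I (cut_target P (C, D)) ==>
   forest_step P C D F F' ==> layered_forest (cut_target P (C, D)) F' ==> Pr (cut_target P (C, D)) F' ==>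
   forest_cuts P F = (C, D) # forest_cuts (cut_target P (C, D)) F' ==>
   forest_target P F = forest_target (cut_target P (C, D)) F' ==> Pr P F"
 shows "Pr P F" using assms(2,3)
proof (induction "forest_size P F" arbitrary: P F)
 case 0
 have fP: "finite P" using partition_on_finite[OF I 0(2)] .
 have leaf: "F S = Leaf S" if S: "S \<in> P" for S
 proof -
  have "length (ranks (F S)) = 0" using 0(1) S fP by (simp add: forest_size_def)
  then obtain b where b: "F S = Leaf b" by (cases "F S") auto
  then have "partition_on S {b}" using 0(3) S by (auto simp: layered_forest_def)
  then show ?thesis using b by (simp add: partition_on_def)
 qed
 show ?case by (rule sticks[OF 0(2) leaf 0(3)]) (use 0(1) leaf in \<open>auto simp: forest_cuts_def forest_target_def\<close>)
next
 case (Suc n)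
 obtain C D F' where V: "valid_cut P (C, D)" and st: "forest_step P C D F F'" and lay: "layered_forest (cut_target P (C, D)) F'"
  by (rule forest_decompose[OF I Suc(3,4)]) (use Suc(2) in auto)
 note Q = partition_on_cut[OF Suc(3) V] and c = cut_parts[OF Suc(3) V]
 have n: "n = forest_size (cut_target P (C, D)) F'" using step_size[OF I Suc(3) V st] Suc(2) by simp
 have parts: "partition_on C (set (leaves (F' C)))" "partition_on D (set (leaves (F' D)))"
  using lay c(1) by (auto simp: layered_forest_def)
 show ?case by (rule step[OF Suc(3) V Q st lay Suc(1)[OF n Q lay] step_cuts[OF I Suc(3) V st parts] step_target[OF I Suc(3) V st]])
qed

lemma cuts_of_forest:
 assumes "finite I" "partition_on I P" "layered_forest P F"
 shows "valid_cuts P (forest_cuts P F) \<and> forest_target P F = cuts_target P (forest_cuts P F)"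
 using assms by (induction rule: forest_induct) auto

lemma partition_on_cuts: "partition_on I P ==> valid_cuts P Vs ==> partition_on I (cuts_target P Vs)"
proof (induction Vs arbitrary: P)
 case (Cons V Vs) then show ?case using partition_on_cut[of I P "fst V" "snd V"] by simp
qed simp

text \<open>Stated with sequences of cuts, the condition passes to a derivative along one cut, since
  prepending a cut to a sequence gives another sequence. The empty sequence gives locality of
  \<open>f\<close> itself.\<close>

definition cut_differentiable :: "'a set set => ('a face => 'k::field) => bool" where
 "cut_differentiable P f \<longleftrightarrow> (\<forall>Vs. valid_cuts P Vs \<longrightarrow> local_on (cuts_target P Vs) (cuts_deriv P Vs f))"

lemma semisimply_differentiable_iff:
 assumes "finite I" "partition_on I P"
 shows "semisimply_differentiable P f \<longleftrightarrow> cut_differentiable P f"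
proof
 assume a: "semisimply_differentiable P f"
 show "cut_differentiable P f" unfolding cut_differentiable_def
 proof (intro allI impI)
  fix Vs assume v: "valid_cuts P Vs"
  obtain F where F: "layered_forest P F" "forest_cuts P F = Vs" "forest_target P F = cuts_target P Vs"
   using forest_of_cuts[OF assms v] by blast
  then have "semisimple (cuts_target P Vs) (cuts_deriv P Vs f)" using a unfolding semisimply_differentiable_def forest_deriv_def by metis
  then show "local_on (cuts_target P Vs) (cuts_deriv P Vs f)" using semisimple_iff[OF assms(1) partition_on_cuts[OF assms(2) v]] by blast
 qed
next
 assume a: "cut_differentiable P f"
 show "semisimply_differentiable P f" unfolding semisimply_differentiable_def
 proof (intro allI impI)
  fix F assume l: "layered_forest P F"
  have c: "valid_cuts P (forest_cuts P F)" "forest_target P F = cuts_target P (forest_cuts P F)" using cuts_of_forest[OF assms l] by auto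
  have "local_on (forest_target P F) (forest_deriv P F f)" using a c unfolding cut_differentiable_def forest_deriv_def by simp
  then show "semisimple (forest_target P F) (forest_deriv P F f)"
   unfolding c(2) using semisimple_iff[OF assms(1) partition_on_cuts[OF assms(2) c(1)]] by blast
 qed
qed

section \<open>The dual species and its bracket\<close>

lemma cut_deriv_add: "cut_deriv P V (\<lambda>X. f X + g X) = (\<lambda>X. cut_deriv P V f X + cut_deriv P V g X)"
 and cut_deriv_scale: "cut_deriv P V (\<lambda>X. c * f X) = (\<lambda>X. c * cut_deriv P V f X)"
 and cut_deriv_zero: "cut_deriv P V (\<lambda>_. 0) = (\<lambda>_. 0)" by (auto simp: cut_deriv_def algebra_simps)

lemma cuts_deriv_add: "cuts_deriv P Vs (\<lambda>X. f X + g X) = (\<lambda>X. cuts_deriv P Vs f X + cuts_deriv P Vs g X)"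
 by (induction Vs arbitrary: P f g) (simp_all add: cut_deriv_add)

lemma cuts_deriv_scale: "cuts_deriv P Vs (\<lambda>X. c * f X) = (\<lambda>X. c * cuts_deriv P Vs f X)"
 by (induction Vs arbitrary: P f) (simp_all add: cut_deriv_scale)

lemma cuts_deriv_zero: "cuts_deriv P Vs (\<lambda>_. 0) = (\<lambda>_. 0)" by (induction Vs arbitrary: P) (simp_all add: cut_deriv_zero)

lemma cuts_deriv_sum: "finite A ==> cuts_deriv P Vs (\<lambda>X. \<Sum>i\<in>A. f i X) = (\<lambda>X. \<Sum>i\<in>A. cuts_deriv P Vs (f i) X)"
 by (induction A rule: finite_induct) (simp_all add: cuts_deriv_zero cuts_deriv_add)

lemma cut_differentiable_add: "cut_differentiable P f ==> cut_differentiable P g ==> cut_differentiable P (\<lambda>X. f X + g X)"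
 unfolding cut_differentiable_def cuts_deriv_add by (simp add: local_on_add)

lemma cut_differentiable_scale: "cut_differentiable P f ==> cut_differentiable P (\<lambda>X. c * f X)"
 unfolding cut_differentiable_def cuts_deriv_scale by (simp add: local_on_scale)

lemma cut_differentiable_zero: "cut_differentiable P (\<lambda>_. 0)" unfolding cut_differentiable_def cuts_deriv_zero by (simp add: local_on_zero)

lemma cut_differentiable_local: "cut_differentiable P f ==> local_on P f"
 unfolding cut_differentiable_def by (metis cuts_deriv.simps(1) cuts_target.simps(1) valid_cuts.simps(1))

lemma cut_differentiable_cut: "cut_differentiable P f ==> valid_cut P V ==> cut_differentiable (cut_target P V) (cut_deriv P V f)"
 unfolding cut_differentiable_def by (metis cuts_deriv.simps(2) cuts_target.simps(2) valid_cuts.simps(2))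

lemma gamma_dual_simps [simp]: "vadd (gamma_dual S) = (\<lambda>u v x. u x + v x)"
 "vscale (gamma_dual S) = (\<lambda>c v x. c * v x)" "vzero (gamma_dual S) = (\<lambda>_. 0)" by (simp_all add: gamma_dual_def)

text \<open>Vanishing outside the faces is already contained in locality at the empty sequence of
  cuts, so one condition remains.\<close>

lemma gamma_dual_iff:
 assumes "finite I" "I \<noteq> {}"
 shows "f \<in> vcarrier (gamma_dual I) \<longleftrightarrow> cut_differentiable {I} f"
proof -
 have "f \<in> vcarrier (gamma_dual I) \<longleftrightarrow> f \<in> vcarrier (Lvee_dual {I}) \<and> cut_differentiable {I} f"
  using semisimply_differentiable_iff[OF assms(1) partition_on_space[OF assms(2)], of f] assms(2) by (simp add: gamma_dual_def)
 then show ?thesis using cut_differentiable_local[of "{I}" f] by (auto simp: local_on_def)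
qed

lemma gamma_dual_sub: "f \<in> vcarrier (gamma_dual I) ==> f \<in> vcarrier (Lvee_dual {I})"
 by (auto simp: gamma_dual_def Lvee_dual_carrier split: if_splits)

lemma pointwise_gamma_dual:
 assumes "finite I" shows "pointwise (gamma_dual I :: ('k::field, 'a face => 'k) vspace)"
proof -
 let ?W = "vcarrier (gamma_dual I) :: ('a face => 'k) set"
 have "(\<lambda>_. 0) \<in> ?W \<and> (\<forall>f\<in>?W. \<forall>g\<in>?W. (\<lambda>X. f X + g X) \<in> ?W) \<and> (\<forall>c. \<forall>f\<in>?W. (\<lambda>X. c * f X) \<in> ?W)"
 proof (cases "I = {}")
  case True then show ?thesis by (simp add: gamma_dual_def)
 next
  case False
  show ?thesis unfolding gamma_dual_iff[OF assms False]
   by (simp add: gamma_dual_iff[OF assms False] cut_differentiable_zero cut_differentiable_add cut_differentiable_scale)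
 qed
 then show ?thesis unfolding pointwise_def vs_def by (simp add: algebra_simps)
qed

lemma vs_gamma_dual: "finite I ==> vs (gamma_dual I)" using pointwise_gamma_dual by (auto simp: pointwise_def)

text \<open>The partial function obtained from \<open>G\<close> by freezing the face on the block
  \<open>D\<close> at \<open>z\<close>; what remains is a functional on the faces of the other
  blocks.\<close>

definition slice :: "'a set => 'a set set => 'a face => ('a face => 'k::field) => 'a face => 'k" where
 "slice D R z G = (\<lambda>X. if X \<in> faces R then G (face_glue D z (\<Union>R) X) else 0)"

section \<open>Slices of differentiable functionals\<close>

context
 fixes C D :: "'a set" and z
 assumes fin: "finite C" "finite D" and CD: "D \<noteq> {}" "C \<inter> D = {}" and z: "z \<in> faces {D}"
begin

text \<open>Gluing a fixed face on \<open>D\<close> commutes with cuts inside \<open>C\<close>,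
  because both sides consult \<open>z\<close> first, then \<open>X\<close>, and finally the cut.
  Which of \<open>A\<close> and \<open>B\<close> a set contains is decided by its part in
  \<open>C\<close>.\<close>

lemma glue_cut:
 assumes R: "partition_on C R" and V: "valid_cut R (A, B)" and X: "X \<in> faces (cut_target R (A, B))"
 shows "face_glue D z C (face_cut R (A, B) X) = face_cut (insert D R) (A, B) (face_glue D z C X)"
  and "face_glue D z C (face_cut R (B, A) X) = face_cut (insert D R) (B, A) (face_glue D z C X)"
  and "cut_target (insert D R) (A, B) = insert D (cut_target R (A, B))" "valid_cut (insert D R) (A, B)"
proof -
 have fCD: "finite (C \<union> D)" using fin by simp
 note c = cut_parts[OF R V]
 have ABC: "A \<union> B \<subseteq> C" using c(6) UnP[OF fin(1) R] by auto
 have "D \<noteq> A \<union> B" using ABC c(8) CD by auto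
 then show t: "cut_target (insert D R) (A, B) = insert D (cut_target R (A, B))" unfolding cut_target_def by auto
 show V': "valid_cut (insert D R) (A, B)" using V by (auto simp: valid_cut_def)
 note Q = partition_on_cut[OF R V]
 note p = partition_on_insert_block[OF R CD] and p' = partition_on_insert_block[OF Q CD]
 note gX = face_glue[OF fin Q CD z X]
 have gX': "face_glue D z C X \<in> faces (cut_target (insert D R) (A, B))" using gX(1) t by simp
 note cX = face_cut[OF fin(1) R V X] and cX' = face_cut_swap[OF fin(1) R V X]
 note gc = face_glue[OF fin R CD z cX(1)] and gc' = face_glue[OF fin R CD z cX'(1)]
 note cg = face_cut[OF fCD p V' gX'] and cg' = face_cut_swap[OF fCD p V' gX']
 have AC: "A \<subseteq> C" "B \<subseteq> C" using ABC by auto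
 have sub: "A \<subseteq> E \<inter> C \<longleftrightarrow> A \<subseteq> E" "B \<subseteq> E \<inter> C \<longleftrightarrow> B \<subseteq> E" for E using ABC by auto
 show "face_glue D z C (face_cut R (A, B) X) = face_cut (insert D R) (A, B) (face_glue D z C X)"
  by (rule face_ext[OF fCD p gc(1) cg(1)]) (simp add: gc(2) cg(2) cX(2) gX(2) sub AC)
 show "face_glue D z C (face_cut R (B, A) X) = face_cut (insert D R) (B, A) (face_glue D z C X)"
  by (rule face_ext[OF fCD p gc'(1) cg'(1)]) (simp add: gc'(2) cg'(2) cX'(2) gX(2) sub AC)
qed

lemma valid_cut_insert:
 assumes R: "partition_on C R" and V: "valid_cut R V"
 shows "cut_target (insert D R) V = insert D (cut_target R V)" "valid_cut (insert D R) V"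
proof -
 obtain A B where [simp]: "V = (A, B)" by (cases V)
 have V': "valid_cut R (A, B)" using V by simp
 note c = cut_parts[OF R V']
 have ABC: "A \<union> B \<subseteq> C" using c(6) UnP[OF fin(1) R] by auto
 have "D \<noteq> A \<union> B" using ABC c(8) CD by auto
 then show "cut_target (insert D R) V = insert D (cut_target R V)" unfolding cut_target_def by auto
 show "valid_cut (insert D R) V" using V by (auto simp: valid_cut_def)
qed

lemma slice_cut:
 assumes R: "partition_on C R" and V: "valid_cut R V"
 shows "cut_deriv R V (slice D R z G) = slice D (cut_target R V) z (cut_deriv (insert D R) V G)"
proof
 fix X
 obtain A B where V_eq: "V = (A, B)" by (cases V)
 have V': "valid_cut R (A, B)" using V V_eq by simp
 note Q = partition_on_cut[OF R V']
 have U: "\<Union>R = C" "\<Union>(cut_target R V) = C" using UnP[OF fin(1)] R Q V_eq by auto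
 show "cut_deriv R V (slice D R z G) X = slice D (cut_target R V) z (cut_deriv (insert D R) V G) X"
 proof (cases "X \<in> faces (cut_target R V)")
  case True
  then have X: "X \<in> faces (cut_target R (A, B))" using V_eq by simp
  note g = glue_cut[OF R V' X]
  have "face_glue D z C X \<in> faces (insert D (cut_target R V))" using face_glue(1)[OF fin Q CD z X] V_eq by simp
  then show ?thesis using True g face_cut(1)[OF fin(1) R V' X] face_cut_swap(1)[OF fin(1) R V' X]
   by (simp add: cut_deriv_def slice_def U[unfolded V_eq] V_eq)
 qed (simp add: cut_deriv_def slice_def)
qed

lemma slice_local:
 assumes R: "partition_on C R" and G: "local_on (insert D R) G"
 shows "local_on R (slice D R z G)"
proof (rule local_onI)
 fix X Y assume XY: "X \<in> faces R" "Y \<in> faces R" "!!S. S \<in> R ==> face_restrict X S = face_restrict Y S"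
 have U: "\<Union>R = C" using UnP[OF fin(1) R] .
 note gX = face_glue_restrict[OF fin R CD z XY(1)] and gY = face_glue_restrict[OF fin R CD z XY(2)]
 have "G (face_glue D z C X) = G (face_glue D z C Y)"
  by (rule local_onD(2)[OF G face_glue(1)[OF fin R CD z XY(1)] face_glue(1)[OF fin R CD z XY(2)]]) (use gX gY XY(3) in auto)
 then show "slice D R z G X = slice D R z G Y" using XY(1,2) by (simp add: slice_def U)
qed (simp add: slice_def)

lemma slice_cuts: "partition_on C R ==> valid_cuts R Vs ==>
  cuts_deriv R Vs (slice D R z G) = slice D (cuts_target R Vs) z (cuts_deriv (insert D R) Vs G) \<and>
  valid_cuts (insert D R) Vs \<and> cuts_target (insert D R) Vs = insert D (cuts_target R Vs)"
proof (induction Vs arbitrary: R G)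
 case (Cons V Vs)
 have V: "valid_cut R V" "valid_cuts (cut_target R V) Vs" using Cons.prems by auto
 have Q: "partition_on C (cut_target R V)" using partition_on_cut[of C R "fst V" "snd V"] Cons.prems V by simp
 show ?case using Cons.IH[OF Q V(2), of "cut_deriv (insert D R) V G"] slice_cut[OF Cons.prems(1) V(1), of G]
   valid_cut_insert[OF Cons.prems(1) V(1)] by simp
qed simp

text \<open>Slicing commutes with every sequence of cuts that avoids \<open>D\<close>, and a slice
  of a local functional is local. Applied to \<open>R = {C}\<close> this places the slices of a
  derivative along \<open>[C, D]\<close> in \<open>\<Gamma>\<^sup>*[C]\<close>.\<close>

lemma slice_differentiable:
 assumes R: "partition_on C R" and G: "cut_differentiable (insert D R) G"
 shows "cut_differentiable R (slice D R z G)" unfolding cut_differentiable_def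
proof (intro allI impI)
 fix Vs assume v: "valid_cuts R Vs"
 note s = slice_cuts[OF R v, of G]
 have "local_on (insert D (cuts_target R Vs)) (cuts_deriv (insert D R) Vs G)" using G s unfolding cut_differentiable_def by metis
 from slice_local[OF partition_on_cuts[OF R v] this] s
 show "local_on (cuts_target R Vs) (cuts_deriv R Vs (slice D R z G))" by simp
qed

end

text \<open>A finite dimensional space of functions has a reproducing kernel: the matrix of a projection onto it.\<close>

lemma reproducing_kernel:
 fixes W :: "('x => 'k::field) set"
 assumes "finite A" "!!w x. w \<in> W ==> x \<notin> A ==> w x = 0" "(\<lambda>_. 0) \<in> W"
  "!!v w. v \<in> W ==> w \<in> W ==> (\<lambda>x. v x + w x) \<in> W" "!!c w. w \<in> W ==> (\<lambda>x. c * w x) \<in> W"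
 shows "\<exists>K. (\<forall>p\<in>A. K p \<in> W) \<and> (\<forall>w\<in>W. \<forall>x. w x = (\<Sum>p\<in>A. w p * K p x))" using assms
proof (induction A arbitrary: W rule: finite_induct)
 case empty
 then show ?case by auto
next
 case (insert a A)
 show ?case
 proof (cases "\<forall>w\<in>W. w a = 0")
  case True
  have "w x = 0" if "w \<in> W" "x \<notin> A" for w x using True insert.prems(1) that by (cases "x = a") auto
  then have "\<exists>K. (\<forall>p\<in>A. K p \<in> W) \<and> (\<forall>w\<in>W. \<forall>x. w x = (\<Sum>p\<in>A. w p * K p x))" by (intro insert.IH insert.prems(2-4)) auto
  then obtain K where K: "\<forall>p\<in>A. K p \<in> W" "\<forall>w\<in>W. \<forall>x. w x = (\<Sum>p\<in>A. w p * K p x)" by blast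
  have "w x = (\<Sum>p\<in>insert a A. w p * (K(a := \<lambda>_. 0)) p x)" if "w \<in> W" for w x
  proof -
   have "(\<Sum>p\<in>insert a A. w p * (K(a := \<lambda>_. 0)) p x) = (\<Sum>p\<in>A. w p * K p x)" using insert.hyps by (simp, intro sum.cong) auto
   then show ?thesis using K(2) that by metis
  qed
  then show ?thesis using K(1) insert.prems(2) insert.hyps by (intro exI[of _ "K(a := \<lambda>_. 0)"]) auto
 next
  case False
  then obtain w1 where w1: "w1 \<in> W" "w1 a \<noteq> 0" by blast
  note addW = insert.prems(3) and scaleW = insert.prems(4)
  define w0 where "w0 = (\<lambda>x. (1 / w1 a) * w1 x)"
  have w0: "w0 \<in> W" unfolding w0_def by (rule insert.prems(4)[OF w1(1)])
  have w0a: "w0 a = 1" using w1 by (simp add: w0_def)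
  let ?W = "{w \<in> W. w a = 0}"
  have z: "w x = 0" if "w \<in> ?W" "x \<notin> A" for w x using insert.prems(1) that by (cases "x = a") auto
  have "\<exists>K. (\<forall>p\<in>A. K p \<in> ?W) \<and> (\<forall>w\<in>?W. \<forall>x. w x = (\<Sum>p\<in>A. w p * K p x))"
  proof (rule insert.IH)
   show "w x = 0" if "w \<in> ?W" "x \<notin> A" for w x by (rule z[OF that])
   show "(\<lambda>_. 0) \<in> ?W" using insert.prems(2) by simp
   show "(\<lambda>x. v x + w x) \<in> ?W" if "v \<in> ?W" "w \<in> ?W" for v w using insert.prems(3)[of v w] that by simp
   show "(\<lambda>x. c * w x) \<in> ?W" if "w \<in> ?W" for c w using insert.prems(4)[of w c] that by simp
  qed
  then obtain K where K: "\<forall>p\<in>A. K p \<in> ?W" "\<forall>w\<in>?W. \<forall>x. w x = (\<Sum>p\<in>A. w p * K p x)" by blast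
  have sumW: "B \<subseteq> A ==> (\<lambda>x. \<Sum>p\<in>B. c p * K p x) \<in> W" if "finite B" for B c using that
  proof (induction B rule: finite_induct)
   case empty then show ?case using insert.prems(2) by simp
  next
   case (insert b B)
   then have b: "(\<lambda>x. c b * K b x) \<in> W" using K(1) by (intro scaleW) auto
   have "(\<lambda>x. \<Sum>p\<in>B. c p * K p x) \<in> W" using insert by auto
   from addW[OF b this] insert.hyps show ?case by simp
  qed
  \<comment> \<open>Write \<open>w\<close> as \<open>w a\<close> times \<open>w0\<close> plus a
    remainder in \<open>W\<close> that vanishes at \<open>a\<close>, and expand the remainder by the
    kernel \<open>K\<close> of the smaller space. \<open>Ka\<close> collects everything that is
    multiplied by \<open>w a\<close>.\<close>
  define Ka where "Ka = (\<lambda>x. w0 x + (\<Sum>p\<in>A. (- w0 p) * K p x))"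
  have Ka: "Ka \<in> W" unfolding Ka_def by (rule addW[OF w0 sumW[OF insert.hyps(1) subset_refl]])
  have "w x = (\<Sum>p\<in>insert a A. w p * (K(a := Ka)) p x)" if w: "w \<in> W" for w x
  proof -
   let ?v = "\<lambda>x. w x + (- w a) * w0 x"
   have "?v \<in> W" by (rule addW[OF w scaleW[OF w0]])
   then have vW: "?v \<in> ?W" using w0a by simp
   have "\<forall>x. ?v x = (\<Sum>p\<in>A. ?v p * K p x)" by (rule bspec[OF K(2) vW])
   then have "?v x = (\<Sum>p\<in>A. ?v p * K p x)" by (rule spec)
   also have "\<dots> = (\<Sum>p\<in>A. w p * K p x) + w a * (\<Sum>p\<in>A. (- w0 p) * K p x)"
    by (simp add: sum_distrib_left sum.distrib[symmetric] algebra_simps)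
   finally have "w x = (\<Sum>p\<in>A. w p * K p x) + w a * Ka x" by (simp add: Ka_def algebra_simps)
   moreover have "(\<Sum>p\<in>A. w p * (K(a := Ka)) p x) = (\<Sum>p\<in>A. w p * K p x)" using insert.hyps by (intro sum.cong) auto
   ultimately show ?thesis using insert.hyps by simp
  qed
  moreover have "\<forall>p\<in>insert a A. (K(a := Ka)) p \<in> W" using K(1) Ka by auto
  ultimately show ?thesis by blast
 qed
qed

context
 fixes C D :: "'a set"
 assumes fin: "finite C" "finite D" and CD: "C \<noteq> {}" "D \<noteq> {}" "C \<inter> D = {}"
begin

lemma pair_partition: "partition_on (C \<union> D) {C \<union> D}" "partition_on C {C}" "partition_on D {D}"
 "partition_on (C \<union> D) {C, D}" "valid_cut {C \<union> D} (C, D)" "cut_target {C \<union> D} (C, D) = {C, D}"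
 using CD by (auto simp: partition_on_def disjoint_def valid_cut_def cut_target_def)

lemma pair_cut_differentiable: "f \<in> vcarrier (gamma_dual (C \<union> D)) ==> cut_differentiable {C, D} (cut_deriv {C \<union> D} (C, D) f)"
 using gamma_dual_iff[of "C \<union> D" f] fin CD cut_differentiable_cut[OF _ pair_partition(5)] pair_partition(6) by auto

text \<open>The two ways of gluing, with the sign on \<open>D\<close> or the sign on
  \<open>C\<close> decisive, may give different faces but have the same restrictions. A local
  functional cannot tell them apart.\<close>

lemma pair_glue:
 assumes "y \<in> faces {C}" "z \<in> faces {D}"
 shows "face_glue D z C y \<in> faces {C, D}" "face_restrict (face_glue D z C y) C = y" "face_restrict (face_glue D z C y) D = z"
  "face_glue C y D z \<in> faces {C, D}" "face_restrict (face_glue C y D z) C = y" "face_restrict (face_glue C y D z) D = z"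
proof -
 have DC: "D \<inter> C = {}" using CD by auto
 have rest: "face_restrict y C = y" "face_restrict z D = z" using face_restrict_eqI[OF fin(1) pair_partition(2) _ assms(1) assms(1)]
   face_restrict_eqI[OF fin(2) pair_partition(3) _ assms(2) assms(2)] by auto
 note g = face_glue(1)[OF fin pair_partition(2) CD(2,3) assms(2,1)]
  face_glue_restrict[OF fin pair_partition(2) CD(2,3) assms(2,1)]
 note g' = face_glue(1)[OF fin(2,1) pair_partition(3) CD(1) DC assms(1,2)]
  face_glue_restrict[OF fin(2,1) pair_partition(3) CD(1) DC assms(1,2)]
 show "face_glue D z C y \<in> faces {C, D}" "face_restrict (face_glue D z C y) C = y" "face_restrict (face_glue D z C y) D = z"
  "face_glue C y D z \<in> faces {C, D}" "face_restrict (face_glue C y D z) C = y" "face_restrict (face_glue C y D z) D = z"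
  using g g' rest by (auto simp: insert_commute)
qed

text \<open>The derivative is local, hence a function of the pair of restrictions. For each fixed
  face on \<open>D\<close> its slice lies in \<open>\<Gamma>\<^sup>*[C]\<close> and is expanded by
  the reproducing kernel of that space. The kernel functions are the \<open>p i\<close>, and the
  coefficients, as functions of the face on \<open>D\<close>, are slices in the other direction and
  hence lie in \<open>\<Gamma>\<^sup>*[D]\<close>. This is the surjectivity of the external product
  onto such derivatives.\<close>

lemma deriv_decompose:
 fixes f :: "'a face => 'k::field"
 assumes f: "f \<in> vcarrier (gamma_dual (C \<union> D))"
 obtains p q where "!!i. i \<in> faces {C} ==> p i \<in> vcarrier (gamma_dual C)" "!!i. i \<in> faces {C} ==> q i \<in> vcarrier (gamma_dual D)"
  "!!X. X \<in> faces {C, D} ==> cut_deriv {C \<union> D} (C, D) f X = (\<Sum>i\<in>faces {C}. p i (face_restrict X C) * q i (face_restrict X D))"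
proof -
 let ?F = "cut_deriv {C \<union> D} (C, D) f"
 have DC: "D \<inter> C = {}" using CD by auto
 note F = pair_cut_differentiable[OF f] and loc = cut_differentiable_local[OF pair_cut_differentiable[OF f]]
 have s1: "slice D {C} z ?F \<in> vcarrier (gamma_dual C)" if "z \<in> faces {D}" for z unfolding gamma_dual_iff[OF fin(1) CD(1)]
  by (rule slice_differentiable[OF fin CD(2,3) that pair_partition(2)]) (use F in \<open>simp add: insert_commute\<close>)
 have s2: "slice C {D} y ?F \<in> vcarrier (gamma_dual D)" if "y \<in> faces {C}" for y unfolding gamma_dual_iff[OF fin(2) CD(2)]
  by (rule slice_differentiable[OF fin(2,1) CD(1) DC that pair_partition(3)]) (use F in \<open>simp add: insert_commute\<close>)
 let ?W = "vcarrier (gamma_dual C) :: ('a face => 'k) set"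
 have "\<exists>K. (\<forall>p\<in>faces {C}. K p \<in> ?W) \<and> (\<forall>w\<in>?W. \<forall>x. w x = (\<Sum>p\<in>faces {C}. w p * K p x))"
 proof (rule reproducing_kernel)
  show "finite (faces {C})" using finite_faces[OF fin(1) pair_partition(2)] .
  show "w x = 0" if "w \<in> ?W" "x \<notin> faces {C}" for w x using gamma_dual_sub[OF that(1)] that(2) by (auto simp: Lvee_dual_carrier)
  have pw: "vs (gamma_dual C)" by (rule vs_gamma_dual[OF fin(1)])
  show "(\<lambda>_. 0) \<in> ?W" using vs_zero[OF pw] by simp
  show "(\<lambda>x. v x + w x) \<in> ?W" if "v \<in> ?W" "w \<in> ?W" for v w using vs_add[OF pw that] by simp
  show "(\<lambda>x. c * w x) \<in> ?W" if "w \<in> ?W" for c w using vs_scale[OF pw that, of c] by simp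
 qed
 then obtain K where K: "!!p. p \<in> faces {C} ==> K p \<in> ?W" "!!w x. w \<in> ?W ==> w x = (\<Sum>p\<in>faces {C}. w p * K p x)" by blast
 have "?F X = (\<Sum>p\<in>faces {C}. K p (face_restrict X C) * slice C {D} p ?F (face_restrict X D))"
  if X: "X \<in> faces {C, D}" for X
 proof -
  let ?y = "face_restrict X C" and ?z = "face_restrict X D"
  have fCD: "finite (C \<union> D)" using fin by simp
  have y: "?y \<in> faces {C}" and zz: "?z \<in> faces {D}" using face_restrict_block(1)[OF fCD pair_partition(4) _ X] by auto
  have "?F X = ?F (face_glue D ?z C ?y)" by (rule local_onD(2)[OF loc X pair_glue(1)[OF y zz]]) (use pair_glue[OF y zz] in auto)
  also have "\<dots> = slice D {C} ?z ?F ?y" using y by (simp add: slice_def)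
  also have "\<dots> = (\<Sum>p\<in>faces {C}. slice D {C} ?z ?F p * K p ?y)" using K(2)[OF s1[OF zz]] .
  also have "\<dots> = (\<Sum>p\<in>faces {C}. K p ?y * slice C {D} p ?F ?z)"
  proof (rule sum.cong[OF refl])
   fix p assume p: "p \<in> faces {C}"
   \<comment> \<open>The slice in the first direction glues with \<open>D\<close> decisive and the
     slice in the second with \<open>C\<close> decisive; locality identifies the two values.\<close>
   have "?F (face_glue D ?z C p) = ?F (face_glue C p D ?z)"
    by (rule local_onD(2)[OF loc pair_glue(1)[OF p zz] pair_glue(4)[OF p zz]]) (use pair_glue[OF p zz] in auto)
   then show "slice D {C} ?z ?F p * K p ?y = K p ?y * slice C {D} p ?F ?z" using p zz by (simp add: slice_def)
  qed
  finally show ?thesis .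
 qed
 then show ?thesis using that[of K "\<lambda>p. slice C {D} p ?F"] K(1) s2 by blast
qed

end

section \<open>The quotient \<Gamma> and its pairing\<close>

lemma Lvee_simps [simp]: "vadd (Lvee P) = (\<lambda>u v x. u x + v x)" "vscale (Lvee P) = (\<lambda>c v x. c * v x)"
 "vzero (Lvee P) = (\<lambda>_. 0)" "vs (Lvee P)" by (auto simp: Lvee_def)

lemma face_pairing_add: "face_pairing P f (\<lambda>x. u x + v x) = face_pairing P f u + face_pairing P f v"
 and face_pairing_scale: "face_pairing P f (\<lambda>x. c * v x) = c * face_pairing P f v"
 and face_pairing_zero: "face_pairing P f (\<lambda>x. 0) = 0"
 and face_pairing_add': "face_pairing P (\<lambda>x. f x + g x) v = face_pairing P f v + face_pairing P g v"
 and face_pairing_scale': "face_pairing P (\<lambda>x. c * f x) v = c * face_pairing P f v"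
 by (simp_all add: face_pairing_def algebra_simps sum.distrib sum_distrib_left)

lemma vsub_gamma_null: "vsub (Lvee {I}) (gamma_null I)" unfolding vsub_def
proof (intro conjI ballI allI)
 show "vzero (Lvee {I}) \<in> gamma_null I" using vs_zero[OF Lvee_simps(4)[of "{I}"]] by (simp add: gamma_null_def face_pairing_zero)
 show "vadd (Lvee {I}) u v \<in> gamma_null I" if "u \<in> gamma_null I" "v \<in> gamma_null I" for u v
  using that vs_add[OF Lvee_simps(4), of u "{I}" v] by (simp add: gamma_null_def face_pairing_add)
 show "vscale (Lvee {I}) c v \<in> gamma_null I" if "v \<in> gamma_null I" for c v
  using that vs_scale[OF Lvee_simps(4), of v "{I}" c] by (simp add: gamma_null_def face_pairing_scale)
qed (auto simp: gamma_null_def)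

lemma vs_gamma: "vs (gamma I)" unfolding gamma_def by (rule vs_vquot) (auto intro: vsub_gamma_null)

abbreviation gamma_class :: "'a set => ('a face => 'k::field) => ('k, 'a) gamma_elt" where "gamma_class I \<equiv> vcoset (Lvee {I}) (gamma_null I)"

lemma gamma_class_in: "d \<in> vcarrier (Lvee {I}) ==> gamma_class I d \<in> vcarrier (gamma I)" by (simp add: gamma_def vquot_def)

lemma gammaE:
 assumes "E \<in> vcarrier (gamma I)" obtains d where "d \<in> vcarrier (Lvee {I})" "E = gamma_class I d"
 using assms by (auto simp: gamma_def vquot_def)

lemma gamma_pairing_class:
 fixes f :: "'a face => 'k::field"
 assumes "f \<in> vcarrier (gamma_dual I)"
 shows "gamma_pairing I f (gamma_class I d) = face_pairing {I} f d"
proof -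
 have "face_pairing {I} f ` gamma_class I d = {face_pairing {I} f d}"
 proof -
  have "face_pairing {I} f (vadd (Lvee {I}) d w) = face_pairing {I} f d" if "w \<in> gamma_null I" for w
   using that assms by (simp add: face_pairing_add gamma_null_def)
  moreover have "gamma_null I \<noteq> ({} :: ('a face => 'k) set)"
  proof -
   have "vsub (Lvee {I}) (gamma_null I :: ('a face => 'k) set)" by (rule vsub_gamma_null)
   then show ?thesis by (auto simp: vsub_def)
  qed
  ultimately show ?thesis unfolding vcoset_def image_image by (auto simp: image_constant_conv)
 qed
 then show ?thesis by (simp add: gamma_pairing_def)
qed

lemma gamma_pairing_linear:
 fixes f :: "'a face => 'k::field"
 assumes "f \<in> vcarrier (gamma_dual I)"
 shows "vlinear (gamma I) vfield (gamma_pairing I f)"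
proof -
 have "\<exists>g. vlinear (vquot (Lvee {I}) (gamma_null I)) vfield g \<and> (\<forall>v\<in>vcarrier (Lvee {I}). g (gamma_class I v) = face_pairing {I} f v)"
  by (rule quot_lift[OF _ vsub_gamma_null vs_vfield])
   (use assms in \<open>auto simp: vlinear_def face_pairing_add face_pairing_scale gamma_null_def\<close>)
 then obtain g where g: "vlinear (gamma I) vfield g" "!!v. v \<in> vcarrier (Lvee {I}) ==> g (gamma_class I v) = face_pairing {I} f v"
  unfolding gamma_def by blast
 show ?thesis
 proof (rule vlinear_cong[OF vs_gamma g(1)])
  fix v :: "('k, 'a) gamma_elt" assume "v \<in> vcarrier (gamma I)"
  then obtain d where d: "d \<in> vcarrier (Lvee {I})" "v = gamma_class I d" by (rule gammaE)
  show "gamma_pairing I f v = g v" unfolding d(2) g(2)[OF d(1)] by (rule gamma_pairing_class[OF assms])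
 qed
qed

lemma gamma_pairing_scale:
 assumes "f \<in> vcarrier (gamma_dual I)" "finite I" "E \<in> vcarrier (gamma I)"
 shows "gamma_pairing I (\<lambda>x. c * f x) E = c * gamma_pairing I f E"
proof -
 have cf: "(\<lambda>x. c * f x) \<in> vcarrier (gamma_dual I)" using vs_scale[OF vs_gamma_dual[OF assms(2)] assms(1), of c] by simp
 obtain d where d: "E = gamma_class I d" using gammaE[OF assms(3)] by blast
 show ?thesis unfolding d gamma_pairing_class[OF cf] gamma_pairing_class[OF assms(1)] by (rule face_pairing_scale')
qed

text \<open>The subspace divided out is by definition the annihilator of
  \<open>\<Gamma>\<^sup>*[I]\<close>, so these functionals separate points. Identities in \<Gamma>
  are proved by pairing both sides with an arbitrary \<open>f\<close>.\<close>

lemma gamma_ext: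
 assumes E: "E \<in> vcarrier (gamma I)" "E' \<in> vcarrier (gamma I)"
  and eq: "!!f. f \<in> vcarrier (gamma_dual I) ==> gamma_pairing I f E = gamma_pairing I f E'"
 shows "E = E'"
proof -
 obtain d d' where d: "d \<in> vcarrier (Lvee {I})" "E = gamma_class I d" "d' \<in> vcarrier (Lvee {I})" "E' = gamma_class I d'"
  by (rule gammaE[OF E(1)], rule gammaE[OF E(2)]) (rule that)
 have "(\<lambda>x. d x + (-1) * d' x) \<in> vcarrier (Lvee {I})" using vs_add[of "Lvee {I}", OF _ d(1) vs_scale[OF _ d(3), of "-1"]] by simp
 moreover have "face_pairing {I} f (\<lambda>x. d x + (-1) * d' x) = 0" if "f \<in> vcarrier (gamma_dual I)" for f
  using eq[OF that] gamma_pairing_class[OF that] d unfolding face_pairing_add face_pairing_scale by simp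
 ultimately have "vadd (Lvee {I}) d (vscale (Lvee {I}) (-1) d') \<in> gamma_null I" by (simp add: gamma_null_def)
 then show ?thesis using vcoset_eq[OF _ vsub_gamma_null d(1,3)] d by simp
qed

lemma vlinear_gammaI:
 assumes "!!x. h x \<in> vcarrier (gamma I)"
  and "!!f. f \<in> vcarrier (gamma_dual I) ==> vlinear V vfield (\<lambda>x. gamma_pairing I f (h x))"
 shows "vlinear V (gamma I) h" unfolding vlinear_def
proof (intro conjI ballI allI Pi_I)
 fix u v c assume uv: "u \<in> vcarrier V"
 show "h u \<in> vcarrier (gamma I)" by (rule assms(1))
 show "h (vscale V c u) = vscale (gamma I) c (h u)" by (rule gamma_ext[OF assms(1) vs_scale[OF vs_gamma assms(1)]])
   (simp only: vlinearD(3)[OF assms(2) uv] vlinearD(3)[OF gamma_pairing_linear assms(1)])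
 assume v: "v \<in> vcarrier V"
 show "h (vadd V u v) = vadd (gamma I) (h u) (h v)" by (rule gamma_ext[OF assms(1) vs_add[OF vs_gamma assms(1) assms(1)]])
   (simp only: vlinearD(2)[OF assms(2) uv v] vlinearD(2)[OF gamma_pairing_linear assms(1) assms(1)])
qed

lemma vlinear_sum: "(!!i. i \<in> A ==> vlinear V vfield (f i)) ==> vlinear V vfield (\<lambda>x. \<Sum>i\<in>A. f i x * c i)"
 by (auto simp: vlinear_def sum.distrib[symmetric] sum_distrib_left algebra_simps intro!: sum.cong)

definition gamma_rep :: "'a set => ('k::field, 'a) gamma_elt => 'a face => 'k" where
 "gamma_rep I E = (SOME d. d \<in> vcarrier (Lvee {I}) \<and> E = gamma_class I d)"

lemma gamma_rep:
 assumes "E \<in> vcarrier (gamma I)"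
 shows "gamma_rep I E \<in> vcarrier (Lvee {I})" "E = gamma_class I (gamma_rep I E)"
proof -
 have "\<exists>d. d \<in> vcarrier (Lvee {I}) \<and> E = gamma_class I d" using gammaE[OF assms] by blast
 from someI_ex[OF this] show "gamma_rep I E \<in> vcarrier (Lvee {I})" "E = gamma_class I (gamma_rep I E)" unfolding gamma_rep_def by blast+
qed

lemma gamma_pairing_rep: "E \<in> vcarrier (gamma I) ==> f \<in> vcarrier (gamma_dual I) ==> gamma_pairing I f E = face_pairing {I} f (gamma_rep I E)"
 using gamma_rep gamma_pairing_class by metis

text \<open>The transpose of the cut derivative on representatives: a pair of faces on
  \<open>C\<close> and \<open>D\<close> is glued and sent to the difference of the two opposite
  cuts. The order of gluing is a convention that disappears after pairing with a functional whose
  derivative is local.\<close>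

definition face_bracket :: "'a set => 'a set => ('a face => 'k::field) => ('a face => 'k) => 'a face => 'k" where
 "face_bracket C D a b = (\<lambda>X. \<Sum>(y, z)\<in>faces {C} \<times> faces {D}. a y * b z *
   (vbasis (face_cut {C \<union> D} (C, D) (face_glue D z C y)) X - vbasis (face_cut {C \<union> D} (D, C) (face_glue D z C y)) X))"

definition bracket :: "'a set => 'a set => ('k::field, 'a) gamma_elt => ('k, 'a) gamma_elt => ('k, 'a) gamma_elt" where
 "bracket C D x y = gamma_class (C \<union> D) (face_bracket C D (gamma_rep C x) (gamma_rep D y))"

context
 fixes C D :: "'a set"
 assumes fin: "finite C" "finite D" and CD: "C \<noteq> {}" "D \<noteq> {}" "C \<inter> D = {}"
begin

lemma face_bracket_cut:
 assumes "y \<in> faces {C}" "z \<in> faces {D}"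
 shows "face_cut {C \<union> D} (C, D) (face_glue D z C y) \<in> faces {C \<union> D}" "face_cut {C \<union> D} (D, C) (face_glue D z C y) \<in> faces {C \<union> D}"
proof -
 note p = pair_partition[OF fin CD] and g = pair_glue[OF fin CD assms]
 have fCD: "finite (C \<union> D)" using fin by simp
 show "face_cut {C \<union> D} (C, D) (face_glue D z C y) \<in> faces {C \<union> D}" "face_cut {C \<union> D} (D, C) (face_glue D z C y) \<in> faces {C \<union> D}"
  using face_cut(1)[OF fCD p(1,5)] face_cut_swap(1)[OF fCD p(1,5)] g(1) p(6) by auto
qed

lemma finite_faces_block: "finite (faces {C \<union> D})" using finite_faces[of "C \<union> D" "{C \<union> D}"] fin pair_partition[OF fin CD] by simp

lemma face_bracket_in: "face_bracket C D a b \<in> vcarrier (Lvee {C \<union> D})"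
proof -
 have "face_bracket C D a b X = 0" if "X \<notin> faces {C \<union> D}" for X unfolding face_bracket_def
 proof (rule sum.neutral, clarify)
  fix y z assume "y \<in> faces {C}" "z \<in> faces {D}"
  from face_bracket_cut[OF this] show "a y * b z *
   (vbasis (face_cut {C \<union> D} (C, D) (face_glue D z C y)) X - vbasis (face_cut {C \<union> D} (D, C) (face_glue D z C y)) X) = 0"
   using that by (auto simp: vbasis_def)
 qed
 moreover from this have "{X. face_bracket C D a b X \<noteq> 0} \<subseteq> faces {C \<union> D}" by blast
 ultimately show ?thesis unfolding Lvee_def vfree_carrier using finite_subset[OF _ finite_faces_block] by blast
qed

lemma face_bracket_pairing: "face_pairing {C \<union> D} f (face_bracket C D a b) =
  (\<Sum>(y, z)\<in>faces {C} \<times> faces {D}. a y * b z * cut_deriv {C \<union> D} (C, D) f (face_glue D z C y))"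
proof -
 have v: "(\<Sum>X\<in>faces {C \<union> D}. f X * vbasis W X) = f W" if "W \<in> faces {C \<union> D}" for W
 proof -
  have "(\<Sum>X\<in>faces {C \<union> D}. f X * vbasis W X) = (\<Sum>X\<in>faces {C \<union> D}. if X = W then f X else 0)" by (rule sum.cong) (auto simp: vbasis_def)
  then show ?thesis using that finite_faces_block by simp
 qed
 have "face_pairing {C \<union> D} f (face_bracket C D a b) = (\<Sum>X\<in>faces {C \<union> D}. \<Sum>(y, z)\<in>faces {C} \<times> faces {D}. f X * (a y * b z *
   (vbasis (face_cut {C \<union> D} (C, D) (face_glue D z C y)) X - vbasis (face_cut {C \<union> D} (D, C) (face_glue D z C y)) X)))"
  by (simp add: face_pairing_def face_bracket_def sum_distrib_left split_beta)
 also have "\<dots> = (\<Sum>(y, z)\<in>faces {C} \<times> faces {D}. \<Sum>X\<in>faces {C \<union> D}. f X * (a y * b z *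
   (vbasis (face_cut {C \<union> D} (C, D) (face_glue D z C y)) X - vbasis (face_cut {C \<union> D} (D, C) (face_glue D z C y)) X)))"
  by (subst sum.swap) (simp add: split_beta)
 also have "\<dots> = (\<Sum>(y, z)\<in>faces {C} \<times> faces {D}. a y * b z * cut_deriv {C \<union> D} (C, D) f (face_glue D z C y))"
 proof (rule sum.cong[OF refl], clarify)
  fix y z assume yz: "y \<in> faces {C}" "z \<in> faces {D}"
  note c = face_bracket_cut[OF yz]
  have "(\<Sum>X\<in>faces {C \<union> D}. f X * (a y * b z *
    (vbasis (face_cut {C \<union> D} (C, D) (face_glue D z C y)) X - vbasis (face_cut {C \<union> D} (D, C) (face_glue D z C y)) X)))
   = a y * b z * ((\<Sum>X\<in>faces {C \<union> D}. f X * vbasis (face_cut {C \<union> D} (C, D) (face_glue D z C y)) X)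
    - (\<Sum>X\<in>faces {C \<union> D}. f X * vbasis (face_cut {C \<union> D} (D, C) (face_glue D z C y)) X))"
   by (simp add: sum_subtractf[symmetric] sum_distrib_left algebra_simps)
  also have "\<dots> = a y * b z * cut_deriv {C \<union> D} (C, D) f (face_glue D z C y)"
   using v[OF c(1)] v[OF c(2)] pair_glue(1)[OF fin CD yz] pair_partition(6)[OF fin CD] by (simp add: cut_deriv_def)
  finally show "(\<Sum>X\<in>faces {C \<union> D}. f X * (a y * b z *
    (vbasis (face_cut {C \<union> D} (C, D) (face_glue D z C y)) X - vbasis (face_cut {C \<union> D} (D, C) (face_glue D z C y)) X)))
   = a y * b z * cut_deriv {C \<union> D} (C, D) f (face_glue D z C y)" .
 qed
 finally show ?thesis .
qed

lemma bracket_in: "bracket C D x y \<in> vcarrier (gamma (C \<union> D))" unfolding bracket_def by (rule gamma_class_in[OF face_bracket_in])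

text \<open>In a factorized derivative each factor meets only the representative on its own block.
  Since the \<open>p i\<close> and \<open>q i\<close> lie in \<open>\<Gamma>\<^sup>*\<close>, the
  resulting sum depends only on the classes of these representatives, so this formula is also the
  proof that the bracket is well defined.\<close>

lemma bracket_pairing:
 assumes x: "x \<in> vcarrier (gamma C)" and y: "y \<in> vcarrier (gamma D)" and f: "f \<in> vcarrier (gamma_dual (C \<union> D))"
  and pq: "!!i. i \<in> N ==> p i \<in> vcarrier (gamma_dual C)" "!!i. i \<in> N ==> q i \<in> vcarrier (gamma_dual D)"
  and eq: "!!X. X \<in> faces {C, D} ==> cut_deriv {C \<union> D} (C, D) f X = (\<Sum>i\<in>N. p i (face_restrict X C) * q i (face_restrict X D))"
 shows "gamma_pairing (C \<union> D) f (bracket C D x y) = (\<Sum>i\<in>N. gamma_pairing C (p i) x * gamma_pairing D (q i) y)"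
proof -
 let ?a = "gamma_rep C x" and ?b = "gamma_rep D y"
 have "gamma_pairing (C \<union> D) f (bracket C D x y) = face_pairing {C \<union> D} f (face_bracket C D ?a ?b)"
  unfolding bracket_def by (rule gamma_pairing_class[OF f])
 also have "\<dots> = (\<Sum>(y, z)\<in>faces {C} \<times> faces {D}. ?a y * ?b z * (\<Sum>i\<in>N. p i y * q i z))" unfolding face_bracket_pairing
  by (rule sum.cong) (use eq pair_glue[OF fin CD] in auto)
 also have "\<dots> = (\<Sum>(y, z)\<in>faces {C} \<times> faces {D}. \<Sum>i\<in>N. (p i y * ?a y) * (q i z * ?b z))" by (simp add: sum_distrib_left mult_ac)
 also have "\<dots> = (\<Sum>i\<in>N. \<Sum>(y, z)\<in>faces {C} \<times> faces {D}. (p i y * ?a y) * (q i z * ?b z))" by (simp add: split_beta, rule sum.swap)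
 also have "\<dots> = (\<Sum>i\<in>N. face_pairing {C} (p i) ?a * face_pairing {D} (q i) ?b)"
  unfolding face_pairing_def by (simp add: sum_product sum.cartesian_product)
 also have "\<dots> = (\<Sum>i\<in>N. gamma_pairing C (p i) x * gamma_pairing D (q i) y)"
  by (rule sum.cong) (use gamma_pairing_rep[OF x pq(1)] gamma_pairing_rep[OF y pq(2)] in auto)
 finally show ?thesis .
qed

lemma bracket_pairing_ex:
 assumes f: "f \<in> vcarrier (gamma_dual (C \<union> D))"
 obtains p q where "!!x y. x \<in> vcarrier (gamma C) ==> y \<in> vcarrier (gamma D) ==>
   gamma_pairing (C \<union> D) f (bracket C D x y) = (\<Sum>i\<in>faces {C}. gamma_pairing C (p i) x * gamma_pairing D (q i) y)"
  "!!i. i \<in> faces {C} ==> p i \<in> vcarrier (gamma_dual C)" "!!i. i \<in> faces {C} ==> q i \<in> vcarrier (gamma_dual D)"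
  "!!X. X \<in> faces {C, D} ==> cut_deriv {C \<union> D} (C, D) f X = (\<Sum>i\<in>faces {C}. p i (face_restrict X C) * q i (face_restrict X D))"
proof -
 obtain p q where pq: "!!i. i \<in> faces {C} ==> p i \<in> vcarrier (gamma_dual C)" "!!i. i \<in> faces {C} ==> q i \<in> vcarrier (gamma_dual D)"
  "!!X. X \<in> faces {C, D} ==> cut_deriv {C \<union> D} (C, D) f X = (\<Sum>i\<in>faces {C}. p i (face_restrict X C) * q i (face_restrict X D))"
  by (rule deriv_decompose[OF fin CD f]) (rule that)
 show ?thesis by (rule that[of p q]) (use bracket_pairing[OF _ _ f pq] pq in auto)
qed

text \<open>For each \<open>f\<close> the expansion of the derivative is fixed before the arguments
  enter, so the same \<open>p i\<close> and \<open>q i\<close> serve all of them, and the pairing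
  with \<open>f\<close> is visibly linear in either argument.\<close>

lemma bracket_bilin: "bilin (gamma C) (gamma D) (gamma (C \<union> D)) (bracket C D :: ('k::field, 'a) gamma_elt => _)"
proof -
 have 1: "vlinear (gamma C) (gamma (C \<union> D)) (\<lambda>x. bracket C D x y)" if y: "y \<in> vcarrier (gamma D)" for y :: "('k, 'a) gamma_elt"
 proof (rule vlinear_gammaI)
  fix f :: "'a face => 'k" assume f: "f \<in> vcarrier (gamma_dual (C \<union> D))"
  obtain p q where e: "!!x y. x \<in> vcarrier (gamma C) ==> y \<in> vcarrier (gamma D) ==>
    gamma_pairing (C \<union> D) f (bracket C D x y) = (\<Sum>i\<in>faces {C}. gamma_pairing C (p i) x * gamma_pairing D (q i) y)"
   "!!i. i \<in> faces {C} ==> p i \<in> vcarrier (gamma_dual C)" by (rule bracket_pairing_ex[OF f]) (rule that)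
  show "vlinear (gamma C) vfield (\<lambda>x. gamma_pairing (C \<union> D) f (bracket C D x y))"
   by (rule vlinear_cong[OF vs_gamma vlinear_sum[OF gamma_pairing_linear[OF e(2)]] e(1)[OF _ y]])
 qed (rule bracket_in)
 have 2: "vlinear (gamma D) (gamma (C \<union> D)) (bracket C D x)" if x: "x \<in> vcarrier (gamma C)" for x :: "('k, 'a) gamma_elt"
 proof (rule vlinear_gammaI)
  fix f :: "'a face => 'k" assume f: "f \<in> vcarrier (gamma_dual (C \<union> D))"
  obtain p q where e: "!!x y. x \<in> vcarrier (gamma C) ==> y \<in> vcarrier (gamma D) ==>
    gamma_pairing (C \<union> D) f (bracket C D x y) = (\<Sum>i\<in>faces {C}. gamma_pairing C (p i) x * gamma_pairing D (q i) y)"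
   "!!i. i \<in> faces {C} ==> q i \<in> vcarrier (gamma_dual D)" by (rule bracket_pairing_ex[OF f]) (rule that)
  show "vlinear (gamma D) vfield (\<lambda>y. gamma_pairing (C \<union> D) f (bracket C D x y))"
   by (rule vlinear_cong[OF vs_gamma vlinear_sum[where A = "faces {C}" and f = "\<lambda>i. gamma_pairing D (q i)" and c = "\<lambda>i. gamma_pairing C (p i) x", OF gamma_pairing_linear[OF e(2)]]])
    (assumption, rule trans[OF e(1)[OF x]], assumption, rule sum.cong[OF refl], rule mult.commute)
 qed (rule bracket_in)
 show ?thesis unfolding bilin_def using 1 2 by blast
qed

end

text \<open>Reversing the cut changes the sign of the derivative. An expansion for
  \<open>[D, C]\<close> is thus obtained from one for \<open>[C, D]\<close> by exchanging the
  factors and negating the \<open>p i\<close>.\<close>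

lemma bracket_antisym:
 fixes x y :: "('k::field, 'a) gamma_elt"
 assumes fin: "finite C" "finite D" and CD: "C \<noteq> {}" "D \<noteq> {}" "C \<inter> D = {}"
  and x: "x \<in> vcarrier (gamma C)" and y: "y \<in> vcarrier (gamma D)"
 shows "bracket D C y x = vscale (gamma (C \<union> D)) (-1) (bracket C D x y)"
proof (rule gamma_ext)
 have DC: "D \<inter> C = {}" and U: "D \<union> C = C \<union> D" using CD by auto
 note b = bracket_in[OF fin CD] and b' = bracket_in[OF fin(2,1) CD(2,1) DC, unfolded U]
 show "bracket D C y x \<in> vcarrier (gamma (C \<union> D))" by (rule b')
 show "vscale (gamma (C \<union> D)) (-1) (bracket C D x y) \<in> vcarrier (gamma (C \<union> D))" by (intro b vs_scale vs_gamma)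
 fix f :: "'a face => 'k" assume f: "f \<in> vcarrier (gamma_dual (C \<union> D))"
 obtain p q where e: "!!x y. x \<in> vcarrier (gamma C) ==> y \<in> vcarrier (gamma D) ==>
   gamma_pairing (C \<union> D) f (bracket C D x y) = (\<Sum>i\<in>faces {C}. gamma_pairing C (p i) x * gamma_pairing D (q i) y)"
  "!!i. i \<in> faces {C} ==> p i \<in> vcarrier (gamma_dual C)" "!!i. i \<in> faces {C} ==> q i \<in> vcarrier (gamma_dual D)"
  "!!X. X \<in> faces {C, D} ==> cut_deriv {C \<union> D} (C, D) f X = (\<Sum>i\<in>faces {C}. p i (face_restrict X C) * q i (face_restrict X D))"
  by (rule bracket_pairing_ex[OF fin CD f]) (rule that)
 have p': "(\<lambda>X. (-1) * p i X) \<in> vcarrier (gamma_dual C)" if "i \<in> faces {C}" for i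
  using vs_scale[OF vs_gamma_dual[OF fin(1)] e(2)[OF that], of "-1"] by simp
 have sw: "cut_deriv {C \<union> D} (D, C) f X = - cut_deriv {C \<union> D} (C, D) f X" for X by (simp add: cut_deriv_def cut_target_swap[of _ D C])
 have "gamma_pairing (D \<union> C) f (bracket D C y x) = (\<Sum>i\<in>faces {C}. gamma_pairing D (q i) y * gamma_pairing C (\<lambda>X. (-1) * p i X) x)"
 proof (rule bracket_pairing[OF fin(2,1) CD(2,1) DC y x])
  show "f \<in> vcarrier (gamma_dual (D \<union> C))" using f U by simp
  fix X assume "X \<in> faces {D, C}"
  then have X: "X \<in> faces {C, D}" by (simp add: insert_commute)
  show "cut_deriv {D \<union> C} (D, C) f X = (\<Sum>i\<in>faces {C}. q i (face_restrict X D) * ((-1) * p i (face_restrict X C)))"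
   unfolding U sw e(4)[OF X] by (simp add: sum_negf[symmetric] mult.commute)
 qed (use e p' in auto)
 also have "\<dots> = - (\<Sum>i\<in>faces {C}. gamma_pairing C (p i) x * gamma_pairing D (q i) y)" unfolding sum_negf[symmetric]
  by (rule sum.cong) (use gamma_pairing_scale[OF e(2) fin(1) x, of _ "-1"] in auto)
 also have "\<dots> = - gamma_pairing (C \<union> D) f (bracket C D x y)" using e(1)[OF x y] by simp
 finally show "gamma_pairing (C \<union> D) f (bracket D C y x) = gamma_pairing (C \<union> D) f (vscale (gamma (C \<union> D)) (-1) (bracket C D x y))"
  using vlinearD(3)[OF gamma_pairing_linear[OF f] b] U by simp
qed

section \<open>Tree brackets and the dual of the tree derivative\<close>

abbreviation ground :: "'a set ltree => 'a set" where "ground t \<equiv> \<Union>(set (leaves t))"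

fun tree_bracket :: "'a set ltree => ('a set => ('k::field, 'a) gamma_elt) => ('k, 'a) gamma_elt" where
 "tree_bracket (Leaf B) x = x B"
| "tree_bracket (Node n l r) x = bracket (ground l) (ground r) (tree_bracket l x) (tree_bracket r x)"

definition block_tree :: "'a set ltree => bool" where
 "block_tree t \<longleftrightarrow> distinct (leaves t) \<and> finite (ground t) \<and> partition_on (ground t) (set (leaves t))"

lemma leaves_ne [simp]: "leaves t \<noteq> []" by (induction t) auto

lemma block_tree_Node:
 assumes "block_tree (Node n l r)"
 shows "block_tree l" "block_tree r" "ground l \<inter> ground r = {}" "ground l \<noteq> {}" "ground r \<noteq> {}" "finite (ground l)" "finite (ground r)"
proof -
 have p: "partition_on (ground (Node n l r)) (set (leaves l) \<union> set (leaves r))"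
  and d: "distinct (leaves l)" "distinct (leaves r)" "set (leaves l) \<inter> set (leaves r) = {}"
  and f: "finite (ground l \<union> ground r)" using assms by (auto simp: block_tree_def)
 have dj: "A \<inter> B = {}" if "A \<in> set (leaves l) \<union> set (leaves r)" "B \<in> set (leaves l) \<union> set (leaves r)" "A \<noteq> B" for A B
  using p that unfolding partition_on_def disjoint_def by blast
 have ne: "B \<noteq> {}" if "B \<in> set (leaves l) \<union> set (leaves r)" for B using p that by (auto simp: partition_on_def)
 have pl: "partition_on (ground l) (set (leaves l))" "partition_on (ground r) (set (leaves r))"
  by (rule partition_onI; use dj ne in \<open>auto simp: disjnt_def\<close>)+
 show "finite (ground l)" "finite (ground r)" using f by auto
 then show "block_tree l" "block_tree r" using d pl by (auto simp: block_tree_def)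
 have "A \<inter> B = {}" if "A \<in> set (leaves l)" "B \<in> set (leaves r)" for A B using dj[of A B] that d(3) by blast
 then show "ground l \<inter> ground r = {}" by blast
 have "ground t \<noteq> {}" if "set (leaves t) \<subseteq> set (leaves l) \<union> set (leaves r)" for t
 proof -
  obtain B where "B \<in> set (leaves t)" using leaves_ne[of t] by (metis list.set_intros(1) neq_Nil_conv)
  then show ?thesis using ne[of B] that by blast
 qed
 then show "ground l \<noteq> {}" "ground r \<noteq> {}" by auto
qed

lemma block_treeI: "distinct (leaves t) ==> partition_on S (set (leaves t)) ==> finite S ==> block_tree t \<and> ground t = S"
 by (auto simp: block_tree_def partition_on_def)

lemma tree_bracket_in: "block_tree t ==> (!!B. B \<in> set (leaves t) ==> x B \<in> vcarrier (gamma B)) ==> tree_bracket t x \<in> vcarrier (gamma (ground t))"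
proof (induction t)
 case (Node n l r)
 note b = block_tree_Node[OF Node.prems(1)]
 show ?case using bracket_in[OF b(6,7,4,5,3)] by simp
qed simp

lemma tree_bracket_cong: "(!!B. B \<in> set (leaves t) ==> x B = y B) ==> tree_bracket t x = tree_bracket t y" by (induction t) auto

lemma tree_bracket_rank_map [simp]: "tree_bracket (rank_map f t) x = tree_bracket t x" by (induction t) auto

text \<open>Ranks do not enter the recursion. This disposes of the relations that identify trees
  differing only in their layering.\<close>

lemma tree_bracket_shape: "shape t = shape t' ==> tree_bracket t x = tree_bracket t' x \<and> leaves t = leaves t'"
proof (induction t arbitrary: t')
 case (Leaf b) then show ?case by (cases t') auto
next
 case (Node n l r)
 then obtain m l' r' where t': "t' = Node m l' r'" "shape l = shape l'" "shape r = shape r'" by (cases t') auto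
 show ?case using Node.IH(1)[OF t'(2)] Node.IH(2)[OF t'(3)] t'(1) by simp
qed

lemma tree_bracket_graft: "(!!b. b \<in> set (leaves t) ==> ground (U b) = b) ==>
  tree_bracket (graft t U) x = tree_bracket t (\<lambda>b. tree_bracket (U b) x) \<and> ground (graft t U) = ground t" by (induction t) auto

lemma bracketD:
 assumes "finite C" "finite D" "C \<noteq> {}" "D \<noteq> {}" "C \<inter> D = {}"
 shows "y \<in> vcarrier (gamma D) ==> vlinear (gamma C) (gamma (C \<union> D)) (\<lambda>x. bracket C D x y)"
  "x \<in> vcarrier (gamma C) ==> vlinear (gamma D) (gamma (C \<union> D)) (bracket C D x)" using bracket_bilin[OF assms] by (auto simp: bilin_def)

text \<open>The label \<open>S\<close> occurs at exactly one leaf, so varying its argument moves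
  only one of the two subtrees at each node on the way up, and the brackets there are linear in that
  subtree.\<close>

lemma tree_bracket_upd:
 assumes "block_tree t" "S \<in> set (leaves t)" "!!B. B \<in> set (leaves t) ==> x B \<in> vcarrier (gamma B)"
 shows "vlinear (gamma S) (gamma (ground t)) (\<lambda>u. tree_bracket t (x(S := u)))" using assms
proof (induction t)
 case (Leaf B)
 then show ?case by (simp add: vlinear_def)
next
 case (Node n l r)
 note b = block_tree_Node[OF Node.prems(1)]
 note br = bracketD[OF b(6,7,4,5,3)]
 have d: "set (leaves l) \<inter> set (leaves r) = {}" using Node.prems(1) by (auto simp: block_tree_def)
 have xl: "!!B. B \<in> set (leaves l) ==> x B \<in> vcarrier (gamma B)"
  and xr: "!!B. B \<in> set (leaves r) ==> x B \<in> vcarrier (gamma B)" using Node.prems(3) by auto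
 show ?case
 proof (cases "S \<in> set (leaves l)")
  case True
  have r: "tree_bracket r (x(S := u)) = tree_bracket r x" for u using True d by (intro tree_bracket_cong) auto
  have "tree_bracket r x \<in> vcarrier (gamma (ground r))" using Node.prems(3) by (intro tree_bracket_in b) auto
  from vlinear_comp[OF Node.IH(1)[OF b(1) True xl] br(1)[OF this]] show ?thesis
   by (simp only: tree_bracket.simps leaves.simps set_append Union_Un_distrib r)
 next
  case False
  then have S: "S \<in> set (leaves r)" using Node.prems(2) by auto
  have l: "tree_bracket l (x(S := u)) = tree_bracket l x" for u using False by (intro tree_bracket_cong) auto
  have "tree_bracket l x \<in> vcarrier (gamma (ground l))" using Node.prems(3) by (intro tree_bracket_in b) auto
  from vlinear_comp[OF Node.IH(2)[OF b(2) S xr] br(2)[OF this]] show ?thesis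
   by (simp only: tree_bracket.simps leaves.simps set_append Union_Un_distrib l)
 qed
qed

lemma tree_bracket_mlin:
 fixes t :: "'a set ltree"
 assumes t: "block_tree t" and P: "set (leaves t) = P" "ground t = I"
 shows "mlin P gamma (gamma I) (tree_bracket t :: _ => ('k::field, 'a) gamma_elt)"
proof -
 have lin: "vlinear (gamma S) (gamma I) (\<lambda>u. tree_bracket t (x(S := u)))"
  if "x \<in> fams P gamma" "S \<in> P" for x :: "'a set => ('k, 'a) gamma_elt" and S using tree_bracket_upd[OF t, of S x] P that by auto
 show ?thesis unfolding mlin_def
 proof (intro ballI conjI allI)
  fix x :: "'a set => ('k, 'a) gamma_elt" assume x: "x \<in> fams P gamma"
  show "tree_bracket t x \<in> vcarrier (gamma I)" using tree_bracket_in[OF t, of x] P x by auto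
  fix S assume S: "S \<in> P"
  show "tree_bracket t (x(S := vadd (gamma S) u w)) = vadd (gamma I) (tree_bracket t (x(S := u))) (tree_bracket t (x(S := w)))"
   if "u \<in> vcarrier (gamma S)" "w \<in> vcarrier (gamma S)" for u w by (rule vlinearD(2)[OF lin[OF x S] that])
  show "tree_bracket t (x(S := vscale (gamma S) c u)) = vscale (gamma I) c (tree_bracket t (x(S := u)))"
   if "u \<in> vcarrier (gamma S)" for u c by (rule vlinearD(3)[OF lin[OF x S] that])
 qed
qed

text \<open>Evaluation of a function on the faces of \<open>Q\<close> at a family of elements of \<open>\<Gamma>\<close>. It depends on the
 chosen representatives, except on the span of the products.\<close>

definition glue_eval :: "'a set set => ('a set => ('k::field, 'a) gamma_elt) => ('a face => 'k) => 'k" where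
 "glue_eval Q x G = (\<Sum>y\<in>(\<Pi>\<^sub>E B\<in>Q. faces {B}). (\<Prod>B\<in>Q. gamma_rep B (x B) (y B)) * G (glue_all Q y))"

text \<open>Their span is a concrete description, inside the functionals on faces, of the image of
  the external product on the spaces \<open>\<Gamma>\<^sup>*\<close> of the blocks.\<close>

abbreviation gamma_products :: "'a set set => ('a face => 'k::field) set" where
 "gamma_products Q \<equiv> prod_fun Q ` {g. \<forall>B\<in>Q. g B \<in> vcarrier (gamma_dual B)}"

lemma glue_eval_linear: "vlinear (Lvee_dual Q) vfield (glue_eval Q x)"
 by (auto simp: vlinear_def glue_eval_def algebra_simps sum.distrib sum_distrib_left)

lemma glue_eval_sum: "glue_eval Q x (\<lambda>X. \<Sum>i\<in>A. G i X) = (\<Sum>i\<in>A. glue_eval Q x (G i))"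
 unfolding glue_eval_def sum_distrib_left by (rule sum.swap)

lemma glue_eval_add: "glue_eval Q x (\<lambda>X. F X + G X) = glue_eval Q x F + glue_eval Q x G"
 by (simp add: glue_eval_def algebra_simps sum.distrib)

text \<open>Expanding the product of the face pairings gives a sum over families of faces, one for
  each block. A product functional at a face glued from such a family is the product of its
  factors.\<close>

lemma glue_eval_prod_fun:
 assumes I: "finite I" and Q: "partition_on I Q"
  and g: "!!B. B \<in> Q ==> g B \<in> vcarrier (gamma_dual B)" and x: "!!B. B \<in> Q ==> x B \<in> vcarrier (gamma B)"
 shows "glue_eval Q x (prod_fun Q g) = (\<Prod>B\<in>Q. gamma_pairing B (g B) (x B))"
proof -
 have "(\<Prod>B\<in>Q. gamma_pairing B (g B) (x B)) = (\<Prod>B\<in>Q. \<Sum>X\<in>faces {B}. g B X * gamma_rep B (x B) X)"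
  by (rule prod.cong[OF refl]) (simp only: gamma_pairing_rep[OF x g] face_pairing_def)
 also have "\<dots> = (\<Sum>y\<in>(\<Pi>\<^sub>E B\<in>Q. faces {B}). \<Prod>B\<in>Q. g B (y B) * gamma_rep B (x B) (y B))" by (rule prod_sum_PiE)
   (use partition_on_finite[OF I Q] finite_faces partition_block_finite[OF I Q] partition_on_block[OF Q] in blast)+
 also have "\<dots> = glue_eval Q x (prod_fun Q g)" unfolding glue_eval_def
 proof (rule sum.cong[OF refl])
  fix y assume "y \<in> (\<Pi>\<^sub>E B\<in>Q. faces {B})"
  then have y: "!!B. B \<in> Q ==> y B \<in> faces {B}" by auto
  note gl = glue_all[of I Q y, OF I Q y]
  have "prod_fun Q g (glue_all Q y) = (\<Prod>B\<in>Q. g B (y B))" using gl by (simp add: prod_fun_def)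
  then show "(\<Prod>B\<in>Q. g B (y B) * gamma_rep B (x B) (y B)) = (\<Prod>B\<in>Q. gamma_rep B (x B) (y B)) * prod_fun Q g (glue_all Q y)"
   by (simp add: prod.distrib mult.commute)
 qed
 finally show ?thesis by simp
qed

text \<open>A set inside another block contains neither \<open>C\<close> nor \<open>D\<close>, so
  the cut leaves its sign alone. Hence only the restriction to \<open>C \<union> D\<close> changes,
  and there the cut is the cut of the one-block partition.\<close>

lemma face_restrict_cut:
 assumes I: "finite I" and P: "partition_on I P" and V: "valid_cut P (C, D)" and X: "X \<in> faces (cut_target P (C, D))"
 shows "face_restrict X (C \<union> D) \<in> faces {C, D}" "face_restrict (face_restrict X (C \<union> D)) C = face_restrict X C"
  "face_restrict (face_restrict X (C \<union> D)) D = face_restrict X D"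
  "face_restrict (face_cut P (C, D) X) (C \<union> D) = face_cut {C \<union> D} (C, D) (face_restrict X (C \<union> D))"
  "S \<in> P ==> S \<noteq> C \<union> D ==> face_restrict (face_cut P (C, D) X) S = face_restrict X S"
proof -
 note c = cut_parts[OF P V] and Q = partition_on_cut[OF P V]
 have sub: "{C, D} \<subseteq> cut_target P (C, D)" using c(1) by auto
 have CDI: "C \<union> D \<subseteq> I" using c(6) UnP[OF I P] by auto
 have fin: "finite C" "finite D" using finite_subset[OF CDI I] by auto
 have fCD: "finite (C \<union> D)" using fin by simp
 note pp = pair_partition[OF fin c(8,9,7)]
 note r = face_restrict[OF I Q sub X]
 have r1: "face_restrict X (C \<union> D) \<in> faces {C, D}" using r(1) by simp
 have r2: "E \<subseteq> C \<union> D ==> face_sign (face_restrict X (C \<union> D)) E = face_sign X E" for E using r(2)[of E] by simp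
 show "face_restrict X (C \<union> D) \<in> faces {C, D}" by (rule r1)
 have CQ: "C \<in> cut_target P (C, D)" "D \<in> cut_target P (C, D)" using sub by auto
 show "face_restrict (face_restrict X (C \<union> D)) C = face_restrict X C"
  by (rule face_restrict_eqI[OF fCD pp(4) _ r1 face_restrict_block(1)[OF I Q CQ(1) X]])
   (use r2 face_restrict_block(2)[OF I Q CQ(1) X] in auto)
 show "face_restrict (face_restrict X (C \<union> D)) D = face_restrict X D"
  by (rule face_restrict_eqI[OF fCD pp(4) _ r1 face_restrict_block(1)[OF I Q CQ(2) X]])
   (use r2 face_restrict_block(2)[OF I Q CQ(2) X] in auto)
 note cX = face_cut[OF I P V X]
 have r1': "face_restrict X (C \<union> D) \<in> faces (cut_target {C \<union> D} (C, D))" using r1 pp(6) by simp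
 note cR = face_cut[OF fCD pp(1,5) r1']
 show "face_restrict (face_cut P (C, D) X) (C \<union> D) = face_cut {C \<union> D} (C, D) (face_restrict X (C \<union> D))"
 proof (rule face_restrict_eqI[OF I P c(6) cX(1) cR(1)])
  fix E assume E: "E \<subseteq> C \<union> D"
  then have "E \<subseteq> I" using CDI by auto
  then show "face_sign (face_cut P (C, D) X) E = face_sign (face_cut {C \<union> D} (C, D) (face_restrict X (C \<union> D))) E"
   using cX(2) cR(2) r2 E by simp
 qed
 assume S: "S \<in> P" "S \<noteq> C \<union> D"
 have SQ: "S \<in> cut_target P (C, D)" using S c(1) by auto
 have dj: "S \<inter> (C \<union> D) = {}" using P S c(6) by (auto simp: partition_on_def disjoint_def)
 show "face_restrict (face_cut P (C, D) X) S = face_restrict X S"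
 proof (rule face_restrict_eqI[OF I P S(1) cX(1) face_restrict_block(1)[OF I Q SQ X]])
  fix E assume E: "E \<subseteq> S"
  have "\<not> C \<subseteq> E" "\<not> D \<subseteq> E" using E dj c(8,9) by auto
  moreover have "E \<subseteq> I" using E S UnP[OF I P] by auto
  ultimately show "face_sign (face_cut P (C, D) X) E = face_sign (face_restrict X S) E"
   using cX(2)[of E] face_restrict_block(2)[OF I Q SQ X E] by simp
 qed
qed

text \<open>The two opposite cuts of \<open>X\<close> have the same restrictions to all blocks other
  than \<open>C \<union> D\<close>, so the corresponding factors can be taken out of the
  difference.\<close>

lemma cut_deriv_prod_fun:
 assumes I: "finite I" and P: "partition_on I P" and V: "valid_cut P (C, D)" and X: "X \<in> faces (cut_target P (C, D))"
 shows "cut_deriv P (C, D) (prod_fun P g) X =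
  cut_deriv {C \<union> D} (C, D) (g (C \<union> D)) (face_restrict X (C \<union> D)) * (\<Prod>S\<in>P - {C \<union> D}. g S (face_restrict X S))"
proof -
 note c = cut_parts[OF P V] and r = face_restrict_cut[OF I P V X]
 have V': "valid_cut P (D, C)" and X': "X \<in> faces (cut_target P (D, C))"
  using V X by (simp_all add: valid_cut_swap cut_target_swap[of P D C])
 note r' = face_restrict_cut[OF I P V' X']
 have fP: "finite P" using partition_on_finite[OF I P] .
 have U: "D \<union> C = C \<union> D" by auto
 have t: "cut_target {C \<union> D} (C, D) = {C, D}" by (simp add: cut_target_def)
 have p: "prod_fun P g Y = g (C \<union> D) (face_restrict Y (C \<union> D)) * (\<Prod>S\<in>P - {C \<union> D}. g S (face_restrict Y S))"
  if "Y \<in> faces P" for Y using that prod.remove[OF fP c(6)] by (simp add: prod_fun_def)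
 have pr: "(\<Prod>S\<in>P - {C \<union> D}. g S (face_restrict (face_cut P (C, D) X) S)) = (\<Prod>S\<in>P - {C \<union> D}. g S (face_restrict X S))"
  "(\<Prod>S\<in>P - {C \<union> D}. g S (face_restrict (face_cut P (D, C) X) S)) = (\<Prod>S\<in>P - {C \<union> D}. g S (face_restrict X S))"
  by (rule prod.cong; use r(5) r'(5) U in auto)+
 show ?thesis using X r(1,4) r'(4) face_cut(1)[OF I P V X] face_cut_swap(1)[OF I P V X] by (simp add: cut_deriv_def p pr t U algebra_simps)
qed

lemma prod_cut_target:
 fixes h :: "'a set => 'k::field"
 assumes "finite I" "partition_on I P" "valid_cut P (C, D)"
 shows "(\<Prod>S\<in>cut_target P (C, D). h S) = h C * h D * (\<Prod>S\<in>P - {C \<union> D}. h S)"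
proof -
 note c = cut_parts[OF assms(2,3)]
 have "finite (P - {C \<union> D})" using partition_on_finite[OF assms(1,2)] by simp
 then show ?thesis unfolding c(1) using c(3-5) by simp
qed

text \<open>Induction on the first cut. It acts on the factor of the block
  \<open>C \<union> D\<close> alone, whose derivative is a sum of products \<open>p i\<close>,
  \<open>q i\<close>; the outcome is a sum of product functionals over the refined partition, to
  which the induction hypothesis applies. On the evaluation side the same sum is the pairing with a
  bracket. The span statement is carried along because evaluation is independent of representatives
  only on that span.\<close>

lemma forest_deriv_prod_fun:
 fixes g :: "'a set => 'a face => 'k::field"
 assumes I: "finite I" and P: "partition_on I P" and lay: "layered_forest P F"
  and g: "!!S. S \<in> P ==> g S \<in> vcarrier (gamma_dual S)"
 shows "cuts_deriv P (forest_cuts P F) (prod_fun P g) \<in> vspan (Lvee_dual (forest_target P F)) (gamma_products (forest_target P F))"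
  and "(!!B. B \<in> forest_target P F ==> x B \<in> vcarrier (gamma B)) ==>
   glue_eval (forest_target P F) x (cuts_deriv P (forest_cuts P F) (prod_fun P g)) =
   (\<Prod>S\<in>P. gamma_pairing S (g S) (tree_bracket (F S) x))"
proof -
 have "\<forall>g :: 'a set => 'a face => 'k. (\<forall>S\<in>P. g S \<in> vcarrier (gamma_dual S)) \<longrightarrow>
  cuts_deriv P (forest_cuts P F) (prod_fun P g) \<in> vspan (Lvee_dual (forest_target P F)) (gamma_products (forest_target P F)) \<and>
  ((\<forall>B\<in>forest_target P F. x B \<in> vcarrier (gamma B)) \<longrightarrow>
   glue_eval (forest_target P F) x (cuts_deriv P (forest_cuts P F) (prod_fun P g)) =
   (\<Prod>S\<in>P. gamma_pairing S (g S) (tree_bracket (F S) x)))" using I P lay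
 proof (induct rule: forest_induct)
  case (sticks P F)
  then show ?case using glue_eval_prod_fun[OF I sticks(1), of _ x] by (auto intro!: vspan.base)
 next
  case (step P F C D F')
  note P = step(1) and V = step(2) and Q = step(3) and st = step(4) and lay' = step(5)
  note c = cut_parts[OF P V]
  let ?P' = "cut_target P (C, D)" and ?T = "forest_target P F"
  let ?Vs = "forest_cuts (cut_target P (C, D)) F'"
  have T: "?T = forest_target ?P' F'" by (rule step(8))
  have CDI: "C \<union> D \<subseteq> I" using c(6) UnP[OF I P] by auto
  have fin: "finite C" "finite D" using finite_subset[OF CDI I] by auto
  show ?case
  proof (intro allI impI)
   fix g :: "'a set => 'a face => 'k" assume g: "\<forall>S\<in>P. g S \<in> vcarrier (gamma_dual S)"
   have gCD: "g (C \<union> D) \<in> vcarrier (gamma_dual (C \<union> D))" using g c(6) by blast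
   obtain p q where pq: "!!x y. x \<in> vcarrier (gamma C) ==> y \<in> vcarrier (gamma D) ==>
     gamma_pairing (C \<union> D) (g (C \<union> D)) (bracket C D x y) = (\<Sum>i\<in>faces {C}. gamma_pairing C (p i) x * gamma_pairing D (q i) y)"
    "!!i. i \<in> faces {C} ==> p i \<in> vcarrier (gamma_dual C)" "!!i. i \<in> faces {C} ==> q i \<in> vcarrier (gamma_dual D)"
    "!!X. X \<in> faces {C, D} ==> cut_deriv {C \<union> D} (C, D) (g (C \<union> D)) X = (\<Sum>i\<in>faces {C}. p i (face_restrict X C) * q i (face_restrict X D))"
    by (rule bracket_pairing_ex[OF fin c(8,9,7) gCD]) (rule that)
   \<comment> \<open>The factor at \<open>C \<union> D\<close> gives way to \<open>p i\<close> and
     \<open>q i\<close>. Since \<open>C\<close> and \<open>D\<close> are not blocks of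
     \<open>P\<close>, none of the other factors is lost.\<close>
   define G where "G i = g(C := p i, D := q i)" for i
   have Gin: "\<forall>S\<in>?P'. G i S \<in> vcarrier (gamma_dual S)" if "i \<in> faces {C}" for i using g pq(2,3)[OF that] unfolding c(1) G_def by auto
   have GCD: "G i C = p i" "G i D = q i" for i using c(5) by (simp_all add: G_def)
   have Gg: "G i S = g S" if "S \<in> P - {C \<union> D}" for i S using that c(3,4) by (auto simp: G_def)
   have fC: "finite (faces {C})" using finite_faces[OF fin(1) pair_partition(2)[OF fin c(8,9,7)]] .
   have deriv: "cut_deriv P (C, D) (prod_fun P g) = (\<lambda>X. \<Sum>i\<in>faces {C}. prod_fun ?P' (G i) X)"
   proof
    fix X
    show "cut_deriv P (C, D) (prod_fun P g) X = (\<Sum>i\<in>faces {C}. prod_fun ?P' (G i) X)"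
    proof (cases "X \<in> faces ?P'")
     case True
     note r = face_restrict_cut[OF I P V True]
     have "prod_fun ?P' (G i) X = p i (face_restrict X C) * q i (face_restrict X D) * (\<Prod>S\<in>P - {C \<union> D}. g S (face_restrict X S))" for i
     proof -
      have "(\<Prod>S\<in>P - {C \<union> D}. G i S (face_restrict X S)) = (\<Prod>S\<in>P - {C \<union> D}. g S (face_restrict X S))"
       by (rule prod.cong[OF refl]) (simp only: Gg)
      then show ?thesis using True prod_cut_target[OF I P V, of "\<lambda>S. G i S (face_restrict X S)"] by (simp add: prod_fun_def GCD)
     qed
     then show ?thesis using cut_deriv_prod_fun[OF I P V True, of g] pq(4)[OF r(1)] r(2,3) by (simp add: sum_distrib_right)
    qed (simp add: cut_deriv_def prod_fun_def)
   qed
   have eq: "cuts_deriv P (forest_cuts P F) (prod_fun P g) = (\<lambda>X. \<Sum>i\<in>faces {C}. cuts_deriv ?P' ?Vs (prod_fun ?P' (G i)) X)"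
    unfolding step(7) by (simp add: deriv cuts_deriv_sum[OF fC])
   have IH1: "cuts_deriv ?P' ?Vs (prod_fun ?P' (G i)) \<in> vspan (Lvee_dual ?T) (gamma_products ?T)" if "i \<in> faces {C}" for i
    using step(6) Gin[OF that] unfolding T by blast
   show "cuts_deriv P (forest_cuts P F) (prod_fun P g) \<in> vspan (Lvee_dual ?T) (gamma_products ?T) \<and> ((\<forall>B\<in>?T. x B \<in> vcarrier (gamma B)) \<longrightarrow>
     glue_eval ?T x (cuts_deriv P (forest_cuts P F) (prod_fun P g)) = (\<Prod>S\<in>P. gamma_pairing S (g S) (tree_bracket (F S) x)))"
   proof (intro conjI impI)
    have sub: "gamma_products ?T \<subseteq> vcarrier (Lvee_dual ?T)" by (auto simp: prod_fun_def Lvee_dual_carrier)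
    have vsp: "vsub (Lvee_dual ?T) (vspan (Lvee_dual ?T) (gamma_products ?T) :: ('a face => 'k) set)"
     by (rule vspan_sub[OF vs_Lvee_dual sub])
    have "cuts_deriv P (forest_cuts P F) (prod_fun P g) = vsum (Lvee_dual ?T) (\<lambda>i. cuts_deriv ?P' ?Vs (prod_fun ?P' (G i))) (faces {C})"
     unfolding eq by (rule vsum_Lvee_dual[symmetric, OF fC]) (rule vspan_closed[OF vs_Lvee_dual sub IH1])
    then show "cuts_deriv P (forest_cuts P F) (prod_fun P g) \<in> vspan (Lvee_dual ?T) (gamma_products ?T)"
     using vspan_vsum[OF fC vs_Lvee_dual vsp, OF Pi_I, OF IH1] by simp
   next
    assume x: "\<forall>B\<in>?T. x B \<in> vcarrier (gamma B)"
    have LT: "block_tree (F' S) \<and> ground (F' S) = S" if "S \<in> ?P'" for S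
     using lay' that partition_block_finite[OF I Q that] block_treeI[of "F' S" S] by (auto simp: layered_forest_def)
    have lv: "x B \<in> vcarrier (gamma B)" if "S \<in> ?P'" "B \<in> set (leaves (F' S))" for S B
    proof -
     have "B \<in> ?T" unfolding T unfolding forest_target_def using that by auto
     then show ?thesis using x by blast
    qed
    have CDP: "C \<in> ?P'" "D \<in> ?P'" using c(1) by auto
    have tC: "tree_bracket (F' C) x \<in> vcarrier (gamma C)" "tree_bracket (F' D) x \<in> vcarrier (gamma D)"
     using tree_bracket_in[of "F' C" x] tree_bracket_in[of "F' D" x] LT CDP lv by auto
    have FCD: "tree_bracket (F (C \<union> D)) x = bracket C D (tree_bracket (F' C) x) (tree_bracket (F' D) x)"
     using st LT[OF CDP(1)] LT[OF CDP(2)] by (simp add: forest_step_def)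
    have FS: "tree_bracket (F S) x = tree_bracket (F' S) x" if "S \<in> P - {C \<union> D}" for S using st that by (simp add: forest_step_def)
    let ?R = "\<Prod>S\<in>P - {C \<union> D}. gamma_pairing S (g S) (tree_bracket (F S) x)"
    have "glue_eval ?T x (cuts_deriv P (forest_cuts P F) (prod_fun P g)) =
      (\<Sum>i\<in>faces {C}. glue_eval ?T x (cuts_deriv ?P' ?Vs (prod_fun ?P' (G i))))" unfolding eq by (rule glue_eval_sum)
    also have "\<dots> = (\<Sum>i\<in>faces {C}. \<Prod>S\<in>?P'. gamma_pairing S (G i S) (tree_bracket (F' S) x))"
     using step(6) Gin x unfolding T by (intro sum.cong) auto
    also have "\<dots> = (\<Sum>i\<in>faces {C}. gamma_pairing C (p i) (tree_bracket (F' C) x) * gamma_pairing D (q i) (tree_bracket (F' D) x) * ?R)"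
    proof (rule sum.cong[OF refl])
     fix i assume "i \<in> faces {C}"
     have "(\<Prod>S\<in>P - {C \<union> D}. gamma_pairing S (G i S) (tree_bracket (F' S) x)) = ?R" by (rule prod.cong[OF refl]) (simp only: Gg FS)
     then show "(\<Prod>S\<in>?P'. gamma_pairing S (G i S) (tree_bracket (F' S) x)) =
       gamma_pairing C (p i) (tree_bracket (F' C) x) * gamma_pairing D (q i) (tree_bracket (F' D) x) * ?R"
      using prod_cut_target[OF I P V, of "\<lambda>S. gamma_pairing S (G i S) (tree_bracket (F' S) x)"] by (simp add: GCD)
    qed
    also have "\<dots> = gamma_pairing (C \<union> D) (g (C \<union> D)) (tree_bracket (F (C \<union> D)) x) * ?R"
     unfolding FCD pq(1)[OF tC] by (simp add: sum_distrib_right)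
    also have "\<dots> = (\<Prod>S\<in>P. gamma_pairing S (g S) (tree_bracket (F S) x))"
     using prod.remove[OF partition_on_finite[OF I P] c(6), of "\<lambda>S. gamma_pairing S (g S) (tree_bracket (F S) x)"] by simp
    finally show "glue_eval ?T x (cuts_deriv P (forest_cuts P F) (prod_fun P g)) = (\<Prod>S\<in>P. gamma_pairing S (g S) (tree_bracket (F S) x))" .
   qed
  qed
 qed
 then show "cuts_deriv P (forest_cuts P F) (prod_fun P g) \<in> vspan (Lvee_dual (forest_target P F)) (gamma_products (forest_target P F))"
  "(!!B. B \<in> forest_target P F ==> x B \<in> vcarrier (gamma B)) ==>
   glue_eval (forest_target P F) x (cuts_deriv P (forest_cuts P F) (prod_fun P g)) =
   (\<Prod>S\<in>P. gamma_pairing S (g S) (tree_bracket (F S) x))" using g by blast+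
qed

section \<open>The derivative along a single tree and its dual\<close>

context
 fixes I :: "'a set" and P and T
 assumes I: "finite I" and P: "partition_on I P" and T: "T \<in> layered_trees P"
begin

lemma layered_tree_nonempty: "I \<noteq> {}"
proof
 assume "I = {}"
 then have "P = {}" using P by (simp add: partition_on_empty)
 then show False using T by (simp add: layered_trees_def)
qed

lemma layered_tree_forest: "layered_forest {I} (\<lambda>_. T)" "forest_target {I} (\<lambda>_. T) = P"
 "partition_on I {I}" "block_tree T" "ground T = I" "set (leaves T) = P"
proof -
 show "layered_forest {I} (\<lambda>_. T)" "forest_target {I} (\<lambda>_. T) = P"
  using T P by (auto simp: layered_trees_def layered_forest_def forest_target_def forest_size_def)
 show "partition_on I {I}" using layered_tree_nonempty by (rule partition_on_space)
 have l: "set (leaves T) = P" "distinct (leaves T)" using T by (auto simp: layered_trees_def)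
 show "set (leaves T) = P" by (rule l(1))
 show "block_tree T" "ground T = I" using block_treeI[of T I] l P I by auto
qed

lemma prod_fun_single: "f \<in> vcarrier (gamma_dual I) ==> prod_fun {I} (\<lambda>_. f) = f"
proof
 fix X assume f: "f \<in> vcarrier (gamma_dual I)"
 show "prod_fun {I} (\<lambda>_. f) X = f X"
 proof (cases "X \<in> faces {I}")
  case True
  have "face_restrict X I = X" by (rule face_restrict_eqI[OF I layered_tree_forest(3) _ True True]) auto
  then show ?thesis using True by (simp add: prod_fun_def)
 next
  case False
  then show ?thesis using gamma_dual_sub[OF f] by (simp add: prod_fun_def Lvee_dual_carrier)
 qed
qed

lemma tree_deriv_span: "f \<in> vcarrier (gamma_dual I) ==> forest_deriv {I} (\<lambda>_. T) f \<in> vspan (Lvee_dual P) (gamma_products P)"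
 using forest_deriv_prod_fun(1)[OF I layered_tree_forest(3,1), of "\<lambda>_. f"] prod_fun_single[of f]
 unfolding forest_deriv_def layered_tree_forest(2) by simp

lemma tree_deriv_eval:
 assumes "f \<in> vcarrier (gamma_dual I)" "!!B. B \<in> P ==> x B \<in> vcarrier (gamma B)"
 shows "glue_eval P x (forest_deriv {I} (\<lambda>_. T) f) = gamma_pairing I f (tree_bracket T x)"
 using forest_deriv_prod_fun(2)[OF I layered_tree_forest(3,1), of "\<lambda>_. f" x] prod_fun_single[of f] assms
 unfolding forest_deriv_def layered_tree_forest(2) by simp

end

context
 fixes I :: "'a set" and P
 assumes I: "finite I" and P: "partition_on I P"
begin

lemma ext_prod_gamma:
 shows "vlinear (tensor P gamma_dual) (Lvee_dual P) (ext_prod P (gamma_dual :: 'a set => ('k::field, 'a face => 'k) vspace))"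
  "g \<in> fams P gamma_dual ==> ext_prod P gamma_dual (pure P gamma_dual g) = prod_fun P (g :: 'a set => 'a face => 'k)"
  "S \<in> P ==> vs (gamma_dual S :: ('k, 'a face => 'k) vspace)"
 using ext_prod_works[of P gamma_dual] partition_on_finite[OF I P] pointwise_gamma_dual partition_block_finite[OF I P] vs_gamma_dual
 by blast+

lemma ext_prod_gamma_image:
 "ext_prod P (gamma_dual :: 'a set => ('k::field, 'a face => 'k) vspace) ` vcarrier (tensor P gamma_dual) = vspan (Lvee_dual P) (gamma_products P)"
proof -
 let ?V = "gamma_dual :: 'a set => ('k, 'a face => 'k) vspace"
 note vsV = ext_prod_gamma(3)
 note vsT = vs_tensor[of P ?V, OF vsV] and pin = pure_in[of P ?V, OF vsV]
 have sub: "pure P ?V ` (fams P ?V) \<subseteq> vcarrier (tensor P ?V)" by (rule image_subsetI) (rule pin)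
 have "ext_prod P ?V u \<in> vspan (Lvee_dual P) (gamma_products P)" if "u \<in> vcarrier (tensor P ?V)" for u
 proof (rule vlinear_span_image[OF vsT vs_Lvee_dual ext_prod_gamma(1) sub])
  show "u \<in> vspan (tensor P ?V) (pure P ?V ` (fams P ?V))" using that tensor_span[of P ?V, OF vsV] by blast
  show "ext_prod P ?V ` pure P ?V ` (fams P ?V) \<subseteq> vspan (Lvee_dual P) (gamma_products P)"
  proof (rule image_subsetI, erule imageE)
   fix y g assume g: "g \<in> fams P ?V" "y = pure P ?V g"
   show "ext_prod P ?V y \<in> vspan (Lvee_dual P) (gamma_products P)"
    unfolding g(2) ext_prod_gamma(2)[OF g(1)] by (rule vspan.base) (use g(1) in auto)
  qed
 qed
 moreover have "\<exists>u\<in>vcarrier (tensor P ?V). F = ext_prod P ?V u" if "F \<in> vspan (Lvee_dual P) (gamma_products P)" for F using that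
 proof induction
  case zero
  then show ?case using vlinear_zero[OF vsT vs_Lvee_dual ext_prod_gamma(1)] vs_zero[OF vsT] by metis
 next
  case (base F)
  then obtain g where g: "\<forall>B\<in>P. g B \<in> vcarrier (?V B)" "F = prod_fun P g" by blast
  have "restrict g P \<in> fams P ?V" using g by auto
  moreover have "prod_fun P (restrict g P) = prod_fun P g" by (auto simp: prod_fun_def)
  ultimately show ?case using ext_prod_gamma(2) pin g(2) by metis
 next
  case (add F G)
  then obtain u v where "u \<in> vcarrier (tensor P ?V)" "F = ext_prod P ?V u" "v \<in> vcarrier (tensor P ?V)" "G = ext_prod P ?V v" by blast
  then show ?case using vlinearD(2)[OF ext_prod_gamma(1)] vs_add[OF vsT] by metis
 next
  case (scale F c)
  then obtain u where "u \<in> vcarrier (tensor P ?V)" "F = ext_prod P ?V u" by blast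
  then show ?case using vlinearD(3)[OF ext_prod_gamma(1)] vs_scale[OF vsT] by metis
 qed
 ultimately show ?thesis by blast
qed

lemma gamma_pairing_prod_mlin:
 fixes g :: "'a set => 'a face => 'k::field"
 assumes g: "!!B. B \<in> P ==> g B \<in> vcarrier (gamma_dual B)"
 shows "mlin P gamma vfield (\<lambda>x. \<Prod>S\<in>P. gamma_pairing S (g S) (x S))"
proof -
 have fP: "finite P" using partition_on_finite[OF I P] .
 have e: "(\<Prod>S\<in>P. gamma_pairing S (g S) ((x(B := u)) S)) = gamma_pairing B (g B) u * (\<Prod>S\<in>P - {B}. gamma_pairing S (g S) (x S))"
  if "B \<in> P" for B u x by (subst prod.remove[OF fP that]) (auto intro!: arg_cong2[where f = "(*)"] prod.cong)
 show ?thesis unfolding mlin_def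
 proof (intro ballI conjI allI)
  fix x :: "'a set => ('k, 'a) gamma_elt" and u w :: "('k, 'a) gamma_elt" and B c assume B: "B \<in> P" and u: "u \<in> vcarrier (gamma B)"
  note lin = gamma_pairing_linear[OF g[OF B]]
  show "(\<Prod>S\<in>P. gamma_pairing S (g S) ((x(B := vadd (gamma B) u w)) S)) =
   vadd vfield (\<Prod>S\<in>P. gamma_pairing S (g S) ((x(B := u)) S)) (\<Prod>S\<in>P. gamma_pairing S (g S) ((x(B := w)) S))"
   if w: "w \<in> vcarrier (gamma B)" unfolding e[OF B] vlinearD(2)[OF lin u w] by (simp add: algebra_simps)
  show "(\<Prod>S\<in>P. gamma_pairing S (g S) ((x(B := vscale (gamma B) c u)) S)) =
   vscale vfield c (\<Prod>S\<in>P. gamma_pairing S (g S) ((x(B := u)) S))" unfolding e[OF B] vlinearD(3)[OF lin u] by simp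
 qed simp
qed

text \<open>Chosen representatives do not depend linearly on the class, so \<open>glue_eval\<close>
  is not multilinear as it stands. On a product functional it equals a product of pairings, which is
  multilinear, and the property is inherited by the span.\<close>

lemma glue_eval_mlin:
 assumes "F \<in> vspan (Lvee_dual P) (gamma_products P)"
 shows "mlin P gamma vfield (\<lambda>x. glue_eval P x F)" using assms
proof induction
 case zero
 then show ?case by (simp add: mlin_def glue_eval_def)
next
 case (base F)
 then obtain g where g: "!!B. B \<in> P ==> g B \<in> vcarrier (gamma_dual B)" "F = prod_fun P g" by blast
 show ?case by (rule mlin_cong[OF gamma_pairing_prod_mlin[OF g(1)] vs_gamma]) (use glue_eval_prod_fun[OF I P g(1)] g(2) in auto)
next
 case (add F G)
 then show ?case unfolding mlin_def by (simp add: glue_eval_add algebra_simps)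
next
 case (scale F c)
 have "glue_eval P x (\<lambda>X. c * F X) = c * glue_eval P x F" for x by (simp add: glue_eval_def sum_distrib_left algebra_simps)
 then show ?case using scale unfolding mlin_def by (simp add: algebra_simps)
qed

text \<open>The two nested extensions are evaluated through \<open>glue_eval\<close>. The pairing
  thus depends on \<open>u\<close> only through its image under the external product, and every
  preimage that \<open>inv_into\<close> may pick in \<open>tree_deriv\<close> gives the same
  value.\<close>

lemma tensor_pairing:
 assumes u: "u \<in> vcarrier (tensor P (gamma_dual :: 'a set => ('k::field, 'a face => 'k) vspace))"
 shows "vlinear (tensor P gamma) vfield (tensor_pairing P u)"
  "x \<in> fams P gamma ==> tensor_pairing P u (pure P gamma x) = glue_eval P x (ext_prod P gamma_dual u)"
proof -
 let ?V = "gamma_dual :: 'a set => ('k, 'a face => 'k) vspace"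
 let ?G = "gamma :: 'a set => ('k, ('k, 'a) gamma_elt) vspace"
 note vsV = ext_prod_gamma(3)
 note vsT = vs_tensor[of P ?V, OF vsV] and pin = pure_in[of P ?V, OF vsV]
 note vsG = vs_tensor[of P ?G, OF vs_gamma] and ginn = pure_in[of P ?G, OF vs_gamma]
 define inner where "inner x = linext (tensor P ?V) vfield (fams P ?V) (pure P ?V) (\<lambda>f. \<Prod>S\<in>P. gamma_pairing S (f S) (x S)) u" for x
 have inner: "inner x = glue_eval P x (ext_prod P ?V u)" if x: "x \<in> fams P ?G" for x
 proof -
  have lin: "vlinear (tensor P ?V) vfield (\<lambda>u. glue_eval P x (ext_prod P ?V u))"
   by (rule vlinear_comp[OF ext_prod_gamma(1) glue_eval_linear])
  have "linext (tensor P ?V) vfield (fams P ?V) (pure P ?V) (\<lambda>f. \<Prod>S\<in>P. gamma_pairing S (f S) (x S))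
   = restrict (\<lambda>u. glue_eval P x (ext_prod P ?V u)) (vcarrier (tensor P ?V))"
  proof (rule linext_eq[OF vsT vs_vfield lin pin])
   fix f assume f: "f \<in> fams P ?V"
   show "glue_eval P x (ext_prod P ?V (pure P ?V f)) = (\<Prod>S\<in>P. gamma_pairing S (f S) (x S))"
    unfolding ext_prod_gamma(2)[OF f] by (rule glue_eval_prod_fun[OF I P]) (use f x in auto)
  qed (use tensor_span[of P ?V, OF vsV] in auto)
  then show ?thesis using u by (simp add: inner_def)
 qed
 have "ext_prod P ?V u \<in> vspan (Lvee_dual P) (gamma_products P)" using u ext_prod_gamma_image by blast
 from mlin_cong[OF glue_eval_mlin[OF this] vs_gamma inner] have ml: "mlin P ?G vfield inner" .
 obtain L where L: "vlinear (tensor P ?G) vfield L" "!!x. x \<in> fams P ?G ==> L (pure P ?G x) = inner x"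
  using tensor_lift[of P ?G, OF vs_gamma vs_vfield ml] by blast
 have e: "tensor_pairing P u = restrict L (vcarrier (tensor P ?G))"
 proof -
  have "linext (tensor P ?G) vfield (fams P ?G) (pure P ?G) inner = restrict L (vcarrier (tensor P ?G))"
   by (rule linext_eq[OF vsG vs_vfield L(1) ginn L(2)]) (use tensor_span[of P ?G, OF vs_gamma] in auto)
  then show ?thesis by (simp add: tensor_pairing_def[abs_def] inner_def[abs_def])
 qed
 show "vlinear (tensor P gamma) vfield (tensor_pairing P u)" using L(1) vlinear_restrict[OF vsG, of vfield L] by (simp add: e)
 show "x \<in> fams P gamma ==> tensor_pairing P u (pure P gamma x) = glue_eval P x (ext_prod P gamma_dual u)"
  unfolding e using L(2) inner ginn by simp
qed

text \<open>The adjunction formula for \<open>A\<close> is checked on pure tensors, where both sides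
  are the evaluation of the derivative of \<open>f\<close>. So \<open>A D\<close> satisfies the
  defining description, and it is the only such element because \<open>\<Gamma>\<^sup>*[I]\<close>
  separates points.\<close>

lemma dual_tree_deriv:
 fixes A :: "(('a set => ('k::field, 'a) gamma_elt) => 'k) set => ('k, 'a) gamma_elt"
 assumes T: "T \<in> layered_trees P" and A: "vlinear (tensor P gamma) (gamma I) A"
  "!!x. x \<in> fams P gamma ==> A (pure P gamma x) = tree_bracket T x"
  and D: "D \<in> vcarrier (tensor P gamma)"
 shows "dual_tree_deriv I P T D = A D"
proof -
 let ?V = "gamma_dual :: 'a set => ('k, 'a face => 'k) vspace"
 let ?G = "gamma :: 'a set => ('k, ('k, 'a) gamma_elt) vspace"
 note vsG = vs_tensor[of P ?G, OF vs_gamma] and ginn = pure_in[of P ?G, OF vs_gamma]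
 have AD: "A D \<in> vcarrier (gamma I)" using vlinearD(1)[OF A(1) D] .
 have main: "gamma_pairing I f (A D) = tensor_pairing P (tree_deriv I P T f) D" if f: "f \<in> vcarrier (gamma_dual I)" for f
 proof -
  have im: "forest_deriv {I} (\<lambda>_. T) f \<in> ext_prod P ?V ` vcarrier (tensor P ?V)"
   using tree_deriv_span[OF I P T f] ext_prod_gamma_image by blast
  have u: "tree_deriv I P T f \<in> vcarrier (tensor P ?V)" "ext_prod P ?V (tree_deriv I P T f) = forest_deriv {I} (\<lambda>_. T) f"
   unfolding tree_deriv_def using inv_into_into[OF im] f_inv_into_f[OF im] by auto
  have sub: "pure P ?G ` (fams P ?G) \<subseteq> vcarrier (tensor P ?G)" by (rule image_subsetI) (rule ginn)
  show ?thesis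
  proof (rule vlinear_eq_span[OF vsG vs_vfield vlinear_comp[OF A(1) gamma_pairing_linear[OF f]] tensor_pairing(1)[OF u(1)] sub])
   show "D \<in> vspan (tensor P ?G) (pure P ?G ` (fams P ?G))" using D tensor_span[of P ?G, OF vs_gamma] by blast
   fix y assume "y \<in> pure P ?G ` (fams P ?G)"
   then obtain x where x: "x \<in> fams P ?G" "y = pure P ?G x" by blast
   have "gamma_pairing I f (tree_bracket T x) = glue_eval P x (forest_deriv {I} (\<lambda>_. T) f)"
    by (rule tree_deriv_eval[OF I P T f, symmetric]) (use x in auto)
   then show "gamma_pairing I f (A y) = tensor_pairing P (tree_deriv I P T f) y"
    unfolding x(2) A(2)[OF x(1)] tensor_pairing(2)[OF u(1) x(1)] u(2) .
  qed
 qed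
 show ?thesis unfolding dual_tree_deriv_def
 proof (rule the_equality)
  show "A D \<in> vcarrier (gamma I) \<and> (\<forall>f\<in>vcarrier (gamma_dual I). gamma_pairing I f (A D) = tensor_pairing P (tree_deriv I P T f) D)"
   using AD main by blast
  fix E assume E: "E \<in> vcarrier (gamma I) \<and> (\<forall>f\<in>vcarrier (gamma_dual I). gamma_pairing I f E = tensor_pairing P (tree_deriv I P T f) D)"
  show "E = A D" by (rule gamma_ext) (use E AD main in auto)
 qed
qed

end

section \<open>The Jacobi identity\<close>

definition chamber_u :: "'a face => 'a set => 'a set => 'a set => 'a face" where
 "chamber_u X A B C = face_cut {A \<union> B \<union> C} (A \<union> B, C) (face_cut {A \<union> B, C} (A, B) X)"

text \<open>Let \<open>h\<close> be a point of \<open>X\<close> and let \<open>a\<close>,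
  \<open>b\<close>, \<open>c\<close> be coordinate vectors at elements of the three blocks. With
  \<open>\<delta>\<close> positive and much smaller than \<open>\<epsilon>\<close>,
  \<open>chamber_u\<close> is the face of \<open>h + \<epsilon> (a - b) + \<delta> (a - c)\<close>
  and \<open>chamber_w\<close> that of \<open>h + \<epsilon> (a - b) + \<delta> (c - a)\<close>. The
  sums over \<open>A\<close>, \<open>B\<close>, \<open>C\<close> have signs + - - in the first and +
  - + in the second. This explains the symmetry of the first in \<open>B\<close> and
  \<open>C\<close> and of the second in \<open>A\<close> and \<open>C\<close>.\<close>

definition chamber_w :: "'a face => 'a set => 'a set => 'a set => 'a face" where
 "chamber_w X A B C = face_cut {A \<union> B \<union> C} (C, A \<union> B) (face_cut {A \<union> B, C} (A, B) X)"

text \<open>Around a face with support \<open>(A|B|C)\<close> there are only six chambers, so that the twelve double cuts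
 coincide in pairs.\<close>

lemma jacobi_face:
 assumes fin: "finite A" "finite B" "finite C" and ne: "A \<noteq> {}" "B \<noteq> {}" "C \<noteq> {}"
  and dj: "A \<inter> B = {}" "A \<inter> C = {}" "B \<inter> C = {}" and X: "X \<in> faces {A, B, C}"
 shows "chamber_u X A B C = chamber_u X A C B" "chamber_w X A B C = chamber_w X C B A"
proof -
 let ?u = "chamber_u X" and ?w = "chamber_w X"
 have main: "?u A B C \<in> faces {A \<union> B \<union> C} \<and> ?w A B C \<in> faces {A \<union> B \<union> C} \<and>
   (\<forall>E\<subseteq>A \<union> B \<union> C. face_sign (?u A B C) E = (if face_sign X E \<noteq> 0 then face_sign X E else
    if (A \<subseteq> E) \<noteq> (B \<subseteq> E) then of_bool (A \<subseteq> E) - of_bool (B \<subseteq> E) else of_bool (A \<subseteq> E) - of_bool (C \<subseteq> E))) \<and>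
   (\<forall>E\<subseteq>A \<union> B \<union> C. face_sign (?w A B C) E = (if face_sign X E \<noteq> 0 then face_sign X E else
    if (A \<subseteq> E) \<noteq> (B \<subseteq> E) then of_bool (A \<subseteq> E) - of_bool (B \<subseteq> E) else of_bool (C \<subseteq> E) - of_bool (A \<subseteq> E)))"
  if fin: "finite A" "finite B" "finite C" and ne: "A \<noteq> {}" "B \<noteq> {}" "C \<noteq> {}"
   and dj: "A \<inter> B = {}" "A \<inter> C = {}" "B \<inter> C = {}" and X: "X \<in> faces {A, B, C}" for A B C
 proof -
  have fI: "finite (A \<union> B \<union> C)" using fin by simp
  have p1: "partition_on (A \<union> B \<union> C) {A \<union> B, C}" using ne dj by (auto simp: partition_on_def disjoint_def)
  have p0: "partition_on (A \<union> B \<union> C) {A \<union> B \<union> C}" using ne by (auto simp: partition_on_def)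
  have v1: "valid_cut {A \<union> B, C} (A, B)" using ne dj by (auto simp: valid_cut_def)
  have v0: "valid_cut {A \<union> B \<union> C} (A \<union> B, C)" using ne dj by (auto simp: valid_cut_def)
  have "C \<noteq> A \<union> B" using ne dj by auto
  then have "cut_target {A \<union> B, C} (A, B) = {A, B, C}" by (auto simp: cut_target_def)
  then have X': "X \<in> faces (cut_target {A \<union> B, C} (A, B))" using X by simp
  note c1 = face_cut[OF fI p1 v1 X']
  have "face_cut {A \<union> B, C} (A, B) X \<in> faces (cut_target {A \<union> B \<union> C} (A \<union> B, C))" using c1(1) by (simp add: cut_target_def)
  note c0 = face_cut[OF fI p0 v0 this] face_cut_swap[OF fI p0 v0 this]
  show ?thesis unfolding chamber_u_def chamber_w_def using c0(1,3) by (auto simp: c0(2,4) c1(2))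
 qed
 note m1 = main[OF fin ne dj X]
 have X2: "X \<in> faces {A, C, B}" using X by (simp add: insert_commute)
 have X3: "X \<in> faces {C, B, A}" using X by (simp add: insert_commute)
 have U: "A \<union> C \<union> B = A \<union> B \<union> C" "C \<union> B \<union> A = A \<union> B \<union> C" by auto
 note m2 = main[OF fin(1,3,2) ne(1,3,2) dj(2,1) _ X2, unfolded U]
 note m3 = main[OF fin(3,2,1) ne(3,2,1) _ _ _ X3, unfolded U]
 have dj': "C \<inter> B = {}" "C \<inter> A = {}" "B \<inter> A = {}" using dj by auto
 have fI: "finite (A \<union> B \<union> C)" using fin by simp
 have p0: "partition_on (A \<union> B \<union> C) {A \<union> B \<union> C}" using ne by (auto simp: partition_on_def)
 show "?u A B C = ?u A C B" by (rule face_ext[OF fI p0]) (use m1 m2 dj' in auto)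
 show "?w A B C = ?w C B A" by (rule face_ext[OF fI p0]) (use m1 m3 dj' in auto)
qed

lemma double_cut_deriv:
 fixes f :: "'a face => 'k::field"
 assumes ne: "A \<noteq> {}" "B \<noteq> {}" "C \<noteq> {}"
  and dj: "A \<inter> B = {}" "A \<inter> C = {}" "B \<inter> C = {}"
 shows "forest_deriv {A \<union> B \<union> C} (\<lambda>_. Node 0 (Node 1 (Leaf A) (Leaf B)) (Leaf C)) f =
  cut_deriv {A \<union> B, C} (A, B) (cut_deriv {A \<union> B \<union> C} (A \<union> B, C) f)"
proof -
 have "forest_cuts {A \<union> B \<union> C} (\<lambda>_. Node 0 (Node 1 (Leaf A) (Leaf B)) (Leaf C)) = [(A \<union> B, C), (A, B)]"
  by (simp add: forest_cuts_def forest_size_def numeral_2_eq_2)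
 moreover have "cut_target {A \<union> B \<union> C} (A \<union> B, C) = {A \<union> B, C}" by (simp add: cut_target_def)
 ultimately show ?thesis by (simp add: forest_deriv_def)
qed

lemma double_cut_deriv_value:
 fixes f :: "'a face => 'k::field"
 assumes fin: "finite A" "finite B" "finite C" and ne: "A \<noteq> {}" "B \<noteq> {}" "C \<noteq> {}"
  and dj: "A \<inter> B = {}" "A \<inter> C = {}" "B \<inter> C = {}" and X: "X \<in> faces {A, B, C}"
 shows "forest_deriv {A \<union> B \<union> C} (\<lambda>_. Node 0 (Node 1 (Leaf A) (Leaf B)) (Leaf C)) f X =
  f (chamber_u X A B C) - f (chamber_w X A B C) - f (chamber_u X B A C) + f (chamber_w X B A C)"
proof -
 have fI: "finite (A \<union> B \<union> C)" using fin by simp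
 have p1: "partition_on (A \<union> B \<union> C) {A \<union> B, C}" using ne dj by (auto simp: partition_on_def disjoint_def)
 have v1: "valid_cut {A \<union> B, C} (A, B)" using ne dj by (auto simp: valid_cut_def)
 have "C \<noteq> A \<union> B" using ne dj by auto
 then have t1: "cut_target {A \<union> B, C} (A, B) = {A, B, C}" by (auto simp: cut_target_def)
 then have X': "X \<in> faces (cut_target {A \<union> B, C} (A, B))" using X by simp
 have t0: "cut_target {A \<union> B \<union> C} (A \<union> B, C) = {A \<union> B, C}" by (simp add: cut_target_def)
 have U: "B \<union> A = A \<union> B" by auto
 show ?thesis unfolding double_cut_deriv[OF ne dj] chamber_u_def chamber_w_def U
  using face_cut(1)[OF fI p1 v1 X'] face_cut_swap(1)[OF fI p1 v1 X'] X' by (simp add: cut_deriv_def t0)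
qed

lemma triple_deriv_outside:
 assumes "A \<noteq> {}" "B \<noteq> {}" "C \<noteq> {}" "A \<inter> B = {}" "A \<inter> C = {}" "B \<inter> C = {}" "X \<notin> faces {A, B, C}"
 shows "forest_deriv {A \<union> B \<union> C} (\<lambda>_. Node 0 (Node 1 (Leaf A) (Leaf B)) (Leaf C)) f X = 0"
proof -
 have "C \<noteq> A \<union> B" using assms by auto
 then have "cut_target {A \<union> B, C} (A, B) = {A, B, C}" by (auto simp: cut_target_def)
 then show ?thesis unfolding double_cut_deriv[OF assms(1-6)] using assms(7) by (simp add: cut_deriv_def)
qed

text \<open>After pairing with \<open>f\<close> the three terms are evaluations of double
  derivatives, each a signed sum of four values of \<open>f\<close>. In the cyclic sum of all
  twelve, every one of the six chambers around \<open>X\<close> occurs exactly twice, with opposite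
  signs.\<close>

lemma bracket_jacobi:
 fixes a b c :: "('k::field, 'a) gamma_elt"
 assumes fin: "finite A" "finite B" "finite C" and ne: "A \<noteq> {}" "B \<noteq> {}" "C \<noteq> {}"
  and dj: "A \<inter> B = {}" "A \<inter> C = {}" "B \<inter> C = {}"
  and abc: "a \<in> vcarrier (gamma A)" "b \<in> vcarrier (gamma B)" "c \<in> vcarrier (gamma C)"
 shows "vadd (gamma (A \<union> B \<union> C)) (vadd (gamma (A \<union> B \<union> C)) (bracket (A \<union> B) C (bracket A B a b) c)
  (bracket (B \<union> C) A (bracket B C b c) a)) (bracket (C \<union> A) B (bracket C A c a) b) = vzero (gamma (A \<union> B \<union> C))"
proof -
 let ?I = "A \<union> B \<union> C" and ?P = "{A, B, C}"
 define x where "x S = (if S = A then a else if S = B then b else c)" for S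
 have neq: "A \<noteq> B" "A \<noteq> C" "B \<noteq> C" using ne dj by auto
 have x: "x A = a" "x B = b" "x C = c" using neq by (auto simp: x_def)
 have xin: "x S \<in> vcarrier (gamma S)" if "S \<in> ?P" for S using that x abc by auto
 have fI: "finite ?I" using fin by simp
 have P: "partition_on ?I ?P" using ne dj by (auto simp: partition_on_def disjoint_def)
 have dj': "B \<inter> A = {}" "C \<inter> A = {}" "C \<inter> B = {}" using dj by auto
 define t where "t A B C = Node 0 (Node 1 (Leaf A) (Leaf B)) (Leaf C)" for A B C :: "'a set"
 have T: "t A B C \<in> layered_trees ?P" "t B C A \<in> layered_trees ?P" "t C A B \<in> layered_trees ?P"
  using neq by (auto simp: layered_trees_def t_def lessThan_Suc)
 have U: "B \<union> C \<union> A = ?I" "C \<union> A \<union> B = ?I" by auto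
 have tb: "tree_bracket (t A B C) x = bracket (A \<union> B) C (bracket A B a b) c"
  "tree_bracket (t B C A) x = bracket (B \<union> C) A (bracket B C b c) a" "tree_bracket (t C A B) x = bracket (C \<union> A) B (bracket C A c a) b"
  by (simp_all add: t_def x)
 have tin: "tree_bracket T x \<in> vcarrier (gamma ?I)" if "T \<in> layered_trees ?P" for T
 proof -
  note l = layered_tree_forest(4-6)[OF fI P that]
  show ?thesis using tree_bracket_in[OF l(1), of x] xin l(2,3) by simp
 qed
 show ?thesis unfolding tb[symmetric]
 proof (rule gamma_ext)
  show "vadd (gamma ?I) (vadd (gamma ?I) (tree_bracket (t A B C) x) (tree_bracket (t B C A) x)) (tree_bracket (t C A B) x) \<in> vcarrier (gamma ?I)"
   by (intro vs_add vs_gamma tin T)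
  show "vzero (gamma ?I) \<in> vcarrier (gamma ?I)" by (intro vs_zero vs_gamma)
  fix f :: "'a face => 'k" assume f: "f \<in> vcarrier (gamma_dual ?I)"
  note gl = gamma_pairing_linear[OF f]
  let ?F = "\<lambda>T. forest_deriv {?I} (\<lambda>_. T) f"
  have ev: "gamma_pairing ?I f (tree_bracket T x) = glue_eval ?P x (?F T)" if "T \<in> layered_trees ?P" for T
   using tree_deriv_eval[OF fI P that f, of x] xin by simp
  have z: "?F (t A B C) X + ?F (t B C A) X + ?F (t C A B) X = 0" for X
  proof (cases "X \<in> faces ?P")
   case False
   then have "X \<notin> faces {B, C, A}" "X \<notin> faces {C, A, B}" by (simp_all add: insert_commute)
   then show ?thesis
    using triple_deriv_outside[OF ne dj False, of f] triple_deriv_outside[of B C A X f] triple_deriv_outside[of C A B X f] ne dj dj'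
    by (simp add: t_def U)
  next
   case True
   then have X: "X \<in> faces {B, A, C}" "X \<in> faces {C, A, B}" "X \<in> faces {B, C, A}" by (simp_all add: insert_commute)
   have e1: "?F (t A B C) X = f (chamber_u X A B C) - f (chamber_w X A B C) - f (chamber_u X B A C) + f (chamber_w X B A C)"
    unfolding t_def by (rule double_cut_deriv_value[OF fin ne dj True])
   have e2: "?F (t B C A) X = f (chamber_u X B C A) - f (chamber_w X B C A) - f (chamber_u X C B A) + f (chamber_w X C B A)"
    unfolding t_def using double_cut_deriv_value[OF fin(2,3,1) ne(2,3,1) dj(3) dj'(1,2) X(3), of f] by (simp add: U)
   have e3: "?F (t C A B) X = f (chamber_u X C A B) - f (chamber_w X C A B) - f (chamber_u X A C B) + f (chamber_w X A C B)"
    unfolding t_def using double_cut_deriv_value[OF fin(3,1,2) ne(3,1,2) dj'(2,3) dj(1) X(2), of f] by (simp add: U)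
   note j1 = jacobi_face[OF fin ne dj True]
   note j2 = jacobi_face[OF fin(2,1,3) ne(2,1,3) dj'(1) dj(3,2) X(1)]
   note j3 = jacobi_face[OF fin(3,1,2) ne(3,1,2) dj'(2,3) dj(1) X(2)]
   note j4 = jacobi_face(2)[OF fin(2,3,1) ne(2,3,1) dj(3) dj'(1,2) X(3)]
   show ?thesis unfolding e1 e2 e3 j1 j2 j3(1) j4 by simp
  qed
  show "gamma_pairing ?I f (vadd (gamma ?I) (vadd (gamma ?I) (tree_bracket (t A B C) x) (tree_bracket (t B C A) x)) (tree_bracket (t C A B) x))
   = gamma_pairing ?I f (vzero (gamma ?I))"
  proof -
   have "gamma_pairing ?I f (vadd (gamma ?I) (vadd (gamma ?I) (tree_bracket (t A B C) x) (tree_bracket (t B C A) x)) (tree_bracket (t C A B) x))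
    = glue_eval ?P x (?F (t A B C)) + glue_eval ?P x (?F (t B C A)) + glue_eval ?P x (?F (t C A B))"
    using vlinearD(2)[OF gl] tin[OF T(1)] tin[OF T(2)] tin[OF T(3)] ev[OF T(1)] ev[OF T(2)] ev[OF T(3)] by (simp add: vs_gamma)
   also have "\<dots> = glue_eval ?P x (\<lambda>X. ?F (t A B C) X + ?F (t B C A) X + ?F (t C A B) X)" by (simp add: glue_eval_add)
   also have "\<dots> = 0" by (simp add: z glue_eval_def)
   finally show ?thesis using vlinear_zero[OF vs_gamma vs_vfield gl] by simp
  qed
 qed
qed

section \<open>The Lie operad and its action\<close>

lemma tree_bracket_swap:
 assumes "swap_at_node t t'" "block_tree t" "!!B. B \<in> set (leaves t) ==> x B \<in> vcarrier (gamma B)"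
 shows "set (leaves t') = set (leaves t) \<and> tree_bracket t' x = vscale (gamma (ground t)) (-1) (tree_bracket t x)" using assms
proof (induction rule: swap_at_node.induct)
 case (1 n a b)
 note b = block_tree_Node[OF 1(1)]
 have "tree_bracket a x \<in> vcarrier (gamma (ground a))" "tree_bracket b x \<in> vcarrier (gamma (ground b))"
  using 1(2) by (auto intro!: tree_bracket_in b)
 from bracket_antisym[OF b(6,7,4,5,3) this] show ?case by (simp add: Un_commute)
next
 case (2 a a' n b)
 note b = block_tree_Node[OF 2(3)]
 have IH: "set (leaves a') = set (leaves a)" "tree_bracket a' x = vscale (gamma (ground a)) (-1) (tree_bracket a x)"
  using 2(2)[OF b(1)] 2(4) by auto
 have "tree_bracket a x \<in> vcarrier (gamma (ground a))" "tree_bracket b x \<in> vcarrier (gamma (ground b))"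
  using 2(4) by (auto intro!: tree_bracket_in b)
 then show ?case using vlinearD(3)[OF bracketD(1)[OF b(6,7,4,5,3)]] IH by simp
next
 case (3 b b' n a)
 note b = block_tree_Node[OF 3(3)]
 have IH: "set (leaves b') = set (leaves b)" "tree_bracket b' x = vscale (gamma (ground b)) (-1) (tree_bracket b x)"
  using 3(2)[OF b(2)] 3(4) by auto
 have "tree_bracket a x \<in> vcarrier (gamma (ground a))" "tree_bracket b x \<in> vcarrier (gamma (ground b))"
  using 3(4) by (auto intro!: tree_bracket_in b)
 then show ?case using vlinearD(3)[OF bracketD(2)[OF b(6,7,4,5,3)]] IH by simp
qed

text \<open>At the node where the three trees differ this is the Jacobi identity of the bracket.
  Above that node the brackets are linear in the changing subtree and carry the relation up to the
  root.\<close>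

lemma tree_bracket_jacobi:
 assumes "jacobi_triple t1 t2 t3" "block_tree t1" "!!B. B \<in> set (leaves t1) ==> x B \<in> vcarrier (gamma B)"
 shows "set (leaves t2) = set (leaves t1) \<and> set (leaves t3) = set (leaves t1) \<and>
  tree_bracket t2 x \<in> vcarrier (gamma (ground t1)) \<and> tree_bracket t3 x \<in> vcarrier (gamma (ground t1)) \<and>
  vadd (gamma (ground t1)) (vadd (gamma (ground t1)) (tree_bracket t1 x) (tree_bracket t2 x)) (tree_bracket t3 x) = vzero (gamma (ground t1))"
 using assms
proof (induction rule: jacobi_triple.induct)
 case (1 m n a b c)
 note b = block_tree_Node[OF 1(1)] and b' = block_tree_Node[OF block_tree_Node(1)[OF 1(1)]]
 have dj: "ground a \<inter> ground c = {}" "ground b \<inter> ground c = {}" using b(3) by auto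
 have in3: "tree_bracket a x \<in> vcarrier (gamma (ground a))" "tree_bracket b x \<in> vcarrier (gamma (ground b))"
  "tree_bracket c x \<in> vcarrier (gamma (ground c))" using 1(2) by (auto intro!: tree_bracket_in b b')
 have U: "ground b \<union> ground c \<union> ground a = ground a \<union> ground b \<union> ground c" "ground c \<union> ground a \<union> ground b = ground a \<union> ground b \<union> ground c" by auto
 have i1: "bracket (ground b) (ground c) (tree_bracket b x) (tree_bracket c x) \<in> vcarrier (gamma (ground b \<union> ground c))"
  by (rule bracket_in[OF b'(7) b(7) b'(5) b(5) dj(2)])
 have i2: "bracket (ground c) (ground a) (tree_bracket c x) (tree_bracket a x) \<in> vcarrier (gamma (ground c \<union> ground a))"
  by (rule bracket_in[OF b(7) b'(6) b(5) b'(4)]) (use dj in auto)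
 have j1: "bracket (ground b \<union> ground c) (ground a) (bracket (ground b) (ground c) (tree_bracket b x) (tree_bracket c x)) (tree_bracket a x)
   \<in> vcarrier (gamma (ground b \<union> ground c \<union> ground a))" by (rule bracket_in) (use b(7) b' dj in auto)
 have j2: "bracket (ground c \<union> ground a) (ground b) (bracket (ground c) (ground a) (tree_bracket c x) (tree_bracket a x)) (tree_bracket b x)
   \<in> vcarrier (gamma (ground c \<union> ground a \<union> ground b))" by (rule bracket_in) (use b(7) b' dj in auto)
 have j0: "bracket (ground a \<union> ground b) (ground c) (bracket (ground a) (ground b) (tree_bracket a x) (tree_bracket b x)) (tree_bracket c x)
   \<in> vcarrier (gamma (ground a \<union> ground b \<union> ground c))" by (rule bracket_in) (use b(7) b' b(5) dj in auto)
 from bracket_jacobi[OF b'(6,7) b(7) b'(4,5) b(5) b'(3) dj in3] j1 j2 show ?case unfolding U by (auto simp: U Un_ac)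
next
 case (2 a1 a2 a3 n b)
 note b = block_tree_Node[OF 2(3)]
 have in2: "tree_bracket a1 x \<in> vcarrier (gamma (ground a1))" "tree_bracket b x \<in> vcarrier (gamma (ground b))"
  using 2(4) by (auto intro!: tree_bracket_in b)
 note IH = 2(2)[OF b(1)]
 have IH': "set (leaves a2) = set (leaves a1)" "set (leaves a3) = set (leaves a1)"
  "tree_bracket a2 x \<in> vcarrier (gamma (ground a1))" "tree_bracket a3 x \<in> vcarrier (gamma (ground a1))"
  "vadd (gamma (ground a1)) (vadd (gamma (ground a1)) (tree_bracket a1 x) (tree_bracket a2 x)) (tree_bracket a3 x) = vzero (gamma (ground a1))"
  using IH 2(4) by auto
 let ?L = "\<lambda>u. bracket (ground a1) (ground b) u (tree_bracket b x)"
 note L = bracketD(1)[OF b(6,7,4,5,3) in2(2)]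
 have "vadd (gamma (ground a1 \<union> ground b)) (vadd (gamma (ground a1 \<union> ground b)) (?L (tree_bracket a1 x)) (?L (tree_bracket a2 x))) (?L (tree_bracket a3 x))
  = vzero (gamma (ground a1 \<union> ground b))" using vlinear_zero[OF vs_gamma vs_gamma L] IH'(3-5) in2
  by (simp only: vlinearD(2)[OF L, symmetric] vs_add[OF vs_gamma])
 then show ?case using IH' vlinearD(1)[OF L] by simp
next
 case (3 b1 b2 b3 n a)
 note b = block_tree_Node[OF 3(3)]
 have in2: "tree_bracket a x \<in> vcarrier (gamma (ground a))" "tree_bracket b1 x \<in> vcarrier (gamma (ground b1))"
  using 3(4) by (auto intro!: tree_bracket_in b)
 note IH = 3(2)[OF b(2)]
 have IH': "set (leaves b2) = set (leaves b1)" "set (leaves b3) = set (leaves b1)"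
  "tree_bracket b2 x \<in> vcarrier (gamma (ground b1))" "tree_bracket b3 x \<in> vcarrier (gamma (ground b1))"
  "vadd (gamma (ground b1)) (vadd (gamma (ground b1)) (tree_bracket b1 x) (tree_bracket b2 x)) (tree_bracket b3 x) = vzero (gamma (ground b1))"
  using IH 3(4) by auto
 let ?L = "bracket (ground a) (ground b1) (tree_bracket a x)"
 note L = bracketD(2)[OF b(6,7,4,5,3) in2(1)]
 have "vadd (gamma (ground a \<union> ground b1)) (vadd (gamma (ground a \<union> ground b1)) (?L (tree_bracket b1 x)) (?L (tree_bracket b2 x))) (?L (tree_bracket b3 x))
  = vzero (gamma (ground a \<union> ground b1))" using vlinear_zero[OF vs_gamma vs_gamma L] IH'(3-5) in2
  by (simp only: vlinearD(2)[OF L, symmetric] vs_add[OF vs_gamma])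
 then show ?case using IH' vlinearD(1)[OF L] by simp
qed

section \<open>Maps out of the Lie operad\<close>

definition lie_admissible :: "'b set => ('k::field, 'z) vspace => ('b ltree => 'z) => bool" where
 "lie_admissible J Z \<phi> \<longleftrightarrow> (\<forall>t\<in>layered_trees J. \<phi> t \<in> vcarrier Z) \<and>
  (\<forall>t\<in>layered_trees J. \<forall>t'\<in>layered_trees J. (swap_at_node t t' \<longrightarrow> vadd Z (\<phi> t) (\<phi> t') = vzero Z) \<and> (shape t = shape t' \<longrightarrow> \<phi> t = \<phi> t')) \<and>
  (\<forall>t1\<in>layered_trees J. \<forall>t2\<in>layered_trees J. \<forall>t3\<in>layered_trees J. jacobi_triple t1 t2 t3 \<longrightarrow>
   vadd Z (vadd Z (\<phi> t1) (\<phi> t2)) (\<phi> t3) = vzero Z)"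

lemma lie_admissibleD:
 assumes "lie_admissible J Z \<phi>"
 shows "t \<in> layered_trees J ==> \<phi> t \<in> vcarrier Z"
  "t \<in> layered_trees J ==> t' \<in> layered_trees J ==> swap_at_node t t' ==> vadd Z (\<phi> t) (\<phi> t') = vzero Z"
  "t \<in> layered_trees J ==> t' \<in> layered_trees J ==> shape t = shape t' ==> \<phi> t = \<phi> t'"
  "t1 \<in> layered_trees J ==> t2 \<in> layered_trees J ==> t3 \<in> layered_trees J ==> jacobi_triple t1 t2 t3 ==>
   vadd Z (vadd Z (\<phi> t1) (\<phi> t2)) (\<phi> t3) = vzero Z" using assms unfolding lie_admissible_def by blast+

text \<open>The relations in the three-term form of \<open>free_comb3\<close>; two-term relations
  repeat a tree with coefficient 0.\<close>

lemma lie_relsE: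
 assumes "r \<in> lie_rels J"
 obtains (swap) t t' where "r = (\<lambda>z. 1 * vbasis t z + 1 * vbasis t' z + 0 * vbasis t z)" "t \<in> layered_trees J" "t' \<in> layered_trees J" "swap_at_node t t'"
 | (jacobi) t1 t2 t3 where "r = (\<lambda>z. 1 * vbasis t1 z + 1 * vbasis t2 z + 1 * vbasis t3 z)" "t1 \<in> layered_trees J" "t2 \<in> layered_trees J"
   "t3 \<in> layered_trees J" "jacobi_triple t1 t2 t3"
 | (shape) t t' where "r = (\<lambda>z. 1 * vbasis t z + (-1) * vbasis t' z + 0 * vbasis t z)" "t \<in> layered_trees J" "t' \<in> layered_trees J" "shape t = shape t'"
proof -
 from assms consider t t' where "r = (\<lambda>z. vbasis t z + vbasis t' z)" "t \<in> layered_trees J" "t' \<in> layered_trees J" "swap_at_node t t'"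
  | t1 t2 t3 where "r = (\<lambda>z. vbasis t1 z + vbasis t2 z + vbasis t3 z)" "t1 \<in> layered_trees J" "t2 \<in> layered_trees J"
   "t3 \<in> layered_trees J" "jacobi_triple t1 t2 t3"
  | t t' where "r = (\<lambda>z. vbasis t z - vbasis t' z)" "t \<in> layered_trees J" "t' \<in> layered_trees J" "shape t = shape t'"
  unfolding lie_rels_def by blast
 then show thesis
 proof cases
  case 1 then show ?thesis by (intro swap[of t t']) simp_all
 next
  case 2 then show ?thesis by (intro jacobi[of t1 t2 t3]) simp_all
 next
  case 3 then show ?thesis by (intro shape[of t t']) simp_all
 qed
qed

lemma lie_rels_in: "(lie_rels J :: ('b ltree => 'k::field) set) \<subseteq> vcarrier (vfree (layered_trees J))"
proof
 fix r :: "'b ltree => 'k" assume "r \<in> lie_rels J"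
 then show "r \<in> vcarrier (vfree (layered_trees J))"
 proof (cases rule: lie_relsE)
  case (swap t t')
  show ?thesis unfolding swap(1) by (rule free_comb3(1)[OF swap(2,3,2)])
 next
  case (jacobi t1 t2 t3)
  show ?thesis unfolding jacobi(1) by (rule free_comb3(1)[OF jacobi(2-4)])
 next
  case (shape t t')
  show ?thesis unfolding shape(1) by (rule free_comb3(1)[OF shape(2,3,2)])
 qed
qed

lemma vs_lie: "vs (lie J)" unfolding lie_def Lay_def by (rule vs_vquot[OF vs_vfree vspan_sub[OF vs_vfree lie_rels_in]])

lemma lie_class_in: "t \<in> layered_trees J ==> lie_class J t \<in> vcarrier (lie J)" by (auto simp: lie_class_def lie_def Lay_def vquot_def)

lemma lie_span: "vcarrier (lie J) \<subseteq> vspan (lie J) (lie_class J ` layered_trees J)"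
 using presented_span[OF lie_rels_in] unfolding lie_def lie_class_def Lay_def .

lemma lie_lift:
 fixes Z :: "('k::field, 'z) vspace" and \<phi> :: "'b ltree => 'z"
 assumes Z: "vs Z" and \<phi>: "lie_admissible J Z \<phi>"
 shows "\<exists>g. vlinear (lie J) Z g \<and> (\<forall>t\<in>layered_trees J. g (lie_class J t) = \<phi> t)" unfolding lie_def lie_class_def Lay_def
proof (rule presented_lift[OF Z _ lie_rels_in])
 show in': "\<phi> \<in> layered_trees J \<rightarrow> vcarrier Z" by (rule Pi_I) (rule lie_admissibleD(1)[OF \<phi>])
 note lin = free_lift_linear[OF Z in']
 have b: "free_lift Z \<phi> (vbasis t) = \<phi> t" if "t \<in> layered_trees J" for t by (rule free_lift_basis[OF Z]) (use in' that in auto)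
 have c: "\<phi> t \<in> vcarrier Z" if "t \<in> layered_trees J" for t using in' that by auto
 fix r :: "'b ltree => 'k" assume "r \<in> lie_rels J"
 then show "free_lift Z \<phi> r = vzero Z"
 proof (cases rule: lie_relsE)
  case (swap t t')
  have "free_lift Z \<phi> r = vadd Z (vadd Z (vscale Z 1 (\<phi> t)) (vscale Z 1 (\<phi> t'))) (vscale Z 0 (\<phi> t))"
   unfolding swap(1) free_comb3(2)[OF swap(2,3,2) Z lin] using swap b by simp
  also have "\<dots> = vadd Z (\<phi> t) (\<phi> t')" using c swap Z by simp
  finally show ?thesis using lie_admissibleD(2)[OF \<phi> swap(2-4)] by simp
 next
  case (jacobi t1 t2 t3)
  have "free_lift Z \<phi> r = vadd Z (vadd Z (vscale Z 1 (\<phi> t1)) (vscale Z 1 (\<phi> t2))) (vscale Z 1 (\<phi> t3))"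
   unfolding jacobi(1) free_comb3(2)[OF jacobi(2-4) Z lin] using jacobi b by simp
  also have "\<dots> = vadd Z (vadd Z (\<phi> t1) (\<phi> t2)) (\<phi> t3)" using c jacobi Z by simp
  also have "\<dots> = vzero Z" by (rule lie_admissibleD(4)[OF \<phi> jacobi(2-5)])
  finally show ?thesis .
 next
  case (shape t t')
  have eq: "\<phi> t = \<phi> t'" by (rule lie_admissibleD(3)[OF \<phi> shape(2-4)])
  have "free_lift Z \<phi> r = vadd Z (vadd Z (vscale Z 1 (\<phi> t)) (vscale Z (-1) (\<phi> t'))) (vscale Z 0 (\<phi> t))"
   unfolding shape(1) free_comb3(2)[OF shape(2,3,2) Z lin] using shape b by simp
  then show ?thesis using c[OF shape(3)] Z vs_neg[OF Z, of "\<phi> t'"] eq by simp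
 qed
qed

text \<open>The defining relations, read as identities in the quotient. Relations between classes of
  grafted trees are derived from these.\<close>

lemma lie_class_admissible: "lie_admissible J (lie J :: ('k::field, ('k, 'b) lie_elt) vspace) (lie_class J)"
proof -
 let ?L = "lie J :: ('k, ('k, 'b) lie_elt) vspace"
 have r: "vadd ?L (vadd ?L (vscale ?L \<alpha> (lie_class J a)) (vscale ?L \<beta> (lie_class J b))) (vscale ?L \<gamma> (lie_class J c)) = vzero ?L"
  if "a \<in> layered_trees J" "b \<in> layered_trees J" "c \<in> layered_trees J"
   "(\<lambda>z. \<alpha> * vbasis a z + \<beta> * vbasis b z + \<gamma> * vbasis c z) \<in> lie_rels J" for a b c \<alpha> \<beta> \<gamma>
  using presented_rel3[OF lie_rels_in that] unfolding lie_def lie_class_def Lay_def .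
 show ?thesis unfolding lie_admissible_def
 proof (intro conjI ballI impI)
  fix t t' assume t: "t \<in> layered_trees J" "t' \<in> layered_trees J"
  show "lie_class J t \<in> vcarrier ?L" by (rule lie_class_in[OF t(1)])
  show "vadd ?L (lie_class J t) (lie_class J t') = vzero ?L" if "swap_at_node t t'"
  proof -
   have "(\<lambda>z. vbasis t z + vbasis t' z :: 'k) \<in> lie_rels J" unfolding lie_rels_def using t that by blast
   then show ?thesis using r[of t t' t 1 1 0] t lie_class_in vs_lie by (simp add: vs_lie lie_class_in)
  qed
  show "lie_class J t = (lie_class J t' :: ('k, 'b) lie_elt)" if "shape t = shape t'"
  proof -
   have "(\<lambda>z. vbasis t z - vbasis t' z :: 'k) \<in> lie_rels J" unfolding lie_rels_def using t that by blast
   then have "vadd ?L (lie_class J t) (vscale ?L (-1) (lie_class J t')) = vzero ?L"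
    using r[of t t' t 1 "-1" 0] t by (simp add: vs_lie lie_class_in)
   then show ?thesis using vs_cancel[OF vs_lie lie_class_in[OF t(1)] lie_class_in[OF t(2)]] by blast
  qed
 next
  fix t1 t2 t3 assume t: "t1 \<in> layered_trees J" "t2 \<in> layered_trees J" "t3 \<in> layered_trees J" "jacobi_triple t1 t2 t3"
  have "(\<lambda>z. vbasis t1 z + vbasis t2 z + vbasis t3 z :: 'k) \<in> lie_rels J" unfolding lie_rels_def using t by blast
  then show "vadd ?L (vadd ?L (lie_class J t1) (lie_class J t2)) (lie_class J t3) = vzero ?L"
   using r[of t1 t2 t3 1 1 1] t by (simp add: vs_lie lie_class_in)
 qed
qed

lemma tree_bracket_admissible:
 assumes I: "finite I" and P: "partition_on I P" and x: "x \<in> fams P gamma"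
 shows "lie_admissible P (gamma I) (\<lambda>t. tree_bracket t x)"
proof -
 have f: "block_tree t" "ground t = I" "set (leaves t) = P" if "t \<in> layered_trees P" for t
  using layered_tree_forest(4-6)[OF I P that] by auto
 have xi: "x B \<in> vcarrier (gamma B)" if "t \<in> layered_trees P" "B \<in> set (leaves t)" for t B using f(3)[OF that(1)] that(2) x by auto
 have tin: "tree_bracket t x \<in> vcarrier (gamma I)" if "t \<in> layered_trees P" for t
  using tree_bracket_in[OF f(1)[OF that], of x] xi[OF that] f(2)[OF that] by simp
 show ?thesis unfolding lie_admissible_def
 proof (intro conjI ballI impI)
  fix t t' assume t: "t \<in> layered_trees P" "t' \<in> layered_trees P"
  show "tree_bracket t x \<in> vcarrier (gamma I)" by (rule tin[OF t(1)])
  show "vadd (gamma I) (tree_bracket t x) (tree_bracket t' x) = vzero (gamma I)" if "swap_at_node t t'"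
   using tree_bracket_swap[OF that f(1)[OF t(1)], of x] xi[OF t(1)] f(2)[OF t(1)] vs_neg[OF vs_gamma tin[OF t(1)]] by simp
  show "tree_bracket t x = tree_bracket t' x" if "shape t = shape t'" using tree_bracket_shape[OF that] by blast
 next
  fix t1 t2 t3 assume t: "t1 \<in> layered_trees P" "t2 \<in> layered_trees P" "t3 \<in> layered_trees P" "jacobi_triple t1 t2 t3"
  show "vadd (gamma I) (vadd (gamma I) (tree_bracket t1 x) (tree_bracket t2 x)) (tree_bracket t3 x) = vzero (gamma I)"
   using tree_bracket_jacobi[OF t(4) f(1)[OF t(1)], of x] xi[OF t(1)] f(2)[OF t(1)] by simp
 qed
qed

lemma vlinear_add: "vs Z ==> vlinear V Z f ==> vlinear V Z g ==> vlinear V Z (\<lambda>v. vadd Z (f v) (g v))"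
 unfolding vlinear_def by (auto simp: vs_scale_vadd vs_assoc vs_lcomm Pi_iff)

lemma vlinear_scale: "vs Z ==> vlinear V Z f ==> vlinear V Z (\<lambda>v. vscale Z c (f v))"
 unfolding vlinear_def by (auto simp: vs_scale_vadd mult.commute Pi_iff)

lemma mlin_add:
 assumes V: "!!j. j \<in> J ==> vs (V j)" and Z: "vs Z" and f: "mlin J V Z f" and g: "mlin J V Z g"
 shows "mlin J V Z (\<lambda>x. vadd Z (f x) (g x))" unfolding mlin_def
proof (intro ballI conjI allI)
 fix x j u w c assume x: "x \<in> fams J V"
 show "vadd Z (f x) (g x) \<in> vcarrier Z" using mlinD(1)[OF f x] mlinD(1)[OF g x] Z by simp
 assume j: "j \<in> J" and u: "u \<in> vcarrier (V j)"
 have c: "f (x(j := v)) \<in> vcarrier Z" "g (x(j := v)) \<in> vcarrier Z" if "v \<in> vcarrier (V j)" for v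
  using mlinD(1)[OF f PiE_upd[OF x j that]] mlinD(1)[OF g PiE_upd[OF x j that]] by auto
 show "vadd Z (f (x(j := vadd (V j) u w))) (g (x(j := vadd (V j) u w))) =
  vadd Z (vadd Z (f (x(j := u))) (g (x(j := u)))) (vadd Z (f (x(j := w))) (g (x(j := w))))" if w: "w \<in> vcarrier (V j)"
  unfolding mlinD(2)[OF f x j u w] mlinD(2)[OF g x j u w]
  using c[OF u] c[OF w] Z by (simp only: vs_assoc[OF Z] vs_lcomm[OF Z] vs_add[OF Z])
 show "vadd Z (f (x(j := vscale (V j) c u))) (g (x(j := vscale (V j) c u))) = vscale Z c (vadd Z (f (x(j := u))) (g (x(j := u))))"
  unfolding mlinD(3)[OF f x j u] mlinD(3)[OF g x j u] using c[OF u] by (simp only: vs_scale_vadd[OF Z])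
qed

lemma mlin_scale:
 assumes "!!j. j \<in> J ==> vs (V j)" "vs Z" "mlin J V Z f"
 shows "mlin J V Z (\<lambda>x. vscale Z c (f x))"
 by (rule mlin_comp_linear[OF assms(3) _ assms(1)]) (use assms(2) in \<open>auto simp: vlinear_def vs_scale_vadd mult.commute\<close>)

lemma mlin_zero_map: "vs Z ==> mlin J V Z (\<lambda>_. vzero Z)" by (simp add: mlin_def)

text \<open>By linearity in \<open>t\<close>, the elements \<open>t\<close> for which
  \<open>\<phi> t\<close> is multilinear are closed under the vector space operations, so generators
  suffice.\<close>

lemma mlin_span:
 assumes V: "!!j. j \<in> J ==> vs (V j)" and U: "vs U" and Z: "vs Z" and X: "X \<subseteq> vcarrier U"
  and lin: "!!x. x \<in> fams J V ==> vlinear U Z (\<lambda>t. \<phi> t x)"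
  and ml: "!!t. t \<in> X ==> mlin J V Z (\<phi> t)" and t: "t \<in> vspan U X"
 shows "mlin J V Z (\<phi> t)" using t
proof induction
 case zero
 have "mlin J V Z (\<lambda>_. vzero Z)" by (rule mlin_zero_map[OF Z])
 then show ?case by (rule mlin_cong[OF _ V]) (use vlinear_zero[OF U Z lin] in auto)
next
 case (base t)
 then show ?case by (rule ml)
next
 case (add s t)
 note st = vspan_closed[OF U X add(1)] vspan_closed[OF U X add(2)]
 have "mlin J V Z (\<lambda>x. vadd Z (\<phi> s x) (\<phi> t x))" by (rule mlin_add[OF V Z add(3,4)])
 then show ?case by (rule mlin_cong[OF _ V]) (use vlinearD(2)[OF lin st] in auto)
next
 case (scale t d)
 note st = vspan_closed[OF U X scale(1)]
 have "mlin J V Z (\<lambda>x. vscale Z d (\<phi> t x))" by (rule mlin_scale[OF V Z scale(2)])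
 then show ?case by (rule mlin_cong[OF _ V]) (use vlinearD(3)[OF lin st] in auto)
qed

text \<open>The value at \<open>t\<close> of the linear map on \<open>Lie[P]\<close> that sends the class of a tree \<open>T\<close> to its bracket.\<close>

definition lie_bracket :: "'a set => 'a set set => ('k::field, 'a set) lie_elt => ('a set => ('k, 'a) gamma_elt) => ('k, 'a) gamma_elt" where
 "lie_bracket I P t x = (SOME L. vlinear (lie P) (gamma I) L \<and> (\<forall>T\<in>layered_trees P. L (lie_class P T) = tree_bracket T x)) t"

context
 fixes I :: "'a set" and P
 assumes I: "finite I" and P: "partition_on I P"
begin

lemma lie_bracket:
 fixes x :: "'a set => ('k::field, 'a) gamma_elt"
 assumes x: "x \<in> fams P gamma"
 shows "vlinear (lie P) (gamma I) (\<lambda>t. lie_bracket I P t x)" "T \<in> layered_trees P ==> lie_bracket I P (lie_class P T) x = tree_bracket T x"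
proof -
 let ?Pr = "\<lambda>L. vlinear (lie P) (gamma I) L \<and> (\<forall>T\<in>layered_trees P. L (lie_class P T) = tree_bracket T x)"
 have s: "?Pr (SOME L. ?Pr L)" by (rule someI_ex[OF lie_lift[OF vs_gamma tree_bracket_admissible[OF I P x]]])
 have e: "(\<lambda>t. lie_bracket I P t x) = (SOME L. ?Pr L)" by (simp add: lie_bracket_def)
 show "vlinear (lie P) (gamma I) (\<lambda>t. lie_bracket I P t x)" unfolding e using s by blast
 show "T \<in> layered_trees P ==> lie_bracket I P (lie_class P T) x = tree_bracket T x" using s by (simp add: lie_bracket_def)
qed

lemma lie_bracket_mlin:
 assumes t: "t \<in> vcarrier (lie P)"
 shows "mlin P gamma (gamma I) (lie_bracket I P (t :: ('k::field, 'a set) lie_elt))"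
proof (rule mlin_span[where U = "lie P" and X = "lie_class P ` layered_trees P"])
 show "t \<in> vspan (lie P) (lie_class P ` layered_trees P)" using lie_span t by blast
 show "lie_class P ` layered_trees P \<subseteq> vcarrier (lie P :: ('k, ('k, 'a set) lie_elt) vspace)" using lie_class_in by blast
 show "vlinear (lie P) (gamma I) (\<lambda>t. lie_bracket I P t x)" if "x \<in> fams P gamma" for x :: "'a set => ('k, 'a) gamma_elt"
  by (rule lie_bracket(1)[OF that])
 fix s :: "('k, 'a set) lie_elt" assume "s \<in> lie_class P ` layered_trees P"
 then obtain T where T: "T \<in> layered_trees P" "s = lie_class P T" by blast
 note f = layered_tree_forest(4-6)[OF I P T(1)]
 show "mlin P gamma (gamma I) (lie_bracket I P s)"
  by (rule mlin_cong[OF tree_bracket_mlin[OF f(1,3,2)] vs_gamma]) (use lie_bracket(2)[OF _ T(1)] T(2) in simp)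
qed (rule vs_lie vs_gamma)+

end

lemma lie_species_span:
 assumes I: "finite I"
 shows "vcarrier (species_comp lie gamma I) \<subseteq> vspan (species_comp lie gamma I)
  {comp_pure lie gamma I P (lie_class P T) x |P T x. partition_on I P \<and> T \<in> layered_trees P \<and> x \<in> fams P gamma}"
 by (rule species_comp_span[OF I vs_lie vs_gamma, where A = "\<lambda>P. lie_class P ` layered_trees P" and B = "\<lambda>S. vcarrier (gamma S)"])
  (use lie_span lie_class_in in \<open>auto intro: vspan.base\<close>)

text \<open>The universal property of the composition product yields a linear map \<open>G\<close>
  from the brackets attached to elements of \<open>Lie[P]\<close>. It takes the values prescribed in
  the definition of the action, and the elements on which they are prescribed span, so the action is
  \<open>G\<close> restricted to the carrier.\<close>

lemma lie_action:
 fixes I :: "'a set"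
 assumes I: "finite I"
 shows "vlinear (species_comp lie gamma I) (gamma I) (lie_action I :: _ => ('k::field, 'a) gamma_elt)" (is ?lin)
  and "partition_on I P ==> T \<in> layered_trees P ==> x \<in> fams P gamma ==>
   lie_action I (comp_pure lie gamma I P (lie_class P T) x) = (tree_bracket T x :: ('k, 'a) gamma_elt)"
  and "partition_on I P ==> T \<in> layered_trees P ==> D \<in> vcarrier (tensor P gamma) ==>
   lie_action I (comp_elem lie gamma I P (lie_class P T) D) = (dual_tree_deriv I P T D :: ('k, 'a) gamma_elt)"
proof -
 let ?G = "gamma :: 'a set => ('k, ('k, 'a) gamma_elt) vspace"
 let ?C = "species_comp lie ?G I"
 have "\<exists>G. vlinear ?C (?G I) G \<and> (\<forall>P t x. partition_on I P \<longrightarrow> t \<in> vcarrier (lie P) \<longrightarrow>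
  x \<in> fams P ?G \<longrightarrow> G (comp_pure lie ?G I P t x) = lie_bracket I P t x)"
  by (rule comp_lift[OF I vs_lie vs_gamma vs_gamma]) (use lie_bracket(1)[OF I] lie_bracket_mlin[OF I] in auto)
 then obtain G where G: "vlinear ?C (?G I) G" "!!P t x. partition_on I P ==> t \<in> vcarrier (lie P) ==>
  x \<in> fams P ?G ==> G (comp_pure lie ?G I P t x) = lie_bracket I P t x" by blast
 note vsC = vs_species_comp[of I lie ?G, OF I vs_lie vs_gamma]
 have G2: "G (comp_pure lie ?G I P (lie_class P T) x) = tree_bracket T x"
  if "partition_on I P" "T \<in> layered_trees P" "x \<in> fams P ?G" for P T x
  using G(2)[OF that(1) lie_class_in[OF that(2)] that(3)] lie_bracket(2)[OF I that(1,3,2)] by simp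
 \<comment> \<open>With the class of \<open>T\<close> fixed, \<open>G\<close> is linear in the
   tensor \<open>D\<close> and gives the bracket of shape \<open>T\<close> on pure tensors, which
   characterizes the dual of the tree derivative.\<close>
 have G3: "dual_tree_deriv I P T D = G (comp_elem lie ?G I P (lie_class P T) D)"
  if P: "partition_on I P" and T: "T \<in> layered_trees P" and D: "D \<in> vcarrier (tensor P ?G)" for P T D
 proof (rule dual_tree_deriv[OF I P T _ _ D])
  have "vlinear (tensor P ?G) ?C (comp_elem lie ?G I P (lie_class P T))"
   using comp_elem_bilin[of I lie ?G, OF I vs_lie vs_gamma P] lie_class_in[OF T] by (auto simp: bilin_def)
  then show "vlinear (tensor P ?G) (?G I) (\<lambda>D. G (comp_elem lie ?G I P (lie_class P T) D))" by (rule vlinear_comp[OF _ G(1)])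
  show "G (comp_elem lie ?G I P (lie_class P T) (pure P ?G x)) = tree_bracket T x" if "x \<in> fams P ?G" for x
   using G2[OF P T that] by (simp add: comp_pure_def)
 qed
 let ?K = "{(P, T, D). partition_on I P \<and> T \<in> layered_trees P \<and> D \<in> vcarrier (tensor P ?G)}"
 have e: "lie_action I = restrict G (vcarrier ?C)" unfolding lie_action_def
 proof (rule linext_eq[OF vsC vs_gamma G(1)])
  show "vcarrier ?C \<subseteq> vspan ?C ((\<lambda>(P, T, D). comp_elem lie ?G I P (lie_class P T) D) ` ?K)"
  proof (rule species_comp_span[OF I vs_lie vs_gamma, where A = "\<lambda>P. lie_class P ` layered_trees P" and B = "\<lambda>S. vcarrier (?G S)"])
   fix P x and t :: "('k, 'a set) lie_elt" assume a: "partition_on I P" "t \<in> lie_class P ` layered_trees P" "x \<in> fams P ?G"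
   then obtain T where T: "T \<in> layered_trees P" "t = lie_class P T" by blast
   show "comp_pure lie ?G I P t x \<in> (\<lambda>(P, T, D). comp_elem lie ?G I P (lie_class P T) D) ` ?K" unfolding comp_pure_def T(2)
    by (rule image_eqI[of _ _ "(P, T, pure P ?G x)"]) (use a T pure_in[of P ?G, OF vs_gamma] in auto)
  qed (use lie_span lie_class_in in \<open>auto intro: vspan.base\<close>)
 next
  fix k assume "k \<in> ?K"
  then obtain P T D where k: "k = (P, T, D)" "partition_on I P" "T \<in> layered_trees P" "D \<in> vcarrier (tensor P ?G)" by blast
  show "(\<lambda>(P, T, D). comp_elem lie ?G I P (lie_class P T) D) k \<in> vcarrier ?C"
   unfolding k(1) prod.case by (rule comp_elem_in[of I lie ?G, OF I vs_lie vs_gamma k(2) lie_class_in[OF k(3)] k(4)])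
  show "G ((\<lambda>(P, T, D). comp_elem lie ?G I P (lie_class P T) D) k) = (\<lambda>(P, T, D). dual_tree_deriv I P T D) k"
   unfolding k(1) prod.case by (rule G3[OF k(2-4), symmetric])
 qed
 show ?lin unfolding e using G(1) vlinear_restrict[OF vsC, of "?G I" G] by blast
 { assume a: "partition_on I P" "T \<in> layered_trees P" "x \<in> fams P ?G"
  have "comp_pure lie ?G I P (lie_class P T) x \<in> vcarrier ?C"
   by (rule comp_pure_in[of I lie ?G, OF I vs_lie vs_gamma a(1) lie_class_in[OF a(2)] a(3)])
  then show "lie_action I (comp_pure lie gamma I P (lie_class P T) x) = (tree_bracket T x :: ('k, 'a) gamma_elt)"
   unfolding e using G2[OF a] by simp }
 { assume a: "partition_on I P" "T \<in> layered_trees P" "D \<in> vcarrier (tensor P ?G)"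
  have "comp_elem lie ?G I P (lie_class P T) D \<in> vcarrier ?C"
   by (rule comp_elem_in[of I lie ?G, OF I vs_lie vs_gamma a(1) lie_class_in[OF a(2)] a(3)])
  then show "lie_action I (comp_elem lie gamma I P (lie_class P T) D) = (dual_tree_deriv I P T D :: ('k, 'a) gamma_elt)"
   unfolding e using G3[OF a] by simp }
qed

text \<open>The numbering in preorder; it is a layering in which the two subtrees of a node occupy consecutive
 intervals, so that it stays a layering after a Jacobi move.\<close>

fun preorder :: "nat => 'b ltree => 'b ltree" where
 "preorder k (Leaf b) = Leaf b"
| "preorder k (Node n l r) = Node k (preorder (Suc k) l) (preorder (Suc k + length (ranks l)) r)"

lemma preorder_simps [simp]: "leaves (preorder k t) = leaves t" "shape (preorder k t) = shape t"
 "length (ranks (preorder k t)) = length (ranks t)" by (induction t arbitrary: k) auto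

lemma set_ranks_preorder [simp]: "set (ranks (preorder k t)) = {k..<k + length (ranks t)}" by (induction t arbitrary: k) auto

lemma heap_ordered_preorder [simp]: "heap_ordered (preorder k t)" by (induction t arbitrary: k) auto

lemma preorder_layered: "distinct (leaves t) ==> preorder 0 t \<in> layered_trees (set (leaves t))" by (auto simp: layered_trees_def)

text \<open>Equal sets and equal lengths suffice to carry distinctness of the leaves from one tree
  to the other.\<close>

definition same_leaves :: "'b ltree => 'b ltree => bool" where
 "same_leaves t s \<longleftrightarrow> set (leaves t) = set (leaves s) \<and> length (leaves t) = length (leaves s)"

text \<open>\<open>swap_at_node\<close> keeps the ranks at the nodes, so the swapped tree is in
  general not numbered in preorder. It is still heap ordered, has the same ranks, and has the shape
  of \<open>s'\<close>. The starting rank is generalized because right subtrees start later.\<close>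

lemma swap_preorder: "swap_at_node s s' ==> \<exists>t'. swap_at_node (preorder k s) t' \<and> shape t' = shape s' \<and> heap_ordered t' \<and>
  set (ranks t') = set (ranks (preorder k s)) \<and> length (ranks t') = length (ranks s) \<and>
  same_leaves t' s"
proof (induction arbitrary: k rule: swap_at_node.induct)
 case (1 n a b)
 show ?case by (rule exI[of _ "Node k (preorder (Suc k + length (ranks a)) b) (preorder (Suc k) a)"])
   (auto simp: same_leaves_def intro: swap_at_node.intros)
next
 case (2 a a' n b)
 from 2(2)[of "Suc k"] obtain t where t: "swap_at_node (preorder (Suc k) a) t" "shape t = shape a'" "heap_ordered t"
  "set (ranks t) = set (ranks (preorder (Suc k) a))" "length (ranks t) = length (ranks a)" "same_leaves t a" by blast
 show ?case by (rule exI[of _ "Node k t (preorder (Suc k + length (ranks a)) b)"])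
   (use t in \<open>auto simp: same_leaves_def intro: swap_at_node.intros\<close>)
next
 case (3 b b' n a)
 from 3(2)[of "Suc k + length (ranks a)"] obtain t where t: "swap_at_node (preorder (Suc k + length (ranks a)) b) t" "shape t = shape b'" "heap_ordered t"
  "set (ranks t) = set (ranks (preorder (Suc k + length (ranks a)) b))" "length (ranks t) = length (ranks b)" "same_leaves t b" by blast
 show ?case by (rule exI[of _ "Node k (preorder (Suc k) a) t"]) (use t in \<open>auto simp: same_leaves_def intro: swap_at_node.intros\<close>)
qed

text \<open>In preorder the outer of the two nodes has the smallest rank and the inner one the next.
  Both precede everything in the three subtrees, so these may be permuted cyclically without
  violating heap order.\<close>

lemma jacobi_preorder: "jacobi_triple s1 s2 s3 ==> \<exists>t2 t3. jacobi_triple (preorder k s1) t2 t3 \<and>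
  (shape t2 = shape s2 \<and> heap_ordered t2 \<and> set (ranks t2) = set (ranks (preorder k s1)) \<and>
   length (ranks t2) = length (ranks s1) \<and> same_leaves t2 s1) \<and>
  (shape t3 = shape s3 \<and> heap_ordered t3 \<and> set (ranks t3) = set (ranks (preorder k s1)) \<and>
   length (ranks t3) = length (ranks s1) \<and> same_leaves t3 s1)"
proof (induction arbitrary: k rule: jacobi_triple.induct)
 case (1 m n a b c)
 let ?a = "preorder (Suc (Suc k)) a" and ?b = "preorder (Suc (Suc k) + length (ranks a)) b"
  and ?c = "preorder (Suc k + length (ranks (Node n a b))) c"
 show ?case by (rule exI[of _ "Node k (Node (Suc k) ?b ?c) ?a"], rule exI[of _ "Node k (Node (Suc k) ?c ?a) ?b"])
   (auto simp: same_leaves_def intro: jacobi_triple.intros)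
next
 case (2 a1 a2 a3 n b)
 from 2(2)[of "Suc k"] obtain t2 t3 where t: "jacobi_triple (preorder (Suc k) a1) t2 t3"
  "shape t2 = shape a2" "heap_ordered t2" "set (ranks t2) = set (ranks (preorder (Suc k) a1))" "length (ranks t2) = length (ranks a1)" "same_leaves t2 a1"
  "shape t3 = shape a3" "heap_ordered t3" "set (ranks t3) = set (ranks (preorder (Suc k) a1))" "length (ranks t3) = length (ranks a1)" "same_leaves t3 a1"
  by (elim exE conjE) (rule that)
 let ?b = "preorder (Suc k + length (ranks a1)) b"
 show ?case by (rule exI[of _ "Node k t2 ?b"], rule exI[of _ "Node k t3 ?b"])
   (use t in \<open>auto simp: same_leaves_def intro: jacobi_triple.intros\<close>)
next
 case (3 b1 b2 b3 n a)
 let ?k = "Suc k + length (ranks a)"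
 from 3(2)[of ?k] obtain t2 t3 where t: "jacobi_triple (preorder ?k b1) t2 t3"
  "shape t2 = shape b2" "heap_ordered t2" "set (ranks t2) = set (ranks (preorder ?k b1))" "length (ranks t2) = length (ranks b1)" "same_leaves t2 b1"
  "shape t3 = shape b3" "heap_ordered t3" "set (ranks t3) = set (ranks (preorder ?k b1))" "length (ranks t3) = length (ranks b1)" "same_leaves t3 b1"
  by (elim exE conjE) (rule that)
 let ?a = "preorder (Suc k) a"
 show ?case by (rule exI[of _ "Node k ?a t2"], rule exI[of _ "Node k ?a t3"])
   (use t in \<open>auto simp: same_leaves_def intro: jacobi_triple.intros\<close>)
qed

text \<open>The class of a tree with arbitrary numbering, through some layering of its shape; these
  are the values prescribed for the operadic composition, since grafting does not produce layered
  trees.\<close>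

definition tree_class :: "'b set => 'b ltree => ('k::field, 'b) lie_elt" where
 "tree_class J s = lie_class J (SOME t. t \<in> layered_trees J \<and> shape t = shape s)"

lemma layeredI:
 assumes "t \<in> layered_trees J" "heap_ordered t'" "set (ranks t') = set (ranks t)" "length (ranks t') = length (ranks t)" "same_leaves t' t"
 shows "t' \<in> layered_trees J"
proof -
 have "distinct (leaves t')"
  using assms(1,5) by (metis (no_types, lifting) card_distinct distinct_card layered_trees_def mem_Collect_eq same_leaves_def)
 then show ?thesis using assms by (auto simp: layered_trees_def same_leaves_def)
qed

lemma tree_class_eq:
 assumes "t \<in> layered_trees J" "shape t = shape s"
 shows "tree_class J s = (lie_class J t :: ('k::field, 'b) lie_elt)"
proof -
 define t0 where "t0 = (SOME t. t \<in> layered_trees J \<and> shape t = shape s)"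
 have "\<exists>t. t \<in> layered_trees J \<and> shape t = shape s" using assms by blast
 from someI_ex[OF this] have t0: "t0 \<in> layered_trees J" "shape t0 = shape t" unfolding t0_def using assms(2) by auto
 show ?thesis unfolding tree_class_def t0_def[symmetric] by (rule lie_admissibleD(3)[OF lie_class_admissible t0(1) assms(1) t0(2)])
qed

lemma tree_class_in:
 assumes "distinct (leaves s)" "set (leaves s) = J"
 shows "tree_class J s \<in> vcarrier (lie J)"
proof -
 have p: "preorder 0 s \<in> layered_trees J" using preorder_layered[OF assms(1)] assms(2) by simp
 show ?thesis unfolding tree_class_eq[OF p preorder_simps(2)] by (rule lie_class_in[OF p])
qed

lemma tree_class_swap:
 assumes "swap_at_node s s'" "distinct (leaves s)" "set (leaves s) = J"
 shows "vadd (lie J) (tree_class J s) (tree_class J s') = vzero (lie J)"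
proof -
 have p: "preorder 0 s \<in> layered_trees J" using preorder_layered[OF assms(2)] assms(3) by simp
 obtain t' where t: "swap_at_node (preorder 0 s) t'" "shape t' = shape s'" "heap_ordered t'" "set (ranks t') = set (ranks (preorder 0 s))"
  "length (ranks t') = length (ranks s)" "same_leaves t' s" using swap_preorder[OF assms(1), of 0] by blast
 have p': "t' \<in> layered_trees J" by (rule layeredI[OF p t(3,4)]) (use t in \<open>auto simp: same_leaves_def\<close>)
 show ?thesis unfolding tree_class_eq[OF p preorder_simps(2)] tree_class_eq[OF p' t(2)]
  by (rule lie_admissibleD(2)[OF lie_class_admissible p p' t(1)])
qed

lemma tree_class_jacobi:
 assumes "jacobi_triple s1 s2 s3" "distinct (leaves s1)" "set (leaves s1) = J"
 shows "vadd (lie J) (vadd (lie J) (tree_class J s1) (tree_class J s2)) (tree_class J s3) = vzero (lie J)"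
proof -
 have p: "preorder 0 s1 \<in> layered_trees J" using preorder_layered[OF assms(2)] assms(3) by simp
 obtain t2 t3 where t: "jacobi_triple (preorder 0 s1) t2 t3"
  "shape t2 = shape s2" "heap_ordered t2" "set (ranks t2) = set (ranks (preorder 0 s1))" "length (ranks t2) = length (ranks s1)" "same_leaves t2 s1"
  "shape t3 = shape s3" "heap_ordered t3" "set (ranks t3) = set (ranks (preorder 0 s1))" "length (ranks t3) = length (ranks s1)" "same_leaves t3 s1"
  using jacobi_preorder[OF assms(1), of 0] by (elim exE conjE) (rule that)
 have p2: "t2 \<in> layered_trees J" by (rule layeredI[OF p t(3,4)]) (use t in \<open>auto simp: same_leaves_def\<close>)
 have p3: "t3 \<in> layered_trees J" by (rule layeredI[OF p t(8,9)]) (use t in \<open>auto simp: same_leaves_def\<close>)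
 show ?thesis unfolding tree_class_eq[OF p preorder_simps(2)] tree_class_eq[OF p2 t(2)] tree_class_eq[OF p3 t(7)]
  by (rule lie_admissibleD(4)[OF lie_class_admissible p p2 p3 t(1)])
qed

section \<open>Extending maps from families of generators\<close>

lemma PiE_imageE:
 assumes "x \<in> (\<Pi>\<^sub>E j\<in>J. e j ` K j)"
 obtains \<kappa> where "\<kappa> \<in> (\<Pi>\<^sub>E j\<in>J. K j)" "x = (\<lambda>j\<in>J. e j (\<kappa> j))"
proof -
 have "\<forall>j\<in>J. \<exists>k. k \<in> K j \<and> x j = e j k" using assms by auto
 then obtain \<kappa> where \<kappa>: "!!j. j \<in> J ==> \<kappa> j \<in> K j \<and> x j = e j (\<kappa> j)" by metis
 have "x = (\<lambda>j\<in>J. e j (restrict \<kappa> J j))"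
 proof
  fix j show "x j = (\<lambda>j\<in>J. e j (restrict \<kappa> J j)) j" using assms \<kappa> by (cases "j \<in> J") (auto simp: PiE_iff extensional_def)
 qed
 moreover have "restrict \<kappa> J \<in> (\<Pi>\<^sub>E j\<in>J. K j)" using \<kappa> by auto
 ultimately show ?thesis by (rule that[rotated])
qed

lemma mlin_insert:
 assumes a: "a \<notin> B" and L: "!!u. u \<in> fams B V ==> vlinear (V a) Z (L u)"
  and ml: "!!v. v \<in> vcarrier (V a) ==> mlin B V Z (\<lambda>u. L u v)"
 shows "mlin (insert a B) V Z (\<lambda>v. L (restrict v B) (v a))" unfolding mlin_def
proof (intro ballI conjI allI)
 fix v assume v: "v \<in> fams (insert a B) V"
 have va: "v a \<in> vcarrier (V a)" and rB: "restrict v B \<in> fams B V" using v by auto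
 show "L (restrict v B) (v a) \<in> vcarrier Z" by (rule vlinearD(1)[OF L[OF rB] va])
 have ra: "restrict (v(a := y)) B = restrict v B" for y using a by (auto simp: fun_eq_iff)
 have rj: "restrict (v(j := y)) B = (restrict v B)(j := y)" "(v(j := y)) a = v a" if "j \<in> B" for j y
  using that a by (auto simp: fun_eq_iff)
 fix j y w c assume j: "j \<in> insert a B" and y: "y \<in> vcarrier (V j)"
 show "L (restrict (v(j := vadd (V j) y w)) B) ((v(j := vadd (V j) y w)) a) =
  vadd Z (L (restrict (v(j := y)) B) ((v(j := y)) a)) (L (restrict (v(j := w)) B) ((v(j := w)) a))" if w: "w \<in> vcarrier (V j)"
 proof (cases "j = a")
  case True
  then show ?thesis using vlinearD(2)[OF L[OF rB]] y w by (simp add: ra)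
 next
  case False
  then have jB: "j \<in> B" using j by simp
  show ?thesis unfolding rj[OF jB] by (rule mlinD(2)[OF ml[OF va] rB jB y w])
 qed
 show "L (restrict (v(j := vscale (V j) c y)) B) ((v(j := vscale (V j) c y)) a) = vscale Z c (L (restrict (v(j := y)) B) ((v(j := y)) a))"
 proof (cases "j = a")
  case True
  then show ?thesis using vlinearD(3)[OF L[OF rB]] y by (simp add: ra)
 next
  case False
  then have jB: "j \<in> B" using j by simp
  show ?thesis unfolding rj[OF jB] by (rule mlinD(3)[OF ml[OF va] rB jB y])
 qed
qed

text \<open>A map on families of generators extends to a multilinear map if its restrictions to single
 coordinates extend to linear maps.\<close>

lemma multi_ext:
 fixes J :: "'i set" and V :: "'i => ('k::field, 'v) vspace" and Z :: "('k, 'z) vspace" and K :: "'i => 'q set"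
 assumes Z: "vs Z" and J: "finite J" and V: "!!j. j \<in> J ==> vs (V j)"
  and sp: "!!j. j \<in> J ==> vcarrier (V j) \<subseteq> vspan (V j) (e j ` K j)" and e: "!!j k. j \<in> J ==> k \<in> K j ==> e j k \<in> vcarrier (V j)"
  and \<phi>: "!!x. x \<in> (\<Pi>\<^sub>E j\<in>J. K j) ==> \<phi> x \<in> vcarrier Z"
   "!!x j. x \<in> (\<Pi>\<^sub>E j\<in>J. K j) ==> j \<in> J ==> \<exists>g. vlinear (V j) Z g \<and> (\<forall>k\<in>K j. g (e j k) = \<phi> (x(j := k)))"
 shows "\<exists>g. mlin J V Z g \<and> (\<forall>x\<in>(\<Pi>\<^sub>E j\<in>J. K j). g (\<lambda>j\<in>J. e j (x j)) = \<phi> x)" using J V sp e \<phi>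
proof (induction J arbitrary: \<phi> rule: finite_induct)
 case empty
 then have "\<phi> (\<lambda>_. undefined) \<in> vcarrier Z" by simp
 then show ?case by (intro exI[of _ "\<lambda>_. \<phi> (\<lambda>_. undefined)"]) (simp add: mlin_def)
next
 case (insert a B)
 note V = insert.prems(1) and sp = insert.prems(2) and e = insert.prems(3) and \<phi> = insert.prems(4,5)
 have VB: "vs (V j)" if "j \<in> B" for j using V that by blast
 have spB: "vcarrier (V j) \<subseteq> vspan (V j) (e j ` K j)" if "j \<in> B" for j using sp that by blast
 have eB: "e j k \<in> vcarrier (V j)" if "j \<in> B" "k \<in> K j" for j k using e that by blast
 have Va: "vs (V a)" and ea: "e a ` K a \<subseteq> vcarrier (V a)" using V e by blast+
 have ins: "x(a := k) \<in> (\<Pi>\<^sub>E j\<in>insert a B. K j)" if "x \<in> (\<Pi>\<^sub>E j\<in>B. K j)" "k \<in> K a" for x k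
  using that by (auto simp: PiE_iff extensional_def)
 \<comment> \<open>With the generator at the new coordinate \<open>a\<close> fixed, the induction
   hypothesis extends over the coordinates in \<open>B\<close>.\<close>
 have "\<exists>g. mlin B V Z g \<and> (\<forall>x\<in>(\<Pi>\<^sub>E j\<in>B. K j). g (\<lambda>j\<in>B. e j (x j)) = \<phi> (x(a := k)))" if k: "k \<in> K a" for k
 proof (rule insert.IH[OF VB spB eB])
  fix x assume x: "x \<in> (\<Pi>\<^sub>E j\<in>B. K j)"
  show "\<phi> (x(a := k)) \<in> vcarrier Z" by (rule \<phi>(1)[OF ins[OF x k]])
  fix j assume j: "j \<in> B"
  then have "j \<noteq> a" using insert.hyps by auto
  then have twist: "(x(a := k))(j := k') = (x(j := k'))(a := k)" for k' by (rule fun_upd_twist[OF not_sym])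
  show "\<exists>g. vlinear (V j) Z g \<and> (\<forall>k'\<in>K j. g (e j k') = \<phi> ((x(j := k'))(a := k)))"
   using \<phi>(2)[OF ins[OF x k], of j] j unfolding twist by blast
 qed
 then have "\<forall>k\<in>K a. \<exists>g. mlin B V Z g \<and> (\<forall>x\<in>(\<Pi>\<^sub>E j\<in>B. K j). g (\<lambda>j\<in>B. e j (x j)) = \<phi> (x(a := k)))" by blast
 from bchoice[OF this] obtain g where g: "!!k. k \<in> K a ==> mlin B V Z (g k)"
  "!!k x. k \<in> K a ==> x \<in> (\<Pi>\<^sub>E j\<in>B. K j) ==> g k (\<lambda>j\<in>B. e j (x j)) = \<phi> (x(a := k))" by blast
 \<comment> \<open>For fixed \<open>u\<close> the values \<open>g k u\<close> at the generators of
   coordinate \<open>a\<close> have to extend to a linear map on \<open>V a\<close>. For families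
   \<open>u\<close> of generators this is the hypothesis on single coordinates. The existence of an
   extension is stable under addition and scaling in each coordinate of \<open>u\<close>, so it
   follows for all \<open>u\<close>.\<close>
 define lifts where "lifts L u \<longleftrightarrow> vlinear (V a) Z L \<and> (\<forall>k\<in>K a. L (e a k) = g k u)" for L u
 have "\<exists>L. lifts L u" if u: "u \<in> fams B V" for u
 proof (rule mlin_induct[where J = B and V = V and E = "\<lambda>j. e j ` K j" and Pr = "\<lambda>u. \<exists>L. lifts L u", OF insert.hyps(1) VB spB _ _ _ _ _ u])
  show "e j ` K j \<subseteq> vcarrier (V j)" if "j \<in> B" for j using eB that by blast
  fix v assume "v \<in> (\<Pi>\<^sub>E j\<in>B. e j ` K j)"
  then obtain x where x: "x \<in> (\<Pi>\<^sub>E j\<in>B. K j)" "v = (\<lambda>j\<in>B. e j (x j))" by (rule PiE_imageE)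
  show "\<exists>L. lifts L v"
  proof (cases "K a = {}")
   case True
   then show ?thesis using Z by (intro exI[of _ "\<lambda>_. vzero Z"]) (auto simp: lifts_def vlinear_def)
  next
   case False
   then obtain k0 where "k0 \<in> K a" by blast
   from \<phi>(2)[OF ins[OF x(1) this] insertI1, unfolded fun_upd_upd] obtain L where "vlinear (V a) Z L" "\<forall>k\<in>K a. L (e a k) = \<phi> (x(a := k))" by blast
   then show ?thesis unfolding lifts_def x(2) using g(2)[OF _ x(1)] by auto
  qed
 next
  fix v j assume v: "v \<in> fams B V" "j \<in> B"
  show "\<exists>L. lifts L (v(j := vzero (V j)))"
   by (rule exI[of _ "\<lambda>_. vzero Z"]) (use Z mlin_zero[of B V, OF VB Z g(1) v] in \<open>auto simp: lifts_def vlinear_def\<close>)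
 next
  fix v j y w assume v: "v \<in> fams B V" "j \<in> B" "y \<in> vcarrier (V j)" "w \<in> vcarrier (V j)"
   "\<exists>L. lifts L (v(j := y))" "\<exists>L. lifts L (v(j := w))"
  then obtain L L' where "lifts L (v(j := y))" "lifts L' (v(j := w))" by blast
  then have "lifts (\<lambda>x. vadd Z (L x) (L' x)) (v(j := vadd (V j) y w))"
   using vlinear_add[OF Z, of "V a" L L'] mlinD(2)[OF g(1) v(1-4)] by (simp add: lifts_def)
  then show "\<exists>L. lifts L (v(j := vadd (V j) y w))" by blast
 next
  fix v j y c assume v: "v \<in> fams B V" "j \<in> B" "y \<in> vcarrier (V j)" "\<exists>L. lifts L (v(j := y))"
  then obtain L where "lifts L (v(j := y))" by blast
  then have "lifts (\<lambda>x. vscale Z c (L x)) (v(j := vscale (V j) c y))"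
   using vlinear_scale[OF Z, of "V a" L] mlinD(3)[OF g(1) v(1-3)] by (simp add: lifts_def)
  then show "\<exists>L. lifts L (v(j := vscale (V j) c y))" by blast
 qed
 then have "\<forall>u\<in>(fams B V). \<exists>L. lifts L u" by blast
 from bchoice[OF this] obtain L where L: "!!u. u \<in> fams B V ==> vlinear (V a) Z (L u)"
  "!!u k. u \<in> fams B V ==> k \<in> K a ==> L u (e a k) = g k u" unfolding lifts_def by blast
 \<comment> \<open>At a generator \<open>e a k\<close> this is multilinearity of \<open>g k\<close>;
   linearity of \<open>L u\<close> carries it over to the span of the generators.\<close>
 have ml: "mlin B V Z (\<lambda>u. L u v)" if "v \<in> vcarrier (V a)" for v
 proof (rule mlin_span[OF VB Va Z ea L(1)])
  show "v \<in> vspan (V a) (e a ` K a)" using sp[of a] that by blast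
  fix t assume "t \<in> e a ` K a"
  then obtain k where k: "k \<in> K a" "t = e a k" by blast
  show "mlin B V Z (\<lambda>u. L u t)" unfolding k(2) by (rule mlin_cong[OF g(1)[OF k(1)] VB L(2)[OF _ k(1)]])
 qed
 define h where "h v = L (restrict v B) (v a)" for v
 show ?case
 proof (rule exI[of _ h], intro conjI ballI)
  show "mlin (insert a B) V Z h" unfolding h_def[abs_def] by (rule mlin_insert[of a B, OF insert.hyps(2) L(1) ml])
  fix x assume x: "x \<in> (\<Pi>\<^sub>E j\<in>insert a B. K j)"
  let ?x = "restrict x B"
  have xB: "?x \<in> (\<Pi>\<^sub>E j\<in>B. K j)" and xa: "x a \<in> K a" using x by auto
  have r: "restrict (\<lambda>j\<in>insert a B. e j (x j)) B = (\<lambda>j\<in>B. e j (?x j))" by (auto simp: fun_eq_iff)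
  have u: "(\<lambda>j\<in>B. e j (?x j)) \<in> fams B V" by (rule restrict_in_PiE) (rule eB[OF _ PiE_mem[OF xB]])
  have "?x(a := x a) = x" using x by (auto simp: fun_eq_iff PiE_iff extensional_def)
  then show "h (\<lambda>j\<in>insert a B. e j (x j)) = \<phi> x" unfolding h_def r using L(2)[OF u xa] g(2)[OF xa xB] by simp
 qed
qed

text \<open>A version with a parameter \<open>t\<close>. For generators \<open>t\<close> the
  extension exists by \<open>multi_ext\<close>, and sums and multiples of extensions serve sums and
  multiples of \<open>t\<close>. Since an extension is unique, the separately chosen maps fit
  together linearly in \<open>t\<close>.\<close>

lemma multi_ext_linear:
 assumes J: "finite J" and Z: "vs Z" and V: "!!j. j \<in> J ==> vs (V j)" and U: "vs U"
  and sp: "!!j. j \<in> J ==> vcarrier (V j) \<subseteq> vspan (V j) (e j ` K j)" and e: "!!j k. j \<in> J ==> k \<in> K j ==> e j k \<in> vcarrier (V j)"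
  and X: "vcarrier U \<subseteq> vspan U X" "X \<subseteq> vcarrier U" and lin: "!!x. x \<in> (\<Pi>\<^sub>E j\<in>J. K j) ==> vlinear U Z (\<lambda>t. \<phi> t x)"
  and ext: "!!t x j. t \<in> X ==> x \<in> (\<Pi>\<^sub>E j\<in>J. K j) ==> j \<in> J ==> \<exists>g. vlinear (V j) Z g \<and> (\<forall>k\<in>K j. g (e j k) = \<phi> t (x(j := k)))"
 shows "\<exists>g. (\<forall>t\<in>vcarrier U. mlin J V Z (g t)) \<and> (\<forall>x\<in>(fams J V). vlinear U Z (\<lambda>t. g t x)) \<and>
  (\<forall>t\<in>vcarrier U. \<forall>x\<in>(\<Pi>\<^sub>E j\<in>J. K j). g t (\<lambda>j\<in>J. e j (x j)) = \<phi> t x)"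
proof -
 define lifts where "lifts g t \<longleftrightarrow> mlin J V Z g \<and> (\<forall>x\<in>(\<Pi>\<^sub>E j\<in>J. K j). g (\<lambda>j\<in>J. e j (x j)) = \<phi> t x)" for g t
 have l0: "lifts (\<lambda>_. vzero Z) (vzero U)" unfolding lifts_def using mlin_zero_map[OF Z, of J V] vlinear_zero[OF U Z lin] by auto
 have la: "lifts (\<lambda>x. vadd Z (g x) (h x)) (vadd U s t)" if "s \<in> vcarrier U" "t \<in> vcarrier U" "lifts g s" "lifts h t" for g h s t
  using that mlin_add[OF V Z, where f = g and g = h] vlinearD(2)[OF lin that(1,2)] by (simp add: lifts_def)
 have ls: "lifts (\<lambda>x. vscale Z c (g x)) (vscale U c t)" if "t \<in> vcarrier U" "lifts g t" for g t c
  using that mlin_scale[OF V Z, where f = g] vlinearD(3)[OF lin that(1)] by (simp add: lifts_def)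
 have "\<exists>g. lifts g t" if "t \<in> vspan U X" for t using that
 proof induction
  case zero then show ?case using l0 by blast
 next
  case (base t)
  have "\<phi> t x \<in> vcarrier Z" if "x \<in> (\<Pi>\<^sub>E j\<in>J. K j)" for x using vlinearD(1)[OF lin[OF that]] base X by blast
  from multi_ext[of Z J V e K "\<phi> t", OF Z J V sp e this ext[OF base]] show ?case unfolding lifts_def .
 next
  case (add s t) then show ?case using la vspan_closed[OF U X(2)] by blast
 next
  case (scale t c) then show ?case using ls vspan_closed[OF U X(2)] by blast
 qed
 then have "\<forall>t\<in>vcarrier U. \<exists>g. lifts g t" using X(1) by blast
 from bchoice[OF this] obtain g where g: "!!t. t \<in> vcarrier U ==> lifts (g t) t" by blast
 have E: "e j ` K j \<subseteq> vcarrier (V j)" if "j \<in> J" for j using e[OF that] by blast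
 have unique: "g x = h x" if "lifts g t" "lifts h t" "x \<in> fams J V" for g h t x
 proof (rule mlin_eq[OF J V Z _ _ sp E _ that(3)])
  show "mlin J V Z g" "mlin J V Z h" using that by (auto simp: lifts_def)
  fix y assume "y \<in> (\<Pi>\<^sub>E j\<in>J. e j ` K j)"
  then obtain \<kappa> where "\<kappa> \<in> (\<Pi>\<^sub>E j\<in>J. K j)" "y = (\<lambda>j\<in>J. e j (\<kappa> j))" by (rule PiE_imageE)
  then show "g y = h y" using that by (simp add: lifts_def)
 qed
 have l: "vlinear U Z (\<lambda>t. g t x)" if x: "x \<in> fams J V" for x unfolding vlinear_def
 proof (intro conjI ballI allI Pi_I)
  fix t assume t: "t \<in> vcarrier U"
  show "g t x \<in> vcarrier Z" using g[OF t] unfolding lifts_def by (elim conjE) (rule mlinD(1)[OF _ x])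
  show "g (vscale U c t) x = vscale Z c (g t x)" for c by (rule unique[OF g[OF vs_scale[OF U t]] ls[OF t g[OF t]] x])
  fix s assume s: "s \<in> vcarrier U"
  show "g (vadd U t s) x = vadd Z (g t x) (g s x)" by (rule unique[OF g[OF vs_add[OF U t s]] la[OF t s g[OF t] g[OF s]] x])
 qed
 show ?thesis by (rule exI[of _ g]) (use g l in \<open>simp add: lifts_def\<close>)
qed

text \<open>For the operadic composition and for the associator the prescribed values make sense
  only when the inner arguments are themselves generators, so \<open>comp_lift\<close> does not
  apply directly. Here it is enough that the value extends linearly when a single inner argument
  varies.\<close>

lemma comp_lift_generators:
 fixes p :: "'a set set => ('k::field, 'v) vspace" and q :: "'a set => ('k, 'w) vspace" and K :: "'a set => 'q set"
 assumes I: "finite I" and p: "!!P. partition_on I P ==> vs (p P)" and q: "!!S. S \<subseteq> I ==> vs (q S)" and Z: "vs Z"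
  and X: "!!P. partition_on I P ==> vcarrier (p P) \<subseteq> vspan (p P) (X P)" "!!P. partition_on I P ==> X P \<subseteq> vcarrier (p P)"
  and e: "!!S. S \<subseteq> I ==> vcarrier (q S) \<subseteq> vspan (q S) (e S ` K S)" "!!S k. S \<subseteq> I ==> k \<in> K S ==> e S k \<in> vcarrier (q S)"
  and lin: "!!P \<kappa>. partition_on I P ==> \<kappa> \<in> (\<Pi>\<^sub>E S\<in>P. K S) ==> vlinear (p P) Z (\<lambda>t. \<phi> P t \<kappa>)"
  and ext: "!!P t \<kappa> S. partition_on I P ==> t \<in> X P ==> \<kappa> \<in> (\<Pi>\<^sub>E S\<in>P. K S) ==> S \<in> P ==>
   \<exists>g. vlinear (q S) Z g \<and> (\<forall>k\<in>K S. g (e S k) = \<phi> P t (\<kappa>(S := k)))"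
 obtains G where "vlinear (species_comp p q I) Z G" "!!P t \<kappa>. partition_on I P ==> t \<in> vcarrier (p P) ==> \<kappa> \<in> (\<Pi>\<^sub>E S\<in>P. K S) ==>
   G (comp_pure p q I P t (\<lambda>S\<in>P. e S (\<kappa> S))) = \<phi> P t \<kappa>"
proof -
 let ?good = "\<lambda>P g. (\<forall>t\<in>vcarrier (p P). mlin P q Z (g t)) \<and> (\<forall>x\<in>(fams P q). vlinear (p P) Z (\<lambda>t. g t x)) \<and>
   (\<forall>t\<in>vcarrier (p P). \<forall>\<kappa>\<in>(\<Pi>\<^sub>E S\<in>P. K S). g t (\<lambda>S\<in>P. e S (\<kappa> S)) = \<phi> P t \<kappa>)"
 have SI: "S \<subseteq> I" if "partition_on I P" "S \<in> P" for P S using that by (auto simp: partition_on_def)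
 have "\<exists>g. ?good P g" if P: "partition_on I P" for P by (rule multi_ext_linear[of P Z q "p P" e K "X P" "\<phi> P",
     OF partition_on_finite[OF I P] Z q[OF SI[OF P]] p[OF P] e(1)[OF SI[OF P]] e(2)[OF SI[OF P]] X[OF P] lin[OF P] ext[OF P]])
 then have "\<forall>P\<in>{P. partition_on I P}. \<exists>g. ?good P g" by (intro ballI) (simp only: mem_Collect_eq)
 from bchoice[OF this] obtain g where g: "\<forall>P\<in>{P. partition_on I P}. ?good P (g P)" by (rule exE)
 have gP: "?good P (g P)" if "partition_on I P" for P by (rule bspec[OF g]) (use that in simp)
 have g1: "mlin P q Z (g P t)" if "partition_on I P" "t \<in> vcarrier (p P)" for P t using gP[OF that(1)] that(2) by (elim conjE) (rule bspec)
 have g2: "vlinear (p P) Z (\<lambda>t. g P t x)" if "partition_on I P" "x \<in> fams P q" for P x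
  using gP[OF that(1), THEN conjunct2, THEN conjunct1] that(2) by (rule bspec)
 have g3: "g P t (\<lambda>S\<in>P. e S (\<kappa> S)) = \<phi> P t \<kappa>" if "partition_on I P" "t \<in> vcarrier (p P)" "\<kappa> \<in> (\<Pi>\<^sub>E S\<in>P. K S)" for P t \<kappa>
  using bspec[OF gP[OF that(1), THEN conjunct2, THEN conjunct2] that(2)] that(3) by (rule bspec)
 have "\<exists>G. vlinear (species_comp p q I) Z G \<and> (\<forall>P t x. partition_on I P \<longrightarrow> t \<in> vcarrier (p P) \<longrightarrow>
   x \<in> fams P q \<longrightarrow> G (comp_pure p q I P t x) = g P t x)" by (rule comp_lift[of I p q, OF I p q Z g2 g1])
 then obtain G where G: "vlinear (species_comp p q I) Z G"
  "!!P t x. partition_on I P ==> t \<in> vcarrier (p P) ==> x \<in> fams P q ==> G (comp_pure p q I P t x) = g P t x" by blast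
 show ?thesis
 proof (rule that[OF G(1)])
  fix P t \<kappa> assume a: "partition_on I P" "t \<in> vcarrier (p P)" "\<kappa> \<in> (\<Pi>\<^sub>E S\<in>P. K S)"
  have "(\<lambda>S\<in>P. e S (\<kappa> S)) \<in> fams P q" by (rule restrict_in_PiE) (rule e(2)[OF SI[OF a(1)] PiE_mem[OF a(3)]])
  from G(2)[OF a(1,2) this] g3[OF a] show "G (comp_pure p q I P t (\<lambda>S\<in>P. e S (\<kappa> S))) = \<phi> P t \<kappa>" by simp
 qed
qed

section \<open>Grafting and the operadic composition\<close>

lemma leaves_graft: "leaves (graft T U) = concat (map (\<lambda>b. leaves (U b)) (leaves T))" by (induction T) auto

lemma graft_cong: "(!!b. b \<in> set (leaves T) ==> U b = U' b) ==> graft T U = graft T U'" by (induction T) auto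

lemma graft_leaves:
 assumes R: "partition_on J R" and T: "T \<in> layered_trees R" and U: "!!r. r \<in> R ==> U r \<in> layered_trees r"
 shows "distinct (leaves (graft T U))" "set (leaves (graft T U)) = J"
proof -
 have T': "distinct (leaves T)" "set (leaves T) = R" using T by (auto simp: layered_trees_def)
 have U': "distinct (leaves (U r))" "set (leaves (U r)) = r" if "r \<in> R" for r using U[OF that] by (auto simp: layered_trees_def)
 show "set (leaves (graft T U)) = J" unfolding leaves_graft using T' U' R by (auto simp: partition_on_def)
 have "distinct (leaves t) ==> set (leaves t) \<subseteq> R ==> distinct (leaves (graft t U))" for t
 proof (induction t)
  case (Leaf b) then show ?case using U' by simp
 next
  case (Node n l r)
  have s: "set (leaves (graft t U)) = \<Union>(set (leaves t))" if "set (leaves t) \<subseteq> R" for t unfolding leaves_graft using U' that by auto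
  have "\<Union>(set (leaves l)) \<inter> \<Union>(set (leaves r)) = {}"
  proof -
   have "A \<inter> B = {}" if "A \<in> set (leaves l)" "B \<in> set (leaves r)" for A B
   proof -
    have "A \<noteq> B" "A \<in> R" "B \<in> R" using that Node.prems by auto
    then show ?thesis using R unfolding partition_on_def disjoint_def by blast
   qed
   then show ?thesis by blast
  qed
  then show ?case using Node s[of l] s[of r] by simp
 qed
 then show "distinct (leaves (graft T U))" using T' by simp
qed

text \<open>Grafting keeps the nodes of the outer tree, so an exchange there remains an
  exchange.\<close>

lemma swap_graft: "swap_at_node T T' ==> swap_at_node (graft T U) (graft T' U)"
 by (induction rule: swap_at_node.induct) (auto intro: swap_at_node.intros)

lemma jacobi_graft: "jacobi_triple T1 T2 T3 ==> jacobi_triple (graft T1 U) (graft T2 U) (graft T3 U)"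
 by (induction rule: jacobi_triple.induct) (auto intro: jacobi_triple.intros)

lemma shape_graft: "shape T = shape T' ==> (!!b. b \<in> set (leaves T) ==> shape (U b) = shape (U' b)) ==> shape (graft T U) = shape (graft T' U')"
proof (induction T arbitrary: T')
 case (Leaf b) then show ?case by (cases T') auto
next
 case (Node n l r)
 then obtain m l' r' where "T' = Node m l' r'" "shape l = shape l'" "shape r = shape r'" by (cases T') auto
 then show ?case using Node by simp
qed

text \<open>The leaf \<open>b\<close> occurs only once in \<open>T\<close>, so replacing the tree
  grafted there changes a single subtree, and the exchange is lifted along the path to it.\<close>

lemma swap_graft_leaf:
 "distinct (leaves T) ==> b \<in> set (leaves T) ==> swap_at_node t t' ==> swap_at_node (graft T (U(b := t))) (graft T (U(b := t')))"
proof (induction T)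
 case (Node n l r)
 have c: "graft s (U(b := t)) = graft s (U(b := t'))" if "b \<notin> set (leaves s)" for s using that by (intro graft_cong) auto
 show ?case
 proof (cases "b \<in> set (leaves l)")
  case True
  then have nb: "b \<notin> set (leaves r)" using Node.prems by auto
  have "swap_at_node (graft l (U(b := t))) (graft l (U(b := t')))" using Node.prems True by (intro Node.IH(1)) auto
  then show ?thesis unfolding graft.simps c[OF nb] by (rule swap_at_node.intros(2))
 next
  case False
  then have "swap_at_node (graft r (U(b := t))) (graft r (U(b := t')))" using Node.prems by (intro Node.IH(2)) auto
  then show ?thesis unfolding graft.simps c[OF False] by (rule swap_at_node.intros(3))
 qed
qed simp

lemma jacobi_graft_leaf: "distinct (leaves T) ==> b \<in> set (leaves T) ==> jacobi_triple t1 t2 t3 ==>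
  jacobi_triple (graft T (U(b := t1))) (graft T (U(b := t2))) (graft T (U(b := t3)))"
proof (induction T)
 case (Node n l r)
 have c: "graft s (U(b := t)) = graft s (U(b := t'))" if "b \<notin> set (leaves s)" for s t t' using that by (intro graft_cong) auto
 show ?case
 proof (cases "b \<in> set (leaves l)")
  case True
  then have nb: "b \<notin> set (leaves r)" using Node.prems by auto
  have "jacobi_triple (graft l (U(b := t1))) (graft l (U(b := t2))) (graft l (U(b := t3)))" using Node.prems True by (intro Node.IH(1)) auto
  then show ?thesis unfolding graft.simps c[OF nb, of t2 t1] c[OF nb, of t3 t1] by (rule jacobi_triple.intros(2))
 next
  case False
  then have "jacobi_triple (graft r (U(b := t1))) (graft r (U(b := t2))) (graft r (U(b := t3)))" using Node.prems by (intro Node.IH(2)) auto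
  then show ?thesis unfolding graft.simps c[OF False, of t2 t1] c[OF False, of t3 t1] by (rule jacobi_triple.intros(3))
 qed
qed simp

text \<open>The class of the grafted tree respects the relations of \<open>Lie\<close> in the outer
  tree and in each inner tree separately. The former gives a linear map \<open>h R U\<close> for
  fixed inner trees, the latter the extension in a single inner argument, and together they produce
  the composition as a linear map.\<close>

lemma lie_mult:
 fixes J :: "'b set"
 assumes J: "finite J"
 shows "vlinear (species_comp lie lie J) (lie J) (lie_mult J :: _ => ('k::field, 'b) lie_elt)"
  and "partition_on J R ==> T \<in> layered_trees R ==> U \<in> (\<Pi>\<^sub>E r\<in>R. layered_trees r) ==>
   lie_mult J (comp_pure lie lie J R (lie_class R T) (\<lambda>r\<in>R. lie_class r (U r))) = (tree_class J (graft T U) :: ('k, 'b) lie_elt)"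
proof -
 let ?Z = "lie J :: ('k, ('k, 'b) lie_elt) vspace"
 let ?L = "lie :: 'b set => ('k, ('k, 'b) lie_elt) vspace"
 let ?M = "lie :: 'b set set => ('k, ('k, 'b set) lie_elt) vspace"
 let ?E = "\<lambda>R. (\<Pi>\<^sub>E r\<in>R. layered_trees r) :: ('b set => 'b ltree) set"
 define h where "h R U = (SOME L. vlinear (?M R) ?Z L \<and> (\<forall>T\<in>layered_trees R. L (lie_class R T) = tree_class J (graft T U)))" for R U
 have h: "vlinear (?M R) ?Z (h R U)" "!!T. T \<in> layered_trees R ==> h R U (lie_class R T) = tree_class J (graft T U)"
  if R: "partition_on J R" and U: "U \<in> ?E R" for R U
 proof -
  have U': "!!r. r \<in> R ==> U r \<in> layered_trees r" using U by auto
  have "lie_admissible R ?Z (\<lambda>T. tree_class J (graft T U))" unfolding lie_admissible_def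
  proof (intro conjI ballI impI)
   fix t t' assume t: "t \<in> layered_trees R" "t' \<in> layered_trees R"
   note g = graft_leaves[OF R t(1) U']
   show "tree_class J (graft t U) \<in> vcarrier ?Z" by (rule tree_class_in[OF g])
   show "vadd ?Z (tree_class J (graft t U)) (tree_class J (graft t' U)) = vzero ?Z" if "swap_at_node t t'"
    by (rule tree_class_swap[OF swap_graft[OF that] g])
   show "tree_class J (graft t U) = (tree_class J (graft t' U) :: ('k, 'b) lie_elt)" if "shape t = shape t'"
    unfolding tree_class_def shape_graft[OF that refl] ..
  next
   fix t1 t2 t3 assume t: "t1 \<in> layered_trees R" "t2 \<in> layered_trees R" "t3 \<in> layered_trees R" "jacobi_triple t1 t2 t3"
   show "vadd ?Z (vadd ?Z (tree_class J (graft t1 U)) (tree_class J (graft t2 U))) (tree_class J (graft t3 U)) = vzero ?Z"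
    by (rule tree_class_jacobi[OF jacobi_graft[OF t(4)] graft_leaves[OF R t(1) U']])
  qed
  from someI_ex[OF lie_lift[OF vs_lie this], folded h_def]
  show "vlinear (?M R) ?Z (h R U)" "!!T. T \<in> layered_trees R ==> h R U (lie_class R T) = tree_class J (graft T U)" by blast+
 qed
 \<comment> \<open>Now the outer tree and all inner trees but the one at \<open>r\<close> are fixed;
   relations applied inside that inner tree persist in the grafted tree.\<close>
 have ext: "\<exists>g. vlinear (?L r) ?Z g \<and> (\<forall>k\<in>layered_trees r. g (lie_class r k) = h R (U(r := k)) t)"
  if R: "partition_on J R" and t: "t \<in> lie_class R ` layered_trees R" and U: "U \<in> ?E R" and r: "r \<in> R" for R t U r
 proof -
  obtain T where T: "T \<in> layered_trees R" "t = lie_class R T" using t by blast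
  have T': "distinct (leaves T)" "r \<in> set (leaves T)" using T r by (auto simp: layered_trees_def)
  have Uk: "U(r := k) \<in> ?E R" if "k \<in> layered_trees r" for k using U r that by (rule PiE_upd)
  have g: "distinct (leaves (graft T (U(r := k))))" "set (leaves (graft T (U(r := k)))) = J" if "k \<in> layered_trees r" for k
   using graft_leaves[OF R T(1) PiE_mem[OF Uk[OF that]]] by blast+
  have "lie_admissible r ?Z (\<lambda>k. tree_class J (graft T (U(r := k))))" unfolding lie_admissible_def
  proof (intro conjI ballI impI)
   fix t t' assume t: "t \<in> layered_trees r" "t' \<in> layered_trees r"
   show "tree_class J (graft T (U(r := t))) \<in> vcarrier ?Z" by (rule tree_class_in[OF g[OF t(1)]])
   show "vadd ?Z (tree_class J (graft T (U(r := t)))) (tree_class J (graft T (U(r := t')))) = vzero ?Z" if "swap_at_node t t'"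
    by (rule tree_class_swap[OF swap_graft_leaf[OF T' that] g[OF t(1)]])
   show "tree_class J (graft T (U(r := t))) = (tree_class J (graft T (U(r := t'))) :: ('k, 'b) lie_elt)" if "shape t = shape t'"
    unfolding tree_class_def by (subst shape_graft[OF refl, of T "U(r := t)" "U(r := t')"]) (use that in auto)
  next
   fix t1 t2 t3 assume t: "t1 \<in> layered_trees r" "t2 \<in> layered_trees r" "t3 \<in> layered_trees r" "jacobi_triple t1 t2 t3"
   show "vadd ?Z (vadd ?Z (tree_class J (graft T (U(r := t1)))) (tree_class J (graft T (U(r := t2))))) (tree_class J (graft T (U(r := t3)))) = vzero ?Z"
    by (rule tree_class_jacobi[OF jacobi_graft_leaf[OF T' t(4)] g[OF t(1)]])
  qed
  from lie_lift[OF vs_lie this] show ?thesis by (simp add: T(2) h(2)[OF R Uk T(1)])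
 qed
 obtain G where G: "vlinear (species_comp ?M ?L J) ?Z G" "!!R t U. partition_on J R ==> t \<in> vcarrier (?M R) ==> U \<in> ?E R ==>
   G (comp_pure ?M ?L J R t (\<lambda>r\<in>R. lie_class r (U r))) = h R U t"
  by (rule comp_lift_generators[of J ?M ?L ?Z "\<lambda>R. lie_class R ` layered_trees R" lie_class layered_trees "\<lambda>R t U. h R U t",
     OF J vs_lie vs_lie vs_lie lie_span _ lie_span lie_class_in h(1) ext]) (use lie_class_in that in blast)+
 note vsC = vs_species_comp[of J ?M ?L, OF J vs_lie vs_lie]
 let ?K = "{(R, T, U). partition_on J R \<and> T \<in> layered_trees R \<and> U \<in> (\<Pi>\<^sub>E r\<in>R. layered_trees r :: 'b ltree set)}"
 have Uin: "(\<lambda>r\<in>R. lie_class r (U r)) \<in> fams R ?L" if "U \<in> (\<Pi>\<^sub>E r\<in>R. layered_trees r)" for R U using that lie_class_in by auto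
 have Cin: "comp_pure ?M ?L J R (lie_class R T) (\<lambda>r\<in>R. lie_class r (U r)) \<in> vcarrier (species_comp ?M ?L J)"
  if "partition_on J R" "T \<in> layered_trees R" "U \<in> (\<Pi>\<^sub>E r\<in>R. layered_trees r)" for R T U
  by (rule comp_pure_in[of J ?M ?L, OF J vs_lie vs_lie that(1) lie_class_in[OF that(2)] Uin[OF that(3)]])
 have GK: "G (comp_pure ?M ?L J R (lie_class R T) (\<lambda>r\<in>R. lie_class r (U r))) = tree_class J (graft T U)"
  if "partition_on J R" "T \<in> layered_trees R" "U \<in> (\<Pi>\<^sub>E r\<in>R. layered_trees r)" for R T U
  unfolding G(2)[OF that(1) lie_class_in[OF that(2)] that(3)] by (rule h(2)[OF that(1,3,2)])
 have e: "lie_mult J = restrict G (vcarrier (species_comp ?M ?L J))" unfolding lie_mult_def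
 proof (rule linext_eq[OF vsC vs_lie G(1)])
  show "vcarrier (species_comp ?M ?L J) \<subseteq> vspan (species_comp ?M ?L J)
    ((\<lambda>(R, T, U). comp_pure ?M ?L J R (lie_class R T) (\<lambda>r\<in>R. lie_class r (U r))) ` ?K)"
  proof (rule species_comp_span[OF J vs_lie vs_lie, where A = "\<lambda>R. lie_class R ` layered_trees R" and B = "\<lambda>r. lie_class r ` layered_trees r"])
   fix R and x :: "'b set => ('k, 'b) lie_elt" and t :: "('k, 'b set) lie_elt" assume a: "partition_on J R" "t \<in> lie_class R ` layered_trees R" "x \<in> (\<Pi>\<^sub>E r\<in>R. lie_class r ` layered_trees r)"
   then obtain T where T: "T \<in> layered_trees R" "t = lie_class R T" by blast
   obtain U where U: "U \<in> ?E R" "x = (\<lambda>r\<in>R. lie_class r (U r))" using a(3) by (rule PiE_imageE)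
   show "comp_pure ?M ?L J R t x \<in> (\<lambda>(R, T, U). comp_pure ?M ?L J R (lie_class R T) (\<lambda>r\<in>R. lie_class r (U r))) ` ?K"
    unfolding T(2) U(2) by (intro image_eqI[of _ _ "(R, T, U)"]) (use U(1) a T in auto)
  qed (use lie_span lie_class_in in blast)+
 next
  fix k assume "k \<in> ?K"
  then obtain R T U where k: "k = (R, T, U)" "partition_on J R" "T \<in> layered_trees R" "U \<in> (\<Pi>\<^sub>E r\<in>R. layered_trees r)" by blast
  show "(\<lambda>(R, T, U). comp_pure ?M ?L J R (lie_class R T) (\<lambda>r\<in>R. lie_class r (U r))) k \<in> vcarrier (species_comp ?M ?L J)"
   unfolding k(1) prod.case by (rule Cin[OF k(2-4)])
  show "G ((\<lambda>(R, T, U). comp_pure ?M ?L J R (lie_class R T) (\<lambda>r\<in>R. lie_class r (U r))) k) =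
    (\<lambda>(R, T, U). lie_class J (SOME t. t \<in> layered_trees J \<and> shape t = shape (graft T U))) k"
   unfolding k(1) prod.case tree_class_def[symmetric] by (rule GK[OF k(2-4)])
 qed
 show "vlinear (species_comp ?M ?L J) ?Z (lie_mult J)" unfolding e using G(1) vlinear_restrict[OF vsC, of ?Z G] by blast
 show "lie_mult J (comp_pure ?M ?L J R (lie_class R T) (\<lambda>r\<in>R. lie_class r (U r))) = tree_class J (graft T U)"
  if a: "partition_on J R" "T \<in> layered_trees R" "U \<in> (\<Pi>\<^sub>E r\<in>R. layered_trees r)" unfolding e using GK[OF a] Cin[OF a] by simp
qed

section \<open>Relabelling\<close>

lemma vsum_vfree: "finite A ==> (!!a. a \<in> A ==> f a \<in> vcarrier (vfree Y)) ==> vsum (vfree Y) f A = (\<lambda>y. \<Sum>a\<in>A. f a y)"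
proof (induction A rule: finite_induct)
 case (insert a A)
 then have "vsum (vfree Y) f (insert a A) = vadd (vfree Y) (f a) (vsum (vfree Y) f A)" by (intro vsum_insert) auto
 then show ?case using insert by simp
qed simp

text \<open>Summing coefficients along the fibres of \<open>\<phi>\<close> agrees with the linear
  extension of the map of bases, from which linearity is immediate.\<close>

lemma free_map_lift:
 fixes v :: "'x => 'k::field"
 assumes \<phi>: "\<phi> ` X \<subseteq> Y" and v: "v \<in> vcarrier (vfree X)"
 shows "free_map \<phi> v = free_lift (vfree Y) (\<lambda>x. vbasis (\<phi> x)) v"
proof
 fix y
 have fin: "finite {x. v x \<noteq> 0}" and sub: "{x. v x \<noteq> 0} \<subseteq> X" using v by (auto simp: vfree_carrier)
 have in': "vscale (vfree Y) (v x) (vbasis (\<phi> x)) \<in> vcarrier (vfree Y)" if "x \<in> {x. v x \<noteq> 0}" for x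
  using sub \<phi> that by (intro vs_scale vs_vfree vbasis_in) auto
 have "free_lift (vfree Y) (\<lambda>x. vbasis (\<phi> x)) v y = (\<Sum>x\<in>{x. v x \<noteq> 0}. vscale (vfree Y) (v x) (vbasis (\<phi> x)) y)"
  unfolding free_lift_def by (subst vsum_vfree[OF fin in']) auto
 also have "\<dots> = (\<Sum>x\<in>{x. v x \<noteq> 0}. if \<phi> x = y then v x else 0)" by (rule sum.cong) (auto simp: vbasis_def)
 also have "\<dots> = free_map \<phi> v y" unfolding free_map_def using sum.inter_filter[OF fin, of v "\<lambda>x. \<phi> x = y"] by simp
 finally show "free_map \<phi> v y = free_lift (vfree Y) (\<lambda>x. vbasis (\<phi> x)) v y" by simp
qed

lemma free_map_linear:
 assumes "\<phi> ` X \<subseteq> Y"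
 shows "vlinear (vfree X) (vfree Y) (free_map \<phi> :: ('x => 'k::field) => _)" "x \<in> X ==> free_map \<phi> (vbasis x :: 'x => 'k) = vbasis (\<phi> x)"
proof -
 have in': "(\<lambda>x. vbasis (\<phi> x)) \<in> X \<rightarrow> vcarrier (vfree Y :: ('k, _) vspace)" using assms by auto
 show "vlinear (vfree X) (vfree Y) (free_map \<phi> :: ('x => 'k::field) => _)"
  by (rule vlinear_cong[OF vs_vfree free_lift_linear[OF vs_vfree in']]) (rule free_map_lift[OF assms])
 assume x: "x \<in> X"
 have b: "vbasis (\<phi> x) \<in> vcarrier (vfree Y :: ('k, _) vspace)" using x assms by auto
 show "free_map \<phi> (vbasis x :: 'x => 'k) = vbasis (\<phi> x)"
  unfolding free_map_lift[OF assms vbasis_in[OF x]] by (rule free_lift_basis[of "vfree Y" "\<lambda>x. vbasis (\<phi> x)" x, OF vs_vfree b])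
qed

lemma free_map_inverse:
 fixes v :: "'x => 'k::field"
 assumes "\<phi> ` X \<subseteq> Y" "\<psi> ` Y \<subseteq> X" "!!x. x \<in> X ==> \<psi> (\<phi> x) = x" "v \<in> vcarrier (vfree X)"
 shows "free_map \<psi> (free_map \<phi> v) = v"
proof (rule vlinear_eq_span[OF vs_vfree vs_vfree vlinear_comp[OF free_map_linear(1)[OF assms(1)] free_map_linear(1)[OF assms(2)]]])
 show "vlinear (vfree X) (vfree X) (\<lambda>v :: 'x => 'k. v)" by (auto simp: vlinear_def)
 show "v \<in> vspan (vfree X) (vbasis ` X)" using vfree_span assms(4) by blast
 show "vbasis ` X \<subseteq> vcarrier (vfree X :: ('k, _) vspace)" by auto
 fix w :: "'x => 'k" assume "w \<in> vbasis ` X"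
 then obtain x where x: "x \<in> X" "w = vbasis x" by blast
 have "\<phi> x \<in> Y" using x assms(1) by blast
 then show "free_map \<psi> (free_map \<phi> w) = w"
  unfolding x(2) free_map_linear(2)[OF assms(1) x(1)] by (simp add: free_map_linear(2)[OF assms(2)] assms(3)[OF x(1)])
qed

text \<open>Relabelling of \<open>Lie\<close> and of \<Gamma> is defined by taking images of cosets.
  The hypothesis is \<open>F\<close> mapping \<open>N\<close> onto \<open>N'\<close>, not merely
  into it, since only then is the image of a coset a full coset.\<close>

lemma quot_map:
 assumes V: "vs V" and V': "vs V'" and N: "vsub V N" and N': "vsub V' N'" and F: "vlinear V V' F" and im: "F ` N = N'"
 shows "vlinear (vquot V N) (vquot V' N') ((`) F)" "v \<in> vcarrier V ==> F ` vcoset V N v = vcoset V' N' (F v)"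
proof -
 show e: "F ` vcoset V N v = vcoset V' N' (F v)" if "v \<in> vcarrier V" for v by (rule vcoset_image[OF V N F im that])
 show "vlinear (vquot V N) (vquot V' N') ((`) F)" unfolding vlinear_def
 proof (intro conjI ballI allI)
  show "(`) F \<in> vcarrier (vquot V N) \<rightarrow> vcarrier (vquot V' N')"
  proof (rule Pi_I)
   fix A assume "A \<in> vcarrier (vquot V N)"
   then obtain v where v: "v \<in> vcarrier V" "A = vcoset V N v" by (auto simp: vquot_carrier[OF V N])
   show "F ` A \<in> vcarrier (vquot V' N')" unfolding v(2) e[OF v(1)] vquot_carrier[OF V' N'] using vlinearD(1)[OF F v(1)] by blast
  qed
  fix A c assume "A \<in> vcarrier (vquot V N)"
  then obtain a where a: "a \<in> vcarrier V" "A = vcoset V N a" by (auto simp: vquot_carrier[OF V N])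
  show "F ` vscale (vquot V N) c A = vscale (vquot V' N') c (F ` A)"
   unfolding a(2) vquot_scale[OF V N a(1)] e[OF vs_scale[OF V a(1)]] e[OF a(1)]
    vquot_scale[OF V' N' vlinearD(1)[OF F a(1)]] vlinearD(3)[OF F a(1)] ..
  fix B assume "B \<in> vcarrier (vquot V N)"
  then obtain b where b: "b \<in> vcarrier V" "B = vcoset V N b" by (auto simp: vquot_carrier[OF V N])
  show "F ` vadd (vquot V N) A B = vadd (vquot V' N') (F ` A) (F ` B)"
   unfolding a(2) b(2) vquot_add[OF V N a(1) b(1)] e[OF vs_add[OF V a(1) b(1)]] e[OF a(1)] e[OF b(1)]
    vquot_add[OF V' N' vlinearD(1)[OF F a(1)] vlinearD(1)[OF F b(1)]] vlinearD(2)[OF F a(1) b(1)] ..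
 qed
qed

section \<open>Relabelling of the Lie operad\<close>

lemma set_ltree_leaves: "set_ltree t = set (leaves t)" by (induction t) auto

lemma map_ltree_simps [simp]: "leaves (map_ltree f t) = map f (leaves t)" "ranks (map_ltree f t) = ranks t" by (induction t) auto

lemma heap_ordered_map_ltree [simp]: "heap_ordered (map_ltree f t) = heap_ordered t" by (induction t) auto

lemma shape_map_ltree: "shape (map_ltree f t) = map_ltree f (shape t)" by (induction t) auto

lemma swap_map_ltree: "swap_at_node t t' ==> swap_at_node (map_ltree f t) (map_ltree f t')"
 by (induction rule: swap_at_node.induct) (auto intro: swap_at_node.intros)

lemma jacobi_map_ltree: "jacobi_triple t1 t2 t3 ==> jacobi_triple (map_ltree f t1) (map_ltree f t2) (map_ltree f t3)"
 by (induction rule: jacobi_triple.induct) (auto intro: jacobi_triple.intros)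

lemma layered_map_ltree: "inj_on f J ==> t \<in> layered_trees J ==> map_ltree f t \<in> layered_trees (f ` J)"
 by (auto simp: layered_trees_def distinct_map)

lemma map_ltree_inverse: "t \<in> layered_trees J ==> (!!b. b \<in> J ==> g (f b) = b) ==> map_ltree g (map_ltree f t) = t"
proof -
 assume t: "t \<in> layered_trees J" and gf: "!!b. b \<in> J ==> g (f b) = b"
 have "map_ltree (g \<circ> f) t = map_ltree id t"
  by (rule ltree.map_cong[OF refl]) (use t gf in \<open>auto simp: set_ltree_leaves layered_trees_def\<close>)
 then show ?thesis by (simp add: ltree.map_comp ltree.map_id)
qed

lemma graft_map_ltree: "graft (map_ltree f T) U = graft T (\<lambda>b. U (f b))" by (induction T) auto

context
 fixes J :: "'b set" and \<phi> :: "'b => 'c"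
 assumes inj: "inj_on \<phi> J"
begin

lemma layered_map_sub: "map_ltree \<phi> ` layered_trees J \<subseteq> layered_trees (\<phi> ` J)" using layered_map_ltree[OF inj] by blast

lemma free_map_lie_rels:
 fixes r :: "'b ltree => 'k::field"
 assumes "r \<in> lie_rels J"
 shows "free_map (map_ltree \<phi>) r \<in> lie_rels (\<phi> ` J)"
proof -
 let ?X = "layered_trees J" and ?Y = "layered_trees (\<phi> ` J)" and ?m = "map_ltree \<phi>"
 note lin = free_map_linear[OF layered_map_sub, where 'k = 'k]
 have m: "?m t \<in> ?Y" if "t \<in> ?X" for t using layered_map_ltree[OF inj that] .
 have c: "free_map ?m (\<lambda>z. \<alpha> * vbasis a z + \<beta> * vbasis b z + \<gamma> * vbasis c z) =
   (\<lambda>z. \<alpha> * vbasis (?m a) z + \<beta> * vbasis (?m b) z + \<gamma> * vbasis (?m c) z)"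
  if "a \<in> ?X" "b \<in> ?X" "c \<in> ?X" for a b c and \<alpha> \<beta> \<gamma> :: 'k
  using free_comb3(2)[OF that vs_vfree lin(1), of \<alpha> \<beta> \<gamma>] lin(2)[OF that(1)] lin(2)[OF that(2)] lin(2)[OF that(3)] by simp
 from assms show ?thesis
 proof (cases rule: lie_relsE)
  case (swap t t')
  have "free_map ?m r = (\<lambda>z. vbasis (?m t) z + vbasis (?m t') z)" unfolding swap(1) c[OF swap(2,3,2)] by simp
  then show ?thesis unfolding lie_rels_def using m[OF swap(2)] m[OF swap(3)] swap_map_ltree[OF swap(4)] by blast
 next
  case (jacobi t1 t2 t3)
  have "free_map ?m r = (\<lambda>z. vbasis (?m t1) z + vbasis (?m t2) z + vbasis (?m t3) z)" unfolding jacobi(1) c[OF jacobi(2-4)] by simp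
  then show ?thesis unfolding lie_rels_def using m[OF jacobi(2)] m[OF jacobi(3)] m[OF jacobi(4)] jacobi_map_ltree[OF jacobi(5)] by blast
 next
  case (shape t t')
  have "free_map ?m r = (\<lambda>z. vbasis (?m t) z - vbasis (?m t') z)" unfolding shape(1) c[OF shape(2,3,2)] by simp
  moreover have "shape (?m t) = shape (?m t')" using shape(4) by (simp add: shape_map_ltree)
  ultimately show ?thesis unfolding lie_rels_def using m[OF shape(2)] m[OF shape(3)] by blast
 qed
qed

lemma free_map_lie_span: "v \<in> vspan (vfree (layered_trees J)) (lie_rels J) ==>
  free_map (map_ltree \<phi>) (v :: 'b ltree => 'k::field) \<in> vspan (vfree (layered_trees (\<phi> ` J))) (lie_rels (\<phi> ` J))"
 by (rule vlinear_span_image[OF vs_vfree vs_vfree free_map_linear(1)[OF layered_map_sub] lie_rels_in])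
  (use free_map_lie_rels in \<open>auto intro: vspan.base\<close>)

end

text \<open>Relabelling sends relations to relations, and so does the inverse bijection; together
  these show that the span of the relations is mapped onto the span of the relations.\<close>

lemma lie_map:
 fixes \<phi> :: "'b => 'c"
 assumes inj: "inj_on \<phi> J"
 shows "vlinear (lie J) (lie (\<phi> ` J)) (lie_map \<phi> :: ('k::field, 'b) lie_elt => _)"
  "T \<in> layered_trees J ==> lie_map \<phi> (lie_class J T :: ('k, 'b) lie_elt) = lie_class (\<phi> ` J) (map_ltree \<phi> T)"
proof -
 let ?V = "vfree (layered_trees J) :: ('k, 'b ltree => 'k) vspace" and ?V' = "vfree (layered_trees (\<phi> ` J)) :: ('k, 'c ltree => 'k) vspace"
 let ?N = "vspan ?V (lie_rels J)" and ?N' = "vspan ?V' (lie_rels (\<phi> ` J))" and ?F = "free_map (map_ltree \<phi>) :: ('b ltree => 'k) => _"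
 let ?\<psi> = "inv_into J \<phi>"
 have inj': "inj_on ?\<psi> (\<phi> ` J)" by (rule inj_on_inv_into) simp
 have im\<psi>: "?\<psi> ` \<phi> ` J = J" using inj by simp
 have sub: "vsub ?V ?N" and sub': "vsub ?V' ?N'" by (rule vspan_sub[OF vs_vfree lie_rels_in])+
 have im: "?F ` ?N = ?N'"
 proof
  show "?F ` ?N \<subseteq> ?N'" using free_map_lie_span[OF inj] by blast
  show "?N' \<subseteq> ?F ` ?N"
  proof
   fix v assume v: "v \<in> ?N'"
   have 1: "free_map (map_ltree ?\<psi>) v \<in> ?N" using free_map_lie_span[OF inj' v] by (simp add: im\<psi>)
   have s: "map_ltree ?\<psi> ` layered_trees (\<phi> ` J) \<subseteq> layered_trees J" using layered_map_sub[OF inj'] by (simp add: im\<psi>)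
   have "?F (free_map (map_ltree ?\<psi>) v) = v"
   proof (rule free_map_inverse[OF s layered_map_sub[OF inj]])
    show "v \<in> vcarrier ?V'" using vspan_closed[OF vs_vfree lie_rels_in v] .
    fix t assume "t \<in> layered_trees (\<phi> ` J)"
    then show "map_ltree \<phi> (map_ltree ?\<psi> t) = t" by (rule map_ltree_inverse) (rule f_inv_into_f)
   qed
   then show "v \<in> ?F ` ?N" using 1 by (metis image_eqI)
  qed
 qed
 have e: "lie_map \<phi> = (`) ?F" by (auto simp: lie_map_def)
 note q = quot_map[OF vs_vfree vs_vfree sub sub' free_map_linear(1)[OF layered_map_sub[OF inj]] im]
 show "vlinear (lie J) (lie (\<phi> ` J)) (lie_map \<phi> :: ('k::field, 'b) lie_elt => _)" unfolding e lie_def Lay_def by (rule q(1))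
 show "lie_map \<phi> (lie_class J T :: ('k, 'b) lie_elt) = lie_class (\<phi> ` J) (map_ltree \<phi> T)" if T: "T \<in> layered_trees J"
  unfolding e lie_class_def Lay_def q(2)[OF vbasis_in[OF T]] free_map_linear(2)[OF layered_map_sub[OF inj] T] ..
qed

lemma lie_map_cong:
 assumes "A \<in> vcarrier (lie J)" "!!b. b \<in> J ==> \<phi> b = \<psi> b"
 shows "lie_map \<phi> A = lie_map \<psi> A"
proof -
 have "free_map (map_ltree \<phi>) v = free_map (map_ltree \<psi>) v" if "v \<in> A" for v
 proof -
  obtain u where u: "u \<in> vcarrier (vfree (layered_trees J))" "A = vcoset (vfree (layered_trees J)) (vspan (vfree (layered_trees J)) (lie_rels J)) u"
   using assms(1) by (auto simp: lie_def Lay_def vquot_def)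
  have "v \<in> vcarrier (vfree (layered_trees J))"
   using that u vspan_closed[OF vs_vfree lie_rels_in] vs_add[OF vs_vfree] unfolding vcoset_def by blast
  then have s: "x \<in> layered_trees J" if "v x \<noteq> 0" for x using that by (auto simp: vfree_carrier)
  have "map_ltree \<phi> x = map_ltree \<psi> x" if "v x \<noteq> 0" for x
   by (rule ltree.map_cong[OF refl]) (use s[OF that] assms(2) in \<open>auto simp: set_ltree_leaves layered_trees_def\<close>)
  then have "{x. v x \<noteq> 0 \<and> map_ltree \<phi> x = y} = {x. v x \<noteq> 0 \<and> map_ltree \<psi> x = y}" for y by auto
  then show ?thesis by (simp add: free_map_def)
 qed
 then show ?thesis unfolding lie_map_def by (rule image_cong[OF refl])
qed

text \<open>\<open>{{}}\<close> is not a partition in the sense of \<open>partition_on\<close>, so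
  the results on faces do not cover the empty ground set and it has to be treated by hand.\<close>

lemma faces_empty: "faces {{}} = {{\<lambda>_. 0}}"
proof -
 have T: "Tspace {{}} = {\<lambda>_. 0}" by (auto simp: Tspace_def vfree_carrier)
 have "vspan (vfree {}) {\<lambda>_. 0 :: real} = {\<lambda>_. 0}"
 proof
  show "vspan (vfree {}) {\<lambda>_. 0 :: real} \<subseteq> {\<lambda>_. 0}" by (rule vspan_least) (auto simp: vsub_def vfree_carrier)
  show "{\<lambda>_. 0} \<subseteq> vspan (vfree {}) {\<lambda>_. 0 :: real}" by (auto intro: vspan.base)
 qed
 then show ?thesis unfolding faces_def adjoint_faces_def using T by auto
qed

text \<open>The transpose of relabelling, a map from functionals on the relabelled faces back to
  functionals on the original ones.\<close>

definition pull_face :: "'a set => ('a => 'b) => 'a set set => ('b face => 'k::field) => 'a face => 'k" where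
 "pull_face I \<sigma> P f = (\<lambda>X. if X \<in> faces P then f (face_map I \<sigma> X) else 0)"

section \<open>Relabelling of faces and of \<Gamma>\<close>

context
 fixes I :: "'a set" and \<sigma> :: "'a => 'b"
 assumes I: "finite I" and \<sigma>: "inj_on \<sigma> I"
begin

lemma finite_image_I: "finite (\<sigma> ` I)" using I by simp

lemma face_map_restrict:
 assumes P: "partition_on I P" and X: "X \<in> faces P" and S: "S \<in> P"
 shows "face_restrict (face_map I \<sigma> X) (\<sigma> ` S) = face_map S \<sigma> (face_restrict X S)"
proof -
 have SI: "S \<subseteq> I" using P S by (auto simp: partition_on_def)
 have \<sigma>S: "inj_on \<sigma> S" using inj_on_subset[OF \<sigma> SI] .
 have fS: "finite S" using finite_subset[OF SI I] .
 note m = face_map[OF I P \<sigma> X] and r = face_restrict_block[OF I P S X]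
 note mS = face_map[OF fS partition_on_block[OF P S] \<sigma>S r(1)]
 show ?thesis
 proof (rule face_restrict_eqI[OF finite_image_I partition_on_image[OF \<sigma> P] imageI[OF S] m(1)])
  show "face_map S \<sigma> (face_restrict X S) \<in> faces {\<sigma> ` S}" using mS(1) by simp
  fix F assume "F \<subseteq> \<sigma> ` S"
  then obtain E where E: "E \<subseteq> S" "F = \<sigma> ` E" by (auto simp: subset_image_iff)
  have "E \<subseteq> I" using E SI by auto
  then show "face_sign (face_map I \<sigma> X) F = face_sign (face_map S \<sigma> (face_restrict X S)) F"
   unfolding E(2) mS(2)[OF E(1)] r(2)[OF E(1)] by (rule m(2))
 qed
qed

lemma valid_cut_image:
 assumes P: "partition_on I P" and V: "valid_cut P (C, D)"
 shows "valid_cut ((`) \<sigma> ` P) (\<sigma> ` C, \<sigma> ` D)" "cut_target ((`) \<sigma> ` P) (\<sigma> ` C, \<sigma> ` D) = (`) \<sigma> ` cut_target P (C, D)"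
proof -
 note c = cut_parts[OF P V]
 have CDI: "C \<subseteq> I" "D \<subseteq> I" using c(6) UnP[OF I P] by auto
 have U: "\<sigma> ` C \<union> \<sigma> ` D = \<sigma> ` (C \<union> D)" by auto
 have "\<sigma> ` C \<inter> \<sigma> ` D = {}" using inj_on_image_Int[OF \<sigma> CDI] c(7) by simp
 then show "valid_cut ((`) \<sigma> ` P) (\<sigma> ` C, \<sigma> ` D)" using c(6,8,9) U by (auto simp: valid_cut_def)
 have inj: "inj_on ((`) \<sigma>) P" by (rule inj_on_subset[OF inj_on_image_Pow[OF \<sigma>]]) (use UnP[OF I P] in auto)
 have "(`) \<sigma> ` (P - {C \<union> D}) = (`) \<sigma> ` P - {\<sigma> ` (C \<union> D)}" using inj_on_image_set_diff[OF inj, of P "{C \<union> D}"] c(6) by auto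
 then show "cut_target ((`) \<sigma> ` P) (\<sigma> ` C, \<sigma> ` D) = (`) \<sigma> ` cut_target P (C, D)" unfolding cut_target_def prod.case U by simp
qed

lemma face_map_cut:
 assumes P: "partition_on I P" and V: "valid_cut P (C, D)" and X: "X \<in> faces (cut_target P (C, D))"
 shows "face_map I \<sigma> (face_cut P (C, D) X) = face_cut ((`) \<sigma> ` P) (\<sigma> ` C, \<sigma> ` D) (face_map I \<sigma> X)"
proof -
 note Q = partition_on_cut[OF P V] and v = valid_cut_image[OF P V]
 note c = cut_parts[OF P V]
 have CDI: "C \<subseteq> I" "D \<subseteq> I" using c(6) UnP[OF I P] by auto
 note m = face_map[OF I Q \<sigma> X] and k = face_cut[OF I P V X]
 note mk = face_map[OF I P \<sigma> k(1)]
 have X': "face_map I \<sigma> X \<in> faces (cut_target ((`) \<sigma> ` P) (\<sigma> ` C, \<sigma> ` D))" using m(1) v(2) by simp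
 note km = face_cut[OF finite_image_I partition_on_image[OF \<sigma> P] v(1) X']
 have sub: "\<sigma> ` B \<subseteq> \<sigma> ` E \<longleftrightarrow> B \<subseteq> E" if B: "B \<subseteq> I" "E \<subseteq> I" for B E
 proof
  assume a: "\<sigma> ` B \<subseteq> \<sigma> ` E"
  show "B \<subseteq> E"
  proof
   fix i assume "i \<in> B"
   then have "\<sigma> i \<in> \<sigma> ` E" "i \<in> I" using a B by auto
   then show "i \<in> E" using inj_on_image_mem_iff[OF \<sigma>] B by simp
  qed
 qed auto
 show ?thesis
 proof (rule face_ext[OF finite_image_I partition_on_image[OF \<sigma> P] mk(1) km(1)])
  fix F assume "F \<subseteq> \<sigma> ` I"
  then obtain E where E: "E \<subseteq> I" "F = \<sigma> ` E" by (auto simp: subset_image_iff)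
  have "\<sigma> ` E \<subseteq> \<sigma> ` I" using E by auto
  then show "face_sign (face_map I \<sigma> (face_cut P (C, D) X)) F = face_sign (face_cut ((`) \<sigma> ` P) (\<sigma> ` C, \<sigma> ` D) (face_map I \<sigma> X)) F"
   unfolding E(2) by (simp add: mk(2) k(2) km(2) m(2) E(1) sub CDI)
 qed
qed

lemma pull_face_cut:
 assumes P: "partition_on I P" and V: "valid_cut P (C, D)"
 shows "cut_deriv P (C, D) (pull_face I \<sigma> P f) =
  pull_face I \<sigma> (cut_target P (C, D)) (cut_deriv ((`) \<sigma> ` P) (\<sigma> ` C, \<sigma> ` D) f)"
proof
 fix X
 note v = valid_cut_image[OF P V]
 show "cut_deriv P (C, D) (pull_face I \<sigma> P f) X =
  pull_face I \<sigma> (cut_target P (C, D)) (cut_deriv ((`) \<sigma> ` P) (\<sigma> ` C, \<sigma> ` D) f) X"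
 proof (cases "X \<in> faces (cut_target P (C, D))")
  case True
  have V': "valid_cut P (D, C)" "X \<in> faces (cut_target P (D, C))" using V True by (simp_all add: valid_cut_swap cut_target_swap[of P D C])
  note m = face_map(1)[OF I partition_on_cut[OF P V] \<sigma> True]
  show ?thesis using True m face_cut(1)[OF I P V True] face_cut_swap(1)[OF I P V True]
   by (simp add: cut_deriv_def pull_face_def v(2) face_map_cut[OF P V True] face_map_cut[OF P V'])
 qed (simp add: cut_deriv_def pull_face_def)
qed

lemma pull_face_cuts: "partition_on I P ==> valid_cuts P Vs ==>
  cuts_deriv P Vs (pull_face I \<sigma> P f) = pull_face I \<sigma> (cuts_target P Vs) (cuts_deriv ((`) \<sigma> ` P) (map (map_prod ((`) \<sigma>) ((`) \<sigma>)) Vs) f) \<and>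
  valid_cuts ((`) \<sigma> ` P) (map (map_prod ((`) \<sigma>) ((`) \<sigma>)) Vs) \<and>
  cuts_target ((`) \<sigma> ` P) (map (map_prod ((`) \<sigma>) ((`) \<sigma>)) Vs) = (`) \<sigma> ` cuts_target P Vs"
proof (induction Vs arbitrary: P f)
 case (Cons W Vs)
 obtain C D where W: "W = (C, D)" by (cases W)
 have V: "valid_cut P (C, D)" "valid_cuts (cut_target P (C, D)) Vs" using Cons.prems W by auto
 note v = valid_cut_image[OF Cons.prems(1) V(1)]
 note IH = Cons.IH[OF partition_on_cut[OF Cons.prems(1) V(1)] V(2), of "cut_deriv ((`) \<sigma> ` P) (\<sigma> ` C, \<sigma> ` D) f"]
 show ?case using IH v pull_face_cut[OF Cons.prems(1) V(1), of f] by (simp add: W)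
qed simp

lemma pull_face_local:
 assumes P: "partition_on I P" and G: "local_on ((`) \<sigma> ` P) G"
 shows "local_on P (pull_face I \<sigma> P G)"
proof (rule local_onI)
 fix X Y assume XY: "X \<in> faces P" "Y \<in> faces P" "!!S. S \<in> P ==> face_restrict X S = face_restrict Y S"
 have "G (face_map I \<sigma> X) = G (face_map I \<sigma> Y)"
 proof (rule local_onD(2)[OF G face_map(1)[OF I P \<sigma> XY(1)] face_map(1)[OF I P \<sigma> XY(2)]])
  fix S' assume "S' \<in> (`) \<sigma> ` P"
  then obtain S where S: "S \<in> P" "S' = \<sigma> ` S" by blast
  show "face_restrict (face_map I \<sigma> X) S' = face_restrict (face_map I \<sigma> Y) S'"
   unfolding S(2) face_map_restrict[OF P XY(1) S(1)] face_map_restrict[OF P XY(2) S(1)] XY(3)[OF S(1)] ..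
 qed
 then show "pull_face I \<sigma> P G X = pull_face I \<sigma> P G Y" using XY by (simp add: pull_face_def)
qed (simp add: pull_face_def)

text \<open>Pulling back turns derivatives along relabelled cuts into derivatives along the original
  cuts, and it preserves locality because relabelling commutes with restriction to blocks.\<close>

lemma pull_face_gamma_dual:
 assumes f: "f \<in> vcarrier (gamma_dual (\<sigma> ` I))"
 shows "pull_face I \<sigma> {I} f \<in> vcarrier (gamma_dual I)"
proof (cases "I = {}")
 case True
 then have "f = (\<lambda>_. 0)" using f by (simp add: gamma_dual_def)
 then show ?thesis using True by (simp add: gamma_dual_def pull_face_def)
next
 case False
 have ne: "\<sigma> ` I \<noteq> {}" using False by simp
 have p: "partition_on I {I}" using False by (rule partition_on_space)
 have f': "cut_differentiable {\<sigma> ` I} f" using f unfolding gamma_dual_iff[OF finite_image_I ne] .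
 show ?thesis unfolding gamma_dual_iff[OF I False] cut_differentiable_def
 proof (intro allI impI)
  fix Vs assume v: "valid_cuts {I} Vs"
  note c = pull_face_cuts[OF p v, of f]
  let ?Vs = "map (map_prod ((`) \<sigma>) ((`) \<sigma>)) Vs"
  have "local_on ((`) \<sigma> ` cuts_target {I} Vs) (cuts_deriv ((`) \<sigma> ` {I}) ?Vs f)"
   using f' c unfolding cut_differentiable_def by (metis image_empty image_insert)
  then show "local_on (cuts_target {I} Vs) (cuts_deriv {I} Vs (pull_face I \<sigma> {I} f))"
   using pull_face_local[OF partition_on_cuts[OF p v]] c by simp
 qed
qed

lemma face_map_block: "X \<in> faces {I} ==> face_map I \<sigma> X \<in> faces {\<sigma> ` I}"
proof (cases "I = {}")
 case True
 assume "X \<in> faces {I}"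
 then show ?thesis using True by (auto simp: faces_empty face_map_def)
next
 case False
 assume "X \<in> faces {I}"
 then show ?thesis using face_map(1)[OF I partition_on_space[OF False] \<sigma>, of X] by simp
qed

end

lemma face_map_inverse:
 assumes I: "finite I" and \<sigma>: "inj_on \<sigma> I" and \<tau>: "!!i. i \<in> I ==> \<tau> (\<sigma> i) = i" and X: "X \<in> faces {I}"
 shows "face_map (\<sigma> ` I) \<tau> (face_map I \<sigma> X) = X"
proof (cases "I = {}")
 case True
 then show ?thesis using X by (auto simp: faces_empty face_map_def)
next
 case False
 have p: "partition_on I {I}" using False by (rule partition_on_space)
 have \<tau>': "inj_on \<tau> (\<sigma> ` I)" using \<tau> by (auto intro!: inj_onI)
 have im: "\<tau> ` \<sigma> ` E = E" if "E \<subseteq> I" for E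
 proof -
  have "\<tau> ` \<sigma> ` E = (\<lambda>i. i) ` E" unfolding image_image by (rule image_cong) (use \<tau> that in auto)
  then show ?thesis by simp
 qed
 have fin: "finite (\<sigma> ` I)" using I by simp
 note m = face_map[OF I p \<sigma> X]
 have m1: "face_map I \<sigma> X \<in> faces {\<sigma> ` I}" using m(1) by simp
 note m' = face_map[OF fin partition_on_space \<tau>' m1]
 have ne: "\<sigma> ` I \<noteq> {}" using False by simp
 show ?thesis
 proof (rule face_ext[OF I p])
  show "face_map (\<sigma> ` I) \<tau> (face_map I \<sigma> X) \<in> faces {I}" using m'(1)[OF ne] im[of I] by simp
  fix E assume E: "E \<subseteq> I"
  then have "\<sigma> ` E \<subseteq> \<sigma> ` I" by auto
  from m'(2)[OF ne this] show "face_sign (face_map (\<sigma> ` I) \<tau> (face_map I \<sigma> X)) E = face_sign X E" unfolding im[OF E] m(2)[OF E] .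
 qed (rule X)
qed

lemma finite_faces_single: "finite I ==> finite (faces {I})"
 by (cases "I = {}") (auto simp: faces_empty intro: finite_faces[OF _ partition_on_space])

lemma face_pairing_map:
 fixes d :: "'a face => 'k::field"
 assumes I: "finite I" and \<sigma>: "inj_on \<sigma> I" and d: "d \<in> vcarrier (Lvee {I})"
 shows "face_pairing {\<sigma> ` I} f (free_map (face_map I \<sigma>) d) = face_pairing {I} (pull_face I \<sigma> {I} f) d"
proof -
 have fp': "face_pairing {J} g (vbasis W) = g W" if "finite J" "W \<in> faces {J}" for J :: "'b set" and g :: "'b face => 'k" and W
 proof -
  have "face_pairing {J} g (vbasis W) = (\<Sum>X\<in>faces {J}. if X = W then g X else 0)"
   unfolding face_pairing_def by (rule sum.cong) (auto simp: vbasis_def)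
  then show ?thesis using that(2) finite_faces_single[OF that(1)] by simp
 qed
 have s: "face_map I \<sigma> ` faces {I} \<subseteq> faces {\<sigma> ` I}" using face_map_block[OF I \<sigma>] by blast
 show ?thesis
 proof (rule vlinear_eq_span[where V = "vfree (faces {I})" and W = vfield and X = "vbasis ` faces {I}" and v = d
    and g = "\<lambda>d. face_pairing {\<sigma> ` I} f (free_map (face_map I \<sigma>) d)" and h = "face_pairing {I} (pull_face I \<sigma> {I} f)"])
  show "vlinear (vfree (faces {I})) vfield (\<lambda>d :: 'a face => 'k. face_pairing {\<sigma> ` I} f (free_map (face_map I \<sigma>) d))"
   by (rule vlinear_comp[OF free_map_linear(1)[OF s]]) (auto simp: vlinear_def face_pairing_add face_pairing_scale)
  show "vlinear (vfree (faces {I})) vfield (face_pairing {I} (pull_face I \<sigma> {I} f))"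
   by (auto simp: vlinear_def face_pairing_add face_pairing_scale)
  show "d \<in> vspan (vfree (faces {I})) (vbasis ` faces {I})" using d vfree_span unfolding Lvee_def by blast
  fix w :: "'a face => 'k" assume "w \<in> vbasis ` faces {I}"
  then obtain X where X: "X \<in> faces {I}" "w = vbasis X" by blast
  have fb: "face_pairing {I} g (vbasis X) = g X" for g :: "'a face => 'k"
  proof -
   have "face_pairing {I} g (vbasis X) = (\<Sum>Y\<in>faces {I}. if Y = X then g Y else 0)"
    unfolding face_pairing_def by (rule sum.cong) (auto simp: vbasis_def)
   then show ?thesis using X(1) finite_faces_single[OF I] by simp
  qed
  have fI: "finite (\<sigma> ` I)" using I by simp
  show "face_pairing {\<sigma> ` I} f (free_map (face_map I \<sigma>) w) = face_pairing {I} (pull_face I \<sigma> {I} f) w"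
   unfolding X(2) free_map_linear(2)[OF s X(1)] fp'[OF fI face_map_block[OF I \<sigma> X(1)]] fb using X(1) by (simp add: pull_face_def)
 qed auto
qed

text \<open>On faces, relabelling is adjoint to \<open>pull_face\<close>, which preserves
  \<open>\<Gamma>\<^sup>*\<close>; hence null vectors go to null vectors. The same applied to the
  inverse bijection shows that all null vectors are reached, as images of cosets require.\<close>

lemma gamma_map:
 fixes \<sigma> :: "'a => 'b"
 assumes I: "finite I" and \<sigma>: "inj_on \<sigma> I"
 shows "vlinear (gamma I) (gamma (\<sigma> ` I)) (gamma_map I \<sigma> :: ('k::field, 'a) gamma_elt => _)"
  and "f \<in> vcarrier (gamma_dual (\<sigma> ` I)) ==> E \<in> vcarrier (gamma I) ==>
   gamma_pairing (\<sigma> ` I) f (gamma_map I \<sigma> E) = gamma_pairing I (pull_face I \<sigma> {I} f) (E :: ('k, 'a) gamma_elt)"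
proof -
 let ?F = "free_map (face_map I \<sigma>) :: ('a face => 'k) => 'b face => 'k"
 let ?\<tau> = "inv_into I \<sigma>"
 have fin: "finite (\<sigma> ` I)" using I by simp
 have \<tau>: "inj_on ?\<tau> (\<sigma> ` I)" by (rule inj_on_inv_into) simp
 have im\<tau>: "?\<tau> ` \<sigma> ` I = I" using \<sigma> by simp
 have s: "face_map I \<sigma> ` faces {I} \<subseteq> faces {\<sigma> ` I}" using face_map_block[OF I \<sigma>] by blast
 have s': "face_map (\<sigma> ` I) ?\<tau> ` faces {\<sigma> ` I} \<subseteq> faces {I}" using face_map_block[OF fin \<tau>] im\<tau> by auto
 have lin: "vlinear (Lvee {I}) (Lvee {\<sigma> ` I}) ?F" unfolding Lvee_def by (rule free_map_linear(1)[OF s])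
 have lin': "vlinear (Lvee {\<sigma> ` I}) (Lvee {I}) (free_map (face_map (\<sigma> ` I) ?\<tau>) :: ('b face => 'k) => _)"
  unfolding Lvee_def by (rule free_map_linear(1)[OF s'])
 have im: "?F ` gamma_null I = gamma_null (\<sigma> ` I)"
 proof
  show "?F ` gamma_null I \<subseteq> gamma_null (\<sigma> ` I)"
  proof (rule image_subsetI)
   fix d :: "'a face => 'k" assume d: "d \<in> gamma_null I"
   then have dL: "d \<in> vcarrier (Lvee {I})" by (simp add: gamma_null_def)
   show "?F d \<in> gamma_null (\<sigma> ` I)" unfolding gamma_null_def
   proof (rule CollectI, rule conjI[OF vlinearD(1)[OF lin dL]], rule ballI)
    fix f :: "'b face => 'k" assume "f \<in> vcarrier (gamma_dual (\<sigma> ` I))"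
    from pull_face_gamma_dual[OF I \<sigma> this] show "face_pairing {\<sigma> ` I} f (?F d) = 0"
     unfolding face_pairing_map[OF I \<sigma> dL] using d by (simp add: gamma_null_def)
   qed
  qed
  show "gamma_null (\<sigma> ` I) \<subseteq> ?F ` gamma_null I"
  proof
   fix d :: "'b face => 'k" assume d: "d \<in> gamma_null (\<sigma> ` I)"
   then have dL: "d \<in> vcarrier (Lvee {\<sigma> ` I})" by (simp add: gamma_null_def)
   let ?e = "free_map (face_map (\<sigma> ` I) ?\<tau>) d"
   have "face_pairing {?\<tau> ` \<sigma> ` I} f ?e = 0" if "f \<in> vcarrier (gamma_dual I)" for f
    unfolding face_pairing_map[OF fin \<tau> dL] using pull_face_gamma_dual[OF fin \<tau>, of f] that d im\<tau> by (simp add: gamma_null_def)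
   then have e: "?e \<in> gamma_null I" using vlinearD(1)[OF lin' dL] im\<tau> by (simp add: gamma_null_def)
   have "?F ?e = d"
   proof (rule free_map_inverse[OF s' s])
    show "d \<in> vcarrier (vfree (faces {\<sigma> ` I}))" using dL by (simp add: Lvee_def)
    fix X assume X: "X \<in> faces {\<sigma> ` I}"
    have "face_map (?\<tau> ` \<sigma> ` I) \<sigma> (face_map (\<sigma> ` I) ?\<tau> X) = X" by (rule face_map_inverse[OF fin \<tau> _ X]) (rule f_inv_into_f)
    then show "face_map I \<sigma> (face_map (\<sigma> ` I) ?\<tau> X) = X" using im\<tau> by simp
   qed
   then show "d \<in> ?F ` gamma_null I" using e by (metis image_eqI)
  qed
 qed
 note q = quot_map[OF Lvee_simps(4) Lvee_simps(4) vsub_gamma_null vsub_gamma_null lin im]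
 have e: "gamma_map I \<sigma> = (`) ?F" by (auto simp: gamma_map_def)
 show lg: "vlinear (gamma I) (gamma (\<sigma> ` I)) (gamma_map I \<sigma> :: ('k::field, 'a) gamma_elt => _)" unfolding e gamma_def by (rule q(1))
 assume f: "f \<in> vcarrier (gamma_dual (\<sigma> ` I))" and E: "E \<in> vcarrier (gamma I)"
 obtain d where d: "d \<in> vcarrier (Lvee {I})" "E = gamma_class I d" using gammaE[OF E] by blast
 show "gamma_pairing (\<sigma> ` I) f (gamma_map I \<sigma> E) = gamma_pairing I (pull_face I \<sigma> {I} f) E"
  unfolding d(2) e q(2)[OF d(1)] gamma_pairing_class[OF f] gamma_pairing_class[OF pull_face_gamma_dual[OF I \<sigma> f]]
  by (rule face_pairing_map[OF I \<sigma> d(1)])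
qed

text \<open>An expansion of the derivative of \<open>f\<close> along the relabelled cut pulls back,
  factor by factor, to an expansion for the pulled-back functional along \<open>[C, D]\<close>. The
  adjunction between relabelling and pulling back then matches the two sums term by term.\<close>

lemma bracket_natural:
 fixes x y :: "('k::field, 'a) gamma_elt"
 assumes fin: "finite C" "finite D" and CD: "C \<noteq> {}" "D \<noteq> {}" "C \<inter> D = {}" and \<sigma>: "inj_on \<sigma> (C \<union> D)"
  and x: "x \<in> vcarrier (gamma C)" and y: "y \<in> vcarrier (gamma D)"
 shows "gamma_map (C \<union> D) \<sigma> (bracket C D x y) = bracket (\<sigma> ` C) (\<sigma> ` D) (gamma_map C \<sigma> x) (gamma_map D \<sigma> y)"
proof (rule gamma_ext)
 let ?I = "C \<union> D"
 have fI: "finite ?I" using fin by simp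
 have \<sigma>CD: "inj_on \<sigma> C" "inj_on \<sigma> D" using \<sigma> by (auto simp: inj_on_Un)
 note b = bracket_in[OF fin CD, of x y] and pp = pair_partition[OF fin CD]
 have fin': "finite (\<sigma> ` C)" "finite (\<sigma> ` D)" using fin by auto
 have CD': "\<sigma> ` C \<noteq> {}" "\<sigma> ` D \<noteq> {}" "\<sigma> ` C \<inter> \<sigma> ` D = {}" using CD inj_on_image_Int[OF \<sigma>, of C D] by auto
 have U: "\<sigma> ` C \<union> \<sigma> ` D = \<sigma> ` ?I" by auto
 have gx: "gamma_map C \<sigma> x \<in> vcarrier (gamma (\<sigma> ` C))" "gamma_map D \<sigma> y \<in> vcarrier (gamma (\<sigma> ` D))"
  using vlinearD(1)[OF gamma_map(1)[OF fin(1) \<sigma>CD(1)] x] vlinearD(1)[OF gamma_map(1)[OF fin(2) \<sigma>CD(2)] y] .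
 note b' = bracket_in[OF fin' CD', of "gamma_map C \<sigma> x" "gamma_map D \<sigma> y", unfolded U]
 show "gamma_map ?I \<sigma> (bracket C D x y) \<in> vcarrier (gamma (\<sigma> ` ?I))" by (rule vlinearD(1)[OF gamma_map(1)[OF fI \<sigma>] b])
 show "bracket (\<sigma> ` C) (\<sigma> ` D) (gamma_map C \<sigma> x) (gamma_map D \<sigma> y) \<in> vcarrier (gamma (\<sigma> ` ?I))" by (rule b')
 fix f :: "_ face => 'k" assume f: "f \<in> vcarrier (gamma_dual (\<sigma> ` ?I))"
 then have f': "f \<in> vcarrier (gamma_dual (\<sigma> ` C \<union> \<sigma> ` D))" using U by simp
 obtain p q where e: "!!x y. x \<in> vcarrier (gamma (\<sigma> ` C)) ==> y \<in> vcarrier (gamma (\<sigma> ` D)) ==>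
   gamma_pairing (\<sigma> ` C \<union> \<sigma> ` D) f (bracket (\<sigma> ` C) (\<sigma> ` D) x y) = (\<Sum>i\<in>faces {\<sigma> ` C}. gamma_pairing (\<sigma> ` C) (p i) x * gamma_pairing (\<sigma> ` D) (q i) y)"
  "!!i. i \<in> faces {\<sigma> ` C} ==> p i \<in> vcarrier (gamma_dual (\<sigma> ` C))" "!!i. i \<in> faces {\<sigma> ` C} ==> q i \<in> vcarrier (gamma_dual (\<sigma> ` D))"
  "!!X. X \<in> faces {\<sigma> ` C, \<sigma> ` D} ==> cut_deriv {\<sigma> ` C \<union> \<sigma> ` D} (\<sigma> ` C, \<sigma> ` D) f X =
   (\<Sum>i\<in>faces {\<sigma> ` C}. p i (face_restrict X (\<sigma> ` C)) * q i (face_restrict X (\<sigma> ` D)))"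
  by (rule bracket_pairing_ex[OF fin' CD' f']) (rule that)
 have "gamma_pairing (\<sigma> ` ?I) f (gamma_map ?I \<sigma> (bracket C D x y)) = gamma_pairing ?I (pull_face ?I \<sigma> {?I} f) (bracket C D x y)"
  by (rule gamma_map(2)[OF fI \<sigma> f b])
 also have "\<dots> = (\<Sum>i\<in>faces {\<sigma> ` C}. gamma_pairing C (pull_face C \<sigma> {C} (p i)) x * gamma_pairing D (pull_face D \<sigma> {D} (q i)) y)"
 proof (rule bracket_pairing[OF fin CD x y pull_face_gamma_dual[OF fI \<sigma> f]])
  fix i assume i: "i \<in> faces {\<sigma> ` C}"
  show "pull_face C \<sigma> {C} (p i) \<in> vcarrier (gamma_dual C)" by (rule pull_face_gamma_dual[OF fin(1) \<sigma>CD(1) e(2)[OF i]])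
  show "pull_face D \<sigma> {D} (q i) \<in> vcarrier (gamma_dual D)" by (rule pull_face_gamma_dual[OF fin(2) \<sigma>CD(2) e(3)[OF i]])
 next
  fix X assume X: "X \<in> faces {C, D}"
  have m: "face_map ?I \<sigma> X \<in> faces {\<sigma> ` C, \<sigma> ` D}" using face_map(1)[OF fI pp(4) \<sigma> X] by simp
  have r: "face_restrict X C \<in> faces {C}" "face_restrict X D \<in> faces {D}" using face_restrict_block(1)[OF fI pp(4) _ X] by auto
  have "cut_deriv {?I} (C, D) (pull_face ?I \<sigma> {?I} f) X = cut_deriv {\<sigma> ` C \<union> \<sigma> ` D} (\<sigma> ` C, \<sigma> ` D) f (face_map ?I \<sigma> X)"
   using pull_face_cut[OF fI \<sigma> pp(1,5), of f] X pp(6) U by (simp add: pull_face_def)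
  also have "\<dots> = (\<Sum>i\<in>faces {\<sigma> ` C}. p i (face_map C \<sigma> (face_restrict X C)) * q i (face_map D \<sigma> (face_restrict X D)))"
   unfolding e(4)[OF m] using face_map_restrict[OF fI \<sigma> pp(4) X] by simp
  finally show "cut_deriv {?I} (C, D) (pull_face ?I \<sigma> {?I} f) X =
    (\<Sum>i\<in>faces {\<sigma> ` C}. pull_face C \<sigma> {C} (p i) (face_restrict X C) * pull_face D \<sigma> {D} (q i) (face_restrict X D))"
   using r by (simp add: pull_face_def)
 qed
 also have "\<dots> = (\<Sum>i\<in>faces {\<sigma> ` C}. gamma_pairing (\<sigma> ` C) (p i) (gamma_map C \<sigma> x) * gamma_pairing (\<sigma> ` D) (q i) (gamma_map D \<sigma> y))"
  by (rule sum.cong[OF refl]) (simp only: gamma_map(2)[OF fin(1) \<sigma>CD(1) e(2) x] gamma_map(2)[OF fin(2) \<sigma>CD(2) e(3) y])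
 also have "\<dots> = gamma_pairing (\<sigma> ` ?I) f (bracket (\<sigma> ` C) (\<sigma> ` D) (gamma_map C \<sigma> x) (gamma_map D \<sigma> y))" using e(1)[OF gx] U by simp
 finally show "gamma_pairing (\<sigma> ` ?I) f (gamma_map ?I \<sigma> (bracket C D x y)) =
  gamma_pairing (\<sigma> ` ?I) f (bracket (\<sigma> ` C) (\<sigma> ` D) (gamma_map C \<sigma> x) (gamma_map D \<sigma> y))" .
qed

lemma tree_bracket_natural:
 fixes x :: "'a set => ('k::field, 'a) gamma_elt"
 shows "block_tree t ==> inj_on \<sigma> (ground t) ==> (!!B. B \<in> set (leaves t) ==> x B \<in> vcarrier (gamma B)) ==>
  (!!B. B \<in> set (leaves t) ==> x' (\<sigma> ` B) = gamma_map B \<sigma> (x B)) ==>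
  gamma_map (ground t) \<sigma> (tree_bracket t x) = tree_bracket (map_ltree ((`) \<sigma>) t) x'"
proof (induction t)
 case (Node n l r)
 note b = block_tree_Node[OF Node.prems(1)]
 have \<sigma>: "inj_on \<sigma> (ground l \<union> ground r)" using Node.prems(2) by simp
 have \<sigma>2: "inj_on \<sigma> (ground l)" "inj_on \<sigma> (ground r)" using inj_on_subset[OF \<sigma>] by auto
 have t2: "tree_bracket l x \<in> vcarrier (gamma (ground l))" "tree_bracket r x \<in> vcarrier (gamma (ground r))"
  using Node.prems(3) by (auto intro!: tree_bracket_in b)
 have g: "ground (map_ltree ((`) \<sigma>) t) = \<sigma> ` ground t" for t by auto
 have IH: "gamma_map (ground l) \<sigma> (tree_bracket l x) = tree_bracket (map_ltree ((`) \<sigma>) l) x'"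
  "gamma_map (ground r) \<sigma> (tree_bracket r x) = tree_bracket (map_ltree ((`) \<sigma>) r) x'"
  using Node.IH(1)[OF b(1) \<sigma>2(1)] Node.IH(2)[OF b(2) \<sigma>2(2)] Node.prems(3,4) by auto
 have "gamma_map (ground (Node n l r)) \<sigma> (tree_bracket (Node n l r) x) =
   gamma_map (ground l \<union> ground r) \<sigma> (bracket (ground l) (ground r) (tree_bracket l x) (tree_bracket r x))" by simp
 also have "\<dots> = bracket (\<sigma> ` ground l) (\<sigma> ` ground r) (gamma_map (ground l) \<sigma> (tree_bracket l x)) (gamma_map (ground r) \<sigma> (tree_bracket r x))"
  by (rule bracket_natural[OF b(6,7,4,5,3) \<sigma> t2])
 finally show ?case unfolding IH g[symmetric] by simp
qed simp

text \<open>The index sets are matched by \<open>f\<close> with inverse \<open>h\<close>, and a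
  linear map is applied in each coordinate. Relabelling uses it with the image map on blocks, the
  action inside blocks with the identity.\<close>

lemma mlin_reindex:
 assumes g: "mlin J' V' Z g" and V: "!!j. j \<in> J ==> vs (V j)"
  and f: "!!j. j \<in> J ==> f j \<in> J' \<and> h (f j) = j" and h: "!!j'. j' \<in> J' ==> h j' \<in> J \<and> f (h j') = j'"
  and A: "!!j. j \<in> J ==> vlinear (V j) (V' (f j)) (A j)"
 shows "mlin J V Z (\<lambda>x. g (\<lambda>j'\<in>J'. A (h j') (x (h j'))))"
proof -
 have in': "(\<lambda>j'\<in>J'. A (h j') (x (h j'))) \<in> fams J' V'" if x: "x \<in> fams J V" for x
 proof (rule restrict_in_PiE)
  fix j' assume j': "j' \<in> J'"
  then have "x (h j') \<in> vcarrier (V (h j'))" using h x by auto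
  from vlinearD(1)[OF A this] show "A (h j') (x (h j')) \<in> vcarrier (V' j')" using h[OF j'] by simp
 qed
 have up: "(\<lambda>j'\<in>J'. A (h j') ((x(j := u)) (h j'))) = (\<lambda>j'\<in>J'. A (h j') (x (h j')))(f j := A j u)" if "j \<in> J" for x j u
 proof
  fix j'
  show "(\<lambda>j'\<in>J'. A (h j') ((x(j := u)) (h j'))) j' = ((\<lambda>j'\<in>J'. A (h j') (x (h j')))(f j := A j u)) j'"
  proof (cases "j' = f j")
   case True then show ?thesis using f[OF that] by simp
  next
   case False
   then have "j' \<in> J' ==> h j' \<noteq> j" using h by auto
   then show ?thesis using False by simp
  qed
 qed
 show ?thesis unfolding mlin_def
 proof (intro ballI conjI allI)
  fix x assume x: "x \<in> fams J V"
  show "g (\<lambda>j'\<in>J'. A (h j') (x (h j'))) \<in> vcarrier Z" by (rule mlinD(1)[OF g in'[OF x]])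
  fix j u w c assume j: "j \<in> J" and u: "u \<in> vcarrier (V j)"
  have fj: "f j \<in> J'" using f[OF j] by simp
  note Aj = vlinearD[OF A[OF j]]
  show "g (\<lambda>j'\<in>J'. A (h j') ((x(j := vadd (V j) u w)) (h j'))) =
   vadd Z (g (\<lambda>j'\<in>J'. A (h j') ((x(j := u)) (h j')))) (g (\<lambda>j'\<in>J'. A (h j') ((x(j := w)) (h j'))))" if w: "w \<in> vcarrier (V j)"
   unfolding up[OF j] Aj(2)[OF u w] by (rule mlinD(2)[OF g in'[OF x] fj Aj(1)[OF u] Aj(1)[OF w]])
  show "g (\<lambda>j'\<in>J'. A (h j') ((x(j := vscale (V j) c u)) (h j'))) = vscale Z c (g (\<lambda>j'\<in>J'. A (h j') ((x(j := u)) (h j'))))"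
   unfolding up[OF j] Aj(3)[OF u] by (rule mlinD(3)[OF g in'[OF x] fj Aj(1)[OF u]])
 qed
qed

lemma lie_gamma_map:
 fixes \<sigma> :: "'a => 'b"
 assumes I: "finite I" and \<sigma>: "inj_on \<sigma> I"
 shows "vlinear (species_comp lie gamma I) (species_comp lie gamma (\<sigma> ` I)) (lie_gamma_map I \<sigma> :: ('k::field, 'a) lie_gamma_elt => _)"
  and "partition_on I P ==> t \<in> vcarrier (lie P) ==> x \<in> fams P gamma ==>
   lie_gamma_map I \<sigma> (comp_pure lie gamma I P t (x :: 'a set => ('k, 'a) gamma_elt)) =
   comp_pure lie gamma (\<sigma> ` I) ((`) \<sigma> ` P) (lie_map ((`) \<sigma>) t)
    (\<lambda>S'\<in>(`) \<sigma> ` P. gamma_map (inv_into P ((`) \<sigma>) S') \<sigma> (x (inv_into P ((`) \<sigma>) S')))"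
proof -
 let ?G = "gamma :: 'a set => ('k, ('k, 'a) gamma_elt) vspace" and ?G' = "gamma :: 'b set => ('k, ('k, 'b) gamma_elt) vspace"
 let ?Z = "species_comp lie ?G' (\<sigma> ` I)"
 let ?x = "\<lambda>P x. \<lambda>S'\<in>(`) \<sigma> ` P. gamma_map (inv_into P ((`) \<sigma>) S') \<sigma> (x (inv_into P ((`) \<sigma>) S')) :: ('k, 'b) gamma_elt"
 have fin: "finite (\<sigma> ` I)" using I by simp
 have inj: "inj_on ((`) \<sigma>) P" if "partition_on I P" for P by (rule inj_on_subset[OF inj_on_image_Pow[OF \<sigma>]]) (use UnP[OF I that] in auto)
 have gm: "vlinear (?G S) (?G' (\<sigma> ` S)) (gamma_map S \<sigma>)" if "partition_on I P" "S \<in> P" for P S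
 proof -
  have "S \<subseteq> I" using UnP[OF I that(1)] that(2) by auto
  then show ?thesis using gamma_map(1) finite_subset[OF _ I] inj_on_subset[OF \<sigma>] by blast
 qed
 have ml: "mlin P ?G Y (\<lambda>x. g (?x P x))" if P: "partition_on I P" and g: "mlin ((`) \<sigma> ` P) ?G' Y g" for P g and Y :: "('k, ('k, 'b) lie_gamma_elt) vspace"
  by (rule mlin_reindex[OF g vs_gamma, where f = "(`) \<sigma>" and h = "inv_into P ((`) \<sigma>)" and A = "\<lambda>S. gamma_map S \<sigma>"])
   (use inj[OF P] gm[OF P] in \<open>auto simp: inv_into_f_f\<close>)
 have xin: "?x P x \<in> fams ((`) \<sigma> ` P) ?G'" if P: "partition_on I P" and x: "x \<in> fams P ?G" for P x
 proof (rule restrict_in_PiE)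
  fix S' assume "S' \<in> (`) \<sigma> ` P"
  then obtain S where S: "S \<in> P" "S' = \<sigma> ` S" by blast
  have "x S \<in> vcarrier (?G S)" using x S by auto
  from vlinearD(1)[OF gm[OF P S(1)] this] show "gamma_map (inv_into P ((`) \<sigma>) S') \<sigma> (x (inv_into P ((`) \<sigma>) S')) \<in> vcarrier (?G' S')"
   using inv_into_f_f[OF inj[OF P] S(1)] S(2) by simp
 qed
 have e: "lie_gamma_map I \<sigma> = comp_ext lie ?G I ?Z (\<lambda>P t x. comp_pure lie ?G' (\<sigma> ` I) ((`) \<sigma> ` P) (lie_map ((`) \<sigma>) t) (?x P x))"
  unfolding lie_gamma_map_def Let_def ..
 note w = comp_ext_works[of I lie ?G ?Z "\<lambda>P t x. comp_pure lie ?G' (\<sigma> ` I) ((`) \<sigma> ` P) (lie_map ((`) \<sigma>) t) (?x P x)",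
   OF I vs_lie vs_gamma vs_species_comp[of "\<sigma> ` I" lie ?G', OF fin vs_lie vs_gamma]]
 have 1: "vlinear (lie P) ?Z (\<lambda>t. comp_pure lie ?G' (\<sigma> ` I) ((`) \<sigma> ` P) (lie_map ((`) \<sigma>) t) (?x P x))"
  if P: "partition_on I P" and x: "x \<in> fams P ?G" for P x by (rule vlinear_comp[OF lie_map(1)[OF inj[OF P]]
     comp_pure_linear[of "\<sigma> ` I" lie ?G', OF fin vs_lie vs_gamma partition_on_image[OF \<sigma> P] xin[OF P x]]])
 have 2: "mlin P ?G ?Z (\<lambda>x. comp_pure lie ?G' (\<sigma> ` I) ((`) \<sigma> ` P) (lie_map ((`) \<sigma>) t) (?x P x))"
  if P: "partition_on I P" and t: "t \<in> vcarrier (lie P)" for P t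
  by (rule ml[OF P comp_pure_mlin[of "\<sigma> ` I" lie ?G', OF fin vs_lie vs_gamma partition_on_image[OF \<sigma> P] vlinearD(1)[OF lie_map(1)[OF inj[OF P]] t]]])
 show "vlinear (species_comp lie ?G I) ?Z (lie_gamma_map I \<sigma>)" unfolding e by (rule w(1)[OF 1 2])
 show "lie_gamma_map I \<sigma> (comp_pure lie ?G I P t x) = comp_pure lie ?G' (\<sigma> ` I) ((`) \<sigma> ` P) (lie_map ((`) \<sigma>) t) (?x P x)"
  if "partition_on I P" "t \<in> vcarrier (lie P)" "x \<in> fams P ?G" unfolding e by (rule w(2)[OF 1 2 that])
qed

lemma lie_action_natural:
 fixes \<sigma> :: "'a => 'b" and u :: "('k::field, 'a) lie_gamma_elt"
 assumes I: "finite I" and \<sigma>: "inj_on \<sigma> I" and u: "u \<in> vcarrier (species_comp lie gamma I)"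
 shows "lie_action (\<sigma> ` I) (lie_gamma_map I \<sigma> u) = gamma_map I \<sigma> (lie_action I u)"
proof -
 let ?G = "gamma :: 'a set => ('k, ('k, 'a) gamma_elt) vspace" and ?G' = "gamma :: 'b set => ('k, ('k, 'b) gamma_elt) vspace"
 let ?X = "{comp_pure lie ?G I P (lie_class P T) x |P T x. partition_on I P \<and> T \<in> layered_trees P \<and> x \<in> fams P ?G}"
 have fin: "finite (\<sigma> ` I)" using I by simp
 have sub: "?X \<subseteq> vcarrier (species_comp lie ?G I)" using comp_pure_in[of I lie ?G, OF I vs_lie vs_gamma] lie_class_in by blast
 show ?thesis
 proof (rule vlinear_eq_span[OF vs_species_comp[of I lie ?G, OF I vs_lie vs_gamma] vs_gamma
    vlinear_comp[OF lie_gamma_map(1)[OF I \<sigma>] lie_action(1)[OF fin]] vlinear_comp[OF lie_action(1)[OF I] gamma_map(1)[OF I \<sigma>]] sub])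
  show "u \<in> vspan (species_comp lie ?G I) ?X" using lie_species_span[OF I] u by blast
  fix v assume "v \<in> ?X"
  then obtain P T x where v: "v = comp_pure lie ?G I P (lie_class P T) x" and P: "partition_on I P" and T: "T \<in> layered_trees P"
   and x: "x \<in> fams P ?G" by blast
  note l = layered_tree_forest(4-6)[OF I P T]
  have inj: "inj_on ((`) \<sigma>) P" by (rule inj_on_subset[OF inj_on_image_Pow[OF \<sigma>]]) (use UnP[OF I P] in auto)
  let ?x = "\<lambda>S'\<in>(`) \<sigma> ` P. gamma_map (inv_into P ((`) \<sigma>) S') \<sigma> (x (inv_into P ((`) \<sigma>) S')) :: ('k, 'b) gamma_elt"
  have xS: "?x (\<sigma> ` B) = gamma_map B \<sigma> (x B)" if "B \<in> P" for B using that inv_into_f_f[OF inj that] by simp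
  have xin: "?x \<in> fams ((`) \<sigma> ` P) ?G'"
  proof (rule restrict_in_PiE)
   fix S' assume "S' \<in> (`) \<sigma> ` P"
   then obtain S where S: "S \<in> P" "S' = \<sigma> ` S" by blast
   have SI: "S \<subseteq> I" using UnP[OF I P] S by auto
   have "x S \<in> vcarrier (?G S)" using x S by auto
   from vlinearD(1)[OF gamma_map(1)[OF finite_subset[OF SI I] inj_on_subset[OF \<sigma> SI]] this]
   show "gamma_map (inv_into P ((`) \<sigma>) S') \<sigma> (x (inv_into P ((`) \<sigma>) S')) \<in> vcarrier (?G' S')"
    using inv_into_f_f[OF inj S(1)] S(2) by simp
  qed
  have "lie_action (\<sigma> ` I) (lie_gamma_map I \<sigma> v) = tree_bracket (map_ltree ((`) \<sigma>) T) ?x"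
   unfolding v lie_gamma_map(2)[OF I \<sigma> P lie_class_in[OF T] x] lie_map(2)[OF inj T]
   by (rule lie_action(2)[OF fin partition_on_image[OF \<sigma> P] layered_map_ltree[OF inj T] xin])
  also have "\<dots> = gamma_map I \<sigma> (tree_bracket T x)" using tree_bracket_natural[OF l(1), of \<sigma> x ?x] l(2,3) \<sigma> x xS by (simp add: PiE_iff)
  also have "\<dots> = gamma_map I \<sigma> (lie_action I v)" unfolding v lie_action(2)[OF I P T x] ..
  finally show "lie_action (\<sigma> ` I) (lie_gamma_map I \<sigma> v) = gamma_map I \<sigma> (lie_action I v)" .
 qed
qed

section \<open>Associativity\<close>

context
 fixes I :: "'a set" and P :: "'a set set" and Ps :: "'a set => 'a set set"
 assumes P: "partition_on I P" and Ps: "!!S. S \<in> P ==> partition_on S (Ps S)"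
begin

lemma refine_Union: "S \<in> P ==> \<Union>(Ps S) = S" using Ps by (simp add: partition_on_def)

lemma refine_nonempty: "S \<in> P ==> B \<in> Ps S ==> B \<noteq> {} \<and> B \<subseteq> S" using Ps by (auto simp: partition_on_def)

lemma refine_unique:
 assumes "S \<in> P" "S' \<in> P" "B \<in> Ps S" "B \<subseteq> S'"
 shows "S = S'"
proof (rule ccontr)
 assume "S \<noteq> S'"
 then have "S \<inter> S' = {}" using P assms(1,2) unfolding partition_on_def disjoint_def by blast
 then show False using refine_nonempty[OF assms(1,3)] assms(4) by blast
qed

text \<open>Each \<open>S\<close> is recovered from \<open>Ps S\<close> as its union. So the sets
  \<open>Ps S\<close> are in bijection with the blocks of \<open>P\<close>, and an outer tree over
  \<open>P\<close> can be relabelled by them.\<close>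

lemma refine_inj: "inj_on Ps P" by (rule inj_onI) (metis refine_Union)

lemma partition_on_refine: "partition_on I (\<Union>(Ps ` P))"
proof (rule partition_onI)
 have "\<Union>(\<Union>(Ps ` P)) = (\<Union>S\<in>P. \<Union>(Ps S))" by blast
 also have "\<dots> = \<Union>P" using refine_Union by auto
 finally show "\<Union>(\<Union>(Ps ` P)) = I" using P by (simp add: partition_on_def)
 fix B B' assume B: "B \<in> \<Union>(Ps ` P)" "B' \<in> \<Union>(Ps ` P)" "B \<noteq> B'"
 then obtain S S' where S: "S \<in> P" "B \<in> Ps S" "S' \<in> P" "B' \<in> Ps S'" by blast
 show "disjnt B B'"
 proof (cases "S = S'")
  case True
  then show ?thesis using Ps[OF S(1)] S B(3) unfolding partition_on_def disjoint_def disjnt_def by blast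
 next
  case False
  then have "S \<inter> S' = {}" using P S unfolding partition_on_def disjoint_def by blast
  then show ?thesis using refine_nonempty[OF S(1,2)] refine_nonempty[OF S(3,4)] unfolding disjnt_def by blast
 qed
next
 show "{} \<notin> \<Union>(Ps ` P)" using refine_nonempty by blast
qed

lemma partition_on_refine_blocks: "partition_on (\<Union>(Ps ` P)) (Ps ` P)"
proof (rule partition_onI)
 show "{} \<notin> Ps ` P"
 proof
  assume "{} \<in> Ps ` P"
  then obtain S where S: "S \<in> P" "Ps S = {}" by force
  then show False using refine_Union[OF S(1)] P by (auto simp: partition_on_def)
 qed
next
 fix p p' assume p: "p \<in> Ps ` P" "p' \<in> Ps ` P" "p \<noteq> p'"
 then obtain S S' where S: "S \<in> P" "p = Ps S" "S' \<in> P" "p' = Ps S'" by blast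
 show "disjnt p p'" unfolding disjnt_def
 proof (rule ccontr)
  assume "p \<inter> p' \<noteq> {}"
  then obtain B where B: "B \<in> Ps S" "B \<in> Ps S'" using S by blast
  have "S = S'" by (rule refine_unique[OF S(1,3) B(1)]) (use refine_nonempty[OF S(3) B(2)] in blast)
  then show False using S p(3) by blast
 qed
qed simp

end

lemma mlin_coord:
 assumes g: "mlin J V Z g" and j: "j \<in> J" and V: "vs (V j)"
  and x: "!!u. u \<in> vcarrier (V j) ==> x(j := u) \<in> fams J V"
 shows "vlinear (V j) Z (\<lambda>u. g (x(j := u)))"
proof -
 note x0 = x[OF vs_zero[OF V]]
 show ?thesis unfolding vlinear_def
 proof (intro conjI ballI allI Pi_I)
  fix u assume u: "u \<in> vcarrier (V j)"
  show "g (x(j := u)) \<in> vcarrier Z" by (rule mlinD(1)[OF g x[OF u]])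
  show "g (x(j := vscale (V j) c u)) = vscale Z c (g (x(j := u)))" for c using mlinD(3)[OF g x0 j u] by simp
  fix w assume w: "w \<in> vcarrier (V j)"
  show "g (x(j := vadd (V j) u w)) = vadd Z (g (x(j := u))) (g (x(j := w)))" using mlinD(2)[OF g x0 j u w] by simp
 qed
qed

text \<open>Freezing the coordinates outside \<open>R\<close> at a fixed family \<open>w\<close>
  leaves a multilinear map in the remaining ones; every coordinate that varies is still a coordinate
  of \<open>Q\<close>.\<close>

lemma mlin_subset:
 assumes g: "mlin Q V Z g" and R: "R \<subseteq> Q" and w: "!!B. B \<in> Q ==> B \<notin> R ==> w B \<in> vcarrier (V B)"
 shows "mlin R V Z (\<lambda>y. g (\<lambda>B\<in>Q. if B \<in> R then y B else w B))"
proof -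
 have in': "(\<lambda>B\<in>Q. if B \<in> R then y B else w B) \<in> fams Q V" if "y \<in> fams R V" for y by (rule restrict_in_PiE) (use that w in auto)
 have up: "(\<lambda>B\<in>Q. if B \<in> R then (y(j := u)) B else w B) = (\<lambda>B\<in>Q. if B \<in> R then y B else w B)(j := u)" if "j \<in> R" for y j u
  using that R by (auto simp: fun_eq_iff)
 show ?thesis unfolding mlin_def
 proof (intro ballI conjI allI)
  fix y assume y: "y \<in> fams R V"
  show "g (\<lambda>B\<in>Q. if B \<in> R then y B else w B) \<in> vcarrier Z" by (rule mlinD(1)[OF g in'[OF y]])
  fix j u v c assume j: "j \<in> R" and u: "u \<in> vcarrier (V j)"
  have jQ: "j \<in> Q" using j R by blast
  show "g (\<lambda>B\<in>Q. if B \<in> R then (y(j := vscale (V j) c u)) B else w B) = vscale Z c (g (\<lambda>B\<in>Q. if B \<in> R then (y(j := u)) B else w B))"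
   unfolding up[OF j] by (rule mlinD(3)[OF g in'[OF y] jQ u])
  assume v: "v \<in> vcarrier (V j)"
  show "g (\<lambda>B\<in>Q. if B \<in> R then (y(j := vadd (V j) u v)) B else w B) =
    vadd Z (g (\<lambda>B\<in>Q. if B \<in> R then (y(j := u)) B else w B)) (g (\<lambda>B\<in>Q. if B \<in> R then (y(j := v)) B else w B))"
   unfolding up[OF j] by (rule mlinD(2)[OF g in'[OF y] jQ u v])
 qed
qed

section \<open>The maps in the associativity law\<close>

lemma lie_comp_action:
 fixes I :: "'a set"
 assumes I: "finite I"
 shows "vlinear (species_comp lie (species_comp lie gamma) I) (species_comp lie gamma I) (lie_comp_action I :: _ => ('k::field, 'a) lie_gamma_elt)"
  and "partition_on I P ==> t \<in> vcarrier (lie P) ==> u \<in> fams P (species_comp lie gamma) ==>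
   lie_comp_action I (comp_pure lie (species_comp lie gamma) I P t u) =
   comp_pure lie gamma I P t (\<lambda>S\<in>P. lie_action S (u S :: ('k, 'a) lie_gamma_elt))"
proof -
 let ?G = "gamma :: 'a set => ('k, ('k, 'a) gamma_elt) vspace"
 let ?q = "species_comp lie ?G" and ?Z = "species_comp lie ?G I"
 have vq: "vs (?q S)" if "S \<subseteq> I" for S by (rule vs_species_comp[of S lie ?G, OF finite_subset[OF that I] vs_lie vs_gamma])
 have la: "vlinear (?q S) (?G S) (lie_action S)" if "partition_on I P" "S \<in> P" for P S
  by (rule lie_action(1)[OF partition_block_finite[OF I that]])
 have bl: "S \<subseteq> I" if "partition_on I P" "S \<in> P" for P S using that by (auto simp: partition_on_def)
 have uin: "(\<lambda>S\<in>P. lie_action S (u S)) \<in> fams P ?G"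
  if P: "partition_on I P" and u: "u \<in> fams P ?q" for P u by (rule restrict_in_PiE) (rule vlinearD(1)[OF la[OF P] PiE_mem[OF u]])
 have 1: "vlinear (lie P) ?Z (\<lambda>t. comp_pure lie ?G I P t (\<lambda>S\<in>P. lie_action S (u S)))"
  if P: "partition_on I P" and u: "u \<in> fams P ?q" for P u by (rule comp_pure_linear[of I lie ?G, OF I vs_lie vs_gamma P uin[OF P u]])
 have 2: "mlin P ?q ?Z (\<lambda>u. comp_pure lie ?G I P t (\<lambda>S\<in>P. lie_action S (u S)))"
  if P: "partition_on I P" and t: "t \<in> vcarrier (lie P)" for P t
  by (rule mlin_reindex[OF comp_pure_mlin[of I lie ?G, OF I vs_lie vs_gamma P t] vq, where f = "\<lambda>S. S" and h = "\<lambda>S. S" and A = lie_action])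
   (use bl[OF P] la[OF P] in auto)
 note w = comp_ext_works[of I lie ?q ?Z "\<lambda>P t u. comp_pure lie ?G I P t (\<lambda>S\<in>P. lie_action S (u S))",
   OF I vs_lie vq vs_species_comp[of I lie ?G, OF I vs_lie vs_gamma]]
 show "vlinear (species_comp lie ?q I) ?Z (lie_comp_action I)" unfolding lie_comp_action_def by (rule w(1)[OF _ 1 2])
 show "lie_comp_action I (comp_pure lie ?q I P t u) = comp_pure lie ?G I P t (\<lambda>S\<in>P. lie_action S (u S))"
  if "partition_on I P" "t \<in> vcarrier (lie P)" "u \<in> fams P ?q" unfolding lie_comp_action_def by (rule w(2)[OF _ 1 2 that])
qed

lemma vs_lie_lie: "finite I ==> partition_on I Q ==> vs (species_comp lie lie Q :: ('k::field, ('k, 'a set) lie_lie_elt) vspace)"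
 by (rule vs_species_comp[OF partition_on_finite vs_lie vs_lie])

lemma mult_comp_gamma:
 fixes I :: "'a set"
 assumes I: "finite I"
 shows "vlinear (species_comp (species_comp lie lie) gamma I) (species_comp lie gamma I) (mult_comp_gamma I :: _ => ('k::field, 'a) lie_gamma_elt)"
  and "partition_on I Q ==> m \<in> vcarrier (species_comp lie lie Q) ==> x \<in> fams Q gamma ==>
   mult_comp_gamma I (comp_pure (species_comp lie lie) gamma I Q m x) = comp_pure lie gamma I Q (lie_mult Q m :: ('k, 'a set) lie_elt) x"
proof -
 let ?G = "gamma :: 'a set => ('k, ('k, 'a) gamma_elt) vspace" and ?L = "species_comp lie lie :: 'a set set => ('k, ('k, 'a set) lie_lie_elt) vspace"
 let ?Z = "species_comp lie ?G I"
 have lm: "vlinear (?L Q) (lie Q) (lie_mult Q)" if "partition_on I Q" for Q by (rule lie_mult(1)[OF partition_on_finite[OF I that]])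
 have 1: "vlinear (?L Q) ?Z (\<lambda>m. comp_pure lie ?G I Q (lie_mult Q m) x)"
  if Q: "partition_on I Q" and x: "x \<in> fams Q ?G" for Q x
  by (rule vlinear_comp[OF lm[OF Q] comp_pure_linear[of I lie ?G, OF I vs_lie vs_gamma Q x]])
 have 2: "mlin Q ?G ?Z (\<lambda>x. comp_pure lie ?G I Q (lie_mult Q m) x)"
  if Q: "partition_on I Q" and m: "m \<in> vcarrier (?L Q)" for Q m
  by (rule comp_pure_mlin[of I lie ?G, OF I vs_lie vs_gamma Q vlinearD(1)[OF lm[OF Q] m]])
 note w = comp_ext_works[of I ?L ?G ?Z "\<lambda>Q m x. comp_pure lie ?G I Q (lie_mult Q m) x",
   OF I vs_lie_lie[OF I] vs_gamma vs_species_comp[of I lie ?G, OF I vs_lie vs_gamma]]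
 show "vlinear (species_comp ?L ?G I) ?Z (mult_comp_gamma I)" unfolding mult_comp_gamma_def by (rule w(1)[OF _ 1 2])
 show "mult_comp_gamma I (comp_pure ?L ?G I Q m x) = comp_pure lie ?G I Q (lie_mult Q m) x"
  if "partition_on I Q" "m \<in> vcarrier (?L Q)" "x \<in> fams Q ?G" unfolding mult_comp_gamma_def by (rule w(2)[OF _ 1 2 that])
qed

text \<open>Recovers from a block \<open>B\<close> of the refinement the block of \<open>P\<close>
  it comes from, which allows separate families on the sets \<open>Ps S\<close> to be merged into
  one family on their union.\<close>

definition block_above :: "'a set set => 'a set => 'a set" where
 "block_above P B = (SOME S. S \<in> P \<and> B \<subseteq> S)"

text \<open>The value prescribed for the associator, with \<open>t\<close> as last argument so that
  it can be read as a map on \<open>Lie[P]\<close>.\<close>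

definition assoc_value ::
 "'a set => 'a set set => ('a set => 'a set set) => ('a set => ('k::field, 'a set) lie_elt) => ('a set => ('k, 'a) gamma_elt) =>
  ('k, 'a set) lie_elt => ('k, 'a, ('k, 'a set) lie_lie_elt, ('k, 'a) gamma_elt) comp_elt" where
 "assoc_value I P Ps ts x t = comp_pure (species_comp lie lie) gamma I (\<Union>(Ps ` P))
   (comp_pure lie lie (\<Union>(Ps ` P)) (Ps ` P) (lie_map Ps t) (\<lambda>r\<in>Ps ` P. ts (\<Union>r))) x"

context
 fixes I :: "'a set" and P :: "'a set set" and Ps :: "'a set => 'a set set"
 assumes I: "finite I" and P: "partition_on I P" and Ps: "!!S. S \<in> P ==> partition_on S (Ps S)"
begin

lemma block_above_eq: "S \<in> P ==> B \<in> Ps S ==> block_above P B = S" unfolding block_above_def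
 by (rule some_equality) (use refine_nonempty[OF P Ps] refine_unique[OF P Ps] in blast)+

lemma finite_refine: "finite (\<Union>(Ps ` P))" by (rule partition_on_finite[OF I partition_on_refine[OF P Ps]])

lemma refine_family: "(!!S. S \<in> P ==> ts S \<in> vcarrier (lie (Ps S))) ==> (\<lambda>r\<in>Ps ` P. ts (\<Union>r)) \<in> fams (Ps ` P) lie"
 by (rule restrict_in_PiE) (use refine_Union[OF P Ps] in auto)

lemma assoc_value_linear:
 fixes ts :: "'a set => ('k::field, 'a set) lie_elt"
 assumes ts: "!!S. S \<in> P ==> ts S \<in> vcarrier (lie (Ps S))" and x: "x \<in> fams (\<Union>(Ps ` P)) gamma"
 shows "vlinear (lie P) (species_comp (species_comp lie lie) gamma I) (assoc_value I P Ps ts x)" unfolding assoc_value_def[abs_def]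
 by (rule vlinear_comp[OF vlinear_comp[OF lie_map(1)[OF refine_inj[OF P Ps]]
    comp_pure_linear[of "\<Union>(Ps ` P)" lie lie, OF finite_refine vs_lie vs_lie partition_on_refine_blocks[OF P Ps] refine_family[OF ts]]]
   comp_pure_linear[of I "species_comp lie lie" gamma, OF I vs_lie_lie[OF I] vs_gamma partition_on_refine[OF P Ps] x]])

lemma assoc_value_family_linear:
 fixes ts :: "'a set => ('k::field, 'a set) lie_elt"
 assumes t: "t \<in> vcarrier (lie P)" and j: "j \<in> P" and ts: "!!S. S \<in> P ==> S \<noteq> j ==> ts S \<in> vcarrier (lie (Ps S))"
  and x: "x \<in> fams (\<Union>(Ps ` P)) gamma"
 shows "vlinear (lie (Ps j)) (species_comp (species_comp lie lie) gamma I) (\<lambda>s. assoc_value I P Ps (ts(j := s)) x t)"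
proof -
 let ?b = "\<lambda>r\<in>Ps ` P. ts (\<Union>r)"
 \<comment> \<open>By injectivity of \<open>Ps\<close>, changing the inner element at the block
   \<open>j\<close> changes the reindexed family in the single coordinate
   \<open>Ps j\<close>.\<close>
 have b: "(\<lambda>r\<in>Ps ` P. (ts(j := s)) (\<Union>r)) = ?b(Ps j := s)" for s
 proof
  fix r
  show "(\<lambda>r\<in>Ps ` P. (ts(j := s)) (\<Union>r)) r = (?b(Ps j := s)) r"
  proof (cases "r \<in> Ps ` P")
   case True
   then obtain S where S: "S \<in> P" "r = Ps S" by blast
   then show ?thesis using refine_Union[OF P Ps S(1)] j inj_onD[OF refine_inj[OF P Ps] _ S(1) j] by auto
  next
   case False
   then show ?thesis using j by auto
  qed
 qed
 have m: "lie_map Ps t \<in> vcarrier (lie (Ps ` P))" by (rule vlinearD(1)[OF lie_map(1)[OF refine_inj[OF P Ps]] t])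
 have "vlinear (lie (Ps j)) (species_comp lie lie (\<Union>(Ps ` P))) (\<lambda>s. comp_pure lie lie (\<Union>(Ps ` P)) (Ps ` P) (lie_map Ps t) (?b(Ps j := s)))"
 proof (rule mlin_coord[OF comp_pure_mlin[of "\<Union>(Ps ` P)" lie lie, OF finite_refine vs_lie vs_lie partition_on_refine_blocks[OF P Ps] m] imageI[OF j] vs_lie])
  fix s :: "('k, 'a set) lie_elt" assume s: "s \<in> vcarrier (lie (Ps j))"
  show "?b(Ps j := s) \<in> fams (Ps ` P) lie" unfolding b[symmetric] by (rule refine_family) (use s ts in auto)
 qed
 from vlinear_comp[OF this comp_pure_linear[of I "species_comp lie lie" gamma, OF I vs_lie_lie[OF I] vs_gamma partition_on_refine[OF P Ps] x]]
 show ?thesis unfolding assoc_value_def b .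
qed

lemma assoc_value_mlin:
 fixes ts :: "'a set => ('k::field, 'a set) lie_elt"
 assumes t: "t \<in> vcarrier (lie P)" and ts: "!!S. S \<in> P ==> ts S \<in> vcarrier (lie (Ps S))"
 shows "mlin (\<Union>(Ps ` P)) gamma (species_comp (species_comp lie lie) gamma I) (\<lambda>x. assoc_value I P Ps ts x t)" unfolding assoc_value_def
 by (rule comp_pure_mlin[of I "species_comp lie lie" gamma, OF I vs_lie_lie[OF I] vs_gamma partition_on_refine[OF P Ps]
   comp_pure_in[of "\<Union>(Ps ` P)" lie lie, OF finite_refine vs_lie vs_lie partition_on_refine_blocks[OF P Ps]
    vlinearD(1)[OF lie_map(1)[OF refine_inj[OF P Ps]] t] refine_family[OF ts]]])

text \<open>Only the values of \<open>Ps\<close> and \<open>ts\<close> on \<open>P\<close> matter.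
  This is needed to replace functions read off from a restricted family, which are unspecified
  outside \<open>P\<close>, by the given ones.\<close>

lemma assoc_value_cong:
 assumes "t \<in> vcarrier (lie P)" "!!S. S \<in> P ==> Ps' S = Ps S" "!!S. S \<in> P ==> ts' S = ts S"
 shows "assoc_value I P Ps' ts' x t = assoc_value I P Ps ts x t"
proof -
 have im: "Ps' ` P = Ps ` P" using assms(2) by auto
 have m: "lie_map Ps' t = lie_map Ps t" by (rule lie_map_cong[OF assms(1,2)])
 have "(\<lambda>r\<in>Ps ` P. ts' (\<Union>r)) = (\<lambda>r\<in>Ps ` P. ts (\<Union>r))" by (rule restrict_ext) (use refine_Union[OF P Ps] assms(3) in auto)
 then show ?thesis unfolding assoc_value_def im m by simp
qed

end

text \<open>The generators of the inner factor at a block \<open>S\<close> are triples of a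
  partition of \<open>S\<close>, an element of \<open>Lie\<close> and a family in \<Gamma>. When the
  triple at one block varies and the others are fixed, the prescribed value is linear in the second
  entry and multilinear in the third, so it extends to all of
  \<open>(Lie \<circ> \<Gamma>)[j]\<close> for that block \<open>j\<close>. Extension over the
  remaining blocks and linearity in the outer argument come from
  \<open>comp_lift_generators\<close>.\<close>

lemma lie_assoc_lift:
 fixes I :: "'a set"
 assumes I: "finite I"
 shows "\<exists>G. vlinear (species_comp lie (species_comp lie gamma) I) (species_comp (species_comp lie lie) gamma I) G \<and>
  (\<forall>P t Ps ts x. partition_on I P \<longrightarrow> t \<in> vcarrier (lie P) \<longrightarrow> (\<forall>S\<in>P. partition_on S (Ps S) \<and> ts S \<in> vcarrier (lie (Ps S))) \<longrightarrow>
   x \<in> fams (\<Union>(Ps ` P)) gamma \<longrightarrow>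
   G (comp_pure lie (species_comp lie gamma) I P t (\<lambda>S\<in>P. comp_pure lie gamma S (Ps S) (ts S) (restrict x (Ps S)))) =
   assoc_value I P Ps ts (x :: 'a set => ('k::field, 'a) gamma_elt) t)"
proof -
 let ?G = "gamma :: 'a set => ('k, ('k, 'a) gamma_elt) vspace" and ?L = "species_comp lie lie :: 'a set set => ('k, ('k, 'a set) lie_lie_elt) vspace"
 let ?lie = "lie :: 'a set set => ('k, ('k, 'a set) lie_elt) vspace"
 let ?q = "species_comp ?lie ?G" and ?Z = "species_comp ?L ?G I"
 let ?K = "\<lambda>S. {(R, s, y). partition_on S R \<and> s \<in> vcarrier (?lie R) \<and> y \<in> fams R ?G}"
 let ?e = "\<lambda>S (R, s, y). comp_pure ?lie ?G S R s y"
 let ?\<phi> = "\<lambda>P t \<kappa>. assoc_value I P (\<lambda>S. fst (\<kappa> S)) (\<lambda>S. fst (snd (\<kappa> S))) (\<lambda>B\<in>\<Union>((\<lambda>S. fst (\<kappa> S)) ` P). snd (snd (\<kappa> (block_above P B))) B) t"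
 have vZ: "vs ?Z" by (rule vs_species_comp[of I ?L ?G, OF I vs_lie_lie[OF I] vs_gamma])
 have fS: "finite S" if "S \<subseteq> I" for S using finite_subset[OF that I] .
 have vq: "vs (?q S)" if "S \<subseteq> I" for S by (rule vs_species_comp[of S ?lie ?G, OF fS[OF that] vs_lie vs_gamma])
 have sp: "vcarrier (?q S) \<subseteq> vspan (?q S) (?e S ` ?K S)" if "S \<subseteq> I" for S
  using species_comp_span_all[of S ?lie ?G, OF fS[OF that] vs_lie vs_gamma] .
 have e: "?e S k \<in> vcarrier (?q S)" if "S \<subseteq> I" "k \<in> ?K S" for S k
  using that(2) comp_pure_in[of S ?lie ?G, OF fS[OF that(1)] vs_lie vs_gamma] by auto
 have \<kappa>D: "partition_on S (fst (\<kappa> S))" "fst (snd (\<kappa> S)) \<in> vcarrier (?lie (fst (\<kappa> S)))"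
   "snd (snd (\<kappa> S)) \<in> fams (fst (\<kappa> S)) ?G" if "\<kappa> \<in> (\<Pi>\<^sub>E S\<in>P. ?K S)" "S \<in> P" for \<kappa> S P using PiE_mem[OF that] by auto
 have xin: "(\<lambda>B\<in>\<Union>((\<lambda>S. fst (\<kappa> S)) ` P). snd (snd (\<kappa> (block_above P B))) B) \<in> (\<Pi>\<^sub>E B\<in>\<Union>((\<lambda>S. fst (\<kappa> S)) ` P). vcarrier (?G B))"
  if P: "partition_on I P" and \<kappa>: "\<kappa> \<in> (\<Pi>\<^sub>E S\<in>P. ?K S)" for P \<kappa>
 proof (rule restrict_in_PiE)
  fix B assume "B \<in> \<Union>((\<lambda>S. fst (\<kappa> S)) ` P)"
  then obtain S where S: "S \<in> P" "B \<in> fst (\<kappa> S)" by blast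
  have "block_above P B = S" by (rule block_above_eq[OF I P \<kappa>D(1)[OF \<kappa>] S])
  then show "snd (snd (\<kappa> (block_above P B))) B \<in> vcarrier (?G B)" using PiE_mem[OF \<kappa>D(3)[OF \<kappa> S(1)] S(2)] by simp
 qed
 have lin: "vlinear (?lie P) ?Z (\<lambda>t. ?\<phi> P t \<kappa>)" if P: "partition_on I P" and \<kappa>: "\<kappa> \<in> (\<Pi>\<^sub>E S\<in>P. ?K S)" for P \<kappa>
  by (rule assoc_value_linear[OF I P \<kappa>D(1)[OF \<kappa>] \<kappa>D(2)[OF \<kappa>] xin[OF P \<kappa>]])
 have ext: "\<exists>g. vlinear (?q j) ?Z g \<and> (\<forall>k\<in>?K j. g (?e j k) = ?\<phi> P t (\<kappa>(j := k)))"
  if P: "partition_on I P" and t: "t \<in> vcarrier (?lie P)" and \<kappa>: "\<kappa> \<in> (\<Pi>\<^sub>E S\<in>P. ?K S)" and j: "j \<in> P" for P t \<kappa> j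
 proof -
  have jI: "j \<subseteq> I" using P j by (auto simp: partition_on_def)
  let ?Ps = "\<lambda>R. (\<lambda>S. fst (\<kappa> S))(j := R)" and ?ts = "\<lambda>S. fst (snd (\<kappa> S))" and ?w = "\<lambda>B. snd (snd (\<kappa> (block_above P B))) B"
  have PsR: "partition_on S (?Ps R S)" if "partition_on j R" "S \<in> P" for R S using \<kappa>D(1)[OF \<kappa>] that by auto
  have blk: "block_above P B = S" "B \<in> R \<longleftrightarrow> S = j" if R: "partition_on j R" and S: "S \<in> P" "B \<in> ?Ps R S" for R S B
  proof -
   show b: "block_above P B = S" by (rule block_above_eq[OF I P PsR[OF R] S])
   show "B \<in> R \<longleftrightarrow> S = j"
   proof
    assume "B \<in> R"
    then have "block_above P B = j" using block_above_eq[OF I P PsR[OF R] j, of B] by simp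
    then show "S = j" using b by simp
   qed (use S in auto)
  qed
  have wB: "?w B \<in> vcarrier (?G B)" if R: "partition_on j R" and B: "B \<in> \<Union>(?Ps R ` P)" "B \<notin> R" for R B
  proof -
   obtain S where S: "S \<in> P" "B \<in> ?Ps R S" using B(1) by blast
   have "S \<noteq> j" using blk(2)[OF R S] B(2) by simp
   then have "B \<in> fst (\<kappa> S)" using S(2) by simp
   from PiE_mem[OF \<kappa>D(3)[OF \<kappa> S(1)] this] show ?thesis using blk(1)[OF R S] by simp
  qed
  have up: "?\<phi> P t (\<kappa>(j := (R, s, y))) = assoc_value I P (?Ps R) (?ts(j := s)) (\<lambda>B\<in>\<Union>(?Ps R ` P). if B \<in> R then y B else ?w B) t"
   if R: "partition_on j R" for R s y
  proof -
   have 1: "(\<lambda>S. fst ((\<kappa>(j := (R, s, y))) S)) = ?Ps R" "(\<lambda>S. fst (snd ((\<kappa>(j := (R, s, y))) S))) = ?ts(j := s)" by (auto simp: fun_eq_iff)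
   have "(\<lambda>B\<in>\<Union>(?Ps R ` P). snd (snd ((\<kappa>(j := (R, s, y))) (block_above P B))) B) = (\<lambda>B\<in>\<Union>(?Ps R ` P). if B \<in> R then y B else ?w B)"
   proof (rule restrict_ext)
    fix B assume "B \<in> \<Union>(?Ps R ` P)"
    then obtain S where S: "S \<in> P" "B \<in> ?Ps R S" by blast
    show "snd (snd ((\<kappa>(j := (R, s, y))) (block_above P B))) B = (if B \<in> R then y B else ?w B)" unfolding blk[OF R S] by simp
   qed
   then show ?thesis unfolding 1 by simp
  qed
  have yin: "(\<lambda>B\<in>\<Union>(?Ps R ` P). if B \<in> R then y B else ?w B) \<in> fams (\<Union>(?Ps R ` P)) ?G"
   if R: "partition_on j R" and y: "y \<in> fams R ?G" for R y by (rule restrict_in_PiE) (use y wB[OF R] in auto)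
  have "\<exists>g. vlinear (?q j) ?Z g \<and> (\<forall>R s y. partition_on j R \<longrightarrow> s \<in> vcarrier (?lie R) \<longrightarrow>
    y \<in> fams R ?G \<longrightarrow> g (comp_pure ?lie ?G j R s y) = ?\<phi> P t (\<kappa>(j := (R, s, y))))"
  proof (rule comp_lift[of j ?lie ?G, OF fS[OF jI] vs_lie vs_gamma vZ])
   fix R assume R: "partition_on j R"
   have jR: "?Ps R j = R" by simp
   show "vlinear (?lie R) ?Z (\<lambda>s. ?\<phi> P t (\<kappa>(j := (R, s, y))))" if y: "y \<in> fams R ?G" for y unfolding up[OF R]
    by (rule assoc_value_family_linear[OF I P PsR[OF R] t j _ yin[OF R y], unfolded jR]) (use \<kappa>D(2)[OF \<kappa>] in auto)
   show "mlin R ?G ?Z (\<lambda>y. ?\<phi> P t (\<kappa>(j := (R, s, y))))" if s: "s \<in> vcarrier (?lie R)" for s unfolding up[OF R]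
   proof (rule mlin_subset[OF assoc_value_mlin[OF I P PsR[OF R] t] _ wB[OF R]])
    fix S assume "S \<in> P"
    then show "(?ts(j := s)) S \<in> vcarrier (?lie (?Ps R S))" using \<kappa>D(2)[OF \<kappa>] s by auto
   next
    show "R \<subseteq> \<Union>(?Ps R ` P)" using j jR by blast
   qed
  qed
  then show ?thesis by auto
 qed
 obtain G where G: "vlinear (species_comp ?lie ?q I) ?Z G" "!!P t \<kappa>. partition_on I P ==> t \<in> vcarrier (?lie P) ==> \<kappa> \<in> (\<Pi>\<^sub>E S\<in>P. ?K S) ==>
   G (comp_pure ?lie ?q I P t (\<lambda>S\<in>P. ?e S (\<kappa> S))) = ?\<phi> P t \<kappa>"
  by (rule comp_lift_generators[of I ?lie ?q ?Z "\<lambda>P. vcarrier (?lie P)" ?e ?K ?\<phi>,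
     OF I vs_lie vq vZ subsetI[OF vspan.base] subset_refl sp e lin ext]) (assumption | rule that)+
 show ?thesis
 proof (rule exI[of _ G], intro conjI allI impI)
  show "vlinear (species_comp ?lie ?q I) ?Z G" by (rule G(1))
  fix P t Ps ts and x :: "'a set => ('k, 'a) gamma_elt"
  assume P: "partition_on I P" and t: "t \<in> vcarrier (?lie P)" and Pt: "\<forall>S\<in>P. partition_on S (Ps S) \<and> ts S \<in> vcarrier (?lie (Ps S))"
   and x: "x \<in> fams (\<Union>(Ps ` P)) ?G"
  have Ps: "!!S. S \<in> P ==> partition_on S (Ps S)" using Pt by blast
  have SI: "S \<subseteq> I" if "S \<in> P" for S using P that by (auto simp: partition_on_def)
  let ?\<kappa> = "\<lambda>S\<in>P. (Ps S, ts S, restrict x (Ps S))"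
  have kS: "(Ps S, ts S, restrict x (Ps S)) \<in> ?K S" if "S \<in> P" for S using Pt that x by (auto simp: PiE_iff)
  have \<kappa>: "?\<kappa> \<in> (\<Pi>\<^sub>E S\<in>P. ?K S)" by (rule restrict_in_PiE) (rule kS)
  have v: "(\<lambda>S\<in>P. comp_pure ?lie ?G S (Ps S) (ts S) (restrict x (Ps S))) = (\<lambda>S\<in>P. ?e S (?\<kappa> S))" by (rule restrict_ext) simp
  have im: "(\<lambda>S. fst (?\<kappa> S)) ` P = Ps ` P" by (rule image_cong) auto
  have "(\<lambda>B\<in>\<Union>(Ps ` P). snd (snd (?\<kappa> (block_above P B))) B) = x"
  proof
   fix B
   show "(\<lambda>B\<in>\<Union>(Ps ` P). snd (snd (?\<kappa> (block_above P B))) B) B = x B"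
   proof (cases "B \<in> \<Union>(Ps ` P)")
    case True
    then obtain S where S: "S \<in> P" "B \<in> Ps S" by blast
    then show ?thesis using True by (simp add: block_above_eq[OF I P Ps S])
   next
    case False
    then show ?thesis using x by (auto simp: PiE_iff extensional_def)
   qed
  qed
  then have "?\<phi> P t ?\<kappa> = assoc_value I P (\<lambda>S. fst (?\<kappa> S)) (\<lambda>S. fst (snd (?\<kappa> S))) x t" unfolding im by simp
  also have "\<dots> = assoc_value I P Ps ts x t" by (rule assoc_value_cong[OF I P Ps t]) auto
  finally show "G (comp_pure ?lie ?q I P t (\<lambda>S\<in>P. comp_pure ?lie ?G S (Ps S) (ts S) (restrict x (Ps S)))) = assoc_value I P Ps ts x t"
   unfolding v G(2)[OF P t \<kappa>] .
 qed
qed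

text \<open>A family of inner generators carries a separate family on each \<open>Ps S\<close>.
  Every block of the refinement lies in a unique \<open>Ps S\<close>, so these merge into one family
  \<open>x\<close> with the given restrictions, which is the format in which the associator is
  specified.\<close>

lemma nested_familyE:
 assumes I: "finite I" and P: "partition_on I P"
  and v: "v \<in> (\<Pi>\<^sub>E S\<in>P. (\<lambda>(R, s, y). c S R s y) ` {(R, s, y). partition_on S R \<and> s \<in> A R \<and> y \<in> (\<Pi>\<^sub>E B\<in>R. G B)})"
 obtains Ps ts x where "!!S. S \<in> P ==> partition_on S (Ps S)" "!!S. S \<in> P ==> ts S \<in> A (Ps S)"
  "x \<in> (\<Pi>\<^sub>E B\<in>\<Union>(Ps ` P). G B)" "v = (\<lambda>S\<in>P. c S (Ps S) (ts S) (restrict x (Ps S)))"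
proof -
 obtain \<kappa> where \<kappa>: "\<kappa> \<in> (\<Pi>\<^sub>E S\<in>P. {(R, s, y). partition_on S R \<and> s \<in> A R \<and> y \<in> (\<Pi>\<^sub>E B\<in>R. G B)})"
  and v': "v = (\<lambda>S\<in>P. (\<lambda>(R, s, y). c S R s y) (\<kappa> S))" by (rule PiE_imageE[OF v])
 define Ps ts y where "Ps S = fst (\<kappa> S)" and "ts S = fst (snd (\<kappa> S))" and "y S = snd (snd (\<kappa> S))" for S
 have k: "\<kappa> S = (Ps S, ts S, y S)" for S by (simp add: Ps_def ts_def y_def)
 have d: "partition_on S (Ps S)" "ts S \<in> A (Ps S)" "y S \<in> (\<Pi>\<^sub>E B\<in>Ps S. G B)" if "S \<in> P" for S using PiE_mem[OF \<kappa> that] by (auto simp: k)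
 define x where "x = (\<lambda>B\<in>\<Union>(Ps ` P). y (block_above P B) B)"
 have xS: "x B = y S B" if "S \<in> P" "B \<in> Ps S" for S B using that block_above_eq[OF I P d(1) that] by (auto simp: x_def)
 show ?thesis
 proof (rule that[of Ps ts x])
  show "x \<in> (\<Pi>\<^sub>E B\<in>\<Union>(Ps ` P). G B)" unfolding x_def
  proof (rule restrict_in_PiE)
   fix B assume "B \<in> \<Union>(Ps ` P)"
   then obtain S where S: "S \<in> P" "B \<in> Ps S" by blast
   show "y (block_above P B) B \<in> G B" using block_above_eq[OF I P d(1) S] PiE_mem[OF d(3)[OF S(1)] S(2)] by simp
  qed
  show "v = (\<lambda>S\<in>P. c S (Ps S) (ts S) (restrict x (Ps S)))" unfolding v'
  proof (rule restrict_ext)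
   fix S assume S: "S \<in> P"
   have "restrict x (Ps S) = y S"
   proof
    fix B show "restrict x (Ps S) B = y S B" using d(3)[OF S] xS[OF S] by (cases "B \<in> Ps S") (auto simp: PiE_iff extensional_def)
   qed
   then show "(\<lambda>(R, s, y). c S R s y) (\<kappa> S) = c S (Ps S) (ts S) (restrict x (Ps S))" by (simp add: k)
  qed
 qed (use d in auto)
qed

lemma layering_exists:
 assumes "distinct (leaves s)" "set (leaves s) = J"
 obtains t where "t \<in> layered_trees J" "shape t = shape s"
 by (rule that[of "preorder 0 s"]) (use preorder_layered[OF assms(1)] assms(2) in auto)

lemma lie_assoc:
 fixes I :: "'a set"
 assumes I: "finite I"
 shows "vlinear (species_comp lie (species_comp lie gamma) I) (species_comp (species_comp lie lie) gamma I)
   (lie_assoc I :: ('k::field, 'a, ('k, 'a set) lie_elt, ('k, 'a) lie_gamma_elt) comp_elt => _)" (is ?lin)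
  and "partition_on I P ==> t \<in> vcarrier (lie P) ==> (!!S. S \<in> P ==> partition_on S (Ps S)) ==>
   (!!S. S \<in> P ==> ts S \<in> vcarrier (lie (Ps S))) ==> x \<in> fams (\<Union>(Ps ` P)) gamma ==>
   lie_assoc I (comp_pure lie (species_comp lie gamma) I P t (\<lambda>S\<in>P. comp_pure lie gamma S (Ps S) (ts S) (restrict x (Ps S)))) =
   assoc_value I P Ps ts (x :: 'a set => ('k, 'a) gamma_elt) t"
proof -
 let ?G = "gamma :: 'a set => ('k, ('k, 'a) gamma_elt) vspace" and ?L = "species_comp lie lie :: 'a set set => ('k, ('k, 'a set) lie_lie_elt) vspace"
 let ?lie = "lie :: 'a set set => ('k, ('k, 'a set) lie_elt) vspace"
 let ?q = "species_comp ?lie ?G" and ?Z = "species_comp ?L ?G I"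
 let ?V = "species_comp ?lie ?q I"
 let ?K = "{(P, t, Ps, ts, x). partition_on I P \<and> t \<in> vcarrier (?lie P) \<and>
   (\<forall>S\<in>P. partition_on S (Ps S) \<and> ts S \<in> vcarrier (?lie (Ps S))) \<and> x \<in> fams (\<Union>(Ps ` P)) ?G}"
 let ?e = "\<lambda>(P, t, Ps, ts, x). comp_pure ?lie ?q I P t (\<lambda>S\<in>P. comp_pure ?lie ?G S (Ps S) (ts S) (restrict x (Ps S)))"
 obtain G where G: "vlinear ?V ?Z G"
  "\<forall>P t Ps ts x. partition_on I P \<longrightarrow> t \<in> vcarrier (?lie P) \<longrightarrow> (\<forall>S\<in>P. partition_on S (Ps S) \<and> ts S \<in> vcarrier (?lie (Ps S))) \<longrightarrow>
   x \<in> fams (\<Union>(Ps ` P)) ?G \<longrightarrow>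
   G (comp_pure ?lie ?q I P t (\<lambda>S\<in>P. comp_pure ?lie ?G S (Ps S) (ts S) (restrict x (Ps S)))) = assoc_value I P Ps ts x t"
  using lie_assoc_lift[OF I] by blast
 have vZ: "vs ?Z" by (rule vs_species_comp[of I ?L ?G, OF I vs_lie_lie[OF I] vs_gamma])
 have fS: "finite S" if "S \<subseteq> I" for S using finite_subset[OF that I] .
 have vq: "vs (?q S)" if "S \<subseteq> I" for S by (rule vs_species_comp[of S ?lie ?G, OF fS[OF that] vs_lie vs_gamma])
 have vV: "vs ?V" by (rule vs_species_comp[of I ?lie ?q, OF I vs_lie vq])
 have ein: "?e k \<in> vcarrier ?V" if "k \<in> ?K" for k
 proof -
  obtain P t Ps ts x where k: "k = (P, t, Ps, ts, x)" by (cases k)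
  have P: "partition_on I P" and t: "t \<in> vcarrier (?lie P)" and Pt: "\<forall>S\<in>P. partition_on S (Ps S) \<and> ts S \<in> vcarrier (?lie (Ps S))"
   and x: "x \<in> fams (\<Union>(Ps ` P)) ?G" using that k by auto
  have "(\<lambda>S\<in>P. comp_pure ?lie ?G S (Ps S) (ts S) (restrict x (Ps S))) \<in> fams P ?q"
  proof (rule restrict_in_PiE)
   fix S assume S: "S \<in> P"
   then have SI: "S \<subseteq> I" using P by (auto simp: partition_on_def)
   have "restrict x (Ps S) \<in> (\<Pi>\<^sub>E B\<in>Ps S. vcarrier (?G B))" using x S by (auto simp: PiE_iff)
   then show "comp_pure ?lie ?G S (Ps S) (ts S) (restrict x (Ps S)) \<in> vcarrier (?q S)"
    using Pt S by (intro comp_pure_in[of S ?lie ?G, OF fS[OF SI] vs_lie vs_gamma]) auto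
  qed
  from comp_pure_in[of I ?lie ?q, OF I vs_lie vq P t this] show ?thesis by (simp add: k)
 qed
 have Gv: "G (?e k) = (case k of (P, t, Ps, ts, x) => assoc_value I P Ps ts x t)" if "k \<in> ?K" for k
  using that G(2) by (auto split: prod.splits)
 have sp: "vcarrier ?V \<subseteq> vspan ?V (?e ` ?K)"
 proof (rule species_comp_span[of I ?lie ?q, OF I vs_lie vq, where A = "\<lambda>P. vcarrier (?lie P)"
    and B = "\<lambda>S. (\<lambda>(R, s, y). comp_pure ?lie ?G S R s y) ` {(R, s, y). partition_on S R \<and> s \<in> vcarrier (?lie R) \<and> y \<in> fams R ?G}"])
  show "vcarrier (?lie P) \<subseteq> vspan (?lie P) (vcarrier (?lie P))" for P by (auto intro: vspan.base)
  show "vcarrier (?lie P) \<subseteq> vcarrier (?lie P)" for P ..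
  fix S assume S: "S \<subseteq> I"
  show "vcarrier (?q S) \<subseteq> vspan (?q S) ((\<lambda>(R, s, y). comp_pure ?lie ?G S R s y) ` {(R, s, y). partition_on S R \<and> s \<in> vcarrier (?lie R) \<and> y \<in> fams R ?G})"
   by (rule species_comp_span_all[of S ?lie ?G, OF fS[OF S] vs_lie vs_gamma])
  show "(\<lambda>(R, s, y). comp_pure ?lie ?G S R s y) ` {(R, s, y). partition_on S R \<and> s \<in> vcarrier (?lie R) \<and> y \<in> fams R ?G} \<subseteq> vcarrier (?q S)"
   using comp_pure_in[of S ?lie ?G, OF fS[OF S] vs_lie vs_gamma] by auto
 next
  fix P t v assume P: "partition_on I P" and t: "t \<in> vcarrier (?lie P)"
   and v: "v \<in> (\<Pi>\<^sub>E S\<in>P. (\<lambda>(R, s, y). comp_pure ?lie ?G S R s y) ` {(R, s, y). partition_on S R \<and> s \<in> vcarrier (?lie R) \<and> y \<in> fams R ?G})"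
  obtain Ps ts x where s: "!!S. S \<in> P ==> partition_on S (Ps S)" "!!S. S \<in> P ==> ts S \<in> vcarrier (?lie (Ps S))"
   "x \<in> fams (\<Union>(Ps ` P)) ?G" "v = (\<lambda>S\<in>P. comp_pure ?lie ?G S (Ps S) (ts S) (restrict x (Ps S)))"
   by (rule nested_familyE[OF I P v]) (rule that)
  have "comp_pure ?lie ?q I P t v = ?e (P, t, Ps, ts, x)" by (simp add: s(4))
  moreover have "(P, t, Ps, ts, x) \<in> ?K" using P t s(1-3) by blast
  ultimately show "comp_pure ?lie ?q I P t v \<in> ?e ` ?K" by (rule image_eqI)
 qed
 have "lie_assoc I = restrict G (vcarrier ?V)" unfolding lie_assoc_def
  by (rule linext_eq[OF vV vZ G(1) ein _ sp]) (use Gv in \<open>auto simp: assoc_value_def\<close>)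
 then show ?lin using G(1) by (simp add: vlinear_restrict[OF vV])
 show "lie_assoc I (comp_pure ?lie ?q I P t (\<lambda>S\<in>P. comp_pure ?lie ?G S (Ps S) (ts S) (restrict x (Ps S)))) = assoc_value I P Ps ts x t"
  if "partition_on I P" "t \<in> vcarrier (?lie P)" "!!S. S \<in> P ==> partition_on S (Ps S)" "!!S. S \<in> P ==> ts S \<in> vcarrier (?lie (Ps S))"
   "x \<in> fams (\<Union>(Ps ` P)) ?G" for P t Ps ts x
 proof -
  have k: "(P, t, Ps, ts, x) \<in> ?K" using that by blast
  show ?thesis using ein[OF k] Gv[OF k] \<open>lie_assoc I = restrict G (vcarrier ?V)\<close> by simp
 qed
qed

text \<open>Both sides are linear, so they are compared on the generators given by an outer tree
  \<open>T\<close>, inner trees \<open>U S\<close> and a family \<open>x\<close>. The left side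
  brackets each block by \<open>U S\<close> and the results by \<open>T\<close>. The right side
  relabels the leaves of \<open>T\<close> by the sets \<open>Ps S\<close>, grafts, and brackets
  once.\<close>

lemma lie_action_assoc:
 fixes I :: "'a set" and w :: "('k::field, 'a, ('k, 'a set) lie_elt, ('k, 'a) lie_gamma_elt) comp_elt"
 assumes I: "finite I" and w: "w \<in> vcarrier (species_comp lie (species_comp lie gamma) I)"
 shows "lie_action I (lie_comp_action I w) = lie_action I (mult_comp_gamma I (lie_assoc I w))"
proof -
 let ?G = "gamma :: 'a set => ('k, ('k, 'a) gamma_elt) vspace" and ?L = "species_comp lie lie :: 'a set set => ('k, ('k, 'a set) lie_lie_elt) vspace"
 let ?lie = "lie :: 'a set set => ('k, ('k, 'a set) lie_elt) vspace"
 let ?q = "species_comp ?lie ?G"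
 let ?V = "species_comp ?lie ?q I"
 let ?C = "\<lambda>S R (s :: ('k, 'a set) lie_elt) y. comp_pure ?lie ?G S R s y"
 let ?B = "\<lambda>S. {?C S R (lie_class R T) y |R T y. partition_on S R \<and> T \<in> layered_trees R \<and> y \<in> fams R ?G}"
 let ?X = "{comp_pure ?lie ?q I P (lie_class P T) v |P T v. partition_on I P \<and> T \<in> layered_trees P \<and> v \<in> (\<Pi>\<^sub>E S\<in>P. ?B S)}"
 have fS: "finite S" if "S \<subseteq> I" for S using finite_subset[OF that I] .
 have vq: "vs (?q S)" if "S \<subseteq> I" for S by (rule vs_species_comp[of S ?lie ?G, OF fS[OF that] vs_lie vs_gamma])
 have vV: "vs ?V" by (rule vs_species_comp[of I ?lie ?q, OF I vs_lie vq])
 have BS: "?B S \<subseteq> vcarrier (?q S)" if "S \<subseteq> I" for S using comp_pure_in[of S ?lie ?G, OF fS[OF that] vs_lie vs_gamma] lie_class_in by blast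
 have SI: "S \<subseteq> I" if "partition_on I P" "S \<in> P" for P S using that by (auto simp: partition_on_def)
 have X: "?X \<subseteq> vcarrier ?V"
 proof
  fix u assume "u \<in> ?X"
  then obtain P T v where u: "u = comp_pure ?lie ?q I P (lie_class P T) v" and P: "partition_on I P" and T: "T \<in> layered_trees P"
   and v: "v \<in> (\<Pi>\<^sub>E S\<in>P. ?B S)" by blast
  have "v \<in> fams P ?q" using PiE_mono[of P ?B "\<lambda>S. vcarrier (?q S)"] BS[OF SI[OF P]] v by blast
  from comp_pure_in[of I ?lie ?q, OF I vs_lie vq P lie_class_in[OF T] this] show "u \<in> vcarrier ?V" by (simp add: u)
 qed
 have sp: "vcarrier ?V \<subseteq> vspan ?V ?X"
 proof (rule species_comp_span[of I ?lie ?q, OF I vs_lie vq, where A = "\<lambda>P. lie_class P ` layered_trees P" and B = ?B])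
  show "vcarrier (?lie P) \<subseteq> vspan (?lie P) (lie_class P ` layered_trees P)" for P by (rule lie_span)
  show "lie_class P ` layered_trees P \<subseteq> vcarrier (?lie P)" for P using lie_class_in by blast
  show "vcarrier (?q S) \<subseteq> vspan (?q S) (?B S)" if "S \<subseteq> I" for S by (rule lie_species_span[OF fS[OF that]])
  show "?B S \<subseteq> vcarrier (?q S)" if "S \<subseteq> I" for S by (rule BS[OF that])
  show "comp_pure ?lie ?q I P t v \<in> ?X" if "partition_on I P" "t \<in> lie_class P ` layered_trees P" "v \<in> (\<Pi>\<^sub>E S\<in>P. ?B S)" for P t v
   using that by blast
 qed
 show ?thesis
 proof (rule vlinear_eq_span[OF vV vs_gamma vlinear_comp[OF lie_comp_action(1)[OF I] lie_action(1)[OF I]]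
    vlinear_comp[OF vlinear_comp[OF lie_assoc(1)[OF I] mult_comp_gamma(1)[OF I]] lie_action(1)[OF I]] X])
  show "w \<in> vspan ?V ?X" using sp w by blast
  fix u assume "u \<in> ?X"
  then obtain P T v where u: "u = comp_pure ?lie ?q I P (lie_class P T) v" and P: "partition_on I P" and T: "T \<in> layered_trees P"
   and v: "v \<in> (\<Pi>\<^sub>E S\<in>P. ?B S)" by blast
  have v': "v \<in> (\<Pi>\<^sub>E S\<in>P. (\<lambda>(R, s, y). ?C S R s y) ` {(R, s, y). partition_on S R \<and> s \<in> lie_class R ` layered_trees R \<and> y \<in> fams R ?G})"
   by (rule subsetD[OF PiE_mono v]) force
  obtain Ps ts x where s: "!!S. S \<in> P ==> partition_on S (Ps S)" "!!S. S \<in> P ==> ts S \<in> lie_class (Ps S) ` layered_trees (Ps S)"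
   "x \<in> fams (\<Union>(Ps ` P)) ?G" "v = (\<lambda>S\<in>P. ?C S (Ps S) (ts S) (restrict x (Ps S)))" by (rule nested_familyE[OF I P v']) (rule that)
  have "\<forall>S\<in>P. \<exists>U. U \<in> layered_trees (Ps S) \<and> ts S = lie_class (Ps S) U" using s(2) by blast
  then obtain U where U: "\<forall>S\<in>P. U S \<in> layered_trees (Ps S) \<and> ts S = lie_class (Ps S) (U S)" by (rule bchoice[THEN exE])
  have U1: "U S \<in> layered_trees (Ps S)" and U2: "ts S = lie_class (Ps S) (U S)" if "S \<in> P" for S using U that by blast+
  have ts: "ts S \<in> vcarrier (?lie (Ps S))" if "S \<in> P" for S unfolding U2[OF that] by (rule lie_class_in[OF U1[OF that]])
  have lT: "set (leaves T) = P" by (rule layered_tree_forest(6)[OF I P T])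
  have lU: "set (leaves (U S)) = Ps S" "ground (U S) = S" if "S \<in> P" for S
   using layered_tree_forest(5,6)[OF fS[OF SI[OF P that]] s(1)[OF that] U1[OF that]] by auto
  have xS: "restrict x (Ps S) \<in> (\<Pi>\<^sub>E B\<in>Ps S. vcarrier (?G B))" if "S \<in> P" for S using s(3) that by (auto simp: PiE_iff)
  \<comment> \<open>The inner trees reindexed by the blocks \<open>r = Ps S\<close> of the partition
    of \<open>?Q\<close>, from which \<open>S\<close> is recovered as the union.\<close>
  let ?Q = "\<Union>(Ps ` P)" and ?V' = "\<lambda>r. U (\<Union>r)"
  note Q = partition_on_refine[OF P s(1)] and R = partition_on_refine_blocks[OF P s(1)] and inj = refine_inj[OF P s(1)]
  note fQ = finite_refine[OF I P s(1)]
  have vin: "v \<in> fams P ?q" using PiE_mono[of P ?B "\<lambda>S. vcarrier (?q S)"] BS[OF SI[OF P]] v by blast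
  have la: "lie_action S (v S) = tree_bracket (U S) x" if S: "S \<in> P" for S
  proof -
   have "lie_action S (v S) = tree_bracket (U S) (restrict x (Ps S))"
    using lie_action(2)[OF fS[OF SI[OF P S]] s(1)[OF S] U1[OF S] xS[OF S]] S U2[OF S] by (simp add: s(4))
   also have "\<dots> = tree_bracket (U S) x" by (rule tree_bracket_cong) (use lU[OF S] in simp)
   finally show ?thesis .
  qed
  have bin: "(\<lambda>S\<in>P. lie_action S (v S)) \<in> fams P ?G" by (rule restrict_in_PiE)
    (rule vlinearD(1)[OF lie_action(1)[OF fS[OF SI[OF P]]] PiE_mem[OF vin]])
  have "lie_action I (lie_comp_action I u) = tree_bracket T (\<lambda>S\<in>P. lie_action S (v S))"
   unfolding u lie_comp_action(2)[OF I P lie_class_in[OF T] vin] by (rule lie_action(2)[OF I P T bin])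
  also have "\<dots> = tree_bracket T (\<lambda>S. tree_bracket (U S) x)" by (rule tree_bracket_cong) (simp add: lT la)
  finally have lhs: "lie_action I (lie_comp_action I u) = tree_bracket T (\<lambda>S. tree_bracket (U S) x)" .
  have mT: "map_ltree Ps T \<in> layered_trees (Ps ` P)" by (rule layered_map_ltree[OF inj T])
  have V': "?V' r \<in> layered_trees r" "ts (\<Union>r) = lie_class r (?V' r)" if r: "r \<in> Ps ` P" for r
  proof -
   obtain S where S: "S \<in> P" "r = Ps S" using r by blast
   show "?V' r \<in> layered_trees r" "ts (\<Union>r) = lie_class r (?V' r)"
    using U1[OF S(1)] U2[OF S(1)] refine_Union[OF P s(1) S(1)] S(2) by simp_all
  qed
  let ?W = "\<lambda>r\<in>Ps ` P. ?V' r"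
  have W: "?W \<in> (\<Pi>\<^sub>E r\<in>Ps ` P. layered_trees r)" by (rule restrict_in_PiE) (rule V'(1))
  have fam: "(\<lambda>r\<in>Ps ` P. ts (\<Union>r)) = (\<lambda>r\<in>Ps ` P. lie_class r (?W r))" by (rule restrict_ext) (simp add: V'(2))
  have fam_in: "(\<lambda>r\<in>Ps ` P. lie_class r (?W r)) \<in> fams (Ps ` P) ?lie" by (rule restrict_in_PiE) (rule lie_class_in[OF PiE_mem[OF W]])
  have m_in: "comp_pure lie lie ?Q (Ps ` P) (lie_class (Ps ` P) (map_ltree Ps T)) (\<lambda>r\<in>Ps ` P. lie_class r (?W r)) \<in> vcarrier (?L ?Q)"
   by (rule comp_pure_in[of ?Q lie lie, OF fQ vs_lie vs_lie R lie_class_in[OF mT] fam_in])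
  let ?g = "graft (map_ltree Ps T) ?W"
  have gl: "distinct (leaves ?g)" "set (leaves ?g) = ?Q" using graft_leaves[OF R mT, of ?W] PiE_mem[OF W] by blast+
  \<comment> \<open>Any layering of the grafted shape will do: its class in \<open>Lie\<close> and
    its bracket depend on the shape alone.\<close>
  obtain t where t: "t \<in> layered_trees ?Q" "shape t = shape ?g" by (rule layering_exists[OF gl])
  have "lie_assoc I u = assoc_value I P Ps ts x (lie_class P T)"
   unfolding u s(4) by (rule lie_assoc(2)[OF I P lie_class_in[OF T] s(1) ts s(3)])
  then have "mult_comp_gamma I (lie_assoc I u) = comp_pure ?lie ?G I ?Q (lie_class ?Q t) x"
   by (simp only: assoc_value_def lie_map(2)[OF inj T] fam mult_comp_gamma(2)[OF I Q m_in s(3)] lie_mult(2)[OF fQ R mT W] tree_class_eq[OF t])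
  then have "lie_action I (mult_comp_gamma I (lie_assoc I u)) = tree_bracket t x" using lie_action(2)[OF I Q t(1) s(3)] by simp
  also have "\<dots> = tree_bracket ?g x" by (rule tree_bracket_shape[OF t(2), THEN conjunct1])
  also have "?g = graft T U" unfolding graft_map_ltree by (rule graft_cong) (simp add: lT refine_Union[OF P s(1)])
  also have "tree_bracket (graft T U) x = tree_bracket T (\<lambda>S. tree_bracket (U S) x)"
   by (rule tree_bracket_graft[THEN conjunct1]) (simp add: lT lU(2))
  finally show "lie_action I (lie_comp_action I u) = lie_action I (mult_comp_gamma I (lie_assoc I u))" unfolding lhs ..
 qed
qed

text \<open>The bracket of a stick is its argument. The hypothesis that \<open>I\<close> is nonempty
  makes \<open>{I}\<close> a partition of \<open>I\<close>.\<close>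

lemma lie_action_unit:
 fixes I :: "'a set" and D :: "('k::field, 'a) gamma_elt"
 assumes I: "finite I" "I \<noteq> {}" and D: "D \<in> vcarrier (gamma I)"
 shows "lie_action I (comp_pure lie gamma I {I} (lie_unit I) (\<lambda>S\<in>{I}. D)) = D"
proof -
 have T: "Leaf I \<in> layered_trees {I}" by (simp add: layered_trees_def)
 have "lie_action I (comp_pure lie gamma I {I} (lie_class {I} (Leaf I)) (\<lambda>S\<in>{I}. D)) = tree_bracket (Leaf I) (\<lambda>S\<in>{I}. D)"
  by (rule lie_action(2)[OF I(1) partition_on_space[OF I(2)] T]) (use D in auto)
 then show ?thesis by (simp add: lie_unit_def)
qed

text \<open>The formula for the action is asserted at arbitrary tensors, decomposable or not. A
  bijection of finite sets is given as a map injective on \<open>I\<close>, with its image as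
  target. The unit law is stated for nonempty \<open>I\<close>, where the stick lives over the
  partition \<open>{I}\<close>.\<close>

theorem theorem5p2:
  fixes I :: "'a set" and \<sigma> :: "'a \<Rightarrow> 'b"
  assumes "finite I"
  shows
    \<comment> \<open>the linear map given by \<open>T \<otimes> D \<mapsto> \<partial>\<^sup>*\<^sub>T D\<close>\<close>
    "vlinear (species_comp lie gamma I) (gamma I :: ('k::field_char_0, ('k, 'a) gamma_elt) vspace)
       (lie_action I)
     \<and> (\<forall>P T. partition_on I P \<and> T \<in> layered_trees P \<longrightarrow>
         (\<forall>D \<in> vcarrier (tensor P (gamma :: 'a set \<Rightarrow> ('k, ('k, 'a) gamma_elt) vspace)).
            lie_action I (comp_elem lie gamma I P (lie_class P T) D) = dual_tree_deriv I P T D))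
     \<comment> \<open>naturality\<close>
     \<and> (inj_on \<sigma> I \<longrightarrow>
         (\<forall>u \<in> vcarrier (species_comp lie gamma I :: ('k, ('k, 'a) lie_gamma_elt) vspace).
            lie_action (\<sigma> ` I) (lie_gamma_map I \<sigma> u) = gamma_map I \<sigma> (lie_action I u)))
     \<comment> \<open>unitality\<close>
     \<and> (I \<noteq> {} \<longrightarrow>
         (\<forall>D \<in> vcarrier (gamma I :: ('k, ('k, 'a) gamma_elt) vspace).
            lie_action I (comp_pure lie gamma I {I} (lie_unit I) (\<lambda>S\<in>{I}. D)) = D))
     \<comment> \<open>associativity\<close>
     \<and> (\<forall>w \<in> vcarrier (species_comp lie (species_comp lie gamma) I ::
                ('k, ('k, 'a, ('k, 'a set) lie_elt, ('k, 'a) lie_gamma_elt) comp_elt) vspace).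
            lie_action I (lie_comp_action I w) = lie_action I (mult_comp_gamma I (lie_assoc I w)))"
proof (intro conjI allI impI ballI)
 show "vlinear (species_comp lie gamma I) (gamma I :: ('k::field_char_0, ('k, 'a) gamma_elt) vspace) (lie_action I)"
  by (rule lie_action(1)[OF assms])
 show "lie_action I (comp_elem lie gamma I P (lie_class P T) D) = dual_tree_deriv I P T D"
  if "partition_on I P \<and> T \<in> layered_trees P" "D \<in> vcarrier (tensor P (gamma :: 'a set => ('k, ('k, 'a) gamma_elt) vspace))" for P T D
  using lie_action(3)[OF assms _ _ that(2), of T] that(1) by blast
 show "lie_action (\<sigma> ` I) (lie_gamma_map I \<sigma> u) = gamma_map I \<sigma> (lie_action I u)"
  if "inj_on \<sigma> I" "u \<in> vcarrier (species_comp lie gamma I :: ('k, ('k, 'a) lie_gamma_elt) vspace)" for u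
  by (rule lie_action_natural[OF assms that])
 show "lie_action I (comp_pure lie gamma I {I} (lie_unit I) (\<lambda>S\<in>{I}. D)) = D"
  if "I \<noteq> {}" "D \<in> vcarrier (gamma I :: ('k, ('k, 'a) gamma_elt) vspace)" for D by (rule lie_action_unit[OF assms that])
 show "lie_action I (lie_comp_action I w) = lie_action I (mult_comp_gamma I (lie_assoc I w))"
  if "w \<in> vcarrier (species_comp lie (species_comp lie gamma) I ::
   ('k, ('k, 'a, ('k, 'a set) lie_elt, ('k, 'a) lie_gamma_elt) comp_elt) vspace)" for w by (rule lie_action_assoc[OF assms that])
qed

end
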